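(* Let $(R,\mathfrak m,k)$ be a regular local ring (respectively, a standard graded polynomial ring over a field $k$ with homogeneous maximal ideal $\mathfrak m$). Let $J=(a_1,\dots,a_n)$ be a proper ideal generated by a regular sequence $a_1,\dots,a_n$ (of homogeneous elements in the graded case) and let $I=(a_1,\dots,a_m)$ for some $1\le m\le n$. Then $R/IJ$ is a Golod ring.
   Context: Let $(A,\mathfrak n,k)$ be a local ring, or a standard graded $k$-algebra with homogeneous maximal ideal $\mathfrak n$. Let $K^A$ be the Koszul complex over $A$ on a minimal set of generators of $\mathfrak n$; it is a DG-algebra with $H_0(K^A)\cong k$. For a homogeneous element $a$ of a DG-algebra put $\overline a:=(-1)^{|a|+1}a$, where $|a|$ is the homological degree. A DG-algebra $B$ with $H_0(B)\cong k$ admits a trivial Massey operation if for some homogeneous $k$-basis $\mathcal B=\{h_\lambda\}_{\lambda\in\Lambda}$ of $H_{\ge 1}(B)$ there is a function $\mu:\coprod_{i=1}^\infty \mathcal B^i\to B$ such that $\mu(h_\lambda)=z_\lambda$ is a cycle with homology class $[z_\lambda]=h_\lambda$, and $d\mu(h_{\lambda_1},\dots,h_{\lambda_p})=\sum_{j=1}^{p-1}\overline{\mu(h_{\lambda_1},\dots,h_{\lambda_j})}\,\mu(h_{\lambda_{j+1}},\dots,h_{\lambda_p})$ for all $p\ge 2$. The ring $A$ is called Golod if $K^A$ admits a trivial Massey operation. *)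

theory Defs
  imports
    "HOL-Algebra.Algebra"
    "HOL-Algebra.Algebraic_Closure_Type"
    "HOL-Library.Poly_Mapping"
    "HOL-Library.Extended_Nat"
begin

section \<open>Regular local rings and regular sequences\<close>

definition local_ring :: "('a, 'b) ring_scheme \<Rightarrow> 'a set \<Rightarrow> bool" where
  "local_ring R M \<longleftrightarrow> cring R \<and> noetherian_ring R \<and> maximalideal M R \<and>
     (\<forall>N. maximalideal N R \<longrightarrow> N = M)"

definition krull_dim :: "('a, 'b) ring_scheme \<Rightarrow> enat" where
  "krull_dim R = Sup {enat n | n. \<exists>P. (\<forall>i\<le>n. primeideal (P i) R) \<and> (\<forall>i<n. P i \<subset> P (Suc i))}"

text \<open>Since the maximal ideal cannot be generated by fewer than \<open>krull_dim R\<close> elements, this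
  says that its minimal number of generators equals the Krull dimension.\<close>

definition regular_local_ring :: "('a, 'b) ring_scheme \<Rightarrow> 'a set \<Rightarrow> bool" where
  "regular_local_ring R M \<longleftrightarrow> local_ring R M \<and>
     (\<exists>xs. set xs \<subseteq> carrier R \<and> Idl\<^bsub>R\<^esub> (set xs) = M \<and> enat (length xs) = krull_dim R)"

definition regular_sequence :: "('a, 'b) ring_scheme \<Rightarrow> 'a list \<Rightarrow> bool" where
  "regular_sequence R as \<longleftrightarrow> set as \<subseteq> carrier R \<and> Idl\<^bsub>R\<^esub> (set as) \<noteq> carrier R \<and>
     (\<forall>i<length as. \<forall>r\<in>carrier R.
        (as ! i) \<otimes>\<^bsub>R\<^esub> r \<in> Idl\<^bsub>R\<^esub> (set (take i as)) \<longrightarrow> r \<in> Idl\<^bsub>R\<^esub> (set (take i as)))"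


section \<open>DG-algebras and trivial Massey operations\<close>

text \<open>The ring operations are those of the underlying ungraded algebra; \<open>hcomp B i\<close> is the set of
  elements of homological degree \<open>i\<close>.\<close>

record 'a dga = "'a ring" +
  hcomp :: "nat \<Rightarrow> 'a set"
  diff :: "'a \<Rightarrow> 'a"

definition cycles :: "('a, 'b) dga_scheme \<Rightarrow> 'a set" where
  "cycles B = {z \<in> carrier B. diff B z = \<zero>\<^bsub>B\<^esub>}"

definition boundaries :: "('a, 'b) dga_scheme \<Rightarrow> 'a set" where
  "boundaries B = diff B ` carrier B"

definition hclass :: "('a, 'b) dga_scheme \<Rightarrow> 'a \<Rightarrow> 'a set" where
  "hclass B z = boundaries B +>\<^bsub>B\<^esub> z"

definition homology_ring :: "('a, 'b) dga_scheme \<Rightarrow> 'a set ring" where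
  "homology_ring B = (B\<lparr>carrier := cycles B\<rparr>) Quot (boundaries B)"

definition homology :: "('a, 'b) dga_scheme \<Rightarrow> nat \<Rightarrow> 'a set set" where
  "homology B i = hclass B ` (cycles B \<inter> hcomp B i)"

definition positive_homology :: "('a, 'b) dga_scheme \<Rightarrow> 'a set set" where
  "positive_homology B = generate (add_monoid (homology_ring B)) (\<Union>i\<in>{1..}. homology B i)"

text \<open>The \<open>k\<close>-vector space structure on homology is multiplication by \<open>homology B 0\<close>, which is
  isomorphic to \<open>k\<close>. The basis is given as a possibly infinite set, while \<^const>\<open>ring.independent\<close>
  and \<^const>\<open>ring.Span\<close> are about finite lists.\<close>

definition homogeneous_basis :: "('a, 'b) dga_scheme \<Rightarrow> 'a set set \<Rightarrow> bool" where
  "homogeneous_basis B \<B> \<longleftrightarrow>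
     \<B> \<subseteq> (\<Union>i\<in>{1..}. homology B i) \<and>
     (\<forall>hs. distinct hs \<and> set hs \<subseteq> \<B> \<longrightarrow> ring.independent (homology_ring B) (homology B 0) hs) \<and>
     (\<forall>h\<in>positive_homology B.
        \<exists>hs. set hs \<subseteq> \<B> \<and> h \<in> ring.Span (homology_ring B) (homology B 0) hs)"

text \<open>The degree of a homogeneous element is unique unless the element is zero, in which case
  the sign in \<open>bar\<close> is irrelevant.\<close>

definition hdegree :: "('a, 'b) dga_scheme \<Rightarrow> 'a \<Rightarrow> nat" where
  "hdegree B a = (LEAST i. a \<in> hcomp B i)"

definition bar :: "('a, 'b) dga_scheme \<Rightarrow> 'a \<Rightarrow> 'a" where
  "bar B a = (if even (hdegree B a + 1) then a else \<ominus>\<^bsub>B\<^esub> a)"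

definition trivial_massey_operation ::
    "('a, 'b) dga_scheme \<Rightarrow> 'a set set \<Rightarrow> ('a set list \<Rightarrow> 'a) \<Rightarrow> bool" where
  "trivial_massey_operation B \<B> \<mu> \<longleftrightarrow>
     (\<forall>w\<in>lists \<B>. w \<noteq> [] \<longrightarrow> \<mu> w \<in> (\<Union>i. hcomp B i)) \<and>
     (\<forall>h\<in>\<B>. \<mu> [h] \<in> cycles B \<and> hclass B (\<mu> [h]) = h) \<and>
     (\<forall>w\<in>lists \<B>. 2 \<le> length w \<longrightarrow>
        diff B (\<mu> w) =
          (\<Oplus>\<^bsub>B\<^esub>j\<in>{1..length w - 1}. bar B (\<mu> (take j w)) \<otimes>\<^bsub>B\<^esub> \<mu> (drop j w)))"

definition admits_trivial_massey_operation :: "('a, 'b) dga_scheme \<Rightarrow> bool" where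
  "admits_trivial_massey_operation B \<longleftrightarrow>
     (\<exists>\<B> \<mu>. homogeneous_basis B \<B> \<and> trivial_massey_operation B \<B> \<mu>)"


section \<open>The Koszul complex\<close>

definition sgn_times :: "('a, 'b) ring_scheme \<Rightarrow> nat \<Rightarrow> 'a \<Rightarrow> 'a" where
  "sgn_times A n a = (if even n then a else \<ominus>\<^bsub>A\<^esub> a)"

text \<open>Let \<open>d = length xs\<close>. The exterior algebra over \<open>A\<close> on \<open>e\<^sub>0, \<dots>, e\<^bsub>d-1\<^esub>\<close> has the basis
  \<open>e\<^sub>S = e\<^bsub>s1\<^esub> \<and> \<dots> \<and> e\<^bsub>sp\<^esub>\<close> for \<open>S = {s1 < \<dots> < sp} \<subseteq> {..<d}\<close>; an element is represented by
  its coefficient function. The signs below come from \<open>e\<^sub>T \<and> e\<^sub>U = (-1)^n e\<^bsub>T \<union> U\<^esub>\<close> for disjoint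
  \<open>T\<close>, \<open>U\<close>, where \<open>n\<close> is the number of pairs \<open>(t, u) \<in> T \<times> U\<close> with \<open>u < t\<close>, and from the
  differential, which is the derivation with \<open>e\<^sub>i \<mapsto> xs ! i\<close>.\<close>

definition koszul :: "('a, 'b) ring_scheme \<Rightarrow> 'a list \<Rightarrow> (nat set \<Rightarrow> 'a) dga" where
  "koszul A xs = (let \<P> = Pow {..<length xs} in
     \<lparr>carrier = \<P> \<rightarrow>\<^sub>E carrier A,
      monoid.mult = (\<lambda>f g. \<lambda>S\<in>\<P>. \<Oplus>\<^bsub>A\<^esub>T\<in>Pow S.
        sgn_times A (card {(t, u) \<in> T \<times> (S - T). u < t}) (f T \<otimes>\<^bsub>A\<^esub> g (S - T))),
      monoid.one = (\<lambda>S\<in>\<P>. if S = {} then \<one>\<^bsub>A\<^esub> else \<zero>\<^bsub>A\<^esub>),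
      ring.zero = (\<lambda>S\<in>\<P>. \<zero>\<^bsub>A\<^esub>),
      ring.add = (\<lambda>f g. \<lambda>S\<in>\<P>. f S \<oplus>\<^bsub>A\<^esub> g S),
      dga.hcomp = (\<lambda>i. {f \<in> \<P> \<rightarrow>\<^sub>E carrier A. \<forall>S\<in>\<P>. card S \<noteq> i \<longrightarrow> f S = \<zero>\<^bsub>A\<^esub>}),
      dga.diff = (\<lambda>f. \<lambda>S\<in>\<P>. \<Oplus>\<^bsub>A\<^esub>i\<in>{..<length xs} - S.
        sgn_times A (card {j \<in> S. j < i}) ((xs ! i) \<otimes>\<^bsub>A\<^esub> f (insert i S)))\<rparr>)"


section \<open>Golod rings\<close>

definition minimal_generators ::
    "('a, 'b) ring_scheme \<Rightarrow> 'a set \<Rightarrow> 'a set \<Rightarrow> 'a list \<Rightarrow> bool" where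
  "minimal_generators A H N xs \<longleftrightarrow> distinct xs \<and> set xs \<subseteq> H \<and> Idl\<^bsub>A\<^esub> (set xs) = N \<and>
     (\<forall>S. S \<subset> set xs \<longrightarrow> Idl\<^bsub>A\<^esub> S \<noteq> N)"

text \<open>\<open>H\<close> is the set of elements admitted as generators: all elements in the local case, the
  homogeneous ones in the graded case (where an irredundant generating set of inhomogeneous elements
  can be too large). Up to isomorphism the Koszul complex does not depend on the generators; all
  choices are required to work, and at least one must exist.\<close>

definition golod :: "('a, 'b) ring_scheme \<Rightarrow> 'a set \<Rightarrow> 'a set \<Rightarrow> bool" where
  "golod A H N \<longleftrightarrow> (\<exists>xs. minimal_generators A H N xs) \<and>
     (\<forall>xs. minimal_generators A H N xs \<longrightarrow> admits_trivial_massey_operation (koszul A xs))"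

definition golod_local_ring :: "('a, 'b) ring_scheme \<Rightarrow> 'a set \<Rightarrow> bool" where
  "golod_local_ring A N \<longleftrightarrow> golod A (carrier A) N"

text \<open>\<open>\<A> i\<close> is the component of degree \<open>i\<close> of the standard graded algebra \<open>A\<close>.\<close>

definition golod_graded_ring :: "('a, 'b) ring_scheme \<Rightarrow> (nat \<Rightarrow> 'a set) \<Rightarrow> bool" where
  "golod_graded_ring A \<A> \<longleftrightarrow> golod A (\<Union>i. \<A> i) (Idl\<^bsub>A\<^esub> (\<Union>i\<in>{1..}. \<A> i))"


section \<open>Polynomial rings\<close>

text \<open>The polynomial ring over the field \<open>'k\<close> in the variables \<open>'v\<close>: finitely supported maps from
  exponent vectors to \<open>'k\<close>, with the convolution product.\<close>

abbreviation mpoly_ring :: "(('v::finite \<Rightarrow>\<^sub>0 nat) \<Rightarrow>\<^sub>0 'k::field) ring" where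
  "mpoly_ring \<equiv> ring_of_type_algebra"

definition homogeneous_polys :: "nat \<Rightarrow> (('v::finite \<Rightarrow>\<^sub>0 nat) \<Rightarrow>\<^sub>0 'k::field) set" where
  "homogeneous_polys i = {p. \<forall>e\<in>Poly_Mapping.keys p. (\<Sum>v\<in>UNIV. Poly_Mapping.lookup e v) = i}"

end

theory Submission
  imports Defs
begin

text \<open>Put \<open>A = R/IJ\<close>. The image of \<open>I\<close> in \<open>A\<close> has square zero since \<open>I \<subseteq> J\<close>, so it suffices to show that
  every cycle of positive degree in \<open>K\<^sup>A\<close> is homologous to one with coefficients in \<open>I/IJ\<close>: then \<open>\<mu>\<close>
  can be taken zero on words of length at least two. Lift the cycle to \<open>z\<close> in the Koszul complex \<open>K\<close>
  over \<open>R\<close>, so that \<open>d z\<close> has coefficients in \<open>IJ\<close>. As \<open>K\<close> is acyclic and multiplication by each \<open>a\<^sub>i\<close>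
  has a homotopy \<open>s\<^sub>i\<close>, the cycles of \<open>K\<close> modulo \<open>I = (a\<^sub>1, \<dots>, a\<^sub>m)\<close> are, up to boundaries and
  elements of \<open>I K\<close>, linear combinations of the iterates \<open>s\<^bsub>i1\<^esub> \<dots> s\<^bsub>ip\<^esub> 1\<close>, which are independent
  modulo the maximal ideal. That \<open>d z\<close> vanishes modulo \<open>IJ\<close>, and not only modulo \<open>I\<close>, forces all
  coefficients of this combination into the maximal ideal, because the first syzygies of a regular
  sequence have coefficients in the ideal it generates; a combination with such coefficients is a
  boundary modulo \<open>I K\<close>.\<close>

section \<open>Complexes with homotopies for a regular sequence\<close>

text \<open>K is built on lifts to R of minimal generators of the maximal ideal of A, and nothing
  makes these lifts a regular sequence a priori. Acyclicity of K is therefore obtained indirectly: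
  the maximal ideal M of R contains a regular sequence at least as long as the list of lifts, each
  of its elements acts null-homotopically on K, and the composite of these homotopies leaves the
  range of degrees of K. The number of lifts is bounded because IJ lies in the square of M, so that
  they are independent modulo this square. For polynomials the long sequence consists of the
  variables; for a regular local ring it has to be extracted from the definition by Krull dimension,
  and this is what the principal ideal theorem is for. The iterates of positive length are nonzero
  classes modulo I and thus have no representative in I K; passing to the smaller ideal IJ is what
  excludes them. Quotient rings are avoided until the end: being a boundary modulo I is expressed
  inside K by \<open>sub_bd I\<close>.\<close>

lemmas (in abelian_group)
  [algebra abelian_group "ring.zero G" "ring.add G" "a_inv G" "a_minus G"] =
  a_closed zero_closed a_inv_closed minus_closed minus_eq a_assoc l_zero l_neg r_neg a_comm
  r_zero r_neg2 r_neg1 minus_add minus_minus a_lcomm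

lemma (in abelian_group) add_eq_imp_diff:
  "x \<in> carrier G \<Longrightarrow> y \<in> carrier G \<Longrightarrow> x \<oplus> y = z \<Longrightarrow> x = z \<ominus> y"
  by (auto simp: minus_eq a_assoc r_neg)

lemma (in abelian_group) diff_eq_swap:
  "x \<in> carrier G \<Longrightarrow> y \<in> carrier G \<Longrightarrow> z \<in> carrier G \<Longrightarrow> x = z \<ominus> y \<Longrightarrow> y = z \<ominus> x"
  by (simp add: minus_eq minus_add a_assoc[symmetric] r_neg)

context cring
begin

lemma Idl_insert:
  assumes "c \<in> carrier R" "S \<subseteq> carrier R" "x \<in> Idl (insert c S)"
  shows "\<exists>u\<in>Idl S. \<exists>r\<in>carrier R. x = u \<oplus> c \<otimes> r"
proof -
  have "ideal (Idl S <+> PIdl c) R"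
    using assms by (intro add_ideals genideal_ideal cgenideal_ideal)
  moreover have "insert c S \<subseteq> Idl S <+> PIdl c"
  proof -
    have "\<zero> \<in> Idl S" "\<zero> \<in> PIdl c"
      using assms by (auto intro!: additive_subgroup.zero_closed ideal.axioms(1) genideal_ideal cgenideal_ideal)
    moreover have "c \<in> PIdl c" "S \<subseteq> Idl S" "S \<subseteq> carrier R" "c \<in> carrier R"
      using assms cgenideal_self genideal_self by auto
    ultimately have "c = \<zero> \<oplus> c \<and> \<zero> \<in> Idl S \<and> c \<in> PIdl c" "x \<in> S \<Longrightarrow> x = x \<oplus> \<zero> \<and> x \<in> Idl S \<and> \<zero> \<in> PIdl c" for x
      by auto
    then show ?thesis unfolding set_add_def' by blast
  qed
  ultimately have "x \<in> Idl S <+> PIdl c"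
    using genideal_minimal assms(3) by blast
  then obtain u v where "u \<in> Idl S" "v \<in> PIdl c" "x = u \<oplus> v" by (auto simp: set_add_def')
  then show ?thesis using assms unfolding cgenideal_def by (auto simp: m_comm)
qed

lemma Idl_empty: "Idl {} = {\<zero>}"
  using genideal_minimal[OF zeroideal, of "{}"] additive_subgroup.zero_closed[OF ideal.axioms(1)[OF genideal_ideal[of "{}"]]]
  by auto

end

section \<open>Linear endomorphisms of a module\<close>

context module
begin

definition linear_endo :: "('c \<Rightarrow> 'c) \<Rightarrow> bool" where
  "linear_endo f \<longleftrightarrow> (\<forall>x\<in>carrier M. f x \<in> carrier M) \<and>
     (\<forall>x\<in>carrier M. \<forall>y\<in>carrier M. f (x \<oplus>\<^bsub>M\<^esub> y) = f x \<oplus>\<^bsub>M\<^esub> f y) \<and>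
     (\<forall>c\<in>carrier R. \<forall>x\<in>carrier M. f (c \<odot>\<^bsub>M\<^esub> x) = c \<odot>\<^bsub>M\<^esub> f x)"

lemma linear_endoI:
  assumes "\<And>x. x \<in> carrier M \<Longrightarrow> f x \<in> carrier M"
    and "\<And>x y. x \<in> carrier M \<Longrightarrow> y \<in> carrier M \<Longrightarrow> f (x \<oplus>\<^bsub>M\<^esub> y) = f x \<oplus>\<^bsub>M\<^esub> f y"
    and "\<And>c x. c \<in> carrier R \<Longrightarrow> x \<in> carrier M \<Longrightarrow> f (c \<odot>\<^bsub>M\<^esub> x) = c \<odot>\<^bsub>M\<^esub> f x"
  shows "linear_endo f"
  using assms by (auto simp: linear_endo_def)

lemma minus_smult: "x \<in> carrier M \<Longrightarrow> \<ominus>\<^bsub>M\<^esub> x = (\<ominus> \<one>) \<odot>\<^bsub>M\<^esub> x"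
  using smult_l_minus[of \<one> x] by simp

lemma linear_endo_closed: "linear_endo f \<Longrightarrow> x \<in> carrier M \<Longrightarrow> f x \<in> carrier M"
  and linear_endo_add: "linear_endo f \<Longrightarrow> x \<in> carrier M \<Longrightarrow> y \<in> carrier M \<Longrightarrow> f (x \<oplus>\<^bsub>M\<^esub> y) = f x \<oplus>\<^bsub>M\<^esub> f y"
  and linear_endo_smult: "linear_endo f \<Longrightarrow> c \<in> carrier R \<Longrightarrow> x \<in> carrier M \<Longrightarrow> f (c \<odot>\<^bsub>M\<^esub> x) = c \<odot>\<^bsub>M\<^esub> f x"
  by (auto simp: linear_endo_def)

lemma linear_endo_minus: "linear_endo f \<Longrightarrow> x \<in> carrier M \<Longrightarrow> f (\<ominus>\<^bsub>M\<^esub> x) = \<ominus>\<^bsub>M\<^esub> f x"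
  using linear_endo_smult[of f "\<ominus> \<one>" x] by (simp add: minus_smult linear_endo_closed)

lemma linear_endo_zero: "linear_endo f \<Longrightarrow> f \<zero>\<^bsub>M\<^esub> = \<zero>\<^bsub>M\<^esub>"
  using linear_endo_smult[of f \<zero> "\<zero>\<^bsub>M\<^esub>"] linear_endo_closed[of f "\<zero>\<^bsub>M\<^esub>"] by simp

lemma linear_endo_diff:
  "linear_endo f \<Longrightarrow> x \<in> carrier M \<Longrightarrow> y \<in> carrier M \<Longrightarrow> f (x \<ominus>\<^bsub>M\<^esub> y) = f x \<ominus>\<^bsub>M\<^esub> f y"
  by (simp add: M.minus_eq linear_endo_add linear_endo_minus)

lemma smult_diff:
  "c \<in> carrier R \<Longrightarrow> x \<in> carrier M \<Longrightarrow> y \<in> carrier M \<Longrightarrow> c \<odot>\<^bsub>M\<^esub> (x \<ominus>\<^bsub>M\<^esub> y) = c \<odot>\<^bsub>M\<^esub> x \<ominus>\<^bsub>M\<^esub> c \<odot>\<^bsub>M\<^esub> y"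
  by (simp add: M.minus_eq smult_r_distr smult_r_minus)

end

text \<open>The axioms collect what is used of the Koszul complex \<open>K\<close> on generators of \<open>N\<close>: \<open>sub I\<close> is
  \<open>I K\<close>, \<open>fil k\<close> consists of the elements of degree at least \<open>k\<close>, \<open>e\<close> is the unit and \<open>ev\<close> the
  coefficient at \<open>e\<close>.\<close>

locale augmented_complex = module R K
  for R :: "('a, 'r) ring_scheme" (structure) and K :: "('a, 'b, 'm) module_scheme" (structure) +
  fixes d :: "'b \<Rightarrow> 'b" and sub :: "'a set \<Rightarrow> 'b set" and fil :: "nat \<Rightarrow> 'b set"
    and e :: 'b and ev :: "'b \<Rightarrow> 'a" and N :: "'a set"
  assumes d_linear: "linear_endo d"
    and d_d: "x \<in> carrier K \<Longrightarrow> d (d x) = \<zero>\<^bsub>K\<^esub>"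
    and sub_subset: "ideal I R \<Longrightarrow> sub I \<subseteq> carrier K"
    and sub_add: "ideal I R \<Longrightarrow> x \<in> sub I \<Longrightarrow> y \<in> sub I \<Longrightarrow> x \<oplus>\<^bsub>K\<^esub> y \<in> sub I"
    and sub_smult: "ideal I R \<Longrightarrow> c \<in> carrier R \<Longrightarrow> x \<in> sub I \<Longrightarrow> c \<odot>\<^bsub>K\<^esub> x \<in> sub I"
    and sub_d: "ideal I R \<Longrightarrow> x \<in> sub I \<Longrightarrow> d x \<in> sub I"
    and sub_scalar: "ideal I R \<Longrightarrow> a \<in> I \<Longrightarrow> x \<in> carrier K \<Longrightarrow> a \<odot>\<^bsub>K\<^esub> x \<in> sub I"
    and sub_mono: "I \<subseteq> J \<Longrightarrow> sub I \<subseteq> sub J"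
    and sub_zero: "sub {\<zero>} = {\<zero>\<^bsub>K\<^esub>}"
    and sub_split: "ideal I R \<Longrightarrow> ideal I' R \<Longrightarrow> a \<in> carrier R \<Longrightarrow>
      (\<And>t. t \<in> I' \<Longrightarrow> \<exists>i\<in>I. \<exists>r\<in>carrier R. t = i \<oplus> a \<otimes> r) \<Longrightarrow> x \<in> sub I' \<Longrightarrow>
      \<exists>p\<in>sub I. \<exists>u\<in>carrier K. x = p \<oplus>\<^bsub>K\<^esub> a \<odot>\<^bsub>K\<^esub> u"
    and sub_cancel: "ideal L R \<Longrightarrow> ideal B R \<Longrightarrow> ideal J R \<Longrightarrow> a \<in> carrier R \<Longrightarrow>
      (\<And>t b. t \<in> carrier R \<Longrightarrow> b \<in> B \<Longrightarrow> a \<otimes> t \<oplus> b \<in> L \<Longrightarrow> t \<in> J) \<Longrightarrow>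
      x \<in> carrier K \<Longrightarrow> b \<in> sub B \<Longrightarrow> a \<odot>\<^bsub>K\<^esub> x \<oplus>\<^bsub>K\<^esub> b \<in> sub L \<Longrightarrow> x \<in> sub J"
    and e_closed: "e \<in> carrier K" and d_e: "d e = \<zero>\<^bsub>K\<^esub>"
    and N_ideal: "ideal N R"
    and ev_closed: "x \<in> carrier K \<Longrightarrow> ev x \<in> carrier R"
    and ev_add: "x \<in> carrier K \<Longrightarrow> y \<in> carrier K \<Longrightarrow> ev (x \<oplus>\<^bsub>K\<^esub> y) = ev x \<oplus> ev y"
    and ev_smult: "c \<in> carrier R \<Longrightarrow> x \<in> carrier K \<Longrightarrow> ev (c \<odot>\<^bsub>K\<^esub> x) = c \<otimes> ev x"
    and ev_e: "ev e = \<one>"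
    and N_e: "t \<in> N \<Longrightarrow> \<exists>q\<in>carrier K. t \<odot>\<^bsub>K\<^esub> e = d q"
    and ev_d: "x \<in> carrier K \<Longrightarrow> ev (d x) \<in> N"
    and ev_sub: "ideal I R \<Longrightarrow> x \<in> sub I \<Longrightarrow> ev x \<in> I"
    and fil_1: "fil (Suc 0) = {x \<in> carrier K. ev x = \<zero>}"
begin

text \<open>A null-homotopy of multiplication by \<open>c\<close>. Respecting every
  \<open>sub I\<close> makes it descend to K modulo any ideal; raising \<open>fil\<close> is what
  the degree count in the acyclicity proof relies on.\<close>

definition homotopy :: "'a \<Rightarrow> ('b \<Rightarrow> 'b) \<Rightarrow> bool" where
  "homotopy c s \<longleftrightarrow> linear_endo s \<and> (\<forall>x\<in>carrier K. d (s x) \<oplus>\<^bsub>K\<^esub> s (d x) = c \<odot>\<^bsub>K\<^esub> x) \<and>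
     (\<forall>I. ideal I R \<longrightarrow> s ` sub I \<subseteq> sub I) \<and> (\<forall>k. s ` fil k \<subseteq> fil (Suc k))"

lemmas d_closed [simp] = linear_endo_closed[OF d_linear]
lemmas d_add = linear_endo_add[OF d_linear]
lemmas d_diff = linear_endo_diff[OF d_linear]
lemmas d_smult = linear_endo_smult[OF d_linear]

section \<open>Boundaries modulo an ideal\<close>

lemma sub_carrier: "ideal I R \<Longrightarrow> x \<in> sub I \<Longrightarrow> x \<in> carrier K"
  using sub_subset by blast

lemma sub_diff: "ideal I R \<Longrightarrow> x \<in> sub I \<Longrightarrow> y \<in> sub I \<Longrightarrow> x \<ominus>\<^bsub>K\<^esub> y \<in> sub I"
  using sub_smult[of I "\<ominus> \<one>" y] by (simp add: M.minus_eq minus_smult sub_carrier sub_add)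

lemma zero_sub: "ideal I R \<Longrightarrow> \<zero>\<^bsub>K\<^esub> \<in> sub I"
  using sub_scalar[of I \<zero> "\<zero>\<^bsub>K\<^esub>"] additive_subgroup.zero_closed[OF ideal.axioms(1)] by fastforce

text \<open>The elements of K whose image in K/IK is a boundary, so that membership replaces a
  statement about homology over R/I.\<close>

definition sub_bd :: "'a set \<Rightarrow> 'b set" where
  "sub_bd I = {p \<oplus>\<^bsub>K\<^esub> d q | p q. p \<in> sub I \<and> q \<in> carrier K}"

lemma sub_bdI: "p \<in> sub I \<Longrightarrow> q \<in> carrier K \<Longrightarrow> x = p \<oplus>\<^bsub>K\<^esub> d q \<Longrightarrow> x \<in> sub_bd I"
  by (auto simp: sub_bd_def)

lemma sub_bdE:
  assumes "x \<in> sub_bd I"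
  obtains p q where "p \<in> sub I" "q \<in> carrier K" "x = p \<oplus>\<^bsub>K\<^esub> d q"
  using assms by (auto simp: sub_bd_def)

lemma sub_bd_carrier: "ideal I R \<Longrightarrow> x \<in> sub_bd I \<Longrightarrow> x \<in> carrier K"
  by (auto simp: sub_bd_def sub_carrier)

lemma sub_in_sub_bd: "ideal I R \<Longrightarrow> x \<in> sub I \<Longrightarrow> x \<in> sub_bd I"
  using linear_endo_zero[OF d_linear] by (intro sub_bdI[of x I "\<zero>\<^bsub>K\<^esub>"]) (auto simp: sub_carrier)

lemma bd_in_sub_bd: "ideal I R \<Longrightarrow> x \<in> carrier K \<Longrightarrow> d x \<in> sub_bd I"
  by (intro sub_bdI[of "\<zero>\<^bsub>K\<^esub>" I x]) (auto simp: zero_sub)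

lemma sub_bd_mono: "I \<subseteq> J \<Longrightarrow> x \<in> sub_bd I \<Longrightarrow> x \<in> sub_bd J"
  using sub_mono unfolding sub_bd_def by blast

lemma sub_bd_diff:
  assumes I: "ideal I R" and "x \<in> sub_bd I" "y \<in> sub_bd I"
  shows "x \<ominus>\<^bsub>K\<^esub> y \<in> sub_bd I"
proof -
  obtain p q where x: "p \<in> sub I" "q \<in> carrier K" "x = p \<oplus>\<^bsub>K\<^esub> d q" by (rule sub_bdE[OF assms(2)])
  obtain p' q' where y: "p' \<in> sub I" "q' \<in> carrier K" "y = p' \<oplus>\<^bsub>K\<^esub> d q'" by (rule sub_bdE[OF assms(3)])
  have c: "p \<in> carrier K" "p' \<in> carrier K" "d q \<in> carrier K" "d q' \<in> carrier K"
    using x y sub_carrier[OF I] by auto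
  have "x \<ominus>\<^bsub>K\<^esub> y = (p \<ominus>\<^bsub>K\<^esub> p') \<oplus>\<^bsub>K\<^esub> (d q \<ominus>\<^bsub>K\<^esub> d q')"
    unfolding x y using c by algebra
  then show ?thesis
    using x y by (intro sub_bdI[of "p \<ominus>\<^bsub>K\<^esub> p'" I "q \<ominus>\<^bsub>K\<^esub> q'"]) (auto simp: sub_diff I d_diff)
qed

lemma sub_bd_add:
  assumes I: "ideal I R" and x: "x \<in> sub_bd I" and y: "y \<in> sub_bd I"
  shows "x \<oplus>\<^bsub>K\<^esub> y \<in> sub_bd I"
proof -
  have c: "x \<in> carrier K" "y \<in> carrier K" using assms sub_bd_carrier by auto
  have "\<zero>\<^bsub>K\<^esub> \<ominus>\<^bsub>K\<^esub> y \<in> sub_bd I"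
    by (rule sub_bd_diff[OF I sub_in_sub_bd[OF I zero_sub[OF I]] y])
  then have "x \<ominus>\<^bsub>K\<^esub> (\<zero>\<^bsub>K\<^esub> \<ominus>\<^bsub>K\<^esub> y) \<in> sub_bd I" by (rule sub_bd_diff[OF I x])
  moreover have "x \<ominus>\<^bsub>K\<^esub> (\<zero>\<^bsub>K\<^esub> \<ominus>\<^bsub>K\<^esub> y) = x \<oplus>\<^bsub>K\<^esub> y" using c by algebra
  ultimately show ?thesis by simp
qed

lemma sub_bd_smult:
  assumes I: "ideal I R" and c: "c \<in> carrier R" and x: "x \<in> sub_bd I"
  shows "c \<odot>\<^bsub>K\<^esub> x \<in> sub_bd I"
proof -
  obtain p q where "p \<in> sub I" "q \<in> carrier K" "x = p \<oplus>\<^bsub>K\<^esub> d q" by (rule sub_bdE[OF x])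
  then show ?thesis
    using I c by (intro sub_bdI[of "c \<odot>\<^bsub>K\<^esub> p" I "c \<odot>\<^bsub>K\<^esub> q"]) (auto simp: sub_smult smult_r_distr d_smult sub_carrier)
qed

lemma d_sub_bd:
  assumes I: "ideal I R" and x: "x \<in> sub_bd I"
  shows "d x \<in> sub I"
proof -
  obtain p q where "p \<in> sub I" "q \<in> carrier K" "x = p \<oplus>\<^bsub>K\<^esub> d q" by (rule sub_bdE[OF x])
  then show ?thesis using I sub_d[OF I, of p] by (simp add: d_add d_d sub_carrier)
qed

lemma ev_sub_bd:
  assumes I: "ideal I R" "I \<subseteq> N" and x: "x \<in> sub_bd I"
  shows "ev x \<in> N"
proof -
  obtain p q where "p \<in> sub I" "q \<in> carrier K" "x = p \<oplus>\<^bsub>K\<^esub> d q" by (rule sub_bdE[OF x])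
  then show ?thesis
    using I ev_sub[of I p] ev_d[of q] additive_subgroup.a_closed[OF ideal.axioms(1)[OF N_ideal]]
    by (auto simp: ev_add sub_carrier)
qed

lemma homotopyD:
  assumes "homotopy c s"
  shows "linear_endo s"
    and "x \<in> carrier K \<Longrightarrow> s x \<in> carrier K"
    and "x \<in> carrier K \<Longrightarrow> y \<in> carrier K \<Longrightarrow> s (x \<oplus>\<^bsub>K\<^esub> y) = s x \<oplus>\<^bsub>K\<^esub> s y"
    and "x \<in> carrier K \<Longrightarrow> y \<in> carrier K \<Longrightarrow> s (x \<ominus>\<^bsub>K\<^esub> y) = s x \<ominus>\<^bsub>K\<^esub> s y"
    and "a \<in> carrier R \<Longrightarrow> x \<in> carrier K \<Longrightarrow> s (a \<odot>\<^bsub>K\<^esub> x) = a \<odot>\<^bsub>K\<^esub> s x"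
    and "ideal I R \<Longrightarrow> x \<in> sub I \<Longrightarrow> s x \<in> sub I"
    and "x \<in> fil k \<Longrightarrow> s x \<in> fil (Suc k)"
proof -
  show "linear_endo s" using assms unfolding homotopy_def by blast
  then show "x \<in> carrier K \<Longrightarrow> s x \<in> carrier K"
    and "x \<in> carrier K \<Longrightarrow> y \<in> carrier K \<Longrightarrow> s (x \<oplus>\<^bsub>K\<^esub> y) = s x \<oplus>\<^bsub>K\<^esub> s y"
    and "x \<in> carrier K \<Longrightarrow> y \<in> carrier K \<Longrightarrow> s (x \<ominus>\<^bsub>K\<^esub> y) = s x \<ominus>\<^bsub>K\<^esub> s y"
    and "a \<in> carrier R \<Longrightarrow> x \<in> carrier K \<Longrightarrow> s (a \<odot>\<^bsub>K\<^esub> x) = a \<odot>\<^bsub>K\<^esub> s x"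
    by (simp_all only: linear_endo_closed linear_endo_add linear_endo_diff linear_endo_smult)
  show "ideal I R \<Longrightarrow> x \<in> sub I \<Longrightarrow> s x \<in> sub I"
    using assms unfolding homotopy_def by blast
  show "x \<in> fil k \<Longrightarrow> s x \<in> fil (Suc k)"
    using assms unfolding homotopy_def by blast
qed

lemma homotopy_d:
  assumes s: "homotopy c s" and c: "c \<in> carrier R" and x: "x \<in> carrier K"
  shows "d (s x) = c \<odot>\<^bsub>K\<^esub> x \<ominus>\<^bsub>K\<^esub> s (d x)"
proof -
  have "d (s x) \<oplus>\<^bsub>K\<^esub> s (d x) = c \<odot>\<^bsub>K\<^esub> x" using s x unfolding homotopy_def by blast
  then show ?thesis
    by (rule M.add_eq_imp_diff[OF d_closed[OF homotopyD(2)[OF s x]] homotopyD(2)[OF s d_closed[OF x]]])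
qed

text \<open>Modulo an ideal containing \<open>c\<close> the homotopy anticommutes with
  \<open>d\<close>, because \<open>s (d q) = c q - d (s q)\<close>; hence boundaries go to
  boundaries.\<close>

lemma homotopy_sub_bd:
  assumes s: "homotopy c s" and J: "ideal I R" "ideal J R" "I \<subseteq> J" "c \<in> J" and x: "x \<in> sub_bd I"
  shows "s x \<in> sub_bd J"
proof -
  have c: "c \<in> carrier R" by (rule ideal.Icarr[OF J(2,4)])
  obtain p q where p: "p \<in> sub I" "q \<in> carrier K" "x = p \<oplus>\<^bsub>K\<^esub> d q" by (rule sub_bdE[OF x])
  have pc: "p \<in> carrier K" using p J sub_carrier by auto
  have "s (d q) = c \<odot>\<^bsub>K\<^esub> q \<ominus>\<^bsub>K\<^esub> d (s q)"
    by (rule M.diff_eq_swap[OF _ _ _ homotopy_d[OF s c p(2)]]) (use s c p in \<open>auto simp: homotopyD(2)\<close>)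
  moreover have "c \<odot>\<^bsub>K\<^esub> q \<ominus>\<^bsub>K\<^esub> d (s q) \<in> sub_bd J"
    by (rule sub_bd_diff[OF J(2) sub_in_sub_bd[OF J(2) sub_scalar[OF J(2,4) p(2)]]
          bd_in_sub_bd[OF J(2) homotopyD(2)[OF s p(2)]]])
  moreover have "s p \<in> sub_bd J"
    using sub_in_sub_bd[OF J(2) homotopyD(6)[OF s J(2)]] p(1) sub_mono[OF J(3)] by blast
  ultimately show ?thesis
    using p pc s J sub_bd_add by (simp add: homotopyD(3))
qed

end

text \<open>The sequence is kept arbitrary because it is used twice on the same complex: with a long
  regular sequence of the maximal ideal, for acyclicity, and with the given generators of J.\<close>

locale complex_sequence = augmented_complex R K d sub fil e ev N
  for R :: "('a, 'r) ring_scheme" (structure) and K :: "('a, 'b, 'm) module_scheme" (structure)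
    and d sub fil e ev N +
  fixes a :: "nat \<Rightarrow> 'a" and s :: "nat \<Rightarrow> 'b \<Rightarrow> 'b" and n :: nat
  assumes a_N: "r < n \<Longrightarrow> a r \<in> N"
    and s_homotopy: "r < n \<Longrightarrow> homotopy (a r) (s r)"
    and a_regular: "r < n \<Longrightarrow> t \<in> carrier R \<Longrightarrow> a r \<otimes> t \<in> Idl (a ` {..<r}) \<Longrightarrow> t \<in> Idl (a ` {..<r})"
begin

abbreviation gen :: "nat set \<Rightarrow> 'a set" where "gen T \<equiv> Idl (a ` T)"

lemma a_carrier: "r < n \<Longrightarrow> a r \<in> carrier R"
  using a_N ideal.Icarr[OF N_ideal] by blast

lemma a_image_carrier: "T \<subseteq> {..<n} \<Longrightarrow> a ` T \<subseteq> carrier R"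
  using a_carrier by auto

lemma gen_ideal: "T \<subseteq> {..<n} \<Longrightarrow> ideal (gen T) R"
  by (intro genideal_ideal a_image_carrier)

lemma gen_below_ideal: "r \<le> n \<Longrightarrow> ideal (gen {..<r}) R"
  by (intro gen_ideal) auto

lemma gen_mono: "Y \<subseteq> {..<n} \<Longrightarrow> T \<subseteq> Y \<Longrightarrow> gen T \<subseteq> gen Y"
  using subset_Idl_subset[OF a_image_carrier[of Y], of "a ` T"] by blast

lemma a_gen: "T \<subseteq> {..<n} \<Longrightarrow> i \<in> T \<Longrightarrow> a i \<in> gen T"
  using genideal_self[OF a_image_carrier] by blast

lemma gen_N: "T \<subseteq> {..<n} \<Longrightarrow> gen T \<subseteq> N"
  using a_N by (intro genideal_minimal[OF N_ideal]) auto

lemma sub_gen_split: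
  assumes T: "T \<subseteq> {..<n}" and i: "i < n" and x: "x \<in> sub (gen (insert i T))"
  shows "\<exists>p\<in>sub (gen T). \<exists>u\<in>carrier K. x = p \<oplus>\<^bsub>K\<^esub> a i \<odot>\<^bsub>K\<^esub> u"
proof (rule sub_split[OF _ _ _ _ x])
  show "\<exists>j\<in>gen T. \<exists>r\<in>carrier R. t = j \<oplus> a i \<otimes> r" if "t \<in> gen (insert i T)" for t
    using Idl_insert[of "a i" "a ` T" t] T i that a_carrier a_image_carrier by auto
  show "ideal (gen (insert i T)) R" using T i by (intro gen_ideal) auto
qed (use T i a_carrier gen_ideal in auto)

text \<open>This is \<open>sub_cancel\<close> with the zero ideal as \<open>B\<close>: regularity is
  applied to each coefficient.\<close>

lemma sub_regular:
  assumes r: "r < n" and x: "x \<in> carrier K" "a r \<odot>\<^bsub>K\<^esub> x \<in> sub (gen {..<r})"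
  shows "x \<in> sub (gen {..<r})"
proof (rule sub_cancel[OF _ zeroideal _ a_carrier[OF r] _ x(1)])
  show "ideal (gen {..<r}) R" "ideal (gen {..<r}) R" using r by (auto intro: gen_below_ideal)
  show "\<zero>\<^bsub>K\<^esub> \<in> sub {\<zero>}" by (simp add: sub_zero)
  show "a r \<odot>\<^bsub>K\<^esub> x \<oplus>\<^bsub>K\<^esub> \<zero>\<^bsub>K\<^esub> \<in> sub (gen {..<r})"
    using x a_carrier[OF r] by simp
  show "t \<in> gen {..<r}" if "t \<in> carrier R" "b \<in> {\<zero>}" "a r \<otimes> t \<oplus> b \<in> gen {..<r}" for t b
    using a_regular[OF r] that a_carrier[OF r] by simp
qed

lemma sub_bd_Suc_split:
  assumes r: "r < n" and x: "x \<in> sub_bd (gen {..<Suc r})"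
  shows "\<exists>u\<in>carrier K. x \<ominus>\<^bsub>K\<^esub> a r \<odot>\<^bsub>K\<^esub> u \<in> sub_bd (gen {..<r})"
proof -
  obtain p q where p: "p \<in> sub (gen {..<Suc r})" "q \<in> carrier K" "x = p \<oplus>\<^bsub>K\<^esub> d q" by (rule sub_bdE[OF x])
  obtain p' u where u: "p' \<in> sub (gen {..<r})" "u \<in> carrier K" "p = p' \<oplus>\<^bsub>K\<^esub> a r \<odot>\<^bsub>K\<^esub> u"
    using sub_gen_split[of "{..<r}" r p] p r by (auto simp: lessThan_Suc)
  have p': "p' \<in> carrier K" using u(1) gen_below_ideal[of r] r sub_carrier by auto
  have c: "a r \<odot>\<^bsub>K\<^esub> u \<in> carrier K" "d q \<in> carrier K" using r u p a_carrier by auto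
  have "x \<ominus>\<^bsub>K\<^esub> a r \<odot>\<^bsub>K\<^esub> u = p' \<oplus>\<^bsub>K\<^esub> d q"
    unfolding p u using c p' by algebra
  then show ?thesis using u p by (intro bexI[of _ u] sub_bdI[of p' _ q]) auto
qed

text \<open>Exactness in the long homology sequence of multiplication by \<open>a r\<close> on K
  modulo the first r elements: a class that dies modulo \<open>a r\<close> is \<open>a r\<close>
  times a class. That \<open>u\<close> is again a cycle comes from cancelling \<open>a r\<close> in
  \<open>a r d u\<close>.\<close>

lemma sub_bd_Suc_cycle:
  assumes r: "r < n" and x: "x \<in> carrier K" "d x \<in> sub (gen {..<r})" "x \<in> sub_bd (gen {..<Suc r})"
  shows "\<exists>u\<in>carrier K. d u \<in> sub (gen {..<r}) \<and> x \<ominus>\<^bsub>K\<^esub> a r \<odot>\<^bsub>K\<^esub> u \<in> sub_bd (gen {..<r})"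
proof -
  have I: "ideal (gen {..<r}) R" using r by (intro gen_below_ideal) auto
  obtain u where u: "u \<in> carrier K" "x \<ominus>\<^bsub>K\<^esub> a r \<odot>\<^bsub>K\<^esub> u \<in> sub_bd (gen {..<r})"
    using sub_bd_Suc_split[OF r x(3)] by blast
  have ar: "a r \<in> carrier R" by (rule a_carrier[OF r])
  have "d x \<ominus>\<^bsub>K\<^esub> a r \<odot>\<^bsub>K\<^esub> d u \<in> sub (gen {..<r})"
    using d_sub_bd[OF I u(2)] u x ar by (simp add: d_diff d_smult)
  then have "d x \<ominus>\<^bsub>K\<^esub> (d x \<ominus>\<^bsub>K\<^esub> a r \<odot>\<^bsub>K\<^esub> d u) \<in> sub (gen {..<r})"
    by (rule sub_diff[OF I x(2)])
  moreover have "d x \<ominus>\<^bsub>K\<^esub> (d x \<ominus>\<^bsub>K\<^esub> a r \<odot>\<^bsub>K\<^esub> d u) = a r \<odot>\<^bsub>K\<^esub> d u"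
    using d_closed[OF x(1)] smult_closed[OF ar d_closed[OF u(1)]] by algebra
  ultimately have "d u \<in> sub (gen {..<r})"
    using sub_regular[OF r] u by simp
  then show ?thesis using u by blast
qed

text \<open>The connecting homomorphism of that sequence kills the class of \<open>x\<close> and
  sends that of \<open>s r y\<close> to the class of \<open>y\<close>, since
  \<open>d (s r y) = a r y - s r (d y)\<close>. So \<open>y\<close> dies if the sum does.\<close>

lemma sub_bd_descend:
  assumes r: "r < n" and x: "x \<in> carrier K" "d x \<in> sub (gen {..<r})"
    and y: "y \<in> carrier K" "d y \<in> sub (gen {..<r})"
    and xy: "x \<oplus>\<^bsub>K\<^esub> s r y \<in> sub_bd (gen {..<Suc r})"
  shows "y \<in> sub_bd (gen {..<r})"
proof -
  have I: "ideal (gen {..<r}) R" using r by (intro gen_below_ideal) auto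
  have ar: "a r \<in> carrier R" by (rule a_carrier[OF r])
  note s = s_homotopy[OF r]
  have sy: "s r y \<in> carrier K" "s r (d y) \<in> carrier K" using homotopyD(2)[OF s] y by auto
  obtain u where u: "u \<in> carrier K" "(x \<oplus>\<^bsub>K\<^esub> s r y) \<ominus>\<^bsub>K\<^esub> a r \<odot>\<^bsub>K\<^esub> u \<in> sub_bd (gen {..<r})"
    using sub_bd_Suc_split[OF r xy] by blast
  have "d ((x \<oplus>\<^bsub>K\<^esub> s r y) \<ominus>\<^bsub>K\<^esub> a r \<odot>\<^bsub>K\<^esub> u) \<in> sub (gen {..<r})" by (rule d_sub_bd[OF I u(2)])
  moreover have "d ((x \<oplus>\<^bsub>K\<^esub> s r y) \<ominus>\<^bsub>K\<^esub> a r \<odot>\<^bsub>K\<^esub> u)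
      = (d x \<oplus>\<^bsub>K\<^esub> (a r \<odot>\<^bsub>K\<^esub> y \<ominus>\<^bsub>K\<^esub> s r (d y))) \<ominus>\<^bsub>K\<^esub> a r \<odot>\<^bsub>K\<^esub> d u"
    using u x y sy ar by (simp add: d_diff d_add d_smult homotopy_d[OF s ar y(1)])
  ultimately have 1: "(d x \<oplus>\<^bsub>K\<^esub> (a r \<odot>\<^bsub>K\<^esub> y \<ominus>\<^bsub>K\<^esub> s r (d y))) \<ominus>\<^bsub>K\<^esub> a r \<odot>\<^bsub>K\<^esub> d u \<in> sub (gen {..<r})"
    by simp
  \<comment> \<open>\<open>d x\<close> and \<open>s r (d y)\<close> already lie in the smaller
    submodule; only \<open>a r (y - d u)\<close> is left, and \<open>a r\<close> cancels.\<close>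
  have 2: "d x \<ominus>\<^bsub>K\<^esub> s r (d y) \<in> sub (gen {..<r})"
    by (rule sub_diff[OF I x(2) homotopyD(6)[OF s I y(2)]])
  have "a r \<odot>\<^bsub>K\<^esub> (y \<ominus>\<^bsub>K\<^esub> d u) =
     ((d x \<oplus>\<^bsub>K\<^esub> (a r \<odot>\<^bsub>K\<^esub> y \<ominus>\<^bsub>K\<^esub> s r (d y))) \<ominus>\<^bsub>K\<^esub> a r \<odot>\<^bsub>K\<^esub> d u) \<ominus>\<^bsub>K\<^esub> (d x \<ominus>\<^bsub>K\<^esub> s r (d y))"
    unfolding smult_diff[OF ar y(1) d_closed[OF u(1)]]
    using smult_closed[OF ar y(1)] smult_closed[OF ar d_closed[OF u(1)]] d_closed[OF x(1)] sy by algebra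
  then have "a r \<odot>\<^bsub>K\<^esub> (y \<ominus>\<^bsub>K\<^esub> d u) \<in> sub (gen {..<r})"
    using sub_diff[OF I 1 2] by simp
  then have yu: "y \<ominus>\<^bsub>K\<^esub> d u \<in> sub (gen {..<r})"
    using sub_regular[OF r] y u by simp
  have "y = (y \<ominus>\<^bsub>K\<^esub> d u) \<oplus>\<^bsub>K\<^esub> d u" using y(1) d_closed[OF u(1)] by algebra
  then show ?thesis by (rule sub_bdI[OF yu u(1)])
qed

text \<open>If a regular sequence of elements of \<open>N\<close> is as long as the complex, then the complex is
  acyclic: the product of all the homotopies kills a positive cycle \<open>z\<close> for degree reasons, and
  regularity allows to cancel them one by one.\<close>

lemma acyclic_of_regular:
  assumes top: "fil (Suc n) \<subseteq> {\<zero>\<^bsub>K\<^esub>}" and z: "z \<in> carrier K" "d z = \<zero>\<^bsub>K\<^esub>" "ev z = \<zero>"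
  shows "z \<in> d ` carrier K"
proof -
  \<comment> \<open>\<open>Z r\<close> is \<open>s (r-1) ... s 0 z\<close>. It lies in
    \<open>fil (r+1)\<close> because \<open>ev z = 0\<close> puts \<open>z\<close> into
    \<open>fil 1\<close>, so \<open>Z n\<close> lies beyond the top degree.\<close>
  define Z where "Z = rec_nat z s"
  have Z_0: "Z 0 = z" and Z_Suc: "Z (Suc r) = s r (Z r)" for r
    by (simp_all add: Z_def)
  have Z: "Z r \<in> carrier K \<and> Z r \<in> fil (Suc r) \<and> d (Z r) \<in> sub (gen {..<r})" if "r \<le> n" for r
    using that
  proof (induction r)
    case 0
    then show ?case using z fil_1 by (simp add: Z_0 Idl_empty sub_zero)
  next
    case (Suc r)
    then have r: "r < n" and IH: "Z r \<in> carrier K" "Z r \<in> fil (Suc r)" "d (Z r) \<in> sub (gen {..<r})" by auto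
    note s = s_homotopy[OF r]
    have I: "ideal (gen {..<Suc r}) R" using Suc.prems by (intro gen_below_ideal)
    have "a r \<odot>\<^bsub>K\<^esub> Z r \<in> sub (gen {..<Suc r})"
      using Suc.prems by (intro sub_scalar[OF I a_gen IH(1)]) auto
    moreover have "d (Z r) \<in> sub (gen {..<Suc r})"
      using IH(3) sub_mono[OF gen_mono[of "{..<Suc r}" "{..<r}"]] Suc.prems by auto
    ultimately show ?case
      using homotopyD(2,7)[OF s] IH homotopyD(6)[OF s I] a_carrier[OF r]
      by (simp add: Z_Suc homotopy_d[OF s a_carrier[OF r]] sub_diff[OF I])
  qed
  \<comment> \<open>Descent by \<open>sub_bd_descend\<close> with \<open>x = 0\<close>: each step
    strips off one homotopy.\<close>
  have desc: "r \<le> n \<Longrightarrow> Z r \<in> sub_bd (gen {..<r}) \<Longrightarrow> Z 0 \<in> sub_bd (gen {..<0})" for r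
  proof (induction r)
    case (Suc r)
    then have r: "r < n" by simp
    have I: "ideal (gen {..<r}) R" using r by (intro gen_below_ideal) auto
    have "Z (Suc r) \<in> carrier K" using Z[of "Suc r"] Suc.prems by auto
    then have "\<zero>\<^bsub>K\<^esub> \<oplus>\<^bsub>K\<^esub> s r (Z r) \<in> sub_bd (gen {..<Suc r})"
      using Suc.prems by (simp add: Z_Suc)
    then have "Z r \<in> sub_bd (gen {..<r})"
      using Z[of r] r linear_endo_zero[OF d_linear] zero_sub[OF I]
      by (intro sub_bd_descend[OF r M.zero_closed]) auto
    then show ?case using Suc r by auto
  qed simp
  have "Z n = \<zero>\<^bsub>K\<^esub>" using Z[of n] top by blast
  then have "Z n \<in> sub_bd (gen {..<n})"
    using sub_in_sub_bd zero_sub gen_below_ideal by simp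
  then have "z \<in> sub_bd {\<zero>}" using desc[of n] by (simp add: Z_0 Idl_empty)
  then show ?thesis by (auto simp: sub_bd_def sub_zero)
qed

text \<open>\<open>Phi r c\<close> is the combination of the iterated homotopies \<open>s\<^bsub>i1\<^esub> \<dots> s\<^bsub>ip\<^esub> e\<close> with
  \<open>r > i1 > \<dots> > ip\<close>, with coefficients \<open>c {i1, \<dots>, ip}\<close>.\<close>

fun Phi :: "nat \<Rightarrow> (nat set \<Rightarrow> 'a) \<Rightarrow> 'b" where
  "Phi 0 c = c {} \<odot>\<^bsub>K\<^esub> e"
| "Phi (Suc r) c = Phi r c \<oplus>\<^bsub>K\<^esub> s r (Phi r (\<lambda>S. c (insert r S)))"

lemma Phi_closed: "r \<le> n \<Longrightarrow> c \<in> UNIV \<rightarrow> carrier R \<Longrightarrow> Phi r c \<in> carrier K"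
proof (induction r arbitrary: c)
  case (Suc r)
  then show ?case using homotopyD(2)[OF s_homotopy[of r]] by (auto simp: Pi_iff)
qed (auto simp: e_closed Pi_iff)

lemma Phi_cong: "(\<And>S. S \<subseteq> {..<r} \<Longrightarrow> c S = c' S) \<Longrightarrow> Phi r c = Phi r c'"
proof (induction r arbitrary: c c')
  case (Suc r)
  have "Phi r c = Phi r c'" using Suc.prems by (intro Suc.IH) (auto simp: lessThan_Suc)
  moreover have "Phi r (\<lambda>S. c (insert r S)) = Phi r (\<lambda>S. c' (insert r S))"
    by (intro Suc.IH Suc.prems) auto
  ultimately show ?case by simp
qed auto

lemma Phi_diff_smult:
  assumes "r \<le> n" "c \<in> UNIV \<rightarrow> carrier R" "c' \<in> UNIV \<rightarrow> carrier R" "t \<in> carrier R"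
  shows "Phi r (\<lambda>S. c S \<ominus> t \<otimes> c' S) = Phi r c \<ominus>\<^bsub>K\<^esub> t \<odot>\<^bsub>K\<^esub> Phi r c'"
  using assms
proof (induction r arbitrary: c c')
  case 0
  then have c: "c {} \<in> carrier R" "c' {} \<in> carrier R" by auto
  have "(c {} \<ominus> t \<otimes> c' {}) \<odot>\<^bsub>K\<^esub> e = c {} \<odot>\<^bsub>K\<^esub> e \<oplus>\<^bsub>K\<^esub> (\<ominus> (t \<otimes> c' {})) \<odot>\<^bsub>K\<^esub> e"
    unfolding R.minus_eq using c 0(4) e_closed by (intro smult_l_distr) auto
  then show ?case using c 0(4) e_closed by (simp add: M.minus_eq smult_l_minus smult_assoc1)
next
  case (Suc r)
  then have r: "r < n" "r \<le> n" by auto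
  define u v u' v' where uv: "u = Phi r c" "v = Phi r c'"
    "u' = Phi r (\<lambda>S. c (insert r S))" "v' = Phi r (\<lambda>S. c' (insert r S))"
  have c: "u \<in> carrier K" "v \<in> carrier K" "u' \<in> carrier K" "v' \<in> carrier K"
    unfolding uv using Suc.prems r by (auto intro!: Phi_closed)
  have sc: "s r u' \<in> carrier K" "s r v' \<in> carrier K"
    using homotopyD(2)[OF s_homotopy[OF r(1)]] c by auto
  have "Phi (Suc r) (\<lambda>S. c S \<ominus> t \<otimes> c' S)
      = (u \<ominus>\<^bsub>K\<^esub> t \<odot>\<^bsub>K\<^esub> v) \<oplus>\<^bsub>K\<^esub> s r (u' \<ominus>\<^bsub>K\<^esub> t \<odot>\<^bsub>K\<^esub> v')"
    unfolding uv using Suc r by (simp add: Pi_iff)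
  also have "s r (u' \<ominus>\<^bsub>K\<^esub> t \<odot>\<^bsub>K\<^esub> v') = s r u' \<ominus>\<^bsub>K\<^esub> t \<odot>\<^bsub>K\<^esub> s r v'"
    using homotopyD(4,5)[OF s_homotopy[OF r(1)]] c Suc.prems by simp
  also have "(u \<ominus>\<^bsub>K\<^esub> t \<odot>\<^bsub>K\<^esub> v) \<oplus>\<^bsub>K\<^esub> (s r u' \<ominus>\<^bsub>K\<^esub> t \<odot>\<^bsub>K\<^esub> s r v')
      = (u \<oplus>\<^bsub>K\<^esub> s r u') \<ominus>\<^bsub>K\<^esub> (t \<odot>\<^bsub>K\<^esub> v \<oplus>\<^bsub>K\<^esub> t \<odot>\<^bsub>K\<^esub> s r v')"
    using c(1) sc(1) smult_closed[OF Suc.prems(4) c(2)] smult_closed[OF Suc.prems(4) sc(2)] by algebra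
  also have "t \<odot>\<^bsub>K\<^esub> v \<oplus>\<^bsub>K\<^esub> t \<odot>\<^bsub>K\<^esub> s r v' = t \<odot>\<^bsub>K\<^esub> Phi (Suc r) c'"
    using c sc Suc.prems(4) by (simp add: smult_r_distr uv)
  finally show ?case by (simp add: uv)
qed

lemma Phi_zero: "r \<le> n \<Longrightarrow> Phi r (\<lambda>S. \<zero>) = \<zero>\<^bsub>K\<^esub>"
proof (induction r)
  case (Suc r)
  then show ?case using linear_endo_zero[OF homotopyD(1)[OF s_homotopy[of r]]] by simp
qed (simp add: e_closed)

text \<open>Allows a combination of iterates with indices below \<open>r\<close> to be tested for
  independence modulo a longer part of the sequence.\<close>

lemma Phi_extend:
  assumes "r \<le> k" "k \<le> n" "c \<in> UNIV \<rightarrow> carrier R" "\<And>S. \<not> S \<subseteq> {..<r} \<Longrightarrow> c S = \<zero>"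
  shows "Phi k c = Phi r c"
  using assms(1,2)
proof (induction k rule: dec_induct)
  case (step k)
  then have "k < n" "Phi r c \<in> carrier K" using assms Phi_closed by auto
  moreover have "(\<lambda>S. c (insert k S)) = (\<lambda>S. \<zero>)" using assms(4) step(1) by fastforce
  ultimately show ?case
    using step Phi_zero[of k] linear_endo_zero[OF homotopyD(1)[OF s_homotopy[of k]]] by simp
qed simp

text \<open>The unit is a cycle, and modulo the sequence every \<open>s i\<close> anticommutes with
  \<open>d\<close>.\<close>

lemma d_Phi:
  assumes "r \<le> n" "c \<in> UNIV \<rightarrow> carrier R"
  shows "d (Phi r c) \<in> sub (gen {..<r})"
  using assms
proof (induction r arbitrary: c)
  case 0
  then have "d (c {} \<odot>\<^bsub>K\<^esub> e) = \<zero>\<^bsub>K\<^esub>" using e_closed by (auto simp: d_smult d_e Pi_iff)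
  then show ?case by (simp add: Idl_empty sub_zero)
next
  case (Suc r)
  then have r: "r < n" "r \<le> n" by auto
  note s = s_homotopy[OF r(1)]
  have I: "ideal (gen {..<Suc r}) R" using Suc.prems by (intro gen_below_ideal)
  have mono: "x \<in> sub (gen {..<r}) \<Longrightarrow> x \<in> sub (gen {..<Suc r})" for x
    using sub_mono[OF gen_mono[of "{..<Suc r}" "{..<r}"]] Suc.prems by auto
  let ?y = "Phi r (\<lambda>S. c (insert r S))"
  have c: "Phi r c \<in> carrier K" "?y \<in> carrier K" using Suc.prems r by (auto intro!: Phi_closed)
  have "a r \<odot>\<^bsub>K\<^esub> ?y \<in> sub (gen {..<Suc r})"
    using Suc.prems by (intro sub_scalar[OF I a_gen c(2)]) auto
  moreover have "s r (d ?y) \<in> sub (gen {..<Suc r})" "d (Phi r c) \<in> sub (gen {..<Suc r})"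
    using Suc.IH[OF r(2)] Suc.prems homotopyD(6)[OF s I] mono by (auto simp: Pi_iff)
  ultimately show ?case
    using c homotopyD(2)[OF s]
    by (simp add: d_add homotopy_d[OF s a_carrier[OF r(1)]] sub_add[OF I] sub_diff[OF I])
qed

text \<open>For \<open>t\<close> in \<open>N\<close> the element \<open>t e\<close> is a boundary by
  \<open>N_e\<close>, and \<open>homotopy_sub_bd\<close> carries this through the iterated
  homotopies.\<close>

lemma Phi_sub_bd:
  assumes "r \<le> n" "c \<in> UNIV \<rightarrow> carrier R" "\<And>S. S \<subseteq> {..<r} \<Longrightarrow> c S \<in> N"
  shows "Phi r c \<in> sub_bd (gen {..<r})"
  using assms
proof (induction r arbitrary: c)
  case 0
  then show ?case using N_e[of "c {}"] bd_in_sub_bd[OF gen_below_ideal[of 0]] by force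
next
  case (Suc r)
  then have r: "r < n" "r \<le> n" by auto
  have I: "ideal (gen {..<Suc r}) R" "ideal (gen {..<r}) R" using Suc.prems r by (auto intro!: gen_below_ideal)
  have mono: "gen {..<r} \<subseteq> gen {..<Suc r}"
    using gen_mono[of "{..<Suc r}" "{..<r}"] Suc.prems by auto
  have 1: "Phi r c \<in> sub_bd (gen {..<r})"
    using Suc.prems r by (intro Suc.IH) (auto simp: lessThan_Suc)
  have 2: "Phi r (\<lambda>S. c (insert r S)) \<in> sub_bd (gen {..<r})"
    using Suc.prems r by (intro Suc.IH Suc.prems(3)) auto
  have "s r (Phi r (\<lambda>S. c (insert r S))) \<in> sub_bd (gen {..<Suc r})"
    using Suc.prems(1) by (intro homotopy_sub_bd[OF s_homotopy[OF r(1)] I(2,1) mono a_gen 2]) auto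
  then show ?case using sub_bd_add[OF I(1) sub_bd_mono[OF mono 1]] by simp
qed

end

section \<open>Homology of an acyclic complex modulo a regular sequence: the iterates as a
  basis\<close>

locale acyclic_sequence = complex_sequence +
  assumes acyclic: "z \<in> carrier K \<Longrightarrow> d z = \<zero>\<^bsub>K\<^esub> \<Longrightarrow> ev z = \<zero> \<Longrightarrow> z \<in> d ` carrier K"
begin

text \<open>In \<open>d z = p + a r w\<close> the element \<open>w\<close> represents the image of
  \<open>z\<close> under the connecting homomorphism. It is a cycle modulo the first r elements
  because \<open>a r\<close> cancels, and \<open>s r w\<close> has the same image as
  \<open>z\<close>; hence \<open>z - s r w\<close> is a cycle modulo the first r elements, and the
  induction hypothesis applies to both. The start is acyclicity after subtracting the unit
  coefficient.\<close>

lemma Phi_generates: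
  assumes "r \<le> n" "z \<in> carrier K" "d z \<in> sub (gen {..<r})"
  shows "\<exists>c\<in>UNIV \<rightarrow> carrier R. z \<ominus>\<^bsub>K\<^esub> Phi r c \<in> sub_bd (gen {..<r})"
  using assms
proof (induction r arbitrary: z)
  case 0
  have I: "ideal (gen {..<0}) R" by (intro gen_below_ideal) auto
  have dz: "d z = \<zero>\<^bsub>K\<^esub>" using 0 by (simp add: Idl_empty sub_zero)
  define c where "c = (\<lambda>S::nat set. ev z)"
  have c: "c \<in> UNIV \<rightarrow> carrier R" "c {} = ev z" "ev z \<in> carrier R" using 0 ev_closed by (auto simp: c_def)
  have "z \<ominus>\<^bsub>K\<^esub> ev z \<odot>\<^bsub>K\<^esub> e \<in> d ` carrier K"
  proof (rule acyclic)
    show "z \<ominus>\<^bsub>K\<^esub> ev z \<odot>\<^bsub>K\<^esub> e \<in> carrier K" using 0 c e_closed by auto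
    show "d (z \<ominus>\<^bsub>K\<^esub> ev z \<odot>\<^bsub>K\<^esub> e) = \<zero>\<^bsub>K\<^esub>" using 0 c e_closed dz by (simp add: d_diff d_smult d_e) (simp add: M.minus_eq)
    have "\<ominus>\<^bsub>K\<^esub> (ev z \<odot>\<^bsub>K\<^esub> e) = (\<ominus> ev z) \<odot>\<^bsub>K\<^esub> e" using c e_closed by (simp add: smult_l_minus)
    then show "ev (z \<ominus>\<^bsub>K\<^esub> ev z \<odot>\<^bsub>K\<^esub> e) = \<zero>"
      using 0 c e_closed by (simp add: M.minus_eq ev_add ev_smult ev_e R.r_neg)
  qed
  then show ?case using c bd_in_sub_bd[OF I] by (intro bexI[of _ c]) auto
next
  case (Suc r)
  then have r: "r < n" "r \<le> n" by auto
  note s = s_homotopy[OF r(1)]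
  have ar: "a r \<in> carrier R" by (rule a_carrier[OF r(1)])
  have I: "ideal (gen {..<Suc r}) R" "ideal (gen {..<r}) R" using Suc.prems r by (auto intro!: gen_below_ideal)
  have mono: "gen {..<r} \<subseteq> gen {..<Suc r}"
    using gen_mono[of "{..<Suc r}" "{..<r}"] Suc.prems by auto
  obtain p w where pw: "p \<in> sub (gen {..<r})" "w \<in> carrier K" "d z = p \<oplus>\<^bsub>K\<^esub> a r \<odot>\<^bsub>K\<^esub> w"
    using sub_gen_split[of "{..<r}" r "d z"] Suc.prems r by (auto simp: lessThan_Suc)
  have pc: "p \<in> carrier K" by (rule sub_carrier[OF I(2) pw(1)])
  \<comment> \<open>From \<open>d (d z) = 0\<close>: \<open>a r d w\<close> equals
    \<open>- d p\<close>, which lies in the submodule of the first r elements.\<close>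
  have "\<zero>\<^bsub>K\<^esub> = d p \<oplus>\<^bsub>K\<^esub> a r \<odot>\<^bsub>K\<^esub> d w"
    using d_d[OF Suc.prems(2)] pw pc ar by (simp add: d_add d_smult)
  then have "a r \<odot>\<^bsub>K\<^esub> d w = \<zero>\<^bsub>K\<^esub> \<ominus>\<^bsub>K\<^esub> d p"
    using M.add_eq_imp_diff[of "a r \<odot>\<^bsub>K\<^esub> d w" "d p" "\<zero>\<^bsub>K\<^esub>"] pw pc ar by (simp add: M.a_comm)
  then have dw: "d w \<in> sub (gen {..<r})"
    using sub_regular[OF r(1), of "d w"] pw sub_diff[OF I(2) zero_sub sub_d] I by simp
  obtain c' where c': "c' \<in> UNIV \<rightarrow> carrier R" "w \<ominus>\<^bsub>K\<^esub> Phi r c' \<in> sub_bd (gen {..<r})"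
    using Suc.IH[OF r(2) pw(2) dw] by blast
  have P': "Phi r c' \<in> carrier K" using c' r Phi_closed by simp
  have sw: "s r w \<in> carrier K" "s r (d w) \<in> carrier K" "s r (Phi r c') \<in> carrier K"
    using homotopyD(2)[OF s] pw P' by auto
  have "d (z \<ominus>\<^bsub>K\<^esub> s r w) = p \<oplus>\<^bsub>K\<^esub> s r (d w)"
  proof -
    have "d (z \<ominus>\<^bsub>K\<^esub> s r w) = (p \<oplus>\<^bsub>K\<^esub> a r \<odot>\<^bsub>K\<^esub> w) \<ominus>\<^bsub>K\<^esub> (a r \<odot>\<^bsub>K\<^esub> w \<ominus>\<^bsub>K\<^esub> s r (d w))"
      using Suc.prems sw by (simp add: d_diff homotopy_d[OF s ar pw(2)] pw(3))
    also have "\<dots> = p \<oplus>\<^bsub>K\<^esub> s r (d w)" using pc smult_closed[OF ar pw(2)] sw(2) by algebra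
    finally show ?thesis .
  qed
  then have "d (z \<ominus>\<^bsub>K\<^esub> s r w) \<in> sub (gen {..<r})"
    using sub_add[OF I(2) pw(1) homotopyD(6)[OF s I(2) dw]] by simp
  then obtain c1 where c1: "c1 \<in> UNIV \<rightarrow> carrier R" "z \<ominus>\<^bsub>K\<^esub> s r w \<ominus>\<^bsub>K\<^esub> Phi r c1 \<in> sub_bd (gen {..<r})"
    using Suc.IH[OF r(2), of "z \<ominus>\<^bsub>K\<^esub> s r w"] Suc.prems sw by blast
  have P1: "Phi r c1 \<in> carrier K" using c1 r Phi_closed by simp
  \<comment> \<open>On sets without \<open>r\<close> the coefficients of \<open>z - s r w\<close>,
    on sets containing \<open>r\<close> those of \<open>w\<close>.\<close>
  define c where "c S = (if r \<in> S then c' (S - {r}) else c1 S)" for S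
  have cc: "c \<in> UNIV \<rightarrow> carrier R" using c'(1) c1(1) by (auto simp: c_def Pi_iff)
  have "Phi r c = Phi r c1" by (rule Phi_cong) (auto simp: c_def)
  moreover have "Phi r (\<lambda>S. c (insert r S)) = Phi r c'"
  proof (rule Phi_cong)
    fix S assume "S \<subseteq> {..<r}"
    then have "r \<notin> S" by auto
    then show "c (insert r S) = c' S" by (simp add: c_def)
  qed
  ultimately have Pc: "Phi (Suc r) c = Phi r c1 \<oplus>\<^bsub>K\<^esub> s r (Phi r c')" by simp
  have "s r (w \<ominus>\<^bsub>K\<^esub> Phi r c') \<in> sub_bd (gen {..<Suc r})"
    using Suc.prems(1) by (intro homotopy_sub_bd[OF s I(2,1) mono a_gen c'(2)]) auto
  then have "(z \<ominus>\<^bsub>K\<^esub> s r w \<ominus>\<^bsub>K\<^esub> Phi r c1) \<oplus>\<^bsub>K\<^esub> (s r w \<ominus>\<^bsub>K\<^esub> s r (Phi r c')) \<in> sub_bd (gen {..<Suc r})"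
    using sub_bd_add[OF I(1) sub_bd_mono[OF mono c1(2)]] homotopyD(4)[OF s pw(2) P'] by simp
  moreover have "(z \<ominus>\<^bsub>K\<^esub> s r w \<ominus>\<^bsub>K\<^esub> Phi r c1) \<oplus>\<^bsub>K\<^esub> (s r w \<ominus>\<^bsub>K\<^esub> s r (Phi r c')) = z \<ominus>\<^bsub>K\<^esub> Phi (Suc r) c"
    unfolding Pc using Suc.prems(2) sw P1 by algebra
  ultimately show ?case using cc by (intro bexI[of _ c]) auto
qed

text \<open>The coefficients of sets containing \<open>r\<close> are detected by the connecting
  homomorphism. Once their contribution is removed, the rest is a boundary only modulo one more
  element; by \<open>Phi_generates\<close> this ambiguity is \<open>a r\<close> times another
  combination, which changes the coefficients only by elements of \<open>N\<close>.\<close>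

lemma Phi_independent:
  assumes "r \<le> n" "c \<in> UNIV \<rightarrow> carrier R" "Phi r c \<in> sub_bd (gen {..<r})" "S \<subseteq> {..<r}"
  shows "c S \<in> N"
  using assms
proof (induction r arbitrary: c S)
  case 0
  then have "ev (Phi 0 c) \<in> N" using gen_below_ideal[of 0] gen_N[of "{}"] by (intro ev_sub_bd) auto
  moreover have "c {} \<in> carrier R" using 0 by auto
  ultimately show ?case using 0 e_closed by (simp add: ev_smult ev_e)
next
  case (Suc r)
  then have r: "r < n" "r \<le> n" by auto
  note s = s_homotopy[OF r(1)]
  have ar: "a r \<in> carrier R" by (rule a_carrier[OF r(1)])
  have I: "ideal (gen {..<Suc r}) R" "ideal (gen {..<r}) R" using Suc.prems r by (auto intro!: gen_below_ideal)
  have mono: "gen {..<r} \<subseteq> gen {..<Suc r}"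
    using gen_mono[of "{..<Suc r}" "{..<r}"] Suc.prems by auto
  let ?c = "\<lambda>S. c (insert r S)"
  have cc: "?c \<in> UNIV \<rightarrow> carrier R" using Suc.prems by auto
  define x y where xy: "x = Phi r c" "y = Phi r ?c"
  have P: "x \<in> carrier K" "y \<in> carrier K" unfolding xy using Suc.prems cc r by (auto intro!: Phi_closed)
  have dP: "d x \<in> sub (gen {..<r})" "d (y) \<in> sub (gen {..<r})"
    unfolding xy using Suc.prems cc r by (auto intro!: d_Phi)
  have sP: "s r (y) \<in> carrier K" using homotopyD(2)[OF s P(2)] .
  have P2: "y \<in> sub_bd (gen {..<r})"
    using Suc.prems xy by (intro sub_bd_descend[OF r(1) P(1) dP(1) P(2) dP(2)]) auto
  then have c_in: "?c S \<in> N" if "S \<subseteq> {..<r}" for S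
    using Suc.IH[OF r(2) cc _ that] by (simp add: xy)
  have "s r (y) \<in> sub_bd (gen {..<Suc r})"
    using Suc.prems(1) by (intro homotopy_sub_bd[OF s I(2,1) mono a_gen P2]) auto
  with Suc.prems(3) have "(x \<oplus>\<^bsub>K\<^esub> s r (y)) \<ominus>\<^bsub>K\<^esub> s r (y) \<in> sub_bd (gen {..<Suc r})"
    by (intro sub_bd_diff[OF I(1)]) (auto simp: xy)
  moreover have "(x \<oplus>\<^bsub>K\<^esub> s r (y)) \<ominus>\<^bsub>K\<^esub> s r (y) = x"
    using P(1) sP by algebra
  ultimately have "x \<in> sub_bd (gen {..<Suc r})" by simp
  \<comment> \<open>\<open>x\<close> is a cycle modulo the first r elements that dies modulo
    \<open>a r\<close> as well, so it is \<open>a r u\<close> up to a boundary.\<close>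
  then obtain u where u: "u \<in> carrier K" "d u \<in> sub (gen {..<r})"
      "x \<ominus>\<^bsub>K\<^esub> a r \<odot>\<^bsub>K\<^esub> u \<in> sub_bd (gen {..<r})"
    using sub_bd_Suc_cycle[OF r(1) P(1) dP(1)] by blast
  obtain c' where c': "c' \<in> UNIV \<rightarrow> carrier R" "u \<ominus>\<^bsub>K\<^esub> Phi r c' \<in> sub_bd (gen {..<r})"
    using Phi_generates[OF r(2) u(1,2)] by blast
  have P': "Phi r c' \<in> carrier K" using c' r Phi_closed by simp
  have "(x \<ominus>\<^bsub>K\<^esub> a r \<odot>\<^bsub>K\<^esub> u) \<oplus>\<^bsub>K\<^esub> a r \<odot>\<^bsub>K\<^esub> (u \<ominus>\<^bsub>K\<^esub> Phi r c') \<in> sub_bd (gen {..<r})"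
    by (rule sub_bd_add[OF I(2) u(3) sub_bd_smult[OF I(2) ar c'(2)]])
  moreover have "(x \<ominus>\<^bsub>K\<^esub> a r \<odot>\<^bsub>K\<^esub> u) \<oplus>\<^bsub>K\<^esub> a r \<odot>\<^bsub>K\<^esub> (u \<ominus>\<^bsub>K\<^esub> Phi r c')
      = x \<ominus>\<^bsub>K\<^esub> a r \<odot>\<^bsub>K\<^esub> Phi r c'"
    unfolding smult_diff[OF ar u(1) P']
    using P(1) smult_closed[OF ar u(1)] smult_closed[OF ar P'] by algebra
  ultimately have "Phi r (\<lambda>S. c S \<ominus> a r \<otimes> c' S) \<in> sub_bd (gen {..<r})"
    using Phi_diff_smult[OF r(2) Suc.prems(2) c'(1) ar] by (simp add: xy)
  then have diff: "c S \<ominus> a r \<otimes> c' S \<in> N" if "S \<subseteq> {..<r}" for S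
    using Suc.IH[OF r(2) _ _ that, of "\<lambda>S. c S \<ominus> a r \<otimes> c' S"] Suc.prems c' ar by (auto simp: Pi_iff)
  show ?case
  proof (cases "r \<in> S")
    case True
    then have "c S = ?c (S - {r})" by (simp add: insert_absorb)
    then show ?thesis using c_in[of "S - {r}"] Suc.prems(4) by (auto simp: lessThan_Suc)
  next
    case False
    then have S: "S \<subseteq> {..<r}" using Suc.prems(4) by (auto simp: lessThan_Suc)
    have cS: "c S \<in> carrier R" "c' S \<in> carrier R" using Suc.prems c' by auto
    have "a r \<otimes> c' S \<in> N" using ideal.I_r_closed[OF N_ideal a_N[OF r(1)] cS(2)] .
    then have "(c S \<ominus> a r \<otimes> c' S) \<oplus> a r \<otimes> c' S \<in> N"
      using diff[OF S] additive_subgroup.a_closed[OF ideal.axioms(1)[OF N_ideal]] by blast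
    moreover have "(c S \<ominus> a r \<otimes> c' S) \<oplus> a r \<otimes> c' S = c S" using cS ar by algebra
    ultimately show ?thesis by simp
  qed
qed

text \<open>The induction removes the classes \<open>s r (Phi r _)\<close> from \<open>z\<close> one index \<open>r\<close> at a time: looking
  at the coefficient of \<open>a r\<close> in \<open>d z\<close>, the class \<open>Phi r _\<close> vanishes modulo \<open>gen {..<n}\<close>.\<close>

lemma cycle_mod_product:
  assumes m: "m \<le> n" and L: "ideal L R" "L \<subseteq> gen {..<m}"
    and syzygy: "\<And>r t b. r < m \<Longrightarrow> t \<in> carrier R \<Longrightarrow> b \<in> gen ({..<m} - {r}) \<Longrightarrow> a r \<otimes> t \<oplus> b \<in> L \<Longrightarrow> t \<in> gen {..<n}"
    and z: "z \<in> carrier K" "ev z \<in> N" "d z \<in> sub L"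
  shows "z \<in> sub_bd (gen {..<m})"
proof -
  let ?I = "gen {..<m}" and ?J = "gen {..<n}"
  have I: "ideal ?I R" and J: "ideal ?J R" using m by (auto intro: gen_below_ideal)
  \<comment> \<open>The hypothesis says that correcting the combination by an element
    \<open>p\<close> of I K gives a differential \<open>l\<close> in L K. Leaving \<open>p\<close>
    arbitrary makes the hypothesis stable when a class is removed in the induction.\<close>
  have *: "Phi r c \<ominus>\<^bsub>K\<^esub> c {} \<odot>\<^bsub>K\<^esub> e \<in> sub_bd ?I"
    if "r \<le> m" "c \<in> UNIV \<rightarrow> carrier R" "l \<in> sub L" "p \<in> sub ?I" "d (Phi r c) = l \<oplus>\<^bsub>K\<^esub> d p" for r c l p
    using that
  proof (induction r arbitrary: p)
    case 0
    have "c {} \<odot>\<^bsub>K\<^esub> e \<in> carrier K" using 0 e_closed by auto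
    then show ?case using sub_in_sub_bd[OF I zero_sub[OF I]] by (simp add: M.minus_eq M.r_neg)
  next
    case (Suc r)
    then have r: "r < m" "r \<le> m" "r < n" "r \<le> n" using m by auto
    note s = s_homotopy[OF r(3)]
    have ar: "a r \<in> carrier R" by (rule a_carrier[OF r(3)])
    let ?c = "\<lambda>S. c (insert r S)" and ?B = "gen ({..<m} - {r})"
    have B: "ideal ?B R" using m by (intro gen_ideal) auto
    have Ir: "ideal (gen {..<r}) R" "ideal (gen {..<Suc r}) R" using r by (auto intro: gen_below_ideal)
    have rB: "gen {..<r} \<subseteq> ?B" and rS: "gen {..<r} \<subseteq> gen {..<Suc r}" and SI: "gen {..<Suc r} \<subseteq> ?I"
      using r m by (intro gen_mono; auto)+
    have cc: "?c \<in> UNIV \<rightarrow> carrier R" using Suc.prems by auto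
    define x y where xy: "x = Phi r c" "y = Phi r ?c"
    have P: "x \<in> carrier K" "y \<in> carrier K" unfolding xy using Suc.prems cc r by (auto intro!: Phi_closed)
    have dP: "d x \<in> sub (gen {..<r})" "d y \<in> sub (gen {..<r})"
      unfolding xy using Suc.prems cc r by (auto intro!: d_Phi)
    have sP: "s r y \<in> carrier K" "s r (d y) \<in> carrier K" using homotopyD(2)[OF s] P by auto
    have l: "l \<in> carrier K" using Suc.prems L sub_carrier by auto
    have p: "p \<in> carrier K" using Suc.prems I sub_carrier by auto
    \<comment> \<open>\<open>p\<close> involves all of the first m elements, including those above
      \<open>r\<close>, so \<open>a r\<close> has to be separated from all the others and not only
      from the smaller ones.\<close>
    have "p \<in> sub (gen (insert r ({..<m} - {r})))"
      using Suc.prems(4) r by (simp add: insert_absorb)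
    then obtain p' u where pu: "p' \<in> sub ?B" "u \<in> carrier K" "p = p' \<oplus>\<^bsub>K\<^esub> a r \<odot>\<^bsub>K\<^esub> u"
      using sub_gen_split[of "{..<m} - {r}" r p] r m by (meson Diff_subset lessThan_subset_iff subset_trans)
    have p'c: "p' \<in> carrier K" by (rule sub_carrier[OF B pu(1)])
    have dsum: "d x \<oplus>\<^bsub>K\<^esub> (a r \<odot>\<^bsub>K\<^esub> y \<ominus>\<^bsub>K\<^esub> s r (d y)) = l \<oplus>\<^bsub>K\<^esub> (d p' \<oplus>\<^bsub>K\<^esub> a r \<odot>\<^bsub>K\<^esub> d u)"
      using Suc.prems(5)[simplified, folded xy] P sP pu p'c ar by (simp add: d_add d_smult homotopy_d[OF s ar])
    let ?b = "d x \<ominus>\<^bsub>K\<^esub> s r (d y) \<ominus>\<^bsub>K\<^esub> d p'"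
    have b: "?b \<in> sub ?B"
    proof (rule sub_diff[OF B sub_diff[OF B] sub_d[OF B pu(1)]])
      show "d x \<in> sub ?B" "s r (d y) \<in> sub ?B"
        using sub_mono[OF rB] dP homotopyD(6)[OF s Ir(1) dP(2)] by blast+
    qed
    \<comment> \<open>Collect the multiples of \<open>a r\<close> in
      \<open>d (Phi (Suc r) c) = l + d p\<close>. All other terms form \<open>?b\<close>, and
      \<open>syzygy\<close>, applied to each coefficient, puts the cofactor \<open>y - d u\<close>
      into J K.\<close>
    have "a r \<odot>\<^bsub>K\<^esub> (y \<ominus>\<^bsub>K\<^esub> d u) \<oplus>\<^bsub>K\<^esub> ?b
        = (d x \<oplus>\<^bsub>K\<^esub> (a r \<odot>\<^bsub>K\<^esub> y \<ominus>\<^bsub>K\<^esub> s r (d y))) \<ominus>\<^bsub>K\<^esub> (d p' \<oplus>\<^bsub>K\<^esub> a r \<odot>\<^bsub>K\<^esub> d u)"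
      unfolding smult_diff[OF ar P(2) d_closed[OF pu(2)]]
      using d_closed[OF P(1)] smult_closed[OF ar P(2)] sP(2) d_closed[OF p'c]
        smult_closed[OF ar d_closed[OF pu(2)]] by algebra
    also have "\<dots> = l"
      unfolding dsum using l d_closed[OF p'c] smult_closed[OF ar d_closed[OF pu(2)]] by algebra
    finally have "a r \<odot>\<^bsub>K\<^esub> (y \<ominus>\<^bsub>K\<^esub> d u) \<oplus>\<^bsub>K\<^esub> ?b \<in> sub L" using Suc.prems(3) by simp
    then have yu: "y \<ominus>\<^bsub>K\<^esub> d u \<in> sub ?J"
      using P pu syzygy r(1) by (intro sub_cancel[OF L(1) B J ar _ _ b]) auto
    have "y = (y \<ominus>\<^bsub>K\<^esub> d u) \<oplus>\<^bsub>K\<^esub> d u" using P(2) d_closed[OF pu(2)] by algebra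
    then have yJ: "y \<in> sub_bd ?J" by (rule sub_bdI[OF yu pu(2)])
    \<comment> \<open>\<open>y\<close> is a boundary modulo the whole sequence, so independence is
      used at length \<open>n\<close>; for this the coefficients are extended by zero.\<close>
    define c' where "c' S = (if S \<subseteq> {..<r} then ?c S else \<zero>)" for S
    have c': "c' \<in> UNIV \<rightarrow> carrier R" using cc by (auto simp: c'_def)
    have "Phi n c' = Phi r c'" using r c' by (intro Phi_extend) (auto simp: c'_def)
    also have "\<dots> = y" unfolding xy by (rule Phi_cong) (simp add: c'_def)
    finally have "Phi n c' \<in> sub_bd ?J" using yJ by simp
    then have "c' S \<in> N" if "S \<subseteq> {..<r}" for S
      using Phi_independent[OF _ c', of n S] that r by force
    then have "?c S \<in> N" if "S \<subseteq> {..<r}" for S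
      using that by (simp add: c'_def)
    then have "y \<in> sub_bd (gen {..<r})" unfolding xy using cc r by (intro Phi_sub_bd) auto
    then have "s r y \<in> sub_bd (gen {..<Suc r})"
      using r by (intro homotopy_sub_bd[OF s Ir rS a_gen]) auto
    then have sy: "s r y \<in> sub_bd ?I" by (rule sub_bd_mono[OF SI])
    then obtain p2 q2 where p2: "p2 \<in> sub ?I" "q2 \<in> carrier K" "s r y = p2 \<oplus>\<^bsub>K\<^esub> d q2" by (rule sub_bdE)
    have p2c: "p2 \<in> carrier K" by (rule sub_carrier[OF I p2(1)])
    have "d (s r y) = d p2" using p2 p2c by (simp add: d_add d_d)
    then have "d x \<oplus>\<^bsub>K\<^esub> d p2 = l \<oplus>\<^bsub>K\<^esub> d p" using Suc.prems(5)[simplified, folded xy] P sP by (simp add: d_add)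
    then have "d x = (l \<oplus>\<^bsub>K\<^esub> d p) \<ominus>\<^bsub>K\<^esub> d p2"
      using P p2c by (intro M.add_eq_imp_diff) auto
    also have "\<dots> = l \<oplus>\<^bsub>K\<^esub> (d p \<ominus>\<^bsub>K\<^esub> d p2)" using l d_closed[OF p] d_closed[OF p2c] by algebra
    also have "\<dots> = l \<oplus>\<^bsub>K\<^esub> d (p \<ominus>\<^bsub>K\<^esub> p2)" using p p2c by (simp add: d_diff)
    finally have "d (Phi r c) = l \<oplus>\<^bsub>K\<^esub> d (p \<ominus>\<^bsub>K\<^esub> p2)" unfolding xy .
    then have "x \<ominus>\<^bsub>K\<^esub> c {} \<odot>\<^bsub>K\<^esub> e \<in> sub_bd ?I"
      unfolding xy using Suc.prems r sub_diff[OF I _ p2(1)] by (intro Suc.IH) auto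
    then have "(x \<ominus>\<^bsub>K\<^esub> c {} \<odot>\<^bsub>K\<^esub> e) \<oplus>\<^bsub>K\<^esub> s r y \<in> sub_bd ?I" by (rule sub_bd_add[OF I _ sy])
    moreover have ce: "c {} \<odot>\<^bsub>K\<^esub> e \<in> carrier K" using Suc.prems e_closed by auto
    have "(x \<ominus>\<^bsub>K\<^esub> c {} \<odot>\<^bsub>K\<^esub> e) \<oplus>\<^bsub>K\<^esub> s r y = (x \<oplus>\<^bsub>K\<^esub> s r y) \<ominus>\<^bsub>K\<^esub> c {} \<odot>\<^bsub>K\<^esub> e"
      using ce P(1) sP(1) by algebra
    ultimately show ?case by (simp add: xy)
  qed
  have "d z \<in> sub ?I" using z(3) sub_mono[OF L(2)] by blast
  then obtain c where c: "c \<in> UNIV \<rightarrow> carrier R" "z \<ominus>\<^bsub>K\<^esub> Phi m c \<in> sub_bd ?I"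
    using Phi_generates[OF m z(1)] by blast
  have P: "Phi m c \<in> carrier K" using c m Phi_closed by simp
  obtain p q where pq: "p \<in> sub ?I" "q \<in> carrier K" "z \<ominus>\<^bsub>K\<^esub> Phi m c = p \<oplus>\<^bsub>K\<^esub> d q"
    by (rule sub_bdE[OF c(2)])
  have pc: "p \<in> carrier K" by (rule sub_carrier[OF I pq(1)])
  have "d z \<ominus>\<^bsub>K\<^esub> d (Phi m c) = d p"
    using pq(2) pc z(1) P arg_cong[OF pq(3), of d] by (simp add: d_diff d_add d_d)
  from this[symmetric] have "d (Phi m c) = d z \<ominus>\<^bsub>K\<^esub> d p"
    using z P pc by (intro M.diff_eq_swap[of "d p" "d (Phi m c)" "d z"] d_closed)
  also have "\<dots> = d z \<oplus>\<^bsub>K\<^esub> d (\<zero>\<^bsub>K\<^esub> \<ominus>\<^bsub>K\<^esub> p)"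
    using pc by (simp add: M.minus_eq linear_endo_minus[OF d_linear])
  finally have 0: "d (Phi m c) = d z \<oplus>\<^bsub>K\<^esub> d (\<zero>\<^bsub>K\<^esub> \<ominus>\<^bsub>K\<^esub> p)" .
  have 1: "Phi m c \<ominus>\<^bsub>K\<^esub> c {} \<odot>\<^bsub>K\<^esub> e \<in> sub_bd ?I"
    by (rule *[OF order.refl c(1) z(3) sub_diff[OF I zero_sub[OF I] pq(1)] 0])
  have c0: "c {} \<in> carrier R" "c {} \<odot>\<^bsub>K\<^esub> e \<in> carrier K" using c e_closed by auto
  have "(z \<ominus>\<^bsub>K\<^esub> Phi m c) \<oplus>\<^bsub>K\<^esub> (Phi m c \<ominus>\<^bsub>K\<^esub> c {} \<odot>\<^bsub>K\<^esub> e) = z \<ominus>\<^bsub>K\<^esub> c {} \<odot>\<^bsub>K\<^esub> e"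
    using z(1) P c0(2) by algebra
  then have zc: "z \<ominus>\<^bsub>K\<^esub> c {} \<odot>\<^bsub>K\<^esub> e \<in> sub_bd ?I" using sub_bd_add[OF I c(2) 1] by simp
  \<comment> \<open>What remains is a multiple of the unit. The hypothesis on \<open>ev z\<close>
    forces its coefficient \<open>c {}\<close> into \<open>N\<close>, where \<open>N_e\<close> makes
    the multiple a boundary.\<close>
  have "ev (z \<ominus>\<^bsub>K\<^esub> c {} \<odot>\<^bsub>K\<^esub> e) \<in> N" using m by (intro ev_sub_bd[OF I gen_N zc]) auto
  moreover have "\<ominus>\<^bsub>K\<^esub> (c {} \<odot>\<^bsub>K\<^esub> e) = (\<ominus> c {}) \<odot>\<^bsub>K\<^esub> e" using c0 e_closed by (simp add: smult_l_minus)
  ultimately have "ev z \<ominus> c {} \<in> N"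
    using z c0 e_closed by (simp add: M.minus_eq ev_add ev_smult ev_e R.minus_eq)
  moreover have "c {} = ev z \<ominus> (ev z \<ominus> c {})" using c0(1) ev_closed[OF z(1)] by algebra
  ultimately have "c {} \<in> N"
    using z(2) additive_subgroup.a_closed[OF ideal.axioms(1)[OF N_ideal]]
      additive_subgroup.a_inv_closed[OF ideal.axioms(1)[OF N_ideal]] by (metis R.minus_eq)
  then have "c {} \<odot>\<^bsub>K\<^esub> e \<in> sub_bd ?I" using N_e bd_in_sub_bd[OF I] by force
  then have "(z \<ominus>\<^bsub>K\<^esub> c {} \<odot>\<^bsub>K\<^esub> e) \<oplus>\<^bsub>K\<^esub> c {} \<odot>\<^bsub>K\<^esub> e \<in> sub_bd ?I" by (rule sub_bd_add[OF I zc])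
  moreover have "(z \<ominus>\<^bsub>K\<^esub> c {} \<odot>\<^bsub>K\<^esub> e) \<oplus>\<^bsub>K\<^esub> c {} \<odot>\<^bsub>K\<^esub> e = z" using z(1) c0(2) by algebra
  ultimately show ?thesis by simp
qed

end

section \<open>The exterior algebra and the Koszul complex\<close>

context cring
begin

definition sg :: "nat \<Rightarrow> 'a" where "sg n = (if even n then \<one> else \<ominus> \<one>)"

lemma sg_closed [simp]: "sg n \<in> carrier R"
  by (simp add: sg_def)

lemma sgn_times_eq: "x \<in> carrier R \<Longrightarrow> sgn_times R n x = sg n \<otimes> x"
  by (simp add: sgn_times_def sg_def l_minus)

lemma sg_add: "sg (m + n) = sg m \<otimes> sg n"
  by (simp add: sg_def l_minus r_minus)

lemma sg_parity: "even (m + n) \<Longrightarrow> sg m = sg n"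
  by (auto simp: sg_def)

lemma sg_parity_neg: "odd (m + n) \<Longrightarrow> sg m = \<ominus> sg n"
  by (auto simp: sg_def)

lemma sg_square: "x \<in> carrier R \<Longrightarrow> sg n \<otimes> (sg n \<otimes> x) = x"
  by (simp add: sg_def l_minus)

lemma sg_0 [simp]: "sg 0 = \<one>"
  by (simp add: sg_def)

lemma finsum_Pow_insert:
  assumes "finite S" "i \<notin> S" "h \<in> Pow (insert i S) \<rightarrow> carrier R"
  shows "finsum R h (Pow (insert i S)) = (\<Oplus>T\<in>Pow S. h T) \<oplus> (\<Oplus>T\<in>Pow S. h (insert i T))"
proof -
  have "finsum R h (Pow S \<union> insert i ` Pow S) = finsum R h (Pow S) \<oplus> finsum R h (insert i ` Pow S)"
    using assms by (intro finsum_Un_disjoint) (auto simp: Pi_iff)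
  moreover have "finsum R h (insert i ` Pow S) = (\<Oplus>T\<in>Pow S. h (insert i T))"
  proof (rule finsum_reindex)
    show "inj_on (insert i) (Pow S)"
      using assms(2) by (intro inj_onI) (metis Pow_iff insert_ident subset_iff)
  qed (use assms in \<open>auto simp: Pi_iff\<close>)
  ultimately show ?thesis by (simp add: Pow_insert)
qed

lemma finsum_swap:
  assumes "finite A" "finite B" "\<And>i j. i \<in> A \<Longrightarrow> j \<in> B \<Longrightarrow> h i j \<in> carrier R"
  shows "(\<Oplus>i\<in>A. \<Oplus>j\<in>B. h i j) = (\<Oplus>j\<in>B. \<Oplus>i\<in>A. h i j)"
  using assms(1,3)
proof (induction A rule: finite_induct)
  case empty
  then show ?case by (simp add: finsum_zero)
next
  case (insert k A)
  have "(\<Oplus>i\<in>insert k A. \<Oplus>j\<in>B. h i j) = (\<Oplus>j\<in>B. h k j) \<oplus> (\<Oplus>j\<in>B. \<Oplus>i\<in>A. h i j)"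
    using insert by (subst finsum_insert) (auto intro!: finsum_closed)
  also have "\<dots> = (\<Oplus>j\<in>B. h k j \<oplus> (\<Oplus>i\<in>A. h i j))"
    using insert by (subst finsum_addf) (auto intro!: finsum_closed)
  also have "\<dots> = (\<Oplus>j\<in>B. \<Oplus>i\<in>insert k A. h i j)"
    using insert by (intro finsum_cong') (auto simp: finsum_insert Pi_iff intro!: finsum_closed)
  finally show ?case .
qed

text \<open>The terms cancel in pairs. The diagonal is a separate hypothesis because in
  characteristic 2 the pair condition says nothing about \<open>h i i\<close>.\<close>

lemma finsum_antisym:
  assumes "finite A" "\<And>i j. i \<in> A \<Longrightarrow> j \<in> A \<Longrightarrow> h i j \<in> carrier R"
    "\<And>i. i \<in> A \<Longrightarrow> h i i = \<zero>" "\<And>i j. i \<in> A \<Longrightarrow> j \<in> A \<Longrightarrow> h i j \<oplus> h j i = \<zero>"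
  shows "(\<Oplus>i\<in>A. \<Oplus>j\<in>A. h i j) = \<zero>"
  using assms
proof (induction A rule: finite_induct)
  case (insert k A)
  have c: "(\<Oplus>i\<in>A. h i k) \<in> carrier R" "(\<Oplus>j\<in>A. h k j) \<in> carrier R" "(\<Oplus>i\<in>A. \<Oplus>j\<in>A. h i j) \<in> carrier R"
    using insert.prems by (auto intro!: finsum_closed)
  have "(\<Oplus>i\<in>insert k A. \<Oplus>j\<in>insert k A. h i j) = (\<Oplus>j\<in>A. h k j) \<oplus> (\<Oplus>i\<in>A. \<Oplus>j\<in>insert k A. h i j)"
    using insert.hyps insert.prems c by (simp add: finsum_insert Pi_iff finsum_closed)
  also have "(\<Oplus>i\<in>A. \<Oplus>j\<in>insert k A. h i j) = (\<Oplus>i\<in>A. h i k \<oplus> (\<Oplus>j\<in>A. h i j))"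
    using insert.hyps insert.prems by (intro finsum_cong') (auto simp: finsum_insert Pi_iff intro!: finsum_closed)
  also have "\<dots> = (\<Oplus>i\<in>A. h i k) \<oplus> (\<Oplus>i\<in>A. \<Oplus>j\<in>A. h i j)"
    using insert.hyps insert.prems by (intro finsum_addf) (auto intro!: finsum_closed)
  also have "(\<Oplus>i\<in>A. \<Oplus>j\<in>A. h i j) = \<zero>" using insert by auto
  also have "(\<Oplus>j\<in>A. h k j) \<oplus> ((\<Oplus>i\<in>A. h i k) \<oplus> \<zero>) = (\<Oplus>i\<in>A. h k i \<oplus> h i k)"
    using insert.prems c by (subst finsum_addf) auto
  also have "\<dots> = \<zero>"
    using insert.prems by (intro add.finprod_one_eqI) auto
  finally show ?case .
qed simp

end

section \<open>Sign exponents\<close>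

definition below :: "nat set \<Rightarrow> nat \<Rightarrow> nat" where
  "below S i = card {j \<in> S. j < i}"

definition inversions :: "nat set \<Rightarrow> nat set \<Rightarrow> nat" where
  "inversions T U = card {(t, u) \<in> T \<times> U. u < t}"

lemma finite_below: "finite {j \<in> S. j < (i::nat)}"
  by (rule finite_subset[of _ "{..<i}"]) auto

lemma below_insert: "k \<notin> S \<Longrightarrow> below (insert k S) i = (if k < i then Suc (below S i) else below S i)"
proof -
  assume k: "k \<notin> S"
  have "{j \<in> insert k S. j < i} = (if k < i then insert k {j \<in> S. j < i} else {j \<in> S. j < i})" by auto
  then show ?thesis using k finite_below[of S i] by (auto simp: below_def)
qed

lemma below_split: "T \<subseteq> S \<Longrightarrow> below S i = below T i + below (S - T) i"
proof -
  assume "T \<subseteq> S"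
  then have "{j \<in> S. j < i} = {j \<in> T. j < i} \<union> {j \<in> S - T. j < i}" by auto
  then show ?thesis
    unfolding below_def by (subst card_Un_disjoint[symmetric]) (auto intro: finite_below)
qed

lemma finite_inversions: "finite T \<Longrightarrow> finite U \<Longrightarrow> finite {(t, u) \<in> T \<times> U. u < (t::nat)}"
  by (rule finite_subset[of _ "T \<times> U"]) auto

lemma inversions_insert_left:
  assumes "finite T" "finite U" "i \<notin> T"
  shows "inversions (insert i T) U = inversions T U + below U i"
proof -
  have "{(t, u) \<in> insert i T \<times> U. u < t} = {(t, u) \<in> T \<times> U. u < t} \<union> Pair i ` {u \<in> U. u < i}" by auto
  moreover have "card (Pair i ` {u \<in> U. u < i}) = below U i"
    unfolding below_def by (rule card_image) (simp add: inj_on_def)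
  moreover have "card ({(t, u) \<in> T \<times> U. u < t} \<union> Pair i ` {u \<in> U. u < i})
      = card {(t, u) \<in> T \<times> U. u < t} + card (Pair i ` {u \<in> U. u < i})"
    using assms finite_inversions[of T U] by (intro card_Un_disjoint) auto
  ultimately show ?thesis by (simp add: inversions_def)
qed

text \<open>The new pairs are \<open>(t, i)\<close> with \<open>i < t\<close>, and there are
  \<open>card T - below T i\<close> of them. The additive form avoids truncated subtraction.\<close>

lemma inversions_insert_right:
  assumes "finite T" "finite U" "i \<notin> U" "i \<notin> T"
  shows "inversions T (insert i U) + below T i = inversions T U + card T"
proof -
  have "{(t, u) \<in> T \<times> insert i U. u < t} = {(t, u) \<in> T \<times> U. u < t} \<union> (\<lambda>t. (t, i)) ` {t \<in> T. i < t}" by auto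
  moreover have "card ((\<lambda>t. (t, i)) ` {t \<in> T. i < t}) = card {t \<in> T. i < t}"
    by (rule card_image) (simp add: inj_on_def)
  moreover have "card ({(t, u) \<in> T \<times> U. u < t} \<union> (\<lambda>t. (t, i)) ` {t \<in> T. i < t})
      = card {(t, u) \<in> T \<times> U. u < t} + card ((\<lambda>t. (t, i)) ` {t \<in> T. i < t})"
    using assms finite_inversions[of T U] by (intro card_Un_disjoint) auto
  ultimately have 1: "inversions T (insert i U) = inversions T U + card {t \<in> T. i < t}"
    by (simp add: inversions_def)
  have "{t \<in> T. i < t} \<union> {t \<in> T. t < i} = T"
    using assms(4) by (auto simp: set_eq_iff) (metis linorder_neqE_nat)
  moreover have "card ({t \<in> T. i < t} \<union> {t \<in> T. t < i}) = card {t \<in> T. i < t} + card {t \<in> T. t < i}"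
  proof (rule card_Un_disjoint)
    show "{t \<in> T. i < t} \<inter> {t \<in> T. t < i} = {}" using less_asym by blast
  qed (use assms(1) in simp_all)
  ultimately have "card T = card {t \<in> T. i < t} + below T i" by (simp add: below_def)
  with 1 show ?thesis by simp
qed

section \<open>Exterior product and contractions\<close>

locale exterior_algebra = cring R for R :: "('a, 'r) ring_scheme" (structure) +
  fixes D :: "nat set"
  assumes finite_D: "finite D"
begin

text \<open>Values outside the subsets of \<open>D\<close> are left free, so constructions need no
  restriction and identities are asserted only at sets \<open>S \<subseteq> D\<close>. Extensional
  versions follow with \<open>kd\<close> and \<open>kh\<close>.\<close>

definition forms :: "(nat set \<Rightarrow> 'a) set" where "forms = Pow D \<rightarrow> carrier R"

text \<open>\<open>con i\<close> is contraction with the \<open>i\<close>-th coordinate, \<open>wed i\<close> multiplication by \<open>e\<^sub>i\<close> from the left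
  and \<open>alt\<close> the grading involution.\<close>

definition con :: "nat \<Rightarrow> (nat set \<Rightarrow> 'a) \<Rightarrow> nat set \<Rightarrow> 'a" where
  "con i f S = (if i \<in> S then \<zero> else sg (below S i) \<otimes> f (insert i S))"

definition wed :: "nat \<Rightarrow> (nat set \<Rightarrow> 'a) \<Rightarrow> nat set \<Rightarrow> 'a" where
  "wed i f S = (if i \<in> S then sg (below S i) \<otimes> f (S - {i}) else \<zero>)"

definition alt :: "(nat set \<Rightarrow> 'a) \<Rightarrow> nat set \<Rightarrow> 'a" where
  "alt f S = sg (card S) \<otimes> f S"

definition mul :: "(nat set \<Rightarrow> 'a) \<Rightarrow> (nat set \<Rightarrow> 'a) \<Rightarrow> nat set \<Rightarrow> 'a" where
  "mul f g S = (\<Oplus>T\<in>Pow S. sg (inversions T (S - T)) \<otimes> (f T \<otimes> g (S - T)))"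

definition unit :: "nat set \<Rightarrow> 'a" where
  "unit S = (if S = {} then \<one> else \<zero>)"

lemma formsD: "f \<in> forms \<Longrightarrow> S \<subseteq> D \<Longrightarrow> f S \<in> carrier R"
  by (auto simp: forms_def)

lemma finite_sub: "S \<subseteq> D \<Longrightarrow> finite S"
  using finite_D finite_subset by blast

lemma con_forms [simp, intro]: "f \<in> forms \<Longrightarrow> i \<in> D \<Longrightarrow> con i f \<in> forms"
  by (auto simp: forms_def con_def Pi_iff)

lemma wed_forms [simp, intro]: "f \<in> forms \<Longrightarrow> wed i f \<in> forms"
  by (auto simp: forms_def wed_def Pi_iff intro!: m_closed)

lemma alt_forms [simp, intro]: "f \<in> forms \<Longrightarrow> alt f \<in> forms"
  by (auto simp: forms_def alt_def Pi_iff)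

lemma mul_forms [simp, intro]: "f \<in> forms \<Longrightarrow> g \<in> forms \<Longrightarrow> mul f g \<in> forms"
  by (auto simp: forms_def mul_def Pi_iff intro!: finsum_closed m_closed)

lemma unit_forms [simp, intro]: "unit \<in> forms"
  by (auto simp: forms_def unit_def)

lemma add_forms: "f \<in> forms \<Longrightarrow> g \<in> forms \<Longrightarrow> (\<lambda>S. f S \<oplus> g S) \<in> forms"
  by (auto simp: forms_def)

lemma smult_forms: "f \<in> forms \<Longrightarrow> c \<in> carrier R \<Longrightarrow> (\<lambda>S. c \<otimes> f S) \<in> forms"
  by (auto simp: forms_def)

lemma mul_cong:
  assumes "\<And>T. T \<subseteq> S \<Longrightarrow> f T = f' T" "\<And>T. T \<subseteq> S \<Longrightarrow> g T = g' T" "f' \<in> forms" "g' \<in> forms" "S \<subseteq> D"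
  shows "mul f g S = mul f' g' S"
  unfolding mul_def
proof (rule finsum_cong')
  show "(\<lambda>T. sg (inversions T (S - T)) \<otimes> (f' T \<otimes> g' (S - T))) \<in> Pow S \<rightarrow> carrier R"
    using assms(5) by (auto intro!: m_closed formsD[OF assms(3)] formsD[OF assms(4)])
qed (use assms(1,2) in auto)

lemma mul_add_left:
  assumes "f \<in> forms" "f' \<in> forms" "g \<in> forms" "S \<subseteq> D"
  shows "mul (\<lambda>T. f T \<oplus> f' T) g S = mul f g S \<oplus> mul f' g S"
proof -
  have c: "f T \<in> carrier R \<and> f' T \<in> carrier R \<and> g (S - T) \<in> carrier R" if "T \<in> Pow S" for T
    using that assms(4) formsD[OF assms(1), of T] formsD[OF assms(2), of T] formsD[OF assms(3), of "S - T"] by (auto simp: subset_iff)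
  have "mul (\<lambda>T. f T \<oplus> f' T) g S = (\<Oplus>T\<in>Pow S. sg (inversions T (S - T)) \<otimes> (f T \<otimes> g (S - T))
      \<oplus> sg (inversions T (S - T)) \<otimes> (f' T \<otimes> g (S - T)))"
    unfolding mul_def using c by (intro finsum_cong') (auto simp: l_distr r_distr)
  also have "\<dots> = mul f g S \<oplus> mul f' g S"
    unfolding mul_def using c by (intro finsum_addf) auto
  finally show ?thesis .
qed

lemma mul_add_right:
  assumes "f \<in> forms" "g \<in> forms" "g' \<in> forms" "S \<subseteq> D"
  shows "mul f (\<lambda>T. g T \<oplus> g' T) S = mul f g S \<oplus> mul f g' S"
proof -
  have c: "f T \<in> carrier R \<and> g (S - T) \<in> carrier R \<and> g' (S - T) \<in> carrier R" if "T \<in> Pow S" for T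
    using that assms(4) formsD[OF assms(1), of T] formsD[OF assms(2), of "S - T"] formsD[OF assms(3), of "S - T"] by (auto simp: subset_iff)
  have "mul f (\<lambda>T. g T \<oplus> g' T) S = (\<Oplus>T\<in>Pow S. sg (inversions T (S - T)) \<otimes> (f T \<otimes> g (S - T))
      \<oplus> sg (inversions T (S - T)) \<otimes> (f T \<otimes> g' (S - T)))"
    unfolding mul_def using c by (intro finsum_cong') (auto simp: r_distr)
  also have "\<dots> = mul f g S \<oplus> mul f g' S"
    unfolding mul_def using c by (intro finsum_addf) auto
  finally show ?thesis .
qed

lemma mul_smult_left:
  assumes "f \<in> forms" "g \<in> forms" "S \<subseteq> D" "c \<in> carrier R"
  shows "mul (\<lambda>T. c \<otimes> f T) g S = c \<otimes> mul f g S"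
proof -
  have *: "f T \<in> carrier R \<and> g (S - T) \<in> carrier R" if "T \<in> Pow S" for T
    using that assms(3) formsD[OF assms(1), of T] formsD[OF assms(2), of "S - T"] by (auto simp: subset_iff)
  have "c \<otimes> mul f g S = (\<Oplus>T\<in>Pow S. c \<otimes> (sg (inversions T (S - T)) \<otimes> (f T \<otimes> g (S - T))))"
    unfolding mul_def using * finite_sub assms by (intro finsum_rdistr) auto
  also have "\<dots> = mul (\<lambda>T. c \<otimes> f T) g S"
    unfolding mul_def using * assms by (intro finsum_cong') (auto simp: m_ac)
  finally show ?thesis by simp
qed

lemma mul_smult_right:
  assumes "f \<in> forms" "g \<in> forms" "S \<subseteq> D" "c \<in> carrier R"
  shows "mul f (\<lambda>T. c \<otimes> g T) S = c \<otimes> mul f g S"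
proof -
  have *: "f T \<in> carrier R \<and> g (S - T) \<in> carrier R" if "T \<in> Pow S" for T
    using that assms(3) formsD[OF assms(1), of T] formsD[OF assms(2), of "S - T"] by (auto simp: subset_iff)
  have "mul f (\<lambda>T. c \<otimes> g T) S = mul (\<lambda>T. c \<otimes> f T) g S"
    unfolding mul_def using * assms by (intro finsum_cong') (auto simp: m_ac)
  then show ?thesis using mul_smult_left assms by simp
qed

lemma mul_zero_left: "g \<in> forms \<Longrightarrow> S \<subseteq> D \<Longrightarrow> (\<And>T. T \<subseteq> S \<Longrightarrow> f T = \<zero>) \<Longrightarrow> mul f g S = \<zero>"
  unfolding mul_def using formsD[of g] by (intro add.finprod_one_eqI) (auto simp: subset_iff)

lemma mul_zero_right: "f \<in> forms \<Longrightarrow> S \<subseteq> D \<Longrightarrow> (\<And>T. T \<subseteq> S \<Longrightarrow> g T = \<zero>) \<Longrightarrow> mul f g S = \<zero>"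
  unfolding mul_def using formsD[of f] by (intro add.finprod_one_eqI) (auto simp: subset_iff)

text \<open>For \<open>i \<notin> S\<close> the splittings of \<open>insert i S\<close> are sorted
  by the factor that receives \<open>i\<close>. For \<open>i \<in> S\<close> the left side is zero,
  and on the right, with \<open>U = S - {i}\<close>, each product of \<open>f (insert i T)\<close>
  and \<open>g (insert i (U - T))\<close> occurs twice with opposite signs.\<close>

lemma con_mul:
  assumes f: "f \<in> forms" and g: "g \<in> forms" and i: "i \<in> D" and S: "S \<subseteq> D"
  shows "con i (mul f g) S = mul (con i f) g S \<oplus> mul (alt f) (con i g) S"
proof (cases "i \<in> S")
  case False
  have fin: "finite S" by (rule finite_sub[OF S])
  have iS: "insert i S \<subseteq> D" using i S by auto
  have sub: "finite T" "finite (S - T)" "i \<notin> T" "i \<notin> S - T" "T \<subseteq> D" "insert i T \<subseteq> D" "S - T \<subseteq> D"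
      "insert i (S - T) \<subseteq> D" if "T \<in> Pow S" for T
    using that False i S fin finite_subset by auto
  define h where "h = (\<lambda>T. sg (inversions T (insert i S - T)) \<otimes> (f T \<otimes> g (insert i S - T)))"
  have hc: "h \<in> Pow (insert i S) \<rightarrow> carrier R"
    unfolding h_def using iS f g by (auto intro!: m_closed formsD[OF f] formsD[OF g])
  then have h: "h T \<in> carrier R" "h (insert i T) \<in> carrier R" if "T \<subseteq> S" for T
    using that by (auto simp: Pi_iff)
  have "con i (mul f g) S = sg (below S i) \<otimes> ((\<Oplus>T\<in>Pow S. h T) \<oplus> (\<Oplus>T\<in>Pow S. h (insert i T)))"
    using False finsum_Pow_insert[OF fin False hc] by (simp add: con_def mul_def h_def)
  also have "\<dots> = sg (below S i) \<otimes> (\<Oplus>T\<in>Pow S. h (insert i T)) \<oplus> sg (below S i) \<otimes> (\<Oplus>T\<in>Pow S. h T)"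
  proof -
    have "(\<Oplus>T\<in>Pow S. h T) \<in> carrier R" "(\<Oplus>T\<in>Pow S. h (insert i T)) \<in> carrier R"
      using h by (auto intro!: finsum_closed)
    then show ?thesis by (simp add: r_distr add.m_comm)
  qed
  also have "sg (below S i) \<otimes> (\<Oplus>T\<in>Pow S. h (insert i T)) = mul (con i f) g S"
  proof -
    have "sg (below S i) \<otimes> (\<Oplus>T\<in>Pow S. h (insert i T)) = (\<Oplus>T\<in>Pow S. sg (below S i) \<otimes> h (insert i T))"
      using fin h by (intro finsum_rdistr) auto
    also have "\<dots> = mul (con i f) g S"
      unfolding mul_def
    proof (rule finsum_cong')
      fix T assume T: "T \<in> Pow S"
      note s = sub[OF T]
      have eq: "insert i S - insert i T = S - T" using False by auto
      have c: "f (insert i T) \<in> carrier R" "g (S - T) \<in> carrier R" using s formsD[OF f] formsD[OF g] by auto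
      \<comment> \<open>The elements of \<open>S - T\<close> below \<open>i\<close> are counted
        twice on the left, once in \<open>below S i\<close> and once as new inversions, and so drop
        out of the parity.\<close>
      have "sg (below S i) \<otimes> sg (inversions (insert i T) (S - T)) = sg (inversions T (S - T)) \<otimes> sg (below T i)"
        unfolding sg_add[symmetric]
        using T below_split[of T S i] inversions_insert_left[OF s(1,2,3)] by (intro sg_parity) auto
      then have "sg (below S i) \<otimes> sg (inversions (insert i T) (S - T)) \<otimes> (f (insert i T) \<otimes> g (S - T))
         = sg (inversions T (S - T)) \<otimes> sg (below T i) \<otimes> (f (insert i T) \<otimes> g (S - T))" by simp
      then show "sg (below S i) \<otimes> h (insert i T) = sg (inversions T (S - T)) \<otimes> (con i f T \<otimes> g (S - T))"
        unfolding h_def eq con_def using s c by (simp add: m_assoc)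
    next
      show "(\<lambda>T. sg (inversions T (S - T)) \<otimes> (con i f T \<otimes> g (S - T))) \<in> Pow S \<rightarrow> carrier R"
        using f g i S by (auto intro!: m_closed formsD[OF con_forms] formsD[OF g])
    qed simp
    finally show ?thesis .
  qed
  also have "sg (below S i) \<otimes> (\<Oplus>T\<in>Pow S. h T) = mul (alt f) (con i g) S"
  proof -
    have "sg (below S i) \<otimes> (\<Oplus>T\<in>Pow S. h T) = (\<Oplus>T\<in>Pow S. sg (below S i) \<otimes> h T)"
      using fin h by (intro finsum_rdistr) auto
    also have "\<dots> = mul (alt f) (con i g) S"
      unfolding mul_def
    proof (rule finsum_cong')
      fix T assume T: "T \<in> Pow S"
      note s = sub[OF T]
      have eq: "insert i S - T = insert i (S - T)" using s by auto
      have c: "f T \<in> carrier R" "g (insert i (S - T)) \<in> carrier R" using s formsD[OF f] formsD[OF g] by auto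
      \<comment> \<open>\<open>inversions_insert_right\<close> trades \<open>below T i\<close> for
        \<open>card T\<close>, which is the exponent in \<open>alt f\<close>.\<close>
      have "sg (below S i) \<otimes> sg (inversions T (insert i (S - T)))
          = sg (inversions T (S - T)) \<otimes> (sg (card T) \<otimes> sg (below (S - T) i))"
        unfolding sg_add[symmetric]
        using T below_split[of T S i] inversions_insert_right[OF s(1,2,4,3)]
        by (intro sg_parity) (simp, presburger)
      then have "sg (below S i) \<otimes> sg (inversions T (insert i (S - T))) \<otimes> (f T \<otimes> g (insert i (S - T)))
         = sg (inversions T (S - T)) \<otimes> (sg (card T) \<otimes> sg (below (S - T) i)) \<otimes> (f T \<otimes> g (insert i (S - T)))" by simp
      then show "sg (below S i) \<otimes> h T = sg (inversions T (S - T)) \<otimes> (alt f T \<otimes> con i g (S - T))"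
        unfolding h_def eq con_def alt_def using s c by (simp add: m_ac)
    next
      show "(\<lambda>T. sg (inversions T (S - T)) \<otimes> (alt f T \<otimes> con i g (S - T))) \<in> Pow S \<rightarrow> carrier R"
        using f g i S by (auto intro!: m_closed formsD[OF con_forms] formsD[OF alt_forms])
    qed simp
    finally show ?thesis .
  qed
  finally show ?thesis .
next
  case True
  define U where "U = S - {i}"
  have SU: "S = insert i U" and iU: "i \<notin> U" using True by (auto simp: U_def)
  have U: "U \<subseteq> D" "finite U" using S finite_sub by (auto simp: U_def)
  have sub: "finite T" "finite (U - T)" "i \<notin> T" "i \<notin> U - T" "T \<subseteq> D" "insert i T \<subseteq> D" "U - T \<subseteq> D"
      "insert i (U - T) \<subseteq> D" "insert i U - T = insert i (U - T)" "insert i U - insert i T = U - T"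
      if "T \<in> Pow U" for T
    using that iU i U finite_subset by auto
  define h where "h = (\<lambda>T. sg (inversions T (S - T)) \<otimes> (con i f T \<otimes> g (S - T)))"
  define k where "k = (\<lambda>T. sg (inversions T (S - T)) \<otimes> (alt f T \<otimes> con i g (S - T)))"
  have hc: "h \<in> Pow (insert i U) \<rightarrow> carrier R" "k \<in> Pow (insert i U) \<rightarrow> carrier R"
    unfolding SU[symmetric] h_def k_def using S f g i
    by (auto intro!: m_closed formsD[OF con_forms] formsD[OF alt_forms] formsD[OF g])
  then have h: "h T \<in> carrier R" "k T \<in> carrier R" "h (insert i T) \<in> carrier R" "k (insert i T) \<in> carrier R" if "T \<subseteq> U" for T
    using that by (auto simp: Pi_iff)
  have "mul (con i f) g S \<oplus> mul (alt f) (con i g) S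
      = ((\<Oplus>T\<in>Pow U. h T) \<oplus> (\<Oplus>T\<in>Pow U. h (insert i T))) \<oplus> ((\<Oplus>T\<in>Pow U. k T) \<oplus> (\<Oplus>T\<in>Pow U. k (insert i T)))"
    using finsum_Pow_insert[OF U(2) iU hc(1)] finsum_Pow_insert[OF U(2) iU hc(2)]
    by (simp add: mul_def h_def[symmetric] k_def[symmetric] SU[symmetric])
  also have "(\<Oplus>T\<in>Pow U. h (insert i T)) = \<zero>"
    using sub formsD[OF g] by (intro add.finprod_one_eqI) (auto simp: con_def SU h_def k_def)
  also have "(\<Oplus>T\<in>Pow U. k T) = \<zero>"
    using sub formsD[OF alt_forms[OF f]] by (intro add.finprod_one_eqI) (auto simp: con_def SU h_def k_def)
  also have "(\<Oplus>T\<in>Pow U. h T) \<oplus> \<zero> \<oplus> (\<zero> \<oplus> (\<Oplus>T\<in>Pow U. k (insert i T))) = (\<Oplus>T\<in>Pow U. h T \<oplus> k (insert i T))"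
    using h by (subst finsum_addf) (auto intro!: finsum_closed)
  also have "\<dots> = \<zero>"
  proof (rule add.finprod_one_eqI)
    fix T assume T: "T \<in> Pow U"
    note s = sub[OF T]
    have c: "f (insert i T) \<in> carrier R" "g (insert i (U - T)) \<in> carrier R" using s formsD[OF f] formsD[OF g] by auto
    \<comment> \<open>\<open>card (insert i T)\<close> exceeds \<open>card T\<close> by one; this
      unit is the only discrepancy in parity and makes the two terms cancel.\<close>
    have "sg (inversions T (insert i (U - T))) \<otimes> sg (below T i)
        = \<ominus> (sg (inversions (insert i T) (U - T)) \<otimes> sg (card (insert i T)) \<otimes> sg (below (U - T) i))"
      unfolding sg_add[symmetric]
      using s inversions_insert_right[OF s(1,2,4,3)] inversions_insert_left[OF s(1,2,3)]
      by (intro sg_parity_neg) (simp, presburger)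
    then have "sg (inversions T (insert i (U - T))) \<otimes> sg (below T i) \<otimes> (f (insert i T) \<otimes> g (insert i (U - T)))
        = \<ominus> (sg (inversions (insert i T) (U - T)) \<otimes> sg (card (insert i T)) \<otimes> sg (below (U - T) i) \<otimes> (f (insert i T) \<otimes> g (insert i (U - T))))"
      using c by (simp add: l_minus)
    then have "h T = \<ominus> k (insert i T)"
      unfolding h_def k_def SU s(9,10) con_def alt_def using s c by (simp add: m_ac)
    then show "h T \<oplus> k (insert i T) = \<zero>"
      using h T by (auto simp: l_neg)
  qed
  finally show ?thesis using True by (simp add: con_def[of i "mul f g"])
qed

lemma insert_con:
  assumes "i \<notin> S" "insert i S \<subseteq> D" "f \<in> forms"
  shows "f (insert i S) = sg (below S i) \<otimes> con i f S"
  using assms formsD[OF assms(3,2)] by (simp add: con_def sg_square)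

lemma mul_empty: "f \<in> forms \<Longrightarrow> g \<in> forms \<Longrightarrow> mul f g {} = f {} \<otimes> g {}"
  using formsD[of f "{}"] formsD[of g "{}"] by (simp add: mul_def inversions_def)

lemma alt_mul:
  assumes f: "f \<in> forms" and g: "g \<in> forms" and S: "S \<subseteq> D"
  shows "alt (mul f g) S = mul (alt f) (alt g) S"
proof -
  have c: "f T \<in> carrier R \<and> g (S - T) \<in> carrier R" if "T \<subseteq> S" for T
    using that S formsD[OF f, of T] formsD[OF g, of "S - T"] by (auto simp: subset_iff)
  have "alt (mul f g) S = (\<Oplus>T\<in>Pow S. sg (card S) \<otimes> (sg (inversions T (S - T)) \<otimes> (f T \<otimes> g (S - T))))"
    unfolding alt_def mul_def using c finite_sub[OF S] by (intro finsum_rdistr) auto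
  also have "\<dots> = mul (alt f) (alt g) S"
    unfolding mul_def
  proof (rule finsum_cong')
    show "(\<lambda>T. sg (inversions T (S - T)) \<otimes> (alt f T \<otimes> alt g (S - T))) \<in> Pow S \<rightarrow> carrier R"
      using c by (auto simp: alt_def)
    fix T assume T: "T \<in> Pow S"
    then have "card S = card T + card (S - T)"
      using finite_sub[OF S] by (metis Pow_iff card_Diff_subset card_mono finite_subset le_add_diff_inverse)
    then have "sg (card S) = sg (card T) \<otimes> sg (card (S - T))" by (simp add: sg_add)
    then show "sg (card S) \<otimes> (sg (inversions T (S - T)) \<otimes> (f T \<otimes> g (S - T)))
        = sg (inversions T (S - T)) \<otimes> (alt f T \<otimes> alt g (S - T))"
      using c T by (simp add: alt_def m_ac)
  qed simp
  finally show ?thesis .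
qed

text \<open>A form is determined by its value at \<open>{}\<close> and its contractions, so identities between
  products follow by induction from the antiderivation rule \<open>con_mul\<close>.\<close>

lemma mul_assoc:
  assumes "f \<in> forms" "g \<in> forms" "h \<in> forms" "S \<subseteq> D"
  shows "mul (mul f g) h S = mul f (mul g h) S"
proof -
  have "finite S" using assms finite_sub by blast
  then show ?thesis using assms
  proof (induction S arbitrary: f g h rule: finite_induct)
    case empty
    then show ?case
      using formsD[of f "{}"] formsD[of g "{}"] formsD[of h "{}"] mul_forms[of f g] mul_forms[of g h]
      by (simp add: mul_empty m_assoc)
  next
    case (insert i S)
    then have i: "i \<in> D" and S: "S \<subseteq> D" by auto
    note f = \<open>f \<in> forms\<close> and g = \<open>g \<in> forms\<close> and h = \<open>h \<in> forms\<close>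
    note c = con_forms[OF f i] con_forms[OF g i] con_forms[OF h i]
    have "con i (mul (mul f g) h) S = mul (con i (mul f g)) h S \<oplus> mul (alt (mul f g)) (con i h) S"
      using f g h i S by (intro con_mul) auto
    also have "mul (con i (mul f g)) h S = mul (\<lambda>T. mul (con i f) g T \<oplus> mul (alt f) (con i g) T) h S"
      using f g i S h by (intro mul_cong con_mul add_forms) auto
    also have "\<dots> = mul (mul (con i f) g) h S \<oplus> mul (mul (alt f) (con i g)) h S"
      using f g h c S by (intro mul_add_left) auto
    also have "mul (alt (mul f g)) (con i h) S = mul (mul (alt f) (alt g)) (con i h) S"
      using f g h i S by (intro mul_cong alt_mul) auto
    also have "mul (mul (con i f) g) h S = mul (con i f) (mul g h) S"
      using f g h c S by (intro insert.IH) auto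
    also have "mul (mul (alt f) (con i g)) h S = mul (alt f) (mul (con i g) h) S"
      using f g h c S by (intro insert.IH) auto
    also have "mul (mul (alt f) (alt g)) (con i h) S = mul (alt f) (mul (alt g) (con i h)) S"
      using f g h c S by (intro insert.IH) auto
    finally have 1: "con i (mul (mul f g) h) S = mul (con i f) (mul g h) S
        \<oplus> mul (alt f) (mul (con i g) h) S \<oplus> mul (alt f) (mul (alt g) (con i h)) S" .
    have "con i (mul f (mul g h)) S = mul (con i f) (mul g h) S \<oplus> mul (alt f) (con i (mul g h)) S"
      using f g h i S by (intro con_mul) auto
    also have "mul (alt f) (con i (mul g h)) S
        = mul (alt f) (\<lambda>T. mul (con i g) h T \<oplus> mul (alt g) (con i h) T) S"
      using f g h i S by (intro mul_cong con_mul add_forms) auto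
    also have "\<dots> = mul (alt f) (mul (con i g) h) S \<oplus> mul (alt f) (mul (alt g) (con i h)) S"
      using f g h c S by (intro mul_add_right) auto
    finally have 2: "con i (mul f (mul g h)) S = mul (con i f) (mul g h) S
        \<oplus> (mul (alt f) (mul (con i g) h) S \<oplus> mul (alt f) (mul (alt g) (con i h)) S)" .
    have "mul (con i f) (mul g h) S \<in> carrier R" "mul (alt f) (mul (con i g) h) S \<in> carrier R"
        "mul (alt f) (mul (alt g) (con i h)) S \<in> carrier R"
      by (rule formsD[OF _ S]; use f g h c in blast)+
    then have "con i (mul (mul f g) h) S = con i (mul f (mul g h)) S"
      unfolding 1 2 by (rule a_assoc)
    then show ?case
      using insert_con[OF insert.hyps(2) insert.prems(4)] f g h mul_forms by (metis (no_types, lifting))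
  qed
qed

lemma mul_unit_left:
  assumes "f \<in> forms" "S \<subseteq> D"
  shows "mul unit f S = f S"
proof -
  have "finite S" using assms finite_sub by blast
  then show ?thesis using assms
  proof (induction S arbitrary: f rule: finite_induct)
    case empty
    then show ?case using formsD[of f "{}"] by (simp add: mul_empty unit_forms) (simp add: unit_def)
  next
    case (insert i S)
    then have i: "i \<in> D" and S: "S \<subseteq> D" by auto
    have u: "con i unit = (\<lambda>T. \<zero>)" "alt unit = unit" by (auto simp: con_def unit_def alt_def)
    have "con i (mul unit f) S = mul (con i unit) f S \<oplus> mul (alt unit) (con i f) S"
      using insert.prems i S by (intro con_mul) auto
    also have "\<dots> = mul unit (con i f) S"
      using insert.prems S i formsD[OF mul_forms[OF unit_forms con_forms[OF insert.prems(1) i]] S]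
      by (simp add: u mul_zero_left)
    also have "\<dots> = con i f S" using insert i S by (intro insert.IH) auto
    finally show ?case
      using insert_con[OF insert.hyps(2) insert.prems(2,1)]
        insert_con[OF insert.hyps(2) insert.prems(2) mul_forms[OF unit_forms insert.prems(1)]]
      by (simp only:)
  qed
qed

lemma mul_unit_right:
  assumes "f \<in> forms" "S \<subseteq> D"
  shows "mul f unit S = f S"
proof -
  have "finite S" using assms finite_sub by blast
  then show ?thesis using assms
  proof (induction S arbitrary: f rule: finite_induct)
    case empty
    then show ?case using formsD[of f "{}"] by (simp add: mul_empty unit_forms) (simp add: unit_def)
  next
    case (insert i S)
    then have i: "i \<in> D" and S: "S \<subseteq> D" by auto
    have u: "con i unit = (\<lambda>T. \<zero>)" by (auto simp: con_def unit_def)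
    have "con i (mul f unit) S = mul (con i f) unit S \<oplus> mul (alt f) (con i unit) S"
      using insert.prems i S by (intro con_mul) auto
    also have "\<dots> = mul (con i f) unit S"
      using insert.prems S i formsD[OF mul_forms[OF con_forms[OF insert.prems(1) i] unit_forms] S]
      by (simp add: u mul_zero_right[OF alt_forms])
    also have "\<dots> = con i f S" using insert i S by (intro insert.IH) auto
    finally show ?case
      using insert_con[OF insert.hyps(2) insert.prems(2,1)]
        insert_con[OF insert.hyps(2) insert.prems(2) mul_forms[OF insert.prems(1) unit_forms]]
      by (simp only:)
  qed
qed

section \<open>The differential and its homotopies as sums of contractions and
  multiplications\<close>

lemma finsum_forms: "(\<And>j. j \<in> A \<Longrightarrow> F j \<in> forms) \<Longrightarrow> (\<lambda>T. \<Oplus>j\<in>A. F j T) \<in> forms"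
  by (auto simp: forms_def Pi_iff intro!: finsum_closed)

lemma con_finsum:
  assumes "finite A" "\<And>j. j \<in> A \<Longrightarrow> F j \<in> forms" "i \<in> D" "S \<subseteq> D"
  shows "con i (\<lambda>T. \<Oplus>j\<in>A. F j T) S = (\<Oplus>j\<in>A. con i (F j) S)"
proof (cases "i \<in> S")
  case False
  have "insert i S \<subseteq> D" using assms by auto
  then have "(\<lambda>j. F j (insert i S)) \<in> A \<rightarrow> carrier R" using assms(2) formsD by auto
  then show ?thesis using False assms(1) by (simp add: con_def finsum_rdistr)
qed (simp add: con_def)

lemma wed_finsum:
  assumes "finite A" "\<And>j. j \<in> A \<Longrightarrow> F j \<in> forms" "S \<subseteq> D"
  shows "wed i (\<lambda>T. \<Oplus>j\<in>A. F j T) S = (\<Oplus>j\<in>A. wed i (F j) S)"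
proof (cases "i \<in> S")
  case True
  have "S - {i} \<subseteq> D" using assms by auto
  then have "(\<lambda>j. F j (S - {i})) \<in> A \<rightarrow> carrier R" using assms(2) formsD by auto
  then show ?thesis using True assms(1) by (simp add: wed_def finsum_rdistr)
qed (simp add: wed_def)

lemma con_smult: "f \<in> forms \<Longrightarrow> c \<in> carrier R \<Longrightarrow> i \<in> D \<Longrightarrow> S \<subseteq> D \<Longrightarrow> con i (\<lambda>T. c \<otimes> f T) S = c \<otimes> con i f S"
  using formsD[of f "insert i S"] by (simp add: con_def m_lcomm[of _ c])

lemma wed_smult:
  assumes "f \<in> forms" "c \<in> carrier R" "S \<subseteq> D"
  shows "wed i (\<lambda>T. c \<otimes> f T) S = c \<otimes> wed i f S"
proof (cases "i \<in> S")
  case True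
  have "f (S - {i}) \<in> carrier R" using assms by (intro formsD) auto
  then show ?thesis using True assms by (simp add: wed_def m_lcomm[of _ c])
qed (simp add: wed_def assms)

lemma mul_finsum_left:
  assumes "finite A" "\<And>j. j \<in> A \<Longrightarrow> F j \<in> forms" "g \<in> forms" "S \<subseteq> D"
  shows "mul (\<lambda>T. \<Oplus>j\<in>A. F j T) g S = (\<Oplus>j\<in>A. mul (F j) g S)"
  using assms(1,2)
proof (induction A rule: finite_induct)
  case empty
  then show ?case using assms by (simp add: mul_zero_left)
next
  case (insert k A)
  have "mul (\<lambda>T. \<Oplus>j\<in>insert k A. F j T) g S = mul (\<lambda>T. F k T \<oplus> (\<Oplus>j\<in>A. F j T)) g S"
  proof (rule mul_cong[OF _ refl _ assms(3,4)])
    show "(\<lambda>T. F k T \<oplus> (\<Oplus>j\<in>A. F j T)) \<in> forms" using insert by (intro add_forms finsum_forms) auto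
    fix T assume "T \<subseteq> S"
    then have "T \<subseteq> D" using assms by auto
    then show "(\<Oplus>j\<in>insert k A. F j T) = F k T \<oplus> (\<Oplus>j\<in>A. F j T)"
      using insert formsD[of _ T] by (intro finsum_insert) auto
  qed
  also have "\<dots> = mul (F k) g S \<oplus> mul (\<lambda>T. \<Oplus>j\<in>A. F j T) g S"
    using insert assms by (intro mul_add_left finsum_forms) auto
  also have "\<dots> = (\<Oplus>j\<in>insert k A. mul (F j) g S)"
    using insert assms formsD[OF mul_forms[OF _ assms(3)] assms(4)]
    by (subst finsum_insert) auto
  finally show ?case .
qed

lemma mul_finsum_right:
  assumes "finite A" "\<And>j. j \<in> A \<Longrightarrow> F j \<in> forms" "f \<in> forms" "S \<subseteq> D"
  shows "mul f (\<lambda>T. \<Oplus>j\<in>A. F j T) S = (\<Oplus>j\<in>A. mul f (F j) S)"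
  using assms(1,2)
proof (induction A rule: finite_induct)
  case empty
  then show ?case using assms by (simp add: mul_zero_right)
next
  case (insert k A)
  have "mul f (\<lambda>T. \<Oplus>j\<in>insert k A. F j T) S = mul f (\<lambda>T. F k T \<oplus> (\<Oplus>j\<in>A. F j T)) S"
  proof (rule mul_cong[OF refl _ assms(3) _ assms(4)])
    show "(\<lambda>T. F k T \<oplus> (\<Oplus>j\<in>A. F j T)) \<in> forms" using insert by (intro add_forms finsum_forms) auto
    fix T assume "T \<subseteq> S"
    then have "T \<subseteq> D" using assms by auto
    then show "(\<Oplus>j\<in>insert k A. F j T) = F k T \<oplus> (\<Oplus>j\<in>A. F j T)"
      using insert formsD[of _ T] by (intro finsum_insert) auto
  qed
  also have "\<dots> = mul f (F k) S \<oplus> mul f (\<lambda>T. \<Oplus>j\<in>A. F j T) S"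
    using insert assms by (intro mul_add_right finsum_forms) auto
  also have "\<dots> = (\<Oplus>j\<in>insert k A. mul f (F j) S)"
    using insert assms formsD[OF mul_forms[OF assms(3)] assms(4)]
    by (subst finsum_insert) auto
  finally show ?case .
qed

text \<open>The Koszul differential: the antiderivation that sends the i-th basis vector to
  \<open>y i\<close>.\<close>

definition del :: "(nat \<Rightarrow> 'a) \<Rightarrow> (nat set \<Rightarrow> 'a) \<Rightarrow> nat set \<Rightarrow> 'a" where
  "del y f S = (\<Oplus>i\<in>D. y i \<otimes> con i f S)"

text \<open>Left exterior multiplication by the element of degree one with coefficients
  \<open>c\<close>.\<close>

definition htp :: "(nat \<Rightarrow> 'a) \<Rightarrow> (nat set \<Rightarrow> 'a) \<Rightarrow> nat set \<Rightarrow> 'a" where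
  "htp c f S = (\<Oplus>i\<in>D. c i \<otimes> wed i f S)"

lemma del_forms [simp, intro]: "y \<in> D \<rightarrow> carrier R \<Longrightarrow> f \<in> forms \<Longrightarrow> del y f \<in> forms"
  unfolding del_def using con_forms[of f] by (intro finsum_forms smult_forms) auto

lemma htp_forms [simp, intro]: "y \<in> D \<rightarrow> carrier R \<Longrightarrow> f \<in> forms \<Longrightarrow> htp y f \<in> forms"
  unfolding htp_def using wed_forms[of f] by (intro finsum_forms smult_forms) auto

lemma del_mul:
  assumes y: "y \<in> D \<rightarrow> carrier R" and f: "f \<in> forms" and g: "g \<in> forms" and S: "S \<subseteq> D"
  shows "del y (mul f g) S = mul (del y f) g S \<oplus> mul (alt f) (del y g) S"
proof -
  have yi: "y i \<in> carrier R" if "i \<in> D" for i using y that by auto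
  have c: "mul (con i f) g S \<in> carrier R" "mul (alt f) (con i g) S \<in> carrier R" if "i \<in> D" for i
    using that f g by (auto intro!: formsD[OF mul_forms S])
  have "mul (del y f) g S = (\<Oplus>i\<in>D. mul (\<lambda>T. y i \<otimes> con i f T) g S)"
    unfolding del_def using f g S yi finite_D by (intro mul_finsum_left smult_forms) auto
  also have "\<dots> = (\<Oplus>i\<in>D. y i \<otimes> mul (con i f) g S)"
    using f g S yi c by (intro finsum_cong') (auto intro!: mul_smult_left)
  finally have 1: "mul (del y f) g S = (\<Oplus>i\<in>D. y i \<otimes> mul (con i f) g S)" .
  have "mul (alt f) (del y g) S = (\<Oplus>i\<in>D. mul (alt f) (\<lambda>T. y i \<otimes> con i g T) S)"
    unfolding del_def using f g S yi finite_D by (intro mul_finsum_right smult_forms) auto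
  also have "\<dots> = (\<Oplus>i\<in>D. y i \<otimes> mul (alt f) (con i g) S)"
    using f g S yi c by (intro finsum_cong') (auto intro!: mul_smult_right)
  finally have 2: "mul (alt f) (del y g) S = (\<Oplus>i\<in>D. y i \<otimes> mul (alt f) (con i g) S)" .
  have "del y (mul f g) S = (\<Oplus>i\<in>D. y i \<otimes> mul (con i f) g S \<oplus> y i \<otimes> mul (alt f) (con i g) S)"
    unfolding del_def using f g S yi c by (intro finsum_cong') (auto simp: con_mul r_distr)
  also have "\<dots> = (\<Oplus>i\<in>D. y i \<otimes> mul (con i f) g S) \<oplus> (\<Oplus>i\<in>D. y i \<otimes> mul (alt f) (con i g) S)"
    using yi c by (intro finsum_addf) auto
  finally show ?thesis by (simp only: 1 2)
qed

lemma con_con: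
  assumes f: "f \<in> forms" and ij: "i \<in> D" "j \<in> D" and S: "S \<subseteq> D"
  shows "con i (con i f) S = \<zero>" "con i (con j f) S \<oplus> con j (con i f) S = \<zero>"
proof -
  show 1: "con i (con i f) S = \<zero>" by (simp add: con_def)
  show "con i (con j f) S \<oplus> con j (con i f) S = \<zero>"
  proof (cases "i = j \<or> i \<in> S \<or> j \<in> S")
    case True
    then show ?thesis using 1 by (auto simp: con_def)
  next
    case False
    have c: "f (insert i (insert j S)) \<in> carrier R" using assms by (intro formsD[OF f]) auto
    have "sg (below S i) \<otimes> sg (below (insert i S) j) = \<ominus> (sg (below S j) \<otimes> sg (below (insert j S) i))"
      unfolding sg_add[symmetric] using False
      by (intro sg_parity_neg) (auto simp: below_insert not_less)
    then have "sg (below S i) \<otimes> sg (below (insert i S) j) \<otimes> f (insert i (insert j S))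
        = \<ominus> (sg (below S j) \<otimes> sg (below (insert j S) i) \<otimes> f (insert i (insert j S)))"
      using c by (simp add: l_minus)
    then show ?thesis
      using False c by (auto simp: con_def m_assoc insert_commute l_neg)
  qed
qed

text \<open>Contractions anticommute by \<open>con_con\<close>, whereas the products
  \<open>y i y j\<close> are symmetric, so the double sum is antisymmetric.\<close>

lemma del_del:
  assumes y: "y \<in> D \<rightarrow> carrier R" and f: "f \<in> forms" and S: "S \<subseteq> D"
  shows "del y (del y f) S = \<zero>"
proof -
  have yi: "y i \<in> carrier R" if "i \<in> D" for i using y that by auto
  have c: "con i (con j f) S \<in> carrier R" if "i \<in> D" "j \<in> D" for i j
    using that f by (intro formsD[OF _ S]) auto
  have "con i (del y f) S = (\<Oplus>j\<in>D. y j \<otimes> con i (con j f) S)" if i: "i \<in> D" for i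
  proof -
    have "con i (del y f) S = (\<Oplus>j\<in>D. con i (\<lambda>T. y j \<otimes> con j f T) S)"
      unfolding del_def using f S i yi finite_D by (intro con_finsum smult_forms) auto
    also have "\<dots> = (\<Oplus>j\<in>D. y j \<otimes> con i (con j f) S)"
      using f S i yi c by (intro finsum_cong') (auto intro!: con_smult)
    finally show ?thesis .
  qed
  then have "del y (del y f) S = (\<Oplus>i\<in>D. y i \<otimes> (\<Oplus>j\<in>D. y j \<otimes> con i (con j f) S))"
    unfolding del_def[of y "del y f"] using yi c by (intro finsum_cong') (auto intro!: finsum_closed)
  also have "\<dots> = (\<Oplus>i\<in>D. \<Oplus>j\<in>D. y i \<otimes> (y j \<otimes> con i (con j f) S))"
    using yi c finite_D by (intro finsum_cong' finsum_rdistr) (auto intro!: finsum_closed)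
  also have "\<dots> = \<zero>"
  proof (rule finsum_antisym[OF finite_D])
    fix i j assume ij: "i \<in> D" "j \<in> D"
    have "y i \<otimes> (y j \<otimes> con i (con j f) S) \<oplus> y j \<otimes> (y i \<otimes> con j (con i f) S)
        = y i \<otimes> y j \<otimes> (con i (con j f) S \<oplus> con j (con i f) S)"
      using ij yi c by (simp add: r_distr m_ac)
    then show "y i \<otimes> (y j \<otimes> con i (con j f) S) \<oplus> y j \<otimes> (y i \<otimes> con j (con i f) S) = \<zero>"
      using con_con(2)[OF f ij S] ij yi by simp
  qed (use yi c con_con(1)[OF f _ _ S] in auto)
  finally show ?thesis .
qed

text \<open>The Clifford relation between contractions and multiplications. For different indices
  only the sets containing \<open>j\<close> but not \<open>i\<close> contribute, and there the two
  orders differ by a sign.\<close>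

lemma con_wed:
  assumes f: "f \<in> forms" and ij: "i \<in> D" "j \<in> D" and S: "S \<subseteq> D"
  shows "con i (wed j f) S \<oplus> wed j (con i f) S = (if i = j then f S else \<zero>)"
proof -
  consider "i = j" "i \<in> S" | "i = j" "i \<notin> S" | "i \<noteq> j" "i \<in> S \<or> j \<notin> S" | "i \<noteq> j" "i \<notin> S" "j \<in> S" by blast
  then show ?thesis
  proof cases
    case 1
    have "below (S - {i}) i = below S i" unfolding below_def by (rule arg_cong[of _ _ card]) auto
    then show ?thesis
      using 1 formsD[OF f S] by (simp add: con_def wed_def insert_absorb sg_square)
  next
    case 2
    then have "below (insert i S) i = below S i" by (simp add: below_insert)
    then show ?thesis using 2 formsD[OF f S] by (simp add: con_def wed_def sg_square)
  next
    case 3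
    then show ?thesis by (auto simp: con_def wed_def)
  next
    case 4
    define U where "U = S - {j}"
    have U: "j \<notin> U" "i \<notin> U" "S = insert j U" "insert i U \<subseteq> D" using 4 S ij by (auto simp: U_def)
    have eq: "insert i S - {j} = insert i U" "S - {j} = U" using 4 by (auto simp: U_def)
    have eq': "insert i (insert j U) - {j} = insert i U" "insert j U - {j} = U" using eq U(3) by auto
    have c: "f (insert i U) \<in> carrier R" by (rule formsD[OF f U(4)])
    have "sg (below S i) \<otimes> sg (below (insert i S) j) = \<ominus> (sg (below S j) \<otimes> sg (below U i))"
      unfolding sg_add[symmetric] U(3) using U(1,2) 4
      by (intro sg_parity_neg) (auto simp: below_insert not_less)
    then have "sg (below S i) \<otimes> sg (below (insert i S) j) \<otimes> f (insert i U)
        = \<ominus> (sg (below S j) \<otimes> sg (below U i) \<otimes> f (insert i U))"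
      using c by (simp add: l_minus)
    then show ?thesis using 4 U c by (simp add: con_def wed_def eq' m_assoc l_neg)
  qed
qed

text \<open>Bilinear expansion of \<open>con_wed\<close>. It makes multiplication by any element of
  the ideal generated by the \<open>y i\<close> null-homotopic, with a homotopy read off from a
  representation of that element.\<close>

lemma del_htp:
  assumes y: "y \<in> D \<rightarrow> carrier R" and c: "c \<in> D \<rightarrow> carrier R" and f: "f \<in> forms" and S: "S \<subseteq> D"
  shows "del y (htp c f) S \<oplus> htp c (del y f) S = (\<Oplus>i\<in>D. y i \<otimes> c i) \<otimes> f S"
proof -
  have yi: "y i \<in> carrier R" "c i \<in> carrier R" if "i \<in> D" for i using y c that by auto
  have k: "con i (wed j f) S \<in> carrier R" "wed j (con i f) S \<in> carrier R" if "i \<in> D" "j \<in> D" for i j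
    using that f by (auto intro!: formsD[OF _ S])
  have fS: "f S \<in> carrier R" by (rule formsD[OF f S])
  have "con i (htp c f) S = (\<Oplus>j\<in>D. c j \<otimes> con i (wed j f) S)" if i: "i \<in> D" for i
  proof -
    have "con i (htp c f) S = (\<Oplus>j\<in>D. con i (\<lambda>T. c j \<otimes> wed j f T) S)"
      unfolding htp_def using f S i yi finite_D by (intro con_finsum smult_forms) auto
    also have "\<dots> = (\<Oplus>j\<in>D. c j \<otimes> con i (wed j f) S)"
      using f S i yi k by (intro finsum_cong') (auto intro!: con_smult)
    finally show ?thesis .
  qed
  then have "del y (htp c f) S = (\<Oplus>i\<in>D. y i \<otimes> (\<Oplus>j\<in>D. c j \<otimes> con i (wed j f) S))"
    unfolding del_def using yi k by (intro finsum_cong') (auto intro!: finsum_closed)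
  also have "\<dots> = (\<Oplus>i\<in>D. \<Oplus>j\<in>D. y i \<otimes> (c j \<otimes> con i (wed j f) S))"
    using yi k finite_D by (intro finsum_cong' finsum_rdistr) (auto intro!: finsum_closed)
  finally have 1: "del y (htp c f) S = (\<Oplus>i\<in>D. \<Oplus>j\<in>D. y i \<otimes> (c j \<otimes> con i (wed j f) S))" .
  have "wed j (del y f) S = (\<Oplus>i\<in>D. y i \<otimes> wed j (con i f) S)" if j: "j \<in> D" for j
  proof -
    have "wed j (del y f) S = (\<Oplus>i\<in>D. wed j (\<lambda>T. y i \<otimes> con i f T) S)"
      unfolding del_def using f S j yi finite_D by (intro wed_finsum smult_forms) auto
    also have "\<dots> = (\<Oplus>i\<in>D. y i \<otimes> wed j (con i f) S)"
      using f S j yi k by (intro finsum_cong') (auto intro!: wed_smult)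
    finally show ?thesis .
  qed
  then have "htp c (del y f) S = (\<Oplus>j\<in>D. c j \<otimes> (\<Oplus>i\<in>D. y i \<otimes> wed j (con i f) S))"
    unfolding htp_def using yi k by (intro finsum_cong') (auto intro!: finsum_closed)
  also have "\<dots> = (\<Oplus>j\<in>D. \<Oplus>i\<in>D. c j \<otimes> (y i \<otimes> wed j (con i f) S))"
    using yi k finite_D by (intro finsum_cong' finsum_rdistr) (auto intro!: finsum_closed)
  also have "\<dots> = (\<Oplus>i\<in>D. \<Oplus>j\<in>D. c j \<otimes> (y i \<otimes> wed j (con i f) S))"
    using yi k finite_D by (intro finsum_swap) auto
  finally have "del y (htp c f) S \<oplus> htp c (del y f) S
      = (\<Oplus>i\<in>D. (\<Oplus>j\<in>D. y i \<otimes> (c j \<otimes> con i (wed j f) S)) \<oplus> (\<Oplus>j\<in>D. c j \<otimes> (y i \<otimes> wed j (con i f) S)))"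
    unfolding 1 using yi k by (subst finsum_addf) (auto intro!: finsum_closed)
  also have "\<dots> = (\<Oplus>i\<in>D. y i \<otimes> c i \<otimes> f S)"
  proof (rule finsum_cong')
    fix i assume i: "i \<in> D"
    have "(\<Oplus>j\<in>D. y i \<otimes> (c j \<otimes> con i (wed j f) S)) \<oplus> (\<Oplus>j\<in>D. c j \<otimes> (y i \<otimes> wed j (con i f) S))
        = (\<Oplus>j\<in>D. y i \<otimes> (c j \<otimes> con i (wed j f) S) \<oplus> c j \<otimes> (y i \<otimes> wed j (con i f) S))"
      using yi k i by (subst finsum_addf) auto
    also have "\<dots> = (\<Oplus>j\<in>D. if i = j then y i \<otimes> c j \<otimes> f S else \<zero>)"
    proof (rule finsum_cong')
      fix j assume j: "j \<in> D"
      have "y i \<otimes> (c j \<otimes> con i (wed j f) S) \<oplus> c j \<otimes> (y i \<otimes> wed j (con i f) S)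
          = y i \<otimes> c j \<otimes> (con i (wed j f) S \<oplus> wed j (con i f) S)"
        using i j yi k by (simp add: r_distr m_ac)
      also have "\<dots> = (if i = j then y i \<otimes> c j \<otimes> f S else \<zero>)"
        using con_wed[OF f i j S] i j yi by simp
      finally show "y i \<otimes> (c j \<otimes> con i (wed j f) S) \<oplus> c j \<otimes> (y i \<otimes> wed j (con i f) S) = \<dots>" .
    qed (use i yi fS in auto)
    also have "\<dots> = y i \<otimes> c i \<otimes> f S"
      using i yi fS finite_D by (intro add.finprod_singleton) auto
    finally show "(\<Oplus>j\<in>D. y i \<otimes> (c j \<otimes> con i (wed j f) S)) \<oplus> (\<Oplus>j\<in>D. c j \<otimes> (y i \<otimes> wed j (con i f) S))
        = y i \<otimes> c i \<otimes> f S" .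
  qed (use yi fS in auto)
  also have "\<dots> = (\<Oplus>i\<in>D. y i \<otimes> c i) \<otimes> f S"
    using yi fS finite_D by (intro finsum_ldistr[symmetric]) auto
  finally show ?thesis .
qed

end

lemma (in ideal) finsum_in_ideal:
  "finite A \<Longrightarrow> (\<And>i. i \<in> A \<Longrightarrow> f i \<in> I) \<Longrightarrow> finsum R f A \<in> I"
proof (induction A rule: finite_induct)
  case (insert x A)
  then have "f \<in> insert x A \<rightarrow> carrier R" using Icarr by auto
  then have "finsum R f (insert x A) = f x \<oplus> finsum R f A" using insert.hyps by (intro finsum_insert) auto
  then show ?case using insert by auto
qed simp

lemma (in cring) Idl_image_finsum:
  assumes "finite A" "y \<in> A \<rightarrow> carrier R" "t \<in> Idl (y ` A)"
  shows "\<exists>c\<in>A \<rightarrow> carrier R. t = (\<Oplus>i\<in>A. y i \<otimes> c i)"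
  using assms
proof (induction A arbitrary: t rule: finite_induct)
  case empty
  then show ?case by (simp add: Idl_empty)
next
  case (insert k A)
  then have "y k \<in> carrier R" "y ` A \<subseteq> carrier R" by auto
  with insert obtain u r where u: "u \<in> Idl (y ` A)" "r \<in> carrier R" "t = u \<oplus> y k \<otimes> r"
    using Idl_insert[of "y k" "y ` A" t] by auto
  obtain c where c: "c \<in> A \<rightarrow> carrier R" "u = (\<Oplus>i\<in>A. y i \<otimes> c i)"
    using insert.IH[OF _ u(1)] insert.prems by auto
  have "(\<Oplus>i\<in>A. y i \<otimes> (c(k := r)) i) = (\<Oplus>i\<in>A. y i \<otimes> c i)"
    using insert c by (intro finsum_cong') auto
  moreover have "(\<Oplus>i\<in>insert k A. y i \<otimes> (c(k := r)) i) = y k \<otimes> (c(k := r)) k \<oplus> (\<Oplus>i\<in>A. y i \<otimes> (c(k := r)) i)"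
    using insert.hyps insert.prems(1) c(1) u(2) by (intro finsum_insert) (auto simp: Pi_iff)
  moreover have "(\<Oplus>i\<in>A. y i \<otimes> c i) \<in> carrier R" using insert.prems c by (intro finsum_closed) auto
  ultimately have "t = (\<Oplus>i\<in>insert k A. y i \<otimes> (c(k := r)) i)"
    using u c insert.prems by (simp add: a_comm)
  then show ?case using c u by (intro bexI[of _ "c(k := r)"]) auto
qed

section \<open>The Koszul complex as an instance of the axioms for complexes\<close>

context exterior_algebra
begin

lemma PiE_forms: "f \<in> Pow D \<rightarrow>\<^sub>E carrier R \<Longrightarrow> f \<in> forms"
  by (auto simp: forms_def)

lemma restrict_forms: "f \<in> forms \<Longrightarrow> restrict f (Pow D) \<in> Pow D \<rightarrow>\<^sub>E carrier R"
  by (auto simp: forms_def)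

lemma restrict_forms': "f \<in> forms \<Longrightarrow> restrict f (Pow D) \<in> forms"
  by (auto simp: forms_def)

lemma del_cong: "(\<And>T. T \<subseteq> D \<Longrightarrow> f T = g T) \<Longrightarrow> S \<subseteq> D \<Longrightarrow> g \<in> forms \<Longrightarrow> y \<in> D \<rightarrow> carrier R \<Longrightarrow> del y f S = del y g S"
  unfolding del_def using formsD[OF con_forms[of g]] by (intro finsum_cong') (auto simp: con_def)

lemma htp_cong:
  assumes "\<And>T. T \<subseteq> D \<Longrightarrow> f T = g T" "S \<subseteq> D" "g \<in> forms" "c \<in> D \<rightarrow> carrier R"
  shows "htp c f S = htp c g S"
  unfolding htp_def
proof (rule finsum_cong')
  have "f (S - {i}) = g (S - {i})" for i using assms(2) by (intro assms(1)) auto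
  then show "c i \<otimes> wed i f S = c i \<otimes> wed i g S" for i by (simp add: wed_def)
  show "(\<lambda>i. c i \<otimes> wed i g S) \<in> D \<rightarrow> carrier R"
    using assms(4) formsD[OF wed_forms[OF assms(3)] assms(2)] by auto
qed simp

lemma con_add: "f \<in> forms \<Longrightarrow> g \<in> forms \<Longrightarrow> i \<in> D \<Longrightarrow> S \<subseteq> D \<Longrightarrow> con i (\<lambda>T. f T \<oplus> g T) S = con i f S \<oplus> con i g S"
  using formsD[of f "insert i S"] formsD[of g "insert i S"] by (simp add: con_def r_distr)

lemma wed_add:
  assumes "f \<in> forms" "g \<in> forms" "S \<subseteq> D"
  shows "wed i (\<lambda>T. f T \<oplus> g T) S = wed i f S \<oplus> wed i g S"
proof (cases "i \<in> S")
  case True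
  have "f (S - {i}) \<in> carrier R" "g (S - {i}) \<in> carrier R" using assms by (auto intro!: formsD[of f] formsD[of g])
  then show ?thesis using True assms by (simp add: wed_def r_distr)
qed (simp add: wed_def assms)

lemma del_add:
  assumes "y \<in> D \<rightarrow> carrier R" "f \<in> forms" "g \<in> forms" "S \<subseteq> D"
  shows "del y (\<lambda>T. f T \<oplus> g T) S = del y f S \<oplus> del y g S"
proof -
  have y: "y i \<in> carrier R" if "i \<in> D" for i using assms that by auto
  note c = formsD[OF con_forms[OF assms(2)] assms(4)] formsD[OF con_forms[OF assms(3)] assms(4)]
  have "del y (\<lambda>T. f T \<oplus> g T) S = (\<Oplus>i\<in>D. y i \<otimes> con i f S \<oplus> y i \<otimes> con i g S)"
    unfolding del_def using assms y c by (intro finsum_cong') (auto simp: con_add r_distr)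
  also have "\<dots> = del y f S \<oplus> del y g S" unfolding del_def using y c by (intro finsum_addf) auto
  finally show ?thesis .
qed

lemma htp_add:
  assumes "y \<in> D \<rightarrow> carrier R" "f \<in> forms" "g \<in> forms" "S \<subseteq> D"
  shows "htp y (\<lambda>T. f T \<oplus> g T) S = htp y f S \<oplus> htp y g S"
proof -
  have y: "y i \<in> carrier R" if "i \<in> D" for i using assms that by auto
  note c = formsD[OF wed_forms[OF assms(2)] assms(4)] formsD[OF wed_forms[OF assms(3)] assms(4)]
  have "htp y (\<lambda>T. f T \<oplus> g T) S = (\<Oplus>i\<in>D. y i \<otimes> wed i f S \<oplus> y i \<otimes> wed i g S)"
    unfolding htp_def using assms y c by (intro finsum_cong') (auto simp: wed_add r_distr)
  also have "\<dots> = htp y f S \<oplus> htp y g S" unfolding htp_def using y c by (intro finsum_addf) auto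
  finally show ?thesis .
qed

lemma del_smult:
  assumes "y \<in> D \<rightarrow> carrier R" "f \<in> forms" "t \<in> carrier R" "S \<subseteq> D"
  shows "del y (\<lambda>T. t \<otimes> f T) S = t \<otimes> del y f S"
proof -
  have y: "y i \<in> carrier R" if "i \<in> D" for i using assms that by auto
  note c = formsD[OF con_forms[OF assms(2)] assms(4)]
  have "del y (\<lambda>T. t \<otimes> f T) S = (\<Oplus>i\<in>D. t \<otimes> (y i \<otimes> con i f S))"
    unfolding del_def using assms y c by (intro finsum_cong') (auto simp: con_smult m_lcomm)
  also have "\<dots> = t \<otimes> del y f S" unfolding del_def using assms y c finite_D by (intro finsum_rdistr[symmetric]) auto
  finally show ?thesis .
qed

lemma htp_smult:
  assumes "y \<in> D \<rightarrow> carrier R" "f \<in> forms" "t \<in> carrier R" "S \<subseteq> D"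
  shows "htp y (\<lambda>T. t \<otimes> f T) S = t \<otimes> htp y f S"
proof -
  have y: "y i \<in> carrier R" if "i \<in> D" for i using assms that by auto
  note c = formsD[OF wed_forms[OF assms(2)] assms(4)]
  have "htp y (\<lambda>T. t \<otimes> f T) S = (\<Oplus>i\<in>D. t \<otimes> (y i \<otimes> wed i f S))"
    unfolding htp_def using assms y c by (intro finsum_cong') (auto simp: wed_smult m_lcomm)
  also have "\<dots> = t \<otimes> htp y f S" unfolding htp_def using assms y c finite_D by (intro finsum_rdistr[symmetric]) auto
  finally show ?thesis .
qed

lemma sub_ideal_closed:
  assumes I: "ideal I R" and f: "f \<in> Pow D \<rightarrow> I" and y: "y \<in> D \<rightarrow> carrier R" and S: "S \<subseteq> D"
  shows "del y f S \<in> I" "htp y f S \<in> I"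
proof -
  interpret I: ideal I R by fact
  have "con i f S \<in> I" if "i \<in> D" for i
    using f that S by (auto simp: con_def intro!: I.I_l_closed)
  moreover have "wed i f S \<in> I" if "i \<in> D" for i
    using f that S Diff_subset[of S "{i}"] by (auto simp: wed_def Pi_iff intro!: I.I_l_closed)
  ultimately show "del y f S \<in> I" "htp y f S \<in> I"
    unfolding del_def htp_def using finite_D y by (auto intro!: I.finsum_in_ideal I.I_l_closed)
qed

text \<open>Only the additive group and the scalar action enter; the slots for multiplication and
  unit, which the record type inherits from rings, are filled arbitrarily.\<close>

definition form_module :: "('a, nat set \<Rightarrow> 'a) module" where
  "form_module = \<lparr>carrier = Pow D \<rightarrow>\<^sub>E carrier R, monoid.mult = (\<lambda>f g. undefined), monoid.one = undefined,
     ring.zero = (\<lambda>S\<in>Pow D. \<zero>), ring.add = (\<lambda>f g. \<lambda>S\<in>Pow D. f S \<oplus> g S),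
     module.smult = (\<lambda>c f. \<lambda>S\<in>Pow D. c \<otimes> f S)\<rparr>"

lemma form_module_simps:
  "carrier form_module = Pow D \<rightarrow>\<^sub>E carrier R"
  "\<zero>\<^bsub>form_module\<^esub> = (\<lambda>S\<in>Pow D. \<zero>)"
  "f \<oplus>\<^bsub>form_module\<^esub> g = (\<lambda>S\<in>Pow D. f S \<oplus> g S)"
  "c \<odot>\<^bsub>form_module\<^esub> f = (\<lambda>S\<in>Pow D. c \<otimes> f S)"
  by (simp_all add: form_module_def)

lemma abelian_group_forms:
  assumes "carrier G = Pow D \<rightarrow>\<^sub>E carrier R" "\<zero>\<^bsub>G\<^esub> = (\<lambda>S\<in>Pow D. \<zero>)"
    "\<And>f g. f \<oplus>\<^bsub>G\<^esub> g = (\<lambda>S\<in>Pow D. f S \<oplus> g S)"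
  shows "abelian_group G"
proof (rule abelian_groupI)
  fix f assume "f \<in> carrier G"
  then have f: "f \<in> Pow D \<rightarrow>\<^sub>E carrier R" by (simp add: assms)
  show "\<zero>\<^bsub>G\<^esub> \<oplus>\<^bsub>G\<^esub> f = f"
    using f by (intro PiE_ext[OF _ f]) (auto simp: assms PiE_mem[OF f])
  show "\<exists>g\<in>carrier G. g \<oplus>\<^bsub>G\<^esub> f = \<zero>\<^bsub>G\<^esub>"
  proof (rule bexI)
    show "(\<lambda>S\<in>Pow D. \<ominus> f S) \<oplus>\<^bsub>G\<^esub> f = \<zero>\<^bsub>G\<^esub>"
      unfolding assms by (rule restrict_ext) (use PiE_mem[OF f] in \<open>auto simp: l_neg\<close>)
  qed (use PiE_mem[OF f] in \<open>auto simp: assms\<close>)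
next
  fix f g assume "f \<in> carrier G" "g \<in> carrier G"
  then have fg: "f \<in> Pow D \<rightarrow>\<^sub>E carrier R" "g \<in> Pow D \<rightarrow>\<^sub>E carrier R" by (simp_all add: assms)
  show "f \<oplus>\<^bsub>G\<^esub> g \<in> carrier G" using fg by (auto simp: assms)
  show "f \<oplus>\<^bsub>G\<^esub> g = g \<oplus>\<^bsub>G\<^esub> f" using fg by (auto simp: assms PiE_mem intro!: a_comm restrict_ext)
next
  fix f g h assume "f \<in> carrier G" "g \<in> carrier G" "h \<in> carrier G"
  then have "f \<in> Pow D \<rightarrow>\<^sub>E carrier R" "g \<in> Pow D \<rightarrow>\<^sub>E carrier R" "h \<in> Pow D \<rightarrow>\<^sub>E carrier R" by (simp_all add: assms)
  then show "f \<oplus>\<^bsub>G\<^esub> g \<oplus>\<^bsub>G\<^esub> h = f \<oplus>\<^bsub>G\<^esub> (g \<oplus>\<^bsub>G\<^esub> h)"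
    by (auto simp: assms PiE_mem intro!: a_assoc restrict_ext)
qed (auto simp: assms)

lemma module_forms: "module R form_module"
proof (rule moduleI)
  show "abelian_group form_module" by (rule abelian_group_forms) (simp_all add: form_module_simps)
next
  fix f assume f: "f \<in> carrier form_module"
  have fS: "f S \<in> carrier R" if "S \<in> Pow D" for S using f that by (auto simp: form_module_simps)
  show "\<one> \<odot>\<^bsub>form_module\<^esub> f = f"
    by (rule PiE_ext[of _ "Pow D" "\<lambda>_. carrier R"]) (use f fS in \<open>auto simp: form_module_simps\<close>)
  fix a assume a: "a \<in> carrier R"
  show "a \<odot>\<^bsub>form_module\<^esub> f \<in> carrier form_module"
    using a fS by (auto simp: form_module_simps)
  fix b assume b: "b \<in> carrier R"
  show "(a \<oplus> b) \<odot>\<^bsub>form_module\<^esub> f = a \<odot>\<^bsub>form_module\<^esub> f \<oplus>\<^bsub>form_module\<^esub> b \<odot>\<^bsub>form_module\<^esub> f"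
    using a b fS by (auto simp: form_module_simps l_distr intro!: restrict_ext)
  show "(a \<otimes> b) \<odot>\<^bsub>form_module\<^esub> f = a \<odot>\<^bsub>form_module\<^esub> (b \<odot>\<^bsub>form_module\<^esub> f)"
    using a b fS by (auto simp: form_module_simps m_assoc intro!: restrict_ext)
next
  fix a f g assume a: "a \<in> carrier R" and fg: "f \<in> carrier form_module" "g \<in> carrier form_module"
  have fS: "f S \<in> carrier R" "g S \<in> carrier R" if "S \<in> Pow D" for S using fg that by (auto simp: form_module_simps)
  show "a \<odot>\<^bsub>form_module\<^esub> (f \<oplus>\<^bsub>form_module\<^esub> g) = a \<odot>\<^bsub>form_module\<^esub> f \<oplus>\<^bsub>form_module\<^esub> a \<odot>\<^bsub>form_module\<^esub> g"
    using a fS by (auto simp: form_module_simps r_distr intro!: restrict_ext)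
qed (rule is_cring)

text \<open>Cutting off outside \<open>Pow D\<close> turns identities at all subsets of
  \<open>D\<close> into equalities of elements of the carrier.\<close>

definition kd :: "(nat \<Rightarrow> 'a) \<Rightarrow> (nat set \<Rightarrow> 'a) \<Rightarrow> nat set \<Rightarrow> 'a" where
  "kd y f = (\<lambda>S\<in>Pow D. del y f S)"

definition kh :: "(nat \<Rightarrow> 'a) \<Rightarrow> (nat set \<Rightarrow> 'a) \<Rightarrow> nat set \<Rightarrow> 'a" where
  "kh c f = (\<lambda>S\<in>Pow D. htp c f S)"

definition kfil :: "nat \<Rightarrow> (nat set \<Rightarrow> 'a) set" where
  "kfil k = {f \<in> Pow D \<rightarrow>\<^sub>E carrier R. \<forall>S\<in>Pow D. card S < k \<longrightarrow> f S = \<zero>}"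

lemma kd_closed: "y \<in> D \<rightarrow> carrier R \<Longrightarrow> f \<in> Pow D \<rightarrow>\<^sub>E carrier R \<Longrightarrow> kd y f \<in> Pow D \<rightarrow>\<^sub>E carrier R"
  unfolding kd_def by (intro restrict_forms del_forms PiE_forms)

lemma kh_closed: "c \<in> D \<rightarrow> carrier R \<Longrightarrow> f \<in> Pow D \<rightarrow>\<^sub>E carrier R \<Longrightarrow> kh c f \<in> Pow D \<rightarrow>\<^sub>E carrier R"
  unfolding kh_def by (intro restrict_forms htp_forms PiE_forms)

lemma kd_add:
  assumes "y \<in> D \<rightarrow> carrier R" "f \<in> Pow D \<rightarrow>\<^sub>E carrier R" "g \<in> Pow D \<rightarrow>\<^sub>E carrier R"
  shows "kd y (\<lambda>S\<in>Pow D. f S \<oplus> g S) = (\<lambda>S\<in>Pow D. kd y f S \<oplus> kd y g S)"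
  unfolding kd_def
proof (rule restrict_ext)
  fix S assume S: "S \<in> Pow D"
  have "del y (\<lambda>S\<in>Pow D. f S \<oplus> g S) S = del y (\<lambda>S. f S \<oplus> g S) S"
    using assms S by (intro del_cong add_forms PiE_forms) auto
  also have "\<dots> = del y f S \<oplus> del y g S" using assms S PiE_forms by (intro del_add) auto
  finally show "del y (\<lambda>S\<in>Pow D. f S \<oplus> g S) S = restrict (del y f) (Pow D) S \<oplus> restrict (del y g) (Pow D) S"
    using S by simp
qed

lemma kh_add:
  assumes "y \<in> D \<rightarrow> carrier R" "f \<in> Pow D \<rightarrow>\<^sub>E carrier R" "g \<in> Pow D \<rightarrow>\<^sub>E carrier R"
  shows "kh y (\<lambda>S\<in>Pow D. f S \<oplus> g S) = (\<lambda>S\<in>Pow D. kh y f S \<oplus> kh y g S)"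
  unfolding kh_def
proof (rule restrict_ext)
  fix S assume S: "S \<in> Pow D"
  have "htp y (\<lambda>S\<in>Pow D. f S \<oplus> g S) S = htp y (\<lambda>S. f S \<oplus> g S) S"
    using assms S by (intro htp_cong add_forms PiE_forms) auto
  also have "\<dots> = htp y f S \<oplus> htp y g S" using assms S PiE_forms by (intro htp_add) auto
  finally show "htp y (\<lambda>S\<in>Pow D. f S \<oplus> g S) S = restrict (htp y f) (Pow D) S \<oplus> restrict (htp y g) (Pow D) S"
    using S by simp
qed

lemma kd_smult:
  assumes "y \<in> D \<rightarrow> carrier R" "f \<in> Pow D \<rightarrow>\<^sub>E carrier R" "c \<in> carrier R"
  shows "kd y (\<lambda>S\<in>Pow D. c \<otimes> f S) = (\<lambda>S\<in>Pow D. c \<otimes> kd y f S)"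
  unfolding kd_def
proof (rule restrict_ext)
  fix S assume S: "S \<in> Pow D"
  have "del y (\<lambda>S\<in>Pow D. c \<otimes> f S) S = del y (\<lambda>S. c \<otimes> f S) S"
    using assms S by (intro del_cong smult_forms PiE_forms) auto
  also have "\<dots> = c \<otimes> del y f S" using assms S PiE_forms by (intro del_smult) auto
  finally show "del y (\<lambda>S\<in>Pow D. c \<otimes> f S) S = c \<otimes> restrict (del y f) (Pow D) S"
    using S by simp
qed

lemma kh_smult:
  assumes "y \<in> D \<rightarrow> carrier R" "f \<in> Pow D \<rightarrow>\<^sub>E carrier R" "c \<in> carrier R"
  shows "kh y (\<lambda>S\<in>Pow D. c \<otimes> f S) = (\<lambda>S\<in>Pow D. c \<otimes> kh y f S)"
  unfolding kh_def
proof (rule restrict_ext)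
  fix S assume S: "S \<in> Pow D"
  have "htp y (\<lambda>S\<in>Pow D. c \<otimes> f S) S = htp y (\<lambda>S. c \<otimes> f S) S"
    using assms S by (intro htp_cong smult_forms PiE_forms) auto
  also have "\<dots> = c \<otimes> htp y f S" using assms S PiE_forms by (intro htp_smult) auto
  finally show "htp y (\<lambda>S\<in>Pow D. c \<otimes> f S) S = c \<otimes> restrict (htp y f) (Pow D) S"
    using S by simp
qed

lemma kd_kd:
  assumes "y \<in> D \<rightarrow> carrier R" "f \<in> Pow D \<rightarrow>\<^sub>E carrier R"
  shows "kd y (kd y f) = (\<lambda>S\<in>Pow D. \<zero>)"
  unfolding kd_def
proof (rule restrict_ext)
  fix S assume S: "S \<in> Pow D"
  have "del y (restrict (del y f) (Pow D)) S = del y (del y f) S"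
    using assms S PiE_forms by (intro del_cong) auto
  then show "del y (restrict (del y f) (Pow D)) S = \<zero>"
    using del_del[OF assms(1) PiE_forms[OF assms(2)]] S by simp
qed

lemma kd_kh:
  assumes "y \<in> D \<rightarrow> carrier R" "c \<in> D \<rightarrow> carrier R" "f \<in> Pow D \<rightarrow>\<^sub>E carrier R"
  shows "(\<lambda>S\<in>Pow D. kd y (kh c f) S \<oplus> kh c (kd y f) S) = (\<lambda>S\<in>Pow D. (\<Oplus>i\<in>D. y i \<otimes> c i) \<otimes> f S)"
proof (rule restrict_ext)
  fix S assume S: "S \<in> Pow D"
  have "kd y (kh c f) S = del y (htp c f) S"
    using assms S PiE_forms by (simp add: kd_def kh_def) (intro del_cong; auto)
  moreover have "kh c (kd y f) S = htp c (del y f) S"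
    using assms S PiE_forms by (simp add: kd_def kh_def) (intro htp_cong; auto)
  ultimately show "kd y (kh c f) S \<oplus> kh c (kd y f) S = (\<Oplus>i\<in>D. y i \<otimes> c i) \<otimes> f S"
    using del_htp[OF assms(1,2) PiE_forms[OF assms(3)]] S by simp
qed

lemma kd_unit: 
  assumes "y \<in> D \<rightarrow> carrier R"
  shows "kd y (restrict unit (Pow D)) = (\<lambda>S\<in>Pow D. \<zero>)"
  unfolding kd_def
proof (rule restrict_ext)
  fix S assume "S \<in> Pow D"
  then have "del y (restrict unit (Pow D)) S = del y unit S"
    using assms by (intro del_cong) auto
  also have "\<dots> = \<zero>"
    unfolding del_def using assms by (intro add.finprod_one_eqI) (auto simp: con_def unit_def Pi_iff)
  finally show "del y (restrict unit (Pow D)) S = \<zero>" .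
qed

lemma kh_kfil:
  assumes "c \<in> D \<rightarrow> carrier R" "f \<in> kfil k"
  shows "kh c f \<in> kfil (Suc k)"
proof -
  have f: "f \<in> Pow D \<rightarrow>\<^sub>E carrier R" and f0: "\<And>S. S \<subseteq> D \<Longrightarrow> card S < k \<Longrightarrow> f S = \<zero>"
    using assms(2) by (auto simp: kfil_def)
  have "htp c f S = \<zero>" if S: "S \<subseteq> D" "card S < Suc k" for S
    unfolding htp_def
  proof (rule add.finprod_one_eqI)
    fix i assume "i \<in> D"
    then have "c i \<in> carrier R" using assms(1) by auto
    moreover have "wed i f S = \<zero>"
    proof (cases "i \<in> S")
      case True
      then have "card (S - {i}) < k" using S finite_sub[OF S(1)] by (metis card_Diff1_less less_Suc_eq_le less_le_trans)
      then have "f (S - {i}) = \<zero>" using S by (intro f0) auto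
      then show ?thesis by (simp add: wed_def)
    qed (simp add: wed_def)
    ultimately show "c i \<otimes> wed i f S = \<zero>" by simp
  qed
  then show ?thesis using kh_closed[OF assms(1) f] by (auto simp: kfil_def kh_def)
qed

text \<open>\<open>sub I\<close> becomes the set of forms with all coefficients in \<open>I\<close>,
  so every axiom about it is a statement about single coefficients.\<close>

lemma augmented_complex_forms:
  assumes y: "y \<in> D \<rightarrow> carrier R"
  shows "augmented_complex R form_module (kd y) (\<lambda>I. Pow D \<rightarrow>\<^sub>E I) kfil
    (restrict unit (Pow D)) (\<lambda>f. f {}) (Idl (y ` D))"
proof -
  interpret F: module R form_module by (rule module_forms)
  have yD: "y ` D \<subseteq> carrier R" using y by auto
  note N = genideal_ideal[OF yD]
  note simps = form_module_simps
  have unit: "restrict unit (Pow D) \<in> Pow D \<rightarrow>\<^sub>E carrier R" by (rule restrict_forms[OF unit_forms])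
  show ?thesis
  proof (intro augmented_complex.intro augmented_complex_axioms.intro)
    show "module R form_module" by (rule module_forms)
    show "F.linear_endo (kd y)"
      using y by (intro F.linear_endoI) (simp_all add: simps kd_closed kd_add kd_smult)
    show "kd y (kd y f) = \<zero>\<^bsub>form_module\<^esub>" if "f \<in> carrier form_module" for f
      using kd_kd[OF y] that by (simp add: simps)
    show "Pow D \<rightarrow>\<^sub>E I \<subseteq> carrier form_module" if "ideal I R" for I
      unfolding simps using ideal.Icarr[OF that] by (intro PiE_mono) blast
    show "f \<oplus>\<^bsub>form_module\<^esub> g \<in> Pow D \<rightarrow>\<^sub>E I" if "ideal I R" "f \<in> Pow D \<rightarrow>\<^sub>E I" "g \<in> Pow D \<rightarrow>\<^sub>E I" for I f g
      using additive_subgroup.a_closed[OF ideal.axioms(1)[OF that(1)]] PiE_mem[OF that(2)] PiE_mem[OF that(3)]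
      unfolding simps restrict_PiE_iff by blast
    show "c \<odot>\<^bsub>form_module\<^esub> f \<in> Pow D \<rightarrow>\<^sub>E I" if "ideal I R" "c \<in> carrier R" "f \<in> Pow D \<rightarrow>\<^sub>E I" for I f c
      using ideal.I_l_closed[OF that(1) _ that(2)] PiE_mem[OF that(3)]
      unfolding simps restrict_PiE_iff by blast
    show "kd y f \<in> Pow D \<rightarrow>\<^sub>E I" if "ideal I R" "f \<in> Pow D \<rightarrow>\<^sub>E I" for I f
      using sub_ideal_closed(1)[OF that(1) _ y, of f] PiE_mem[OF that(2)]
      unfolding kd_def restrict_PiE_iff by blast
    show "a \<odot>\<^bsub>form_module\<^esub> f \<in> Pow D \<rightarrow>\<^sub>E I" if "ideal I R" "a \<in> I" "f \<in> carrier form_module" for I f a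
      using ideal.I_r_closed[OF that(1,2)] PiE_mem[OF that(3)[unfolded simps]]
      unfolding simps restrict_PiE_iff by blast
    show "Pow D \<rightarrow>\<^sub>E I \<subseteq> Pow D \<rightarrow>\<^sub>E J" if "I \<subseteq> J" for I J :: "'a set"
      using that by (intro PiE_mono) auto
    show "Pow D \<rightarrow>\<^sub>E {\<zero>} = {\<zero>\<^bsub>form_module\<^esub>}"
      unfolding simps by (auto simp: fun_eq_iff PiE_iff extensional_def restrict_def)
    show "\<exists>p\<in>Pow D \<rightarrow>\<^sub>E I. \<exists>u\<in>carrier form_module. f = p \<oplus>\<^bsub>form_module\<^esub> a \<odot>\<^bsub>form_module\<^esub> u"
      if I: "ideal I R" "ideal I' R" "a \<in> carrier R"
        and sp: "\<And>t. t \<in> I' \<Longrightarrow> \<exists>i\<in>I. \<exists>r\<in>carrier R. t = i \<oplus> a \<otimes> r" and f: "f \<in> Pow D \<rightarrow>\<^sub>E I'"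
      for I I' a f
    proof -
      have "\<forall>S\<in>Pow D. \<exists>ir. fst ir \<in> I \<and> snd ir \<in> carrier R \<and> f S = fst ir \<oplus> a \<otimes> snd ir"
    proof
      fix S assume "S \<in> Pow D"
      then obtain i r where "i \<in> I" "r \<in> carrier R" "f S = i \<oplus> a \<otimes> r" using sp[OF PiE_mem[OF f]] by blast
      then show "\<exists>ir. fst ir \<in> I \<and> snd ir \<in> carrier R \<and> f S = fst ir \<oplus> a \<otimes> snd ir"
        by (intro exI[of _ "(i, r)"]) simp
    qed
      then obtain h where "\<forall>S\<in>Pow D. fst (h S) \<in> I \<and> snd (h S) \<in> carrier R \<and> f S = fst (h S) \<oplus> a \<otimes> snd (h S)"
        by (rule bchoice[THEN exE])
      then have h: "\<And>S. S \<in> Pow D \<Longrightarrow> fst (h S) \<in> I \<and> snd (h S) \<in> carrier R \<and> f S = fst (h S) \<oplus> a \<otimes> snd (h S)"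
        by blast
      show ?thesis
      proof (rule bexI, rule bexI)
        show "f = (\<lambda>S\<in>Pow D. fst (h S)) \<oplus>\<^bsub>form_module\<^esub> a \<odot>\<^bsub>form_module\<^esub> (\<lambda>S\<in>Pow D. snd (h S))"
        proof (rule extensionalityI[of _ "Pow D"])
          show "f \<in> extensional (Pow D)" using f by (auto simp: PiE_iff)
          show "f S = ((\<lambda>S\<in>Pow D. fst (h S)) \<oplus>\<^bsub>form_module\<^esub> a \<odot>\<^bsub>form_module\<^esub> (\<lambda>S\<in>Pow D. snd (h S))) S"
            if "S \<in> Pow D" for S
            using h[OF that] that unfolding simps by simp
        qed (simp add: simps)
        show "(\<lambda>S\<in>Pow D. fst (h S)) \<in> Pow D \<rightarrow>\<^sub>E I" "(\<lambda>S\<in>Pow D. snd (h S)) \<in> carrier form_module"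
          unfolding simps restrict_PiE_iff using h by blast+
      qed
    qed
    show "f \<in> Pow D \<rightarrow>\<^sub>E J"
      if "ideal L R" "ideal B R" "ideal J R" "a \<in> carrier R"
        and c: "\<And>t b. t \<in> carrier R \<Longrightarrow> b \<in> B \<Longrightarrow> a \<otimes> t \<oplus> b \<in> L \<Longrightarrow> t \<in> J"
        and f: "f \<in> carrier form_module" and b: "b \<in> Pow D \<rightarrow>\<^sub>E B"
        and l: "a \<odot>\<^bsub>form_module\<^esub> f \<oplus>\<^bsub>form_module\<^esub> b \<in> Pow D \<rightarrow>\<^sub>E L" for L B J a f b
    proof (rule PiE_I)
      fix S assume S: "S \<in> Pow D"
      have "(a \<odot>\<^bsub>form_module\<^esub> f \<oplus>\<^bsub>form_module\<^esub> b) S \<in> L" using PiE_mem[OF l S] .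
      then have "a \<otimes> f S \<oplus> b S \<in> L" using S by (simp add: simps)
      then show "f S \<in> J" using c[of "f S" "b S"] f b S by (auto simp: simps)
    next
      fix S assume "S \<notin> Pow D"
      then show "f S = undefined" using f by (auto simp: simps)
    qed
    show "restrict unit (Pow D) \<in> carrier form_module" using unit by (simp add: simps)
    show "kd y (restrict unit (Pow D)) = \<zero>\<^bsub>form_module\<^esub>" using kd_unit[OF y] by (simp add: simps)
    show "ideal (Idl (y ` D)) R" by (rule N)
    show "f {} \<in> carrier R" if "f \<in> carrier form_module" for f using that by (auto simp: simps)
    show "(f \<oplus>\<^bsub>form_module\<^esub> g) {} = f {} \<oplus> g {}" for f g by (simp add: simps)
    show "(c \<odot>\<^bsub>form_module\<^esub> f) {} = c \<otimes> f {}" for c f by (simp add: simps)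
    show "restrict unit (Pow D) {} = \<one>" by (simp add: unit_def)
    show "\<exists>q\<in>carrier form_module. t \<odot>\<^bsub>form_module\<^esub> restrict unit (Pow D) = kd y q"
      if t: "t \<in> Idl (y ` D)" for t
    proof -
      \<comment> \<open>Write \<open>t\<close> as the sum of the \<open>y i c i\<close>. Since the
        unit is a cycle, the homotopy identity at the unit reads
        \<open>t e = d (kh c e)\<close>.\<close>
      obtain c where c: "c \<in> D \<rightarrow> carrier R" "t = (\<Oplus>i\<in>D. y i \<otimes> c i)"
        using Idl_image_finsum[OF finite_D y t] by blast
      have "t \<odot>\<^bsub>form_module\<^esub> restrict unit (Pow D)
          = (\<lambda>S\<in>Pow D. kd y (kh c (restrict unit (Pow D))) S \<oplus> kh c (kd y (restrict unit (Pow D))) S)"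
        unfolding kd_kh[OF y c(1) unit] c(2)[symmetric] by (simp add: simps)
      also have "\<dots> = kd y (kh c (restrict unit (Pow D)))"
      proof (rule PiE_ext[of _ "Pow D" "\<lambda>_. carrier R"])
        fix S assume S: "S \<in> Pow D"
        have "kh c (\<lambda>S\<in>Pow D. \<zero>) S = htp c (\<lambda>S. \<zero>) S"
          unfolding kh_def using S c by (simp, intro htp_cong) (auto simp: forms_def)
        also have "\<dots> = \<zero>"
          unfolding htp_def using c(1) by (intro add.finprod_one_eqI) (auto simp: wed_def Pi_iff)
        finally show "(\<lambda>S\<in>Pow D. kd y (kh c (restrict unit (Pow D))) S \<oplus> kh c (kd y (restrict unit (Pow D))) S) S
            = kd y (kh c (restrict unit (Pow D))) S"
          using S PiE_mem[OF kd_closed[OF y kh_closed[OF c(1) unit]] S] by (simp add: kd_unit[OF y])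
      qed (use kd_closed[OF y kh_closed[OF c(1) unit]] kh_closed[OF c(1) kd_closed[OF y unit]] in auto)
      finally show ?thesis using kh_closed[OF c(1) unit] by (intro bexI[of _ "kh c (restrict unit (Pow D))"]) (simp_all add: simps)
    qed
    show "kd y f {} \<in> Idl (y ` D)" if f: "f \<in> carrier form_module" for f
    proof -
      \<comment> \<open>At the empty set the differential is the sum of the
        \<open>y i f {i}\<close>.\<close>
      have "y i \<otimes> con i f {} \<in> Idl (y ` D)" if i: "i \<in> D" for i
        using genideal_self[OF yD] i f formsD[OF con_forms[OF PiE_forms], of f i "{}"]
        by (intro ideal.I_r_closed[OF N]) (auto simp: simps)
      then show ?thesis unfolding kd_def del_def using finite_D by (auto intro!: ideal.finsum_in_ideal[OF N])
    qed
    show "f {} \<in> I" if "f \<in> Pow D \<rightarrow>\<^sub>E I" for f I using that by auto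
    show "kfil (Suc 0) = {f \<in> carrier form_module. f {} = \<zero>}"
      using finite_sub by (auto simp: kfil_def simps card_eq_0_iff)
  qed
qed

lemma homotopy_forms:
  assumes y: "y \<in> D \<rightarrow> carrier R" and c: "c \<in> D \<rightarrow> carrier R"
  shows "augmented_complex.homotopy R form_module (kd y) (\<lambda>I. Pow D \<rightarrow>\<^sub>E I) kfil (\<Oplus>i\<in>D. y i \<otimes> c i) (kh c)"
proof -
  interpret F: augmented_complex R form_module "kd y" "\<lambda>I. Pow D \<rightarrow>\<^sub>E I" kfil
    "restrict unit (Pow D)" "\<lambda>f. f {}" "Idl (y ` D)"
    by (rule augmented_complex_forms[OF y])
  note simps = form_module_simps
  show ?thesis
    unfolding F.homotopy_def
  proof (intro conjI allI ballI impI)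
    show "F.linear_endo (kh c)"
      using c by (intro F.linear_endoI) (simp_all add: simps kh_closed kh_add kh_smult)
    show "kd y (kh c f) \<oplus>\<^bsub>form_module\<^esub> kh c (kd y f) = (\<Oplus>i\<in>D. y i \<otimes> c i) \<odot>\<^bsub>form_module\<^esub> f"
      if "f \<in> carrier form_module" for f
      using kd_kh[OF y c] that by (simp add: simps)
    show "kh c ` (Pow D \<rightarrow>\<^sub>E I) \<subseteq> Pow D \<rightarrow>\<^sub>E I" if "ideal I R" for I
    proof (rule image_subsetI)
      fix f assume "f \<in> Pow D \<rightarrow>\<^sub>E I"
      then have "f \<in> Pow D \<rightarrow> I" by auto
      then show "kh c f \<in> Pow D \<rightarrow>\<^sub>E I"
        using sub_ideal_closed(2)[OF that _ c] by (simp add: kh_def)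
    qed
    show "kh c ` kfil k \<subseteq> kfil (Suc k)" for k
      using kh_kfil[OF c] by auto
  qed
qed

end

lemma (in cring) exterior_algebra_lessThan: "exterior_algebra R {..<n}"
  by (intro exterior_algebra.intro exterior_algebra_axioms.intro is_cring) simp

section \<open>The Koszul complex as a DG-algebra\<close>

locale koszul_complex = exterior_algebra R "{..<length xs}"
  for R :: "('a, 'r) ring_scheme" (structure) and xs :: "'a list" +
  assumes xs_carrier: "set xs \<subseteq> carrier R"
begin

lemma nth_carrier: "(!) xs \<in> {..<length xs} \<rightarrow> carrier R"
  using xs_carrier by auto

lemma koszul_simps:
  "carrier (koszul R xs) = Pow {..<length xs} \<rightarrow>\<^sub>E carrier R"
  "\<zero>\<^bsub>koszul R xs\<^esub> = (\<lambda>S\<in>Pow {..<length xs}. \<zero>)"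
  "\<one>\<^bsub>koszul R xs\<^esub> = restrict unit (Pow {..<length xs})"
  "f \<oplus>\<^bsub>koszul R xs\<^esub> g = (\<lambda>S\<in>Pow {..<length xs}. f S \<oplus> g S)"
  "hcomp (koszul R xs) i =
     {f \<in> Pow {..<length xs} \<rightarrow>\<^sub>E carrier R. \<forall>S\<in>Pow {..<length xs}. card S \<noteq> i \<longrightarrow> f S = \<zero>}"
  by (simp_all add: koszul_def Let_def unit_def fun_eq_iff restrict_def)

lemma koszul_mult:
  assumes "f \<in> carrier (koszul R xs)" "g \<in> carrier (koszul R xs)"
  shows "f \<otimes>\<^bsub>koszul R xs\<^esub> g = restrict (mul f g) (Pow {..<length xs})"
proof -
  have "(\<Oplus>T\<in>Pow S. sgn_times R (card {(t, u) \<in> T \<times> (S - T). u < t}) (f T \<otimes> g (S - T))) = mul f g S"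
    if S: "S \<in> Pow {..<length xs}" for S
    unfolding mul_def
  proof (rule finsum_cong')
    fix T assume "T \<in> Pow S"
    then have "f T \<in> carrier R" "g (S - T) \<in> carrier R"
      using S by (auto intro!: PiE_mem[OF assms(1)[unfolded koszul_simps]] PiE_mem[OF assms(2)[unfolded koszul_simps]])
    then show "sgn_times R (card {(t, u) \<in> T \<times> (S - T). u < t}) (f T \<otimes> g (S - T))
        = sg (inversions T (S - T)) \<otimes> (f T \<otimes> g (S - T))"
      by (simp add: sgn_times_eq inversions_def)
  next
    show "(\<lambda>T. sg (inversions T (S - T)) \<otimes> (f T \<otimes> g (S - T))) \<in> Pow S \<rightarrow> carrier R"
      using S by (auto intro!: m_closed PiE_mem[OF assms(1)[unfolded koszul_simps]]
        PiE_mem[OF assms(2)[unfolded koszul_simps]])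
  qed simp
  then show ?thesis by (auto simp: koszul_def Let_def intro!: restrict_ext)
qed

lemma koszul_diff:
  assumes "f \<in> carrier (koszul R xs)"
  shows "diff (koszul R xs) f = kd ((!) xs) f"
proof -
  have "(\<Oplus>i\<in>{..<length xs} - S. sgn_times R (card {j \<in> S. j < i}) (xs ! i \<otimes> f (insert i S)))
      = del ((!) xs) f S" if S: "S \<in> Pow {..<length xs}" for S
  proof -
    have c: "xs ! i \<in> carrier R" "f (insert i S) \<in> carrier R" if "i < length xs" for i
      using assms S xs_carrier that by (auto simp: koszul_simps)
    have "(\<Oplus>i\<in>{..<length xs} - S. sgn_times R (card {j \<in> S. j < i}) (xs ! i \<otimes> f (insert i S)))
        = (\<Oplus>i\<in>{..<length xs} - S. xs ! i \<otimes> con i f S)"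
    proof (rule finsum_cong')
      fix i assume i: "i \<in> {..<length xs} - S"
      then show "sgn_times R (card {j \<in> S. j < i}) (xs ! i \<otimes> f (insert i S)) = xs ! i \<otimes> con i f S"
        using c[of i] by (simp add: con_def below_def sgn_times_eq m_lcomm)
    qed (use c in \<open>auto simp: con_def\<close>)
    \<comment> \<open>The sum may be extended to the indices in \<open>S\<close> because contraction
      vanishes there.\<close>
    also have "\<dots> = del ((!) xs) f S"
      unfolding del_def
    proof (rule add.finprod_mono_neutral_cong_left)
      show "(\<lambda>i. xs ! i \<otimes> con i f S) \<in> {..<length xs} \<rightarrow> carrier R" using c by (auto simp: con_def)
      show "xs ! i \<otimes> con i f S = \<zero>" if "i \<in> {..<length xs} - ({..<length xs} - S)" for i
        using that c[of i] by (auto simp: con_def)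
    qed auto
    finally show ?thesis .
  qed
  then show ?thesis by (auto simp: koszul_def Let_def kd_def intro!: restrict_ext)
qed

lemma koszul_abelian_group: "abelian_group (koszul R xs)"
  by (rule abelian_group_forms) (simp_all add: koszul_simps)

lemma koszul_ring: "ring (koszul R xs)"
proof (rule ringI[OF koszul_abelian_group])
  let ?K = "koszul R xs" and ?P = "Pow {..<length xs}"
  have closed: "f \<otimes>\<^bsub>?K\<^esub> g \<in> carrier ?K" if "f \<in> carrier ?K" "g \<in> carrier ?K" for f g
    using that unfolding koszul_mult[OF that] koszul_simps by (intro restrict_forms mul_forms PiE_forms)
  have one: "\<one>\<^bsub>?K\<^esub> \<in> carrier ?K" unfolding koszul_simps by (intro restrict_forms unit_forms)
  have forms: "f \<in> carrier ?K \<Longrightarrow> f \<in> forms" for f by (simp add: koszul_simps PiE_forms)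
  show "monoid ?K"
  proof (rule monoidI[OF closed one])
    fix f g h assume f: "f \<in> carrier ?K" and g: "g \<in> carrier ?K" and h: "h \<in> carrier ?K"
    note F = forms[OF f] forms[OF g] forms[OF h]
    show "f \<otimes>\<^bsub>?K\<^esub> g \<otimes>\<^bsub>?K\<^esub> h = f \<otimes>\<^bsub>?K\<^esub> (g \<otimes>\<^bsub>?K\<^esub> h)"
      unfolding koszul_mult[OF closed[OF f g] h] koszul_mult[OF f closed[OF g h]]
    proof (rule restrict_ext)
      fix S assume S: "S \<in> ?P"
      have "mul (f \<otimes>\<^bsub>?K\<^esub> g) h S = mul (mul f g) h S"
        using F S by (intro mul_cong mul_forms) (auto simp: koszul_mult[OF f g])
      also have "\<dots> = mul f (mul g h) S" using F S by (intro mul_assoc) auto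
      also have "\<dots> = mul f (g \<otimes>\<^bsub>?K\<^esub> h) S"
        using F S forms[OF closed[OF g h]] by (intro mul_cong) (auto simp: koszul_mult[OF g h])
      finally show "mul (f \<otimes>\<^bsub>?K\<^esub> g) h S = mul f (g \<otimes>\<^bsub>?K\<^esub> h) S" .
    qed
  next
    fix f assume f: "f \<in> carrier ?K"
    note F = forms[OF f]
    have fP: "f = restrict f ?P" using f by (simp add: koszul_simps PiE_restrict)
    have "\<one>\<^bsub>?K\<^esub> \<otimes>\<^bsub>?K\<^esub> f = restrict f ?P"
      unfolding koszul_mult[OF one f]
    proof (rule restrict_ext)
      fix S assume S: "S \<in> ?P"
      have "mul \<one>\<^bsub>?K\<^esub> f S = mul unit f S" using F S by (intro mul_cong) (auto simp: koszul_simps)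
      then show "mul \<one>\<^bsub>?K\<^esub> f S = f S" using mul_unit_left[OF F] S by simp
    qed
    then show "\<one>\<^bsub>?K\<^esub> \<otimes>\<^bsub>?K\<^esub> f = f" using fP by simp
    have "f \<otimes>\<^bsub>?K\<^esub> \<one>\<^bsub>?K\<^esub> = restrict f ?P"
      unfolding koszul_mult[OF f one]
    proof (rule restrict_ext)
      fix S assume S: "S \<in> ?P"
      have "mul f \<one>\<^bsub>?K\<^esub> S = mul f unit S" using F S by (intro mul_cong) (auto simp: koszul_simps)
      then show "mul f \<one>\<^bsub>?K\<^esub> S = f S" using mul_unit_right[OF F] S by simp
    qed
    then show "f \<otimes>\<^bsub>?K\<^esub> \<one>\<^bsub>?K\<^esub> = f" using fP by simp
  qed
  fix f g h assume f: "f \<in> carrier ?K" and g: "g \<in> carrier ?K" and h: "h \<in> carrier ?K"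
  note F = forms[OF f] forms[OF g] forms[OF h]
  have fg: "f \<oplus>\<^bsub>?K\<^esub> g \<in> carrier ?K" using f g by (auto simp: koszul_simps)
  show "(f \<oplus>\<^bsub>?K\<^esub> g) \<otimes>\<^bsub>?K\<^esub> h = f \<otimes>\<^bsub>?K\<^esub> h \<oplus>\<^bsub>?K\<^esub> g \<otimes>\<^bsub>?K\<^esub> h"
    unfolding koszul_mult[OF fg h] koszul_mult[OF f h] koszul_mult[OF g h]
    unfolding koszul_simps(4)
  proof (rule restrict_ext)
    fix S assume S: "S \<in> ?P"
    have "mul (\<lambda>S\<in>?P. f S \<oplus> g S) h S = mul (\<lambda>S. f S \<oplus> g S) h S"
      using F S by (intro mul_cong add_forms) auto
    then show "mul (\<lambda>S\<in>?P. f S \<oplus> g S) h S = restrict (mul f h) ?P S \<oplus> restrict (mul g h) ?P S"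
      using mul_add_left[OF F] S by simp
  qed
  show "h \<otimes>\<^bsub>?K\<^esub> (f \<oplus>\<^bsub>?K\<^esub> g) = h \<otimes>\<^bsub>?K\<^esub> f \<oplus>\<^bsub>?K\<^esub> h \<otimes>\<^bsub>?K\<^esub> g"
    unfolding koszul_mult[OF h fg] koszul_mult[OF h f] koszul_mult[OF h g]
    unfolding koszul_simps(4)
  proof (rule restrict_ext)
    fix S assume S: "S \<in> ?P"
    have "mul h (\<lambda>S\<in>?P. f S \<oplus> g S) S = mul h (\<lambda>S. f S \<oplus> g S) S"
      using F S by (intro mul_cong add_forms) auto
    then show "mul h (\<lambda>S\<in>?P. f S \<oplus> g S) S = restrict (mul h f) ?P S \<oplus> restrict (mul h g) ?P S"
      using mul_add_right[OF F(3,1,2)] S by simp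
  qed
qed

text \<open>\<open>alt f\<close> is the usual sign times \<open>f\<close> for homogeneous
  \<open>f\<close>; written in this way the Leibniz rule also covers inhomogeneous elements, as
  products in the whole ring of cycles demand.\<close>

lemma koszul_leibniz:
  assumes f: "f \<in> carrier (koszul R xs)" and g: "g \<in> carrier (koszul R xs)"
  shows "diff (koszul R xs) (f \<otimes>\<^bsub>koszul R xs\<^esub> g) =
    diff (koszul R xs) f \<otimes>\<^bsub>koszul R xs\<^esub> g \<oplus>\<^bsub>koszul R xs\<^esub>
    restrict (alt f) (Pow {..<length xs}) \<otimes>\<^bsub>koszul R xs\<^esub> diff (koszul R xs) g"
proof -
  let ?K = "koszul R xs" and ?P = "Pow {..<length xs}"
  interpret K: ring ?K by (rule koszul_ring)
  have F: "f \<in> forms" "g \<in> forms" using f g by (simp_all add: koszul_simps PiE_forms)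
  have d: "kd ((!) xs) f \<in> carrier ?K" "kd ((!) xs) g \<in> carrier ?K"
    using f g kd_closed[OF nth_carrier] by (auto simp: koszul_simps)
  have a: "restrict (alt f) ?P \<in> carrier ?K" unfolding koszul_simps by (intro restrict_forms alt_forms F)
  have m: "f \<otimes>\<^bsub>?K\<^esub> g \<in> carrier ?K" using f g by simp
  show ?thesis
    unfolding koszul_diff[OF f] koszul_diff[OF g] koszul_diff[OF m]
    unfolding koszul_mult[OF d(1) g] koszul_mult[OF a d(2)] koszul_mult[OF f g] koszul_simps(4)
    unfolding kd_def[of _ "restrict (mul f g) ?P"]
  proof (rule restrict_ext)
    fix S assume S: "S \<in> ?P"
    have "del ((!) xs) (restrict (mul f g) ?P) S = del ((!) xs) (mul f g) S"
      using F S nth_carrier by (intro del_cong) auto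
    also have "\<dots> = mul (del ((!) xs) f) g S \<oplus> mul (alt f) (del ((!) xs) g) S"
      using F S nth_carrier by (intro del_mul) auto
    also have "mul (del ((!) xs) f) g S = mul (kd ((!) xs) f) g S"
      using F S nth_carrier PiE_forms[OF kd_closed[OF nth_carrier]] f
      by (intro mul_cong) (auto simp: kd_def koszul_simps)
    also have "mul (alt f) (del ((!) xs) g) S = mul (restrict (alt f) ?P) (kd ((!) xs) g) S"
      using F S nth_carrier PiE_forms[OF kd_closed[OF nth_carrier]] g restrict_forms'[OF alt_forms[OF F(1)]]
      by (intro mul_cong) (auto simp: kd_def koszul_simps)
    finally show "del ((!) xs) (restrict (mul f g) ?P) S
      = restrict (mul (kd ((!) xs) f) g) ?P S \<oplus> restrict (mul (restrict (alt f) ?P) (kd ((!) xs) g)) ?P S"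
      using S by (simp del: restrict_apply add: restrict_apply'[of S])
  qed
qed

end

section \<open>Ideals and chains of primes\<close>

text \<open>The exchange argument: elements of \<open>A\<close> outside \<open>W\<close> are
  replaced one at a time by elements of \<open>W\<close>, which lowers \<open>card (A - W)\<close>.
  It is phrased for a closure operator because it will be applied to spans modulo the square of a
  maximal ideal, without forming the quotient vector space.\<close>

lemma steinitz:
  fixes cl :: "'a set \<Rightarrow> 'a set"
  assumes mono: "\<And>S T. S \<subseteq> T \<Longrightarrow> cl S \<subseteq> cl T"
    and ext: "\<And>S. S \<subseteq> V \<Longrightarrow> S \<subseteq> cl S"
    and idem: "\<And>S T. S \<subseteq> V \<Longrightarrow> T \<subseteq> V \<Longrightarrow> S \<subseteq> cl T \<Longrightarrow> cl S \<subseteq> cl T"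
    and exch: "\<And>S x w. S \<subseteq> V \<Longrightarrow> x \<in> V \<Longrightarrow> w \<in> V \<Longrightarrow> x \<in> cl (insert w S) \<Longrightarrow> x \<notin> cl S \<Longrightarrow> w \<in> cl (insert x S)"
    and "finite A" "finite W" "A \<subseteq> V" "W \<subseteq> V"
    and "\<And>x. x \<in> A \<Longrightarrow> x \<notin> cl (A - {x})" and "A \<subseteq> cl W"
  shows "card A \<le> card W"
  using assms(5-)
proof (induction "card (A - W)" arbitrary: A)
  case 0
  then have "A \<subseteq> W" by (metis Diff_eq_empty_iff card_0_eq finite_Diff)
  then show ?case using 0 card_mono by blast
next
  case (Suc k)
  have "A - W \<noteq> {}" using Suc.hyps(2) by (metis card.empty nat.simps(3))
  then obtain x where x: "x \<in> A" "x \<notin> W" by blast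
  let ?B = "A - {x}"
  \<comment> \<open>If all of \<open>W\<close> lay in the closure of the rest of \<open>A\<close>,
    so would \<open>x\<close>, against independence.\<close>
  have "\<exists>w\<in>W. w \<notin> cl ?B"
  proof (rule ccontr)
    assume "\<not> ?thesis"
    then have "cl W \<subseteq> cl ?B" using Suc.prems by (intro idem) auto
    then show False using x Suc.prems by blast
  qed
  then obtain w where w: "w \<in> W" "w \<notin> cl ?B" by blast
  have wB: "w \<notin> ?B" using w ext[of ?B] Suc.prems by blast
  have "card (insert w ?B) \<le> card W"
  proof (rule Suc.hyps(1))
    have "insert w ?B - W = (A - W) - {x}" using w by auto
    then show "k = card (insert w ?B - W)" using Suc.hyps(2) x Suc.prems(1) by simp
    show "y \<notin> cl (insert w ?B - {y})" if y: "y \<in> insert w ?B" for y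
    proof (cases "y = w")
      case True
      then show ?thesis using w wB by (metis Diff_insert_absorb)
    next
      case False
      then have yB: "y \<in> ?B" using y by auto
      have eq: "insert w ?B - {y} = insert w (?B - {y})" using False by auto
      show ?thesis
      proof
        assume "y \<in> cl (insert w ?B - {y})"
        then have "y \<in> cl (insert w (?B - {y}))" unfolding eq .
        moreover have "y \<notin> cl (?B - {y})"
          using Suc.prems(5)[of y] yB mono[of "?B - {y}" "A - {y}"] by blast
        ultimately have "w \<in> cl (insert y (?B - {y}))"
          by (rule exch[rotated 3]) (use yB Suc.prems w in auto)
        then show False using w(2) yB by (simp add: insert_absorb)
      qed
    qed
    show "insert w ?B \<subseteq> cl W" using Suc.prems w ext[of W] by auto
  qed (use Suc.prems w in auto)
  moreover have "card (insert w ?B) = card A"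
    using Suc.prems(1) x wB by (metis card_Suc_Diff1 card_insert_disjoint finite_Diff)
  ultimately show ?case by simp
qed

section \<open>Ideal arithmetic and saturation at a prime\<close>

context cring
begin

lemma ideal_subset: "ideal I R \<Longrightarrow> I \<subseteq> carrier R"
  by (rule subsetI) (rule ideal.Icarr)

lemma Idl_ideal:
  assumes "ideal I R"
  shows "Idl I = I"
  using genideal_self[OF ideal_subset[OF assms]] genideal_minimal[OF assms subset_refl] by (rule subset_antisym[rotated])

lemma Idl_insert_ideal:
  assumes "ideal I R" "c \<in> carrier R" "x \<in> Idl (insert c I)"
  shows "\<exists>u\<in>I. \<exists>r\<in>carrier R. x = u \<oplus> c \<otimes> r"
  using Idl_insert[OF assms(2) ideal_subset[OF assms(1)] assms(3)] unfolding Idl_ideal[OF assms(1)] .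

lemma ideal_add: "ideal I R \<Longrightarrow> a \<in> I \<Longrightarrow> b \<in> I \<Longrightarrow> a \<oplus> b \<in> I"
  by (rule additive_subgroup.a_closed[OF ideal.axioms(1)])

lemma ideal_diff: "ideal I R \<Longrightarrow> a \<in> I \<Longrightarrow> b \<in> I \<Longrightarrow> a \<ominus> b \<in> I"
  unfolding minus_eq by (simp add: ideal_add additive_subgroup.a_inv_closed[OF ideal.axioms(1)])

lemma ideal_add_cancel:
  assumes "ideal I R" "a \<in> I" "b \<in> carrier R" "a \<oplus> b \<in> I"
  shows "b \<in> I"
proof -
  have a: "a \<in> carrier R" using assms ideal.Icarr by metis
  have "(a \<oplus> b) \<ominus> a \<in> I" using assms by (intro ideal_diff)
  moreover have "(a \<oplus> b) \<ominus> a = b" using a assms(3) by algebra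
  ultimately show ?thesis by simp
qed

lemma genideal_mono: "T \<subseteq> carrier R \<Longrightarrow> S \<subseteq> T \<Longrightarrow> Idl S \<subseteq> Idl T"
  using subset_Idl_subset by blast

lemma genideal_union_cong:
  assumes "S \<subseteq> carrier R" "S' \<subseteq> carrier R" "Idl S = Idl S'" "T \<subseteq> carrier R"
  shows "Idl (S \<union> T) = Idl (S' \<union> T)"
proof -
  have "Idl (S1 \<union> T) \<subseteq> Idl (S2 \<union> T)"
    if "S1 \<subseteq> carrier R" "S2 \<subseteq> carrier R" "Idl S1 = Idl S2" for S1 S2
  proof (rule genideal_minimal)
    show "ideal (Idl (S2 \<union> T)) R" using that assms by (intro genideal_ideal) auto
    have "S1 \<subseteq> Idl S1" "T \<subseteq> Idl (S2 \<union> T)" "Idl S2 \<subseteq> Idl (S2 \<union> T)"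
      using that assms genideal_self[of S1] genideal_self[of "S2 \<union> T"] genideal_mono[of "S2 \<union> T" S2] by auto
    then show "S1 \<union> T \<subseteq> Idl (S2 \<union> T)" using that by auto
  qed
  then show ?thesis using assms by blast
qed

lemma colon_ideal:
  assumes A: "ideal A R" and b: "b \<in> carrier R"
  shows "ideal {r \<in> carrier R. r \<otimes> b \<in> A} R"
proof (rule idealI[OF ring_axioms])
  show "subgroup {r \<in> carrier R. r \<otimes> b \<in> A} (add_monoid R)"
    using A b additive_subgroup.zero_closed[OF ideal.axioms(1)[OF A]]
      additive_subgroup.a_inv_closed[OF ideal.axioms(1)[OF A]]
    by (intro add.subgroupI) (auto simp: l_distr l_minus ideal_add)
  fix a x assume a: "a \<in> {r \<in> carrier R. r \<otimes> b \<in> A}" and x: "x \<in> carrier R"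
  then have "x \<otimes> (a \<otimes> b) \<in> A" using ideal.I_l_closed[OF A] by simp
  then show "x \<otimes> a \<in> {r \<in> carrier R. r \<otimes> b \<in> A}" using a x b by (simp add: m_assoc)
  then show "a \<otimes> x \<in> {r \<in> carrier R. r \<otimes> b \<in> A}" using a x by (simp add: m_comm)
qed

lemma maximalideal_inverse:
  assumes N: "maximalideal N R" and r: "r \<in> carrier R" "r \<notin> N"
  shows "\<exists>r'\<in>carrier R. \<exists>t\<in>N. r' \<otimes> r \<oplus> t = \<one>"
proof -
  note Ni = maximalideal.axioms(1)[OF N]
  have rN: "insert r N \<subseteq> carrier R" using r ideal_subset[OF Ni] by auto
  note I = genideal_ideal[OF rN]
  have "Idl (insert r N) = carrier R"
    using maximalideal.I_maximal[OF N I] genideal_self[OF rN] ideal_subset[OF I] r by blast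
  then have "\<one> \<in> Idl (insert r N)" by simp
  then obtain t r' where "t \<in> N" "r' \<in> carrier R" "\<one> = t \<oplus> r \<otimes> r'"
    using Idl_insert_ideal[OF Ni r(1)] by blast
  then show ?thesis using r ideal.Icarr[OF Ni] by (metis a_comm m_closed m_comm)
qed

text \<open>Ideals saturated with respect to the complement of the prime ideal \<open>Q\<close> stand for the ideals
  of the localisation at \<open>Q\<close>, which is not available as a ring.\<close>

definition saturated :: "'a set \<Rightarrow> 'a set \<Rightarrow> bool" where
  "saturated Q A \<longleftrightarrow> ideal A R \<and> (\<forall>s\<in>carrier R - Q. \<forall>b\<in>carrier R. s \<otimes> b \<in> A \<longrightarrow> b \<in> A)"

definition sat :: "'a set \<Rightarrow> 'a set \<Rightarrow> 'a set" where
  "sat Q A = {b \<in> carrier R. \<exists>s\<in>carrier R - Q. s \<otimes> b \<in> A}"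

lemma saturatedD: "saturated Q A \<Longrightarrow> s \<in> carrier R \<Longrightarrow> s \<notin> Q \<Longrightarrow> b \<in> carrier R \<Longrightarrow> s \<otimes> b \<in> A \<Longrightarrow> b \<in> A"
  unfolding saturated_def by blast

lemma saturated_ideal: "saturated Q A \<Longrightarrow> ideal A R"
  unfolding saturated_def by blast

lemma saturated_mono: "saturated P A \<Longrightarrow> P \<subseteq> Q \<Longrightarrow> saturated Q A"
  unfolding saturated_def by blast

lemma saturated_carrier: "saturated Q (carrier R)"
  unfolding saturated_def using oneideal by blast

lemma prime_saturated:
  assumes "primeideal P R" "P \<subseteq> Q"
  shows "saturated Q P"
  unfolding saturated_def
proof (intro conjI ballI impI)
  show "ideal P R" by (rule primeideal.axioms(1)[OF assms(1)])
  fix s b assume "s \<in> carrier R - Q" "b \<in> carrier R" "s \<otimes> b \<in> P"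
  then show "b \<in> P" using primeideal.I_prime[OF assms(1), of s b] assms(2) by auto
qed

context
  fixes Q assumes Q: "primeideal Q R"
begin

lemma prime_complement_mult:
  assumes "s \<in> carrier R - Q" "t \<in> carrier R - Q"
  shows "s \<otimes> t \<in> carrier R - Q"
  using primeideal.I_prime[OF Q, of s t] assms by auto

lemma one_notin_prime: "\<one> \<notin> Q"
proof
  assume "\<one> \<in> Q"
  then have "Q = carrier R" by (rule ideal.one_imp_carrier[OF primeideal.axioms(1)[OF Q]])
  then show False using primeideal.I_notcarr[OF Q] by simp
qed

lemma sat_superset: "A \<subseteq> carrier R \<Longrightarrow> A \<subseteq> sat Q A"
  using one_notin_prime by (auto simp: sat_def intro!: bexI[of _ \<one>])

lemma sat_ideal:
  assumes A: "ideal A R"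
  shows "ideal (sat Q A) R"
proof (rule idealI[OF ring_axioms])
  interpret A: ideal A R by fact
  show "subgroup (sat Q A) (add_monoid R)"
  proof (rule add.subgroupI)
    show "sat Q A \<subseteq> carrier R" by (auto simp: sat_def)
    show "sat Q A \<noteq> {}" using sat_superset[of A] A.zero_closed A.Icarr by blast
    show "\<ominus> b \<in> sat Q A" if "b \<in> sat Q A" for b
      using that by (auto simp: sat_def r_minus)
    show "b \<oplus> c \<in> sat Q A" if bc: "b \<in> sat Q A" "c \<in> sat Q A" for b c
    proof -
      obtain s t where st: "s \<in> carrier R - Q" "s \<otimes> b \<in> A" "t \<in> carrier R - Q" "t \<otimes> c \<in> A"
        and c: "b \<in> carrier R" "c \<in> carrier R" using bc by (auto simp: sat_def)
      have "(s \<otimes> t) \<otimes> (b \<oplus> c) = t \<otimes> (s \<otimes> b) \<oplus> s \<otimes> (t \<otimes> c)" using st c by (simp add: r_distr m_ac)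
      also have "\<dots> \<in> A" using st A.I_l_closed by auto
      finally show ?thesis using c prime_complement_mult[OF st(1,3)] by (auto simp: sat_def)
    qed
  qed
  fix b r assume b: "b \<in> sat Q A" and r: "r \<in> carrier R"
  then obtain s where s: "s \<in> carrier R - Q" "s \<otimes> b \<in> A" "b \<in> carrier R" by (auto simp: sat_def)
  have "s \<otimes> (r \<otimes> b) = r \<otimes> (s \<otimes> b)" using s r by (simp add: m_lcomm)
  then have "s \<otimes> (r \<otimes> b) \<in> A" using s r A.I_l_closed by auto
  then show "r \<otimes> b \<in> sat Q A" using s r by (auto simp: sat_def)
  then show "b \<otimes> r \<in> sat Q A" using s r by (simp add: m_comm)
qed

lemma sat_saturated:
  assumes A: "ideal A R"
  shows "saturated Q (sat Q A)"
  unfolding saturated_def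
proof (intro conjI ballI impI sat_ideal A)
  fix s b assume s: "s \<in> carrier R - Q" and b: "b \<in> carrier R" and "s \<otimes> b \<in> sat Q A"
  then obtain t where t: "t \<in> carrier R - Q" "t \<otimes> (s \<otimes> b) \<in> A" by (auto simp: sat_def)
  then have "(t \<otimes> s) \<otimes> b \<in> A" using s b by (auto simp: m_assoc)
  then show "b \<in> sat Q A" using b prime_complement_mult[OF t(1) s] unfolding sat_def by blast
qed

lemma sat_minimal: "saturated Q B \<Longrightarrow> A \<subseteq> B \<Longrightarrow> sat Q A \<subseteq> B"
  unfolding sat_def using saturatedD[of Q B] by blast

lemma sat_insertE:
  assumes A: "ideal A R" and c: "c \<in> carrier R" and b: "b \<in> sat Q (Idl (insert c A))"
  obtains s u r where "s \<in> carrier R - Q" "u \<in> A" "r \<in> carrier R" "s \<otimes> b = u \<oplus> c \<otimes> r"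
proof -
  obtain s where s: "s \<in> carrier R - Q" "s \<otimes> b \<in> Idl (insert c A)" using b by (auto simp: sat_def)
  then show ?thesis using Idl_insert_ideal[OF A c s(2)] that by blast
qed

lemma sat_insert:
  assumes A: "ideal A R" and c: "c \<in> carrier R"
  shows "saturated Q (sat Q (Idl (insert c A)))" "A \<subseteq> sat Q (Idl (insert c A))" "c \<in> sat Q (Idl (insert c A))"
proof -
  have Ac: "insert c A \<subseteq> carrier R" using A c ideal.Icarr by fast
  note I = genideal_ideal[OF Ac]
  show "saturated Q (sat Q (Idl (insert c A)))" by (rule sat_saturated[OF I])
  have "insert c A \<subseteq> sat Q (Idl (insert c A))"
    using genideal_self[OF Ac] sat_superset[of "Idl (insert c A)"] ideal.Icarr[OF I] by blast
  then show "A \<subseteq> sat Q (Idl (insert c A))" "c \<in> sat Q (Idl (insert c A))" by auto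
qed

lemma sat_insert_minimal:
  assumes "saturated Q B" "A \<subseteq> B" "c \<in> B"
  shows "sat Q (Idl (insert c A)) \<subseteq> B"
  using assms by (intro sat_minimal[OF assms(1)] genideal_minimal[OF saturated_ideal[OF assms(1)]]) simp

end

end

context noetherian_ring
begin

lemma noetherian_maximal:
  assumes "F \<noteq> {}" "\<And>I. I \<in> F \<Longrightarrow> ideal I R"
  obtains L where "L \<in> F" "\<And>L'. L' \<in> F \<Longrightarrow> L \<subseteq> L' \<Longrightarrow> L' = L"
proof -
  have "\<exists>L\<in>F. \<forall>L'\<in>F. L \<subseteq> L' \<longrightarrow> L' = L"
  proof (rule subset_Zorn_nonempty[OF assms(1)])
    fix C assume C: "C \<noteq> {}" "subset.chain F C"
    then have "subset.chain {I. ideal I R} C" using assms(2) by (auto simp: pred_on.chain_def)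
    then have "\<Union>C \<in> C" by (rule ideal_chain_is_trivial[OF C(1)])
    then show "\<Union>C \<in> F" using C(2) by (auto simp: pred_on.chain_def)
  qed
  then show ?thesis using that by blast
qed

end

section \<open>Krull's principal ideal theorem\<close>

locale noetherian_cring = noetherian_ring + cring
begin

text \<open>Nakayama's lemma in the localisation at \<open>Q\<close>. The hypothesis
  \<open>gen\<close> says that locally \<open>J\<close> is generated by \<open>C\<close> and the
  products of \<open>Y\<close> and \<open>J\<close>. A saturated \<open>L\<close> that is maximal
  strictly between, \<open>C\<close> allowed, contains all these products: otherwise adjoining
  \<open>x b\<close> to \<open>L\<close> gives all of \<open>J\<close>, and \<open>b\<close> itself
  can be solved for.\<close>

lemma nakayama_saturated:
  assumes Q: "primeideal Q R" and Y: "Y \<subseteq> Q" and J: "saturated Q J" and C: "saturated Q C" "C \<subseteq> J"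
    and gen: "\<And>L. saturated Q L \<Longrightarrow> C \<subseteq> L \<Longrightarrow> (\<And>x b. x \<in> Y \<Longrightarrow> b \<in> J \<Longrightarrow> x \<otimes> b \<in> L) \<Longrightarrow> J \<subseteq> L"
  shows "J = C"
proof (rule ccontr)
  assume "J \<noteq> C"
  define F where "F = {L. saturated Q L \<and> C \<subseteq> L \<and> L \<subset> J}"
  have "C \<in> F" using C \<open>J \<noteq> C\<close> by (auto simp: F_def)
  then have "F \<noteq> {}" by blast
  then obtain L where L: "L \<in> F" and max: "\<And>L'. L' \<in> F \<Longrightarrow> L \<subseteq> L' \<Longrightarrow> L' = L"
    by (rule noetherian_maximal) (auto simp: F_def intro: saturated_ideal)
  then have LF: "saturated Q L" "C \<subseteq> L" "L \<subset> J" by (auto simp: F_def)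
  note Li = saturated_ideal[OF LF(1)] and Ji = saturated_ideal[OF J]
  interpret Q: primeideal Q R by fact
  have "J \<subseteq> L"
  proof (rule gen[OF LF(1,2)])
    fix x b assume x: "x \<in> Y" and b: "b \<in> J"
    have c: "x \<in> carrier R" "b \<in> carrier R" using x b Y ideal.Icarr[OF Ji] Q.Icarr by auto
    have xb: "x \<otimes> b \<in> J" using b c ideal.I_l_closed[OF Ji] by auto
    show "x \<otimes> b \<in> L"
    proof (rule ccontr)
      assume n: "x \<otimes> b \<notin> L"
      let ?L = "sat Q (Idl (insert (x \<otimes> b) L))"
      have xbc: "x \<otimes> b \<in> carrier R" using c by simp
      note s = sat_insert[OF Q Li xbc]
      have "?L \<subseteq> J" using LF xb by (intro sat_insert_minimal[OF Q J]) auto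
      moreover have "?L \<notin> F" using max[of ?L] s n by blast
      ultimately have "?L = J" using s LF by (auto simp: F_def)
      then have "b \<in> ?L" using b by simp
      then obtain s u r where sur: "s \<in> carrier R - Q" "u \<in> L" "r \<in> carrier R" "s \<otimes> b = u \<oplus> (x \<otimes> b) \<otimes> r"
        using sat_insertE[OF Q Li xbc] by metis
      have u: "u \<in> carrier R" using sur ideal.Icarr[OF Li] by auto
      have s: "s \<in> carrier R" using sur by simp
      \<comment> \<open>\<open>x\<close> lies in \<open>Q\<close> and \<open>s\<close> does not, so
        \<open>s - x r\<close> is outside \<open>Q\<close>, that is, a unit of the
        localisation.\<close>
      have "(s \<ominus> x \<otimes> r) \<otimes> b = s \<otimes> b \<ominus> (x \<otimes> b) \<otimes> r" using s sur(3) c by algebra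
      also have "\<dots> = u" unfolding sur(4) using u c sur(3) by algebra
      finally have "(s \<ominus> x \<otimes> r) \<otimes> b \<in> L" using sur by simp
      moreover have "s \<ominus> x \<otimes> r \<notin> Q"
      proof
        assume "s \<ominus> x \<otimes> r \<in> Q"
        moreover have "x \<otimes> r \<in> Q" using x Y sur Q.I_r_closed by auto
        ultimately have "(s \<ominus> x \<otimes> r) \<oplus> x \<otimes> r \<in> Q" by simp
        moreover have "(s \<ominus> x \<otimes> r) \<oplus> x \<otimes> r = s" using s sur(3) c by algebra
        ultimately show False using sur by simp
      qed
      ultimately have "b \<in> L" using s sur(3) c by (intro saturatedD[OF LF(1) _ _ c(2), of "s \<ominus> x \<otimes> r"]) simp_all
      then show False using n c ideal.I_l_closed[OF Li] by auto
    qed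
  qed
  then show False using LF by auto
qed

text \<open>The localisation of R/A at \<open>Q\<close> is Artinian.\<close>

definition sat_dcc :: "'a set \<Rightarrow> 'a set \<Rightarrow> bool" where
  "sat_dcc Q A \<longleftrightarrow> (\<forall>f :: nat \<Rightarrow> 'a set. (\<forall>n. saturated Q (f n) \<and> A \<subseteq> f n \<and> f (Suc n) \<subseteq> f n) \<longrightarrow>
     (\<exists>N. \<forall>n\<ge>N. f n = f N))"

lemma decseq_subset: "(\<And>n. f (Suc n) \<subseteq> f n) \<Longrightarrow> m \<le> n \<Longrightarrow> f n \<subseteq> (f m :: 'a set)"
  by (rule lift_Suc_antimono_le)

text \<open>Locally at \<open>Q\<close>, the ideal generated by \<open>A\<close> and
  \<open>b\<close> is an extension of \<open>A\<close> by a copy of the residue field, since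
  \<open>Q\<close> kills \<open>b\<close> modulo \<open>A\<close>. Such an extension does not affect
  the descending chain condition.\<close>

lemma sat_dcc_step:
  assumes Q: "primeideal Q R" and A: "saturated Q A" and b: "b \<in> carrier R" "b \<notin> A"
    and Qb: "\<And>q. q \<in> Q \<Longrightarrow> q \<otimes> b \<in> A"
    and dcc: "sat_dcc Q (sat Q (Idl (insert b A)))"
  shows "sat_dcc Q A"
  unfolding sat_dcc_def
proof (intro allI impI)
  fix f :: "nat \<Rightarrow> 'a set"
  assume "\<forall>n. saturated Q (f n) \<and> A \<subseteq> f n \<and> f (Suc n) \<subseteq> f n"
  then have f: "\<And>n. saturated Q (f n)" "\<And>n. A \<subseteq> f n" "\<And>n. f (Suc n) \<subseteq> f n" by auto
  interpret Q: primeideal Q R by fact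
  note Ai = saturated_ideal[OF A] and fi = saturated_ideal[OF f(1)]
  let ?B = "sat Q (Idl (insert b A))"
  note B = sat_insert[OF Q Ai b(1)]
  note Bi = saturated_ideal[OF B(1)]
  define g where "g n = sat Q (Idl (insert b (f n)))" for n
  note g = sat_insert[OF Q fi b(1), folded g_def]
  \<comment> \<open>Locally \<open>?B\<close> is simple modulo \<open>A\<close>: a multiple of
    \<open>b\<close> that is not in \<open>A\<close> has its cofactor outside \<open>Q\<close>, so
    it gives back \<open>b\<close>.\<close>
  have simple: "f n \<inter> ?B = A \<or> ?B \<subseteq> f n" for n
  proof (rule disjCI)
    assume nB: "\<not> ?B \<subseteq> f n"
    have "c \<in> A" if c: "c \<in> f n" "c \<in> ?B" for c
    proof (rule ccontr)
      assume cA: "c \<notin> A"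
      have cc: "c \<in> carrier R" using c ideal.Icarr[OF fi] by auto
      obtain s u r where sur: "s \<in> carrier R - Q" "u \<in> A" "r \<in> carrier R" "s \<otimes> c = u \<oplus> b \<otimes> r"
        using sat_insertE[OF Q Ai b(1) c(2)] by metis
      have "r \<notin> Q"
      proof
        assume "r \<in> Q"
        then have "b \<otimes> r \<in> A" using Qb[of r] b sur by (simp add: m_comm)
        then have "s \<otimes> c \<in> A" using sur Ai ideal_add by simp
        then show False using sur cc cA saturatedD[OF A] by auto
      qed
      have "s \<otimes> c \<in> f n" by (rule ideal.I_l_closed[OF fi c(1)]) (use sur in auto)
      then have "b \<otimes> r \<in> f n" using sur b f(2)[of n] fi[of n] ideal_add_cancel[of "f n" u "b \<otimes> r"] by auto
      then have "r \<otimes> b \<in> f n" using b sur by (simp add: m_comm)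
      then have "b \<in> f n" using \<open>r \<notin> Q\<close> sur b saturatedD[OF f(1)] by auto
      then show False using nB sat_insert_minimal[OF Q f(1) f(2)] by auto
    qed
    then show "f n \<inter> ?B = A" using f(2) B(2) by auto
  qed
  have "g (Suc n) \<subseteq> g n" for n
    using g(2)[of n] g(3)[of n] f(3)[of n] unfolding g_def[of "Suc n"]
    by (intro sat_insert_minimal[OF Q g(1)]) auto
  moreover have "?B \<subseteq> g n" for n
    using g(2)[of n] f(2)[of n] g(3)[of n] by (intro sat_insert_minimal[OF Q g(1)]) auto
  ultimately obtain N where N: "\<And>n. n \<ge> N \<Longrightarrow> g n = g N"
    using dcc g(1) unfolding sat_dcc_def by metis
  have "\<exists>N'. \<forall>n\<ge>N'. f n \<inter> ?B = f N' \<inter> ?B"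
  proof (cases "\<exists>m. f m \<inter> ?B = A")
    case True
    then obtain m where m: "f m \<inter> ?B = A" ..
    have "f n \<inter> ?B = A" if "n \<ge> m" for n
      using decseq_subset[of f, OF f(3) that] m f(2)[of n] B(2) by auto
    then show ?thesis by (intro exI[of _ m]) auto
  next
    case False
    then have "f n \<inter> ?B = ?B" for n using simple[of n] by auto
    then show ?thesis by auto
  qed
  then obtain N' where N': "\<And>n. n \<ge> N' \<Longrightarrow> f n \<inter> ?B = f N' \<inter> ?B" by blast
  define m where "m = max N N'"
  \<comment> \<open>The modular law: the two ideals are nested, have the same sum with
    \<open>b\<close> and the same intersection with \<open>?B\<close>.\<close>
  have "f n = f m" if n: "n \<ge> m" for n
  proof
    show "f n \<subseteq> f m" by (rule decseq_subset[of f, OF f(3) n])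
    show "f m \<subseteq> f n"
    proof
      fix c assume c: "c \<in> f m"
      then have cc: "c \<in> carrier R" using ideal.Icarr[OF fi] by auto
      have "g m = g n" using N[of m] N[of n] n by (auto simp: m_def)
      then have "c \<in> g n" using c g(2)[of m] by auto
      then obtain s u r where sur: "s \<in> carrier R - Q" "u \<in> f n" "r \<in> carrier R" "s \<otimes> c = u \<oplus> b \<otimes> r"
        using sat_insertE[OF Q fi b(1)] unfolding g_def by metis
      have "u \<in> f m" using sur decseq_subset[of f, OF f(3) n] by auto
      moreover have "s \<otimes> c \<in> f m" by (rule ideal.I_l_closed[OF fi c]) (use sur in auto)
      ultimately have "b \<otimes> r \<in> f m" using sur b fi[of m] ideal_add_cancel[of "f m" u "b \<otimes> r"] by auto
      moreover have "b \<otimes> r \<in> ?B" using B(3) sur ideal.I_r_closed[OF Bi] by auto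
      ultimately have "b \<otimes> r \<in> f m \<inter> ?B" by simp
      also have "f m \<inter> ?B = f n \<inter> ?B" using N'[of m] N'[of n] n by (auto simp: m_def)
      finally have "s \<otimes> c \<in> f n" using sur fi[of n] ideal_add by auto
      then show "c \<in> f n" using sur cc saturatedD[OF f(1)] by auto
    qed
  qed
  then show "\<exists>N. \<forall>n\<ge>N. f n = f N" by blast
qed

text \<open>Noetherian induction: at a maximal counterexample \<open>B\<close> an associated prime
  lies between \<open>Z\<close> and \<open>Q\<close>, so it is \<open>Q\<close>. Adjoining the
  corresponding element leaves the counterexamples, and \<open>sat_dcc_step\<close> comes back to
  \<open>B\<close>.\<close>

lemma sat_dcc_minimal_prime:
  assumes Q: "primeideal Q R"
    and min: "\<And>Q'. primeideal Q' R \<Longrightarrow> Z \<subseteq> Q' \<Longrightarrow> Q' \<subseteq> Q \<Longrightarrow> Q' = Q"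
    and A: "saturated Q A" "Z \<subseteq> A"
  shows "sat_dcc Q A"
proof (rule ccontr)
  assume n: "\<not> sat_dcc Q A"
  interpret Q: primeideal Q R by fact
  define F where "F = {A. saturated Q A \<and> Z \<subseteq> A \<and> \<not> sat_dcc Q A}"
  have "F \<noteq> {}" using A n by (auto simp: F_def)
  then obtain B where B: "B \<in> F" and max: "\<And>B'. B' \<in> F \<Longrightarrow> B \<subseteq> B' \<Longrightarrow> B' = B"
    by (rule noetherian_maximal) (auto simp: F_def intro: saturated_ideal)
  then have BF: "saturated Q B" "Z \<subseteq> B" "\<not> sat_dcc Q B" by (auto simp: F_def)
  note Bi = saturated_ideal[OF BF(1)]
  have Bc: "B \<subseteq> carrier R" using ideal.Icarr[OF Bi] by blast
  have "B \<noteq> carrier R"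
  proof
    assume "B = carrier R"
    then have "f n = carrier R" if "\<forall>n. saturated Q (f n) \<and> B \<subseteq> f n \<and> f (Suc n) \<subseteq> f n" for f and n :: nat
      using that ideal.Icarr[OF saturated_ideal] by blast
    then show False using BF(3) unfolding sat_dcc_def by metis
  qed
  \<comment> \<open>The annihilator of \<open>b\<close> modulo \<open>B\<close>. A maximal one among
    those of elements outside \<open>B\<close> is prime, and it is contained in \<open>Q\<close>
    because \<open>B\<close> is saturated.\<close>
  define col where "col b = {r \<in> carrier R. r \<otimes> b \<in> B}" for b
  have col_ideal: "ideal (col b) R" if b: "b \<in> carrier R" for b
    unfolding col_def by (rule colon_ideal[OF Bi b])
  let ?G = "col ` (carrier R - B)"
  have "?G \<noteq> {}" using \<open>B \<noteq> carrier R\<close> Bc by auto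
  then obtain C where "C \<in> ?G" and Cmax: "\<And>C'. C' \<in> ?G \<Longrightarrow> C \<subseteq> C' \<Longrightarrow> C' = C"
    by (rule noetherian_maximal) (auto intro: col_ideal)
  then obtain b where b: "b \<in> carrier R" "b \<notin> B" and "C = col b" by blast
  with Cmax have bmax: "b' \<in> carrier R \<Longrightarrow> b' \<notin> B \<Longrightarrow> col b \<subseteq> col b' \<Longrightarrow> col b' = col b" for b' by blast
  have "col b = Q"
  proof (rule min)
    show "primeideal (col b) R"
    proof (rule primeidealI[OF col_ideal[OF b(1)] is_cring])
      have "\<one> \<notin> col b" using b by (simp add: col_def)
      then show "carrier R \<noteq> col b" using one_closed by blast
      fix r s assume rs: "r \<in> carrier R" "s \<in> carrier R" "r \<otimes> s \<in> col b"
      show "r \<in> col b \<or> s \<in> col b"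
      proof (cases "s \<in> col b")
        case False
        then have "s \<otimes> b \<notin> B" using rs by (auto simp: col_def)
        moreover have "col b \<subseteq> col (s \<otimes> b)"
          using rs b ideal.I_l_closed[OF Bi] by (auto simp: col_def m_lcomm[of _ s])
        ultimately have "col (s \<otimes> b) = col b" using rs b by (intro bmax) auto
        then show ?thesis using rs b by (auto simp: col_def m_assoc)
      qed simp
    qed
    show "Z \<subseteq> col b" using BF(2) Bc b ideal.I_r_closed[OF Bi] by (auto simp: col_def)
    show "col b \<subseteq> Q" using b saturatedD[OF BF(1)] by (auto simp: col_def)
  qed
  then have "q \<otimes> b \<in> B" if "q \<in> Q" for q using that by (auto simp: col_def)
  moreover have "sat_dcc Q (sat Q (Idl (insert b B)))"
  proof (rule ccontr)
    assume n: "\<not> ?thesis"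
    note s = sat_insert[OF Q Bi b(1)]
    have "sat Q (Idl (insert b B)) \<in> F" using BF(2) n s by (auto simp: F_def)
    then show False using max s b by auto
  qed
  ultimately show False using sat_dcc_step[OF Q BF(1) b] BF(3) by blast
qed

text \<open>Krull's principal ideal theorem: otherwise \<open>Q\<close> is minimal over \<open>P + (x)\<close>, the ideals
  \<open>J n + (x)\<close>, for \<open>J n\<close> the symbolic powers of \<open>P'\<close> modulo \<open>P\<close>, become stationary at \<open>Q\<close>, and two
  applications of Nakayama's lemma give \<open>J n = J (n + 1)\<close> and \<open>J n \<subseteq> P\<close>.\<close>

theorem principal_ideal_theorem:
  assumes P: "primeideal P R" and P': "primeideal P' R" and Q: "primeideal Q R"
    and PP': "P \<subset> P'" and P'Q: "P' \<subset> Q" and x: "x \<in> Q"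
  shows "\<exists>Q'. primeideal Q' R \<and> P \<subseteq> Q' \<and> x \<in> Q' \<and> Q' \<subset> Q"
proof (rule ccontr)
  assume contra: "\<not> ?thesis"
  then have min: "primeideal Q' R \<Longrightarrow> insert x P \<subseteq> Q' \<Longrightarrow> Q' \<subseteq> Q \<Longrightarrow> Q' = Q" for Q' by blast
  interpret P: primeideal P R by fact
  interpret P': primeideal P' R by fact
  interpret Q: primeideal Q R by fact
  have xc: "x \<in> carrier R" using x Q.Icarr by auto
  have xP': "x \<notin> P'" using contra P' PP' P'Q by blast
  \<comment> \<open>Each step multiplies by \<open>P'\<close>, adds \<open>P\<close> and saturates;
    localised at \<open>P'\<close>, the ideal \<open>J n\<close> is P + P'^n.\<close>
  define step where "step J = sat P' (Idl (P \<union> {p \<otimes> b | p b. p \<in> P' \<and> b \<in> J}))" for J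
  define J where "J = rec_nat (carrier R) (\<lambda>_. step)"
  have J_0: "J 0 = carrier R" and J_Suc: "J (Suc n) = step (J n)" for n by (simp_all add: J_def)
  have gen_car: "P \<union> {p \<otimes> b | p b. p \<in> P' \<and> b \<in> L} \<subseteq> carrier R" if "L \<subseteq> carrier R" for L
    using that P.Icarr P'.Icarr by auto
  have step: "saturated P' (step L)" "P \<subseteq> step L" "p \<in> P' \<Longrightarrow> b \<in> L \<Longrightarrow> p \<otimes> b \<in> step L" if L: "L \<subseteq> carrier R" for L p b
  proof -
    note c = gen_car[OF L]
    note I = genideal_ideal[OF c]
    show "saturated P' (step L)" unfolding step_def by (rule sat_saturated[OF P' I])
    have "P \<union> {p \<otimes> b | p b. p \<in> P' \<and> b \<in> L} \<subseteq> step L"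
      unfolding step_def using genideal_self[OF c] sat_superset[OF P', of "Idl (P \<union> {p \<otimes> b | p b. p \<in> P' \<and> b \<in> L})"] ideal.Icarr[OF I] by blast
    then show "P \<subseteq> step L" "p \<in> P' \<Longrightarrow> b \<in> L \<Longrightarrow> p \<otimes> b \<in> step L" by blast+
  qed
  have step_min: "step L \<subseteq> B" if "saturated P' B" "P \<subseteq> B" "\<And>p b. p \<in> P' \<Longrightarrow> b \<in> L \<Longrightarrow> p \<otimes> b \<in> B" for L B
    unfolding step_def using that saturated_ideal by (intro sat_minimal[OF P'] genideal_minimal) auto
  have J: "saturated P' (J n) \<and> P \<subseteq> J n" for n
  proof (induction n)
    case 0
    then show ?case using saturated_carrier P.Icarr by (auto simp: J_0)
  next
    case (Suc n)
    then have "J n \<subseteq> carrier R" using ideal.Icarr[OF saturated_ideal] by blast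
    then show ?case using step by (simp add: J_Suc)
  qed
  have Ji: "ideal (J n) R" for n using J saturated_ideal by blast
  have Jc: "J n \<subseteq> carrier R" for n using ideal.Icarr[OF Ji] by blast
  have J_dec: "J (Suc n) \<subseteq> J n" for n
  proof (induction n)
    case 0
    then show ?case using Jc by (simp add: J_0)
  next
    case (Suc n)
    then show ?case using J[of "Suc n"] step(3)[OF Jc[of n]]
      unfolding J_Suc[of "Suc n"] by (intro step_min) (auto simp: J_Suc)
  qed
  define f where "f n = sat Q (Idl (insert x (J n)))" for n
  note f = sat_insert[OF Q Ji xc, folded f_def]
  have "sat_dcc Q (sat Q (Idl (insert x P)))"
    using sat_insert[OF Q P.is_ideal xc] by (intro sat_dcc_minimal_prime[OF Q, of "insert x P"] min) auto
  moreover have "sat Q (Idl (insert x P)) \<subseteq> f n" for n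
    using f(2)[of n] f(3)[of n] J[of n] by (intro sat_insert_minimal[OF Q f(1)]) auto
  moreover have "f (Suc n) \<subseteq> f n" for n
    using f(2)[of n] f(3)[of n] J_dec[of n] unfolding f_def[of "Suc n"] by (intro sat_insert_minimal[OF Q f(1)]) auto
  ultimately have "\<exists>N. \<forall>n\<ge>N. f n = f N"
    using f(1) unfolding sat_dcc_def by (elim allE[of _ f] impE) blast+
  then obtain n where "\<forall>m\<ge>n. f m = f n" ..
  then have fn: "f (Suc n) = f n" by (rule allE[of _ "Suc n"]) simp
  \<comment> \<open>Stationarity writes \<open>s b = u + x r\<close> for \<open>b\<close> in
    \<open>J n\<close> with \<open>u\<close> in \<open>J (n+1)\<close>. Then \<open>x r\<close> is
    in \<open>J n\<close>, and so is \<open>r\<close> because \<open>x\<close> is outside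
    \<open>P'\<close>. Locally at \<open>Q\<close> this says J n = J (n+1) + x J n.\<close>
  have "J n = J (Suc n)"
  proof (rule nakayama_saturated[OF Q, of "{x}"])
    show "{x} \<subseteq> Q" using x by simp
    show "saturated Q (J n)" "saturated Q (J (Suc n))" using J saturated_mono P'Q by blast+
    show "J (Suc n) \<subseteq> J n" by (rule J_dec)
    fix L assume L: "saturated Q L" "J (Suc n) \<subseteq> L" and xJ: "\<And>y b. y \<in> {x} \<Longrightarrow> b \<in> J n \<Longrightarrow> y \<otimes> b \<in> L"
    show "J n \<subseteq> L"
    proof
      fix b assume b: "b \<in> J n"
      then have bc: "b \<in> carrier R" using Jc by auto
      have "b \<in> f (Suc n)" using b f(2)[of n] fn by auto
      then obtain s u r where sur: "s \<in> carrier R - Q" "u \<in> J (Suc n)" "r \<in> carrier R" "s \<otimes> b = u \<oplus> x \<otimes> r"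
        using sat_insertE[OF Q Ji xc] unfolding f_def by metis
      have "s \<otimes> b \<in> J n" by (rule ideal.I_l_closed[OF Ji b]) (use sur in auto)
      then have "u \<oplus> x \<otimes> r \<in> J n" using sur by simp
      moreover have "u \<in> J n" using sur(2) J_dec by blast
      ultimately have "x \<otimes> r \<in> J n" using sur(3) xc ideal_add_cancel[OF Ji] by blast
      then have "r \<in> J n" using saturatedD[OF conjunct1[OF J] xc xP' sur(3)] by blast
      then have "x \<otimes> r \<in> L" using xJ by simp
      then have "s \<otimes> b \<in> L" unfolding sur(4) using sur(2) L(2) by (intro ideal_add[OF saturated_ideal[OF L(1)]]) auto
      then show "b \<in> L" using saturatedD[OF L(1) _ _ bc] sur(1) by blast
    qed
  qed
  \<comment> \<open>The second application takes place at \<open>P'\<close>, with all of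
    \<open>P'\<close> as multipliers: \<open>J n = step (J n)\<close> means that locally it is
    generated by \<open>P\<close> and P' J n.\<close>
  moreover have "J n = P" if JJ: "J n = J (Suc n)"
  proof (rule nakayama_saturated[OF P' subset_refl])
    show "saturated P' (J n)" "P \<subseteq> J n" using J by auto
    show "saturated P' P" using PP' by (intro prime_saturated[OF P]) auto
    show "J n \<subseteq> L" if "saturated P' L" "P \<subseteq> L" "\<And>p b. p \<in> P' \<Longrightarrow> b \<in> J n \<Longrightarrow> p \<otimes> b \<in> L" for L
      by (rule ord_eq_le_trans[OF trans[OF JJ J_Suc] step_min[OF that(1,2)]]) (rule that(3))
  qed
  ultimately have JP: "J n = P" by simp
  obtain p where p: "p \<in> P'" "p \<notin> P" using PP' by blast
  have pc: "p \<in> carrier R" using p P'.Icarr by auto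
  \<comment> \<open>The powers of an element of \<open>P'\<close> outside \<open>P\<close> lie in
    the successive \<open>J k\<close>, but never in the prime \<open>P\<close>.\<close>
  have "p [^] k \<in> J k" for k :: nat
  proof (induction k)
    case (Suc k)
    then have "p \<otimes> p [^] k \<in> J (Suc k)" using step(3)[OF Jc[of k]] p by (simp add: J_Suc)
    then show ?case using pc by (simp add: m_comm)
  qed (simp add: J_0)
  moreover have "p [^] k \<notin> P" for k :: nat
  proof (induction k)
    case 0
    then show ?case using one_notin_prime[OF P] by simp
  next
    case (Suc k)
    then show ?case using P.I_prime[of "p [^] k" p] p pc by auto
  qed
  ultimately show False using JP by blast
qed

text \<open>The element \<open>x\<close> is pushed down the chain from the top: as long as a prime
  misses \<open>x\<close>, the principal ideal theorem replaces it by one that contains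
  \<open>x\<close> and still fits between its neighbours.\<close>

lemma prime_chain_through:
  assumes "\<And>i. i \<le> l \<Longrightarrow> primeideal (P i) R" "\<And>i. i < l \<Longrightarrow> P i \<subset> P (Suc i)" "0 < l" "x \<in> P l"
  shows "\<exists>P'. (\<forall>i\<le>l. primeideal (P' i) R) \<and> (\<forall>i<l. P' i \<subset> P' (Suc i)) \<and> P' 0 = P 0 \<and> P' l = P l \<and> x \<in> P' 1"
  using assms
proof (induction l arbitrary: P)
  case (Suc k)
  show ?case
  proof (cases "k = 0")
    case True
    then show ?thesis using Suc.prems by (intro exI[of _ P]) auto
  next
    case False
    then obtain j where k: "k = Suc j" using not0_implies_Suc by auto
    have *: ?thesis if "primeideal Q' R" "P j \<subset> Q'" "Q' \<subset> P (Suc k)" "x \<in> Q'" for Q'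
    proof -
      let ?P = "P(k := Q')"
      have "\<exists>P'. (\<forall>i\<le>k. primeideal (P' i) R) \<and> (\<forall>i<k. P' i \<subset> P' (Suc i)) \<and> P' 0 = ?P 0 \<and> P' k = ?P k \<and> x \<in> P' 1"
      proof (rule Suc.IH)
        show "?P i \<subset> ?P (Suc i)" if "i < k" for i
          using that Suc.prems(2)[of i] \<open>P j \<subset> Q'\<close> k by (cases "i = j") auto
      qed (use that Suc.prems False in auto)
      then obtain P' where P': "\<forall>i\<le>k. primeideal (P' i) R" "\<forall>i<k. P' i \<subset> P' (Suc i)" "P' 0 = P 0" "P' k = Q'" "x \<in> P' 1"
        using False by auto
      show ?thesis
      proof (intro exI[of _ "P'(Suc k := P (Suc k))"] conjI allI impI)
        fix i assume "i < Suc k"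
        then show "(P'(Suc k := P (Suc k))) i \<subset> (P'(Suc k := P (Suc k))) (Suc i)"
          using P' that by (cases "i = k") auto
      qed (use P' Suc.prems False le_Suc_eq in auto)
    qed
    show ?thesis
    proof (cases "x \<in> P k")
      case True
      then show ?thesis using *[of "P k"] Suc.prems(1)[of k] Suc.prems(2)[of j] Suc.prems(2)[of k] k by auto
    next
      case False
      then obtain Q' where "primeideal Q' R" "P j \<subseteq> Q'" "x \<in> Q'" "Q' \<subset> P (Suc k)"
        using principal_ideal_theorem[of "P j" "P k" "P (Suc k)" x] Suc.prems k by auto
      \<comment> \<open>This makes the inclusion of \<open>P j\<close> in the new prime strict, so
        the chain keeps its length.\<close>
      moreover have "x \<notin> P j" using False Suc.prems(2)[of j] k by auto
      ultimately show ?thesis using *[of Q'] by auto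
    qed
  qed
qed simp

end

lemma strict_chain_less:
  fixes P :: "nat \<Rightarrow> 'a set"
  assumes "\<And>i. i < l \<Longrightarrow> P i \<subset> P (Suc i)" "i < j" "j \<le> l"
  shows "P i \<subset> P j"
  using assms(2,3)
proof (induction j)
  case (Suc j)
  then have "P j \<subset> P (Suc j)" using assms(1)[of j] by simp
  then show ?case using Suc by (cases "i = j") auto
qed simp

section \<open>Generators of the maximal ideal along a long chain of primes\<close>

context noetherian_cring
begin

text \<open>Induction over \<open>ys\<close>, with an ideal \<open>B\<close> in place of a quotient
  ring. By \<open>prime_chain_through\<close> the chain may be assumed to contain \<open>y\<close>
  from its second member on, so its remainder serves for \<open>B' = B + (y)\<close> and one
  generator less. Counting then forces \<open>B' = P' 1\<close>, and Nakayama's lemma gives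
  \<open>B = P' 0\<close>. Only a lower bound on the length of the chain is assumed; equality comes
  out.\<close>

lemma regular_of_prime_chain:
  assumes M: "maximalideal M R" and units: "\<And>s. s \<in> carrier R - M \<Longrightarrow> s \<in> Units R"
    and "ideal B R" "set ys \<subseteq> carrier R" "M = Idl (B \<union> set ys)"
    and "\<And>i. i \<le> l \<Longrightarrow> primeideal (P i) R" "\<And>i. i < l \<Longrightarrow> P i \<subset> P (Suc i)" "P l = M" "B \<subseteq> P 0"
    and "length ys \<le> l"
  shows "l = length ys \<and> primeideal B R \<and>
    (\<forall>i<length ys. primeideal (Idl (B \<union> set (take i ys))) R \<and> ys ! i \<notin> Idl (B \<union> set (take i ys)))"
  using assms(3-)
proof (induction ys arbitrary: B P l)
  case Nil
  then have BM: "B = M" using Idl_ideal by simp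
  have "l = 0"
  proof (rule ccontr)
    assume "l \<noteq> 0"
    then have "P 0 \<subset> P l" using Nil by (intro strict_chain_less[of l P 0 l]) auto
    then show False using Nil.prems(6,7) BM by blast
  qed
  then show ?case using maximalideal_prime[OF M] BM by simp
next
  case (Cons y ys)
  obtain k where l: "l = Suc k" using Cons.prems(8) by (cases l) auto
  have Bc: "B \<subseteq> carrier R" by (rule ideal_subset[OF Cons.prems(1)])
  have yc: "y \<in> carrier R" "set ys \<subseteq> carrier R" using Cons.prems by auto
  define B' where "B' = Idl (insert y B)"
  have yBc: "insert y B \<subseteq> carrier R" using yc Bc by auto
  have B': "ideal B' R" "B \<subseteq> B'" "y \<in> B'"
    using genideal_self[OF yBc] genideal_ideal[OF yBc] by (auto simp: B'_def)
  have union: "Idl (B \<union> set (y # zs)) = Idl (B' \<union> set zs)" if "set zs \<subseteq> carrier R" for zs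
  proof -
    have "Idl (insert y B \<union> set zs) = Idl (B' \<union> set zs)"
      using that yBc ideal_subset[OF B'(1)] Idl_ideal[OF B'(1)]
      by (intro genideal_union_cong) (auto simp: B'_def)
    then show ?thesis by simp
  qed
  have MB': "M = Idl (B' \<union> set ys)" using Cons.prems(3) union yc by simp
  have "y \<in> Idl (B' \<union> set ys)"
    using B' yc ideal_subset[OF B'(1)] genideal_self[of "B' \<union> set ys"] by auto
  then have "y \<in> M" using MB' by simp
  then have "y \<in> P l" using Cons.prems(6) by simp
  then obtain P' where "\<forall>i\<le>l. primeideal (P' i) R" "\<forall>i<l. P' i \<subset> P' (Suc i)" "P' 0 = P 0" "P' l = P l" "y \<in> P' 1"
    using prime_chain_through[of l P y, OF Cons.prems(4,5)] l by blast
  then have P': "\<forall>i\<le>l. primeideal (P' i) R" "\<forall>i<l. P' i \<subset> P' (Suc i)" "P' 0 = P 0" "P' l = M" "y \<in> P' 1"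
    using Cons.prems(6) by simp_all
  have PB: "P' 0 \<subset> P' 1" using P'(2) l by auto
  have P1: "primeideal (P' 1) R" "primeideal (P' 0) R" using P'(1) l by auto
  have B'P: "B' \<subseteq> P' 1"
    unfolding B'_def using P' Cons.prems(7) PB primeideal.axioms(1)[OF P1(1)] by (intro genideal_minimal) auto
  have IH': "l' = length ys \<and> primeideal B' R \<and>
      (\<forall>i<length ys. primeideal (Idl (B' \<union> set (take i ys))) R \<and> ys ! i \<notin> Idl (B' \<union> set (take i ys)))"
    if "\<And>i. i \<le> l' \<Longrightarrow> primeideal (Q i) R" "\<And>i. i < l' \<Longrightarrow> Q i \<subset> Q (Suc i)" "Q l' = M" "B' \<subseteq> Q 0"
      "length ys \<le> l'" for l' and Q :: "nat \<Rightarrow> 'a set"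
    by (rule Cons.IH[OF B'(1) yc(2) MB']) (fact that)+
  have IH: "k = length ys \<and> primeideal B' R \<and>
      (\<forall>i<length ys. primeideal (Idl (B' \<union> set (take i ys))) R \<and> ys ! i \<notin> Idl (B' \<union> set (take i ys)))"
    using P' l B'P Cons.prems(8)
    by (intro IH'[of k "\<lambda>i. P' (Suc i)"]) auto
  \<comment> \<open>Otherwise \<open>B'\<close>, prime by the induction hypothesis, could be put
    below \<open>P' 1\<close>, and the chain above \<open>B'\<close> would be one longer than the
    number of generators left.\<close>
  have "B' = P' 1"
  proof (rule ccontr)
    assume ne: "B' \<noteq> P' 1"
    let ?P = "\<lambda>i. case i of 0 \<Rightarrow> B' | Suc j \<Rightarrow> P' (Suc j)"
    have "Suc k = length ys"
    proof (rule IH'[of "Suc k" ?P, THEN conjunct1])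
      show "?P i \<subset> ?P (Suc i)" if "i < Suc k" for i
        using that ne B'P P'(2) l by (cases i) auto
      show "primeideal (?P i) R" if "i \<le> Suc k" for i
        using that IH P'(1) l by (cases i) auto
    qed (use P' l IH in auto)
    then show False using IH by simp
  qed
  then have yP: "y \<notin> P' 0"
    using PB Cons.prems(7) P'(3) primeideal.axioms(1)[OF P1(2)] genideal_minimal[of "P' 0" "insert y B"]
    by (auto simp: B'_def)
  \<comment> \<open>Outside \<open>M\<close> there are only units, so every ideal is saturated at
    \<open>M\<close> and the saturated form of Nakayama's lemma applies.\<close>
  have sat_B: "saturated M B"
    unfolding saturated_def
  proof (intro conjI ballI impI Cons.prems(1))
    fix s b assume s: "s \<in> carrier R - M" and b: "b \<in> carrier R" "s \<otimes> b \<in> B"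
    have u: "s \<in> Units R" by (rule units[OF s])
    then have "inv s \<otimes> (s \<otimes> b) \<in> B" using b ideal.I_l_closed[OF Cons.prems(1)] by simp
    moreover have "inv s \<otimes> (s \<otimes> b) = b" using u b s by (simp add: m_assoc[symmetric])
    ultimately show "b \<in> B" by simp
  qed
  have Mp: "primeideal M R" by (rule maximalideal_prime[OF M])
  have P0M: "P' 0 \<subseteq> M" using strict_chain_less[of l P' 0 l] P' l by auto
  \<comment> \<open>An element of \<open>P' 0\<close> is \<open>u + y r\<close> with
    \<open>u\<close> in \<open>B\<close>; as \<open>y\<close> is not in the prime
    \<open>P' 0\<close>, the cofactor \<open>r\<close> is. So P' 0 = B + y P' 0.\<close>
  have "P' 0 = B"
  proof (rule nakayama_saturated[OF Mp, of "{y}"])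
    show "{y} \<subseteq> M" using \<open>y \<in> M\<close> by simp
    show "saturated M (P' 0)" by (rule prime_saturated[OF P1(2) P0M])
    show "saturated M B" by (rule sat_B)
    show "B \<subseteq> P' 0" using Cons.prems(7) P' by simp
    fix L assume L: "saturated M L" "B \<subseteq> L" and yL: "\<And>x b. x \<in> {y} \<Longrightarrow> b \<in> P' 0 \<Longrightarrow> x \<otimes> b \<in> L"
    show "P' 0 \<subseteq> L"
    proof
      fix p assume p: "p \<in> P' 0"
      then have "p \<in> Idl (insert y B)" using PB \<open>B' = P' 1\<close> by (auto simp: B'_def)
      then obtain u r where ur: "u \<in> B" "r \<in> carrier R" "p = u \<oplus> y \<otimes> r"
        using Idl_insert_ideal[OF Cons.prems(1) yc(1)] by blast
      have "u \<in> P' 0" using ur Cons.prems(7) P'(3) by auto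
      moreover have "u \<oplus> y \<otimes> r \<in> P' 0" using p ur(3) by simp
      ultimately have "y \<otimes> r \<in> P' 0"
        using ur(2) yc(1) ideal_add_cancel[OF primeideal.axioms(1)[OF P1(2)], of u "y \<otimes> r"] by simp
      then have "r \<in> P' 0" using primeideal.I_prime[OF P1(2) yc(1) ur(2)] yP by blast
      then have "y \<otimes> r \<in> L" using yL by simp
      then show "p \<in> L" unfolding ur(3) using ur(1) L(2) by (intro ideal_add[OF saturated_ideal[OF L(1)]]) auto
    qed
  qed
  then have B: "primeideal B R" "y \<notin> B" using P1 yP by auto
  have "primeideal (Idl (B \<union> set (take i (y # ys)))) R \<and> (y # ys) ! i \<notin> Idl (B \<union> set (take i (y # ys)))"
    if "i < length (y # ys)" for i
  proof (cases i)
    case 0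
    then show ?thesis using B Idl_ideal[OF Cons.prems(1)] by simp
  next
    case (Suc j)
    have "set (take j ys) \<subseteq> carrier R" using yc set_take_subset[of j ys] by blast
    then have "Idl (B \<union> set (take i (y # ys))) = Idl (B' \<union> set (take j ys))"
      using union[of "take j ys"] Suc by simp
    then show ?thesis using IH that Suc by simp
  qed
  then show ?case using B(1) IH l by simp
qed

lemma proper_ideal_subset_maximal:
  assumes "ideal I R" "I \<noteq> carrier R"
  shows "\<exists>N. maximalideal N R \<and> I \<subseteq> N"
proof -
  define F where "F = {J. ideal J R \<and> I \<subseteq> J \<and> J \<noteq> carrier R}"
  have "F \<noteq> {}" using assms by (auto simp: F_def)
  then obtain N where N: "N \<in> F" and max: "\<And>J. J \<in> F \<Longrightarrow> N \<subseteq> J \<Longrightarrow> J = N"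
    by (rule noetherian_maximal) (auto simp: F_def)
  have "maximalideal N R"
  proof (rule maximalidealI)
    show "ideal N R" "carrier R \<noteq> N" using N by (auto simp: F_def)
    show "J = N \<or> J = carrier R" if "ideal J R" "N \<subseteq> J" "J \<subseteq> carrier R" for J
      using max[of J] N that by (auto simp: F_def)
  qed
  then show ?thesis using N by (auto simp: F_def)
qed

end

section \<open>Regular local rings\<close>

lemma local_ring_noetherian_cring: "local_ring R M \<Longrightarrow> noetherian_cring R"
  by (intro noetherian_cring.intro) (auto simp: local_ring_def)

lemma local_ring_subset:
  assumes "local_ring R M" "ideal I R" "I \<noteq> carrier R"
  shows "I \<subseteq> M"
  using noetherian_cring.proper_ideal_subset_maximal[OF local_ring_noetherian_cring[OF assms(1)] assms(2,3)]
    assms(1) by (auto simp: local_ring_def)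

lemma local_ring_unit:
  assumes "local_ring R M" "s \<in> carrier R - M"
  shows "s \<in> Units R"
proof -
  interpret cring R using assms by (simp add: local_ring_def)
  have s: "s \<in> carrier R" "s \<notin> M" using assms by auto
  have "s \<in> PIdl\<^bsub>R\<^esub> s" by (rule cgenideal_self[OF s(1)])
  then have "PIdl\<^bsub>R\<^esub> s = carrier R"
    using local_ring_subset[OF assms(1) cgenideal_ideal[OF s(1)]] s(2) by blast
  then have "\<one>\<^bsub>R\<^esub> \<in> PIdl\<^bsub>R\<^esub> s" by simp
  then obtain r where "r \<in> carrier R" "\<one>\<^bsub>R\<^esub> = r \<otimes>\<^bsub>R\<^esub> s" unfolding cgenideal_def by blast
  then show ?thesis using s(1) m_comm[of r s] by (auto simp: Units_def)
qed

text \<open>If all chains were shorter than a positive \<open>d\<close>, their supremum would be at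
  most \<open>d - 1\<close>. The value 0 is also the supremum of the empty set, so there the chain
  consisting of \<open>M\<close> alone is supplied.\<close>

lemma krull_dim_chain:
  assumes "krull_dim R = enat d" "primeideal M R"
  shows "\<exists>n P. d \<le> n \<and> (\<forall>i\<le>n. primeideal (P i) R) \<and> (\<forall>i<n. P i \<subset> P (Suc i))"
proof (cases d)
  case 0
  then show ?thesis using assms(2) by (intro exI[of _ 0] exI[of _ "\<lambda>_. M"]) auto
next
  case (Suc k)
  show ?thesis
  proof (rule ccontr)
    assume n: "\<not> ?thesis"
    have "krull_dim R \<le> enat k"
      unfolding krull_dim_def
    proof (rule Sup_least, clarify)
      fix n :: nat and P assume "\<forall>i\<le>n. primeideal (P i) R" "\<forall>i<n. P i \<subset> P (Suc i)"
      then have "\<not> d \<le> n" using n by blast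
      then show "enat n \<le> enat k" using Suc by simp
    qed
    then show False using assms(1) Suc by simp
  qed
qed

text \<open>The generators whose number is the dimension are taken along a chain of at least that
  length, starting over the zero ideal. Each partial ideal is prime and misses the next generator,
  which is stronger than regularity.\<close>

lemma regular_local_ring_regular_sequence:
  assumes "regular_local_ring R M"
  shows "\<exists>xs. regular_sequence R xs \<and> Idl\<^bsub>R\<^esub> (set xs) = M"
proof -
  have loc: "local_ring R M" using assms by (simp add: regular_local_ring_def)
  then have M: "maximalideal M R" by (simp add: local_ring_def)
  interpret noetherian_cring R by (rule local_ring_noetherian_cring[OF loc])
  obtain xs where xs: "set xs \<subseteq> carrier R" "Idl\<^bsub>R\<^esub> (set xs) = M" "enat (length xs) = krull_dim R"
    using assms by (auto simp: regular_local_ring_def)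
  obtain n P where P: "length xs \<le> n" "\<forall>i\<le>n. primeideal (P i) R" "\<forall>i<n. P i \<subset> P (Suc i)"
    using krull_dim_chain[of R "length xs" M] xs(3) maximalideal_prime[OF M] by auto
  have PM: "P n \<subseteq> M"
    using P(2) primeideal.I_notcarr by (intro local_ring_subset[OF loc] primeideal.axioms(1)) auto
  \<comment> \<open>\<open>regular_of_prime_chain\<close> wants a chain ending at \<open>M\<close>;
    enlarging its last member keeps it strict.\<close>
  let ?P = "P(n := M)"
  have 0: "{\<zero>\<^bsub>R\<^esub>} \<union> set (take i xs) \<subseteq> carrier R" "set (take i xs) \<subseteq> carrier R" for i
    using xs(1) set_take_subset[of i xs] by auto
  have Idl0: "Idl\<^bsub>R\<^esub> ({\<zero>\<^bsub>R\<^esub>} \<union> set (take i xs)) = Idl\<^bsub>R\<^esub> (set (take i xs))" for i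
  proof -
    have "Idl\<^bsub>R\<^esub> ({\<zero>\<^bsub>R\<^esub>} \<union> set (take i xs)) = Idl\<^bsub>R\<^esub> ({} \<union> set (take i xs))"
      using 0(2) by (intro genideal_union_cong) (auto simp: genideal_zero Idl_empty)
    then show ?thesis by simp
  qed
  have zero_in: "\<zero>\<^bsub>R\<^esub> \<in> ?P 0"
    using P(2) maximalideal_prime[OF M] additive_subgroup.zero_closed[OF ideal.axioms(1)[OF primeideal.axioms(1)]]
    by (cases n) auto
  have reg: "\<forall>i<length xs. primeideal (Idl\<^bsub>R\<^esub> ({\<zero>\<^bsub>R\<^esub>} \<union> set (take i xs))) R \<and> xs ! i \<notin> Idl\<^bsub>R\<^esub> ({\<zero>\<^bsub>R\<^esub>} \<union> set (take i xs))"
  proof (rule regular_of_prime_chain[OF M, THEN conjunct2, THEN conjunct2])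
    show "M = Idl\<^bsub>R\<^esub> ({\<zero>\<^bsub>R\<^esub>} \<union> set xs)" using Idl0[of "length xs"] xs(2) by simp
    show "primeideal (?P i) R" if "i \<le> n" for i using that P(2) maximalideal_prime[OF M] by auto
    show "?P i \<subset> ?P (Suc i)" if "i < n" for i
      using that P(3) PM by (cases "Suc i = n") (auto dest: spec[of _ i])
    show "{\<zero>\<^bsub>R\<^esub>} \<subseteq> ?P 0" using zero_in by simp
  qed (use xs P zeroideal local_ring_unit[OF loc] in auto)
  have "regular_sequence R xs"
    unfolding regular_sequence_def
  proof (intro conjI allI impI ballI)
    show "set xs \<subseteq> carrier R" by (rule xs(1))
    show "Idl\<^bsub>R\<^esub> (set xs) \<noteq> carrier R" using xs(2) maximalideal.I_notcarr[OF M] by simp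
    fix i r assume i: "i < length xs" and r: "r \<in> carrier R" "xs ! i \<otimes>\<^bsub>R\<^esub> r \<in> Idl\<^bsub>R\<^esub> (set (take i xs))"
    have "xs ! i \<in> carrier R" using i xs(1) by auto
    then show "r \<in> Idl\<^bsub>R\<^esub> (set (take i xs))"
      using reg i r primeideal.I_prime[of "Idl\<^bsub>R\<^esub> (set (take i xs))" R "xs ! i" r] unfolding Idl0 by blast
  qed
  then show ?thesis using xs(2) by blast
qed

text \<open>This covers both cases: in a local ring all elements are admitted, in a graded ring with
  irrelevant ideal \<open>M\<close> the homogeneous ones.\<close>

locale nakayama_ring = cring R for R :: "('a, 'r) ring_scheme" (structure) +
  fixes M H W :: "'a set"
  assumes maximal_M: "maximalideal M R" and H_carrier: "H \<subseteq> carrier R"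
    and W: "finite W" "W \<subseteq> H" "Idl W = M"
    and H_cancel: "s \<in> carrier R - M \<Longrightarrow> S \<subseteq> H \<Longrightarrow> x \<in> H \<Longrightarrow> s \<otimes> x \<in> Idl S \<Longrightarrow> x \<in> Idl S"
begin

section \<open>Nakayama's lemma and the number of generators\<close>

lemma M_ideal: "ideal M R"
  using maximalideal.axioms(1)[OF maximal_M] .

lemma one_minus_notin_M:
  assumes "t \<in> M"
  shows "\<one> \<ominus> t \<in> carrier R - M"
proof -
  have t: "t \<in> carrier R" using ideal.Icarr[OF M_ideal assms] .
  have "\<one> \<ominus> t \<notin> M"
  proof
    assume "\<one> \<ominus> t \<in> M"
    then have "(\<one> \<ominus> t) \<oplus> t \<in> M" using assms M_ideal ideal_add by blast
    moreover have "(\<one> \<ominus> t) \<oplus> t = \<one>" using t by algebra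
    ultimately have "M = carrier R" using ideal.one_imp_carrier[OF M_ideal] by simp
    then show False using maximalideal.I_notcarr[OF maximal_M] by simp
  qed
  then show ?thesis using t by simp
qed

lemma square_split:
  assumes "insert w T \<subseteq> carrier R" "Idl (insert w T) = M" "v \<in> M \<cdot> M"
  shows "\<exists>u\<in>Idl T. \<exists>t\<in>M. v = u \<oplus> w \<otimes> t"
  using assms(3)
proof (induction v rule: ideal_prod.induct)
  case (prod i j)
  have T: "ideal (Idl T) R" using assms(1) by (intro genideal_ideal) auto
  have c: "i \<in> carrier R" "w \<in> carrier R" using prod ideal.Icarr[OF M_ideal] assms(1) by auto
  obtain u r where ur: "u \<in> Idl T" "r \<in> carrier R" "j = u \<oplus> w \<otimes> r"
    using Idl_insert[of w T j] prod assms by auto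
  have u: "u \<in> carrier R" by (rule ideal.Icarr[OF T ur(1)])
  have "i \<otimes> j = i \<otimes> u \<oplus> w \<otimes> (i \<otimes> r)" unfolding ur(3) using c u ur(2) by (simp add: r_distr m_lcomm)
  moreover have "i \<otimes> u \<in> Idl T" using ideal.I_l_closed[OF T ur(1) c(1)] .
  moreover have "i \<otimes> r \<in> M" using ideal.I_r_closed[OF M_ideal prod(1) ur(2)] .
  ultimately show ?case by blast
next
  case (sum s1 s2)
  have T: "ideal (Idl T) R" using assms(1) by (intro genideal_ideal) auto
  obtain u1 t1 u2 t2 where *: "u1 \<in> Idl T" "t1 \<in> M" "s1 = u1 \<oplus> w \<otimes> t1" "u2 \<in> Idl T" "t2 \<in> M" "s2 = u2 \<oplus> w \<otimes> t2"
    using sum by blast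
  have c: "u1 \<in> carrier R" "t1 \<in> carrier R" "u2 \<in> carrier R" "t2 \<in> carrier R" "w \<in> carrier R"
    using * ideal.Icarr[OF T] ideal.Icarr[OF M_ideal] assms(1) by auto
  have "s1 \<oplus> s2 = (u1 \<oplus> u2) \<oplus> w \<otimes> (t1 \<oplus> t2)" unfolding * using c by algebra
  then show ?case using ideal_add[OF T *(1,4)] ideal_add[OF M_ideal *(2,5)] by blast
qed

lemma square_ideal: "ideal (M \<cdot> M) R"
  by (rule ideal_prod_is_ideal[OF M_ideal M_ideal])

lemma square_subset: "M \<cdot> M \<subseteq> M"
  using ideal_prod_inter[OF M_ideal M_ideal] by blast

text \<open>A smallest subset \<open>W'\<close> of \<open>W\<close> that generates M together with
  \<open>S\<close> must be empty: for \<open>w\<close> in \<open>W'\<close> the hypothesis gives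
  \<open>(1 - t) w\<close> in the ideal of the others with \<open>t\<close> in M. In the graded case
  \<open>1 - t\<close> need not be a unit, but \<open>w\<close> is homogeneous and
  \<open>H_cancel\<close> applies.\<close>

lemma nakayama:
  assumes S: "S \<subseteq> H" "S \<subseteq> M" and gen: "M \<subseteq> Idl (S \<union> M \<cdot> M)"
  shows "Idl S = M"
proof -
  have Hc: "B \<subseteq> H \<Longrightarrow> B \<subseteq> carrier R" for B using H_carrier by blast
  have Sc: "S \<subseteq> carrier R" using S Hc by auto
  define Q where "Q W' \<longleftrightarrow> W' \<subseteq> W \<and> Idl (S \<union> W') = M" for W'
  have "Idl (S \<union> W) = M"
  proof
    have "W \<subseteq> M" using W genideal_self[OF Hc] by blast
    then show "Idl (S \<union> W) \<subseteq> M" using S by (intro genideal_minimal[OF M_ideal]) auto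
    show "M \<subseteq> Idl (S \<union> W)" using W genideal_mono[of "S \<union> W" W] Sc Hc[OF W(2)] by auto
  qed
  then have "Q W" by (simp add: Q_def)
  then obtain W' where W': "Q W'" and min: "\<And>V. Q V \<Longrightarrow> card W' \<le> card V"
    using ex_has_least_nat[of Q W card] by blast
  have W'W: "W' \<subseteq> W" "Idl (S \<union> W') = M" using W' by (auto simp: Q_def)
  have "W' = {}"
  proof (rule ccontr)
    assume "W' \<noteq> {}"
    then obtain w where w: "w \<in> W'" by blast
    let ?T = "S \<union> (W' - {w})"
    have wT: "insert w ?T = S \<union> W'" using w by auto
    have Tc: "S \<union> W' \<subseteq> carrier R" "?T \<subseteq> carrier R" "w \<in> carrier R"
      using Sc Hc[OF W(2)] W'W(1) w by auto
    note I = genideal_ideal[OF Tc(2)]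
    have "w \<in> M" using W'W(2) genideal_self[OF Tc(1)] w by blast
    then have "w \<in> Idl (M \<cdot> M \<union> S)" using gen by (auto simp: Un_commute)
    moreover have "Idl (S \<union> M \<cdot> M) = Idl (Idl S \<union> M \<cdot> M)"
      using Sc ideal_subset[OF square_ideal] ideal_subset[OF genideal_ideal[OF Sc]] Idl_ideal[OF genideal_ideal[OF Sc]]
      by (intro genideal_union_cong) simp_all
    then have "Idl (M \<cdot> M \<union> S) \<subseteq> M \<cdot> M <+> Idl S"
      using union_genideal[OF square_ideal genideal_ideal[OF Sc]] by (simp add: Un_commute)
    ultimately obtain v u where vu: "v \<in> M \<cdot> M" "u \<in> Idl S" "w = v \<oplus> u"
      by (auto simp: set_add_def')
    obtain u' t where ut: "u' \<in> Idl ?T" "t \<in> M" "v = u' \<oplus> w \<otimes> t"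
      using square_split[of w ?T v] wT Tc(1) W'W(2) vu(1) by auto
    have u: "u \<in> Idl ?T" using vu(2) genideal_mono[OF Tc(2), of S] by auto
    have c: "u \<in> carrier R" "u' \<in> carrier R" "t \<in> carrier R"
      using u ut ideal.Icarr[OF I] ideal.Icarr[OF M_ideal] by auto
    have eq: "w = u' \<oplus> w \<otimes> t \<oplus> u" using vu(3) ut(3) by simp
    have "(\<one> \<ominus> t) \<otimes> w = w \<ominus> w \<otimes> t" using c(3) Tc(3) by algebra
    also have "\<dots> = (u' \<oplus> w \<otimes> t \<oplus> u) \<ominus> w \<otimes> t" using eq by simp
    also have "\<dots> = u' \<oplus> u" using c Tc(3) by algebra
    finally have "(\<one> \<ominus> t) \<otimes> w \<in> Idl ?T" using ideal_add[OF I ut(1) u] by simp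
    then have "w \<in> Idl ?T"
      using one_minus_notin_M[OF ut(2)] S(1) W'W(1) W(2) w by (intro H_cancel[of "\<one> \<ominus> t" ?T w]) auto
    then have "Idl (S \<union> W') \<subseteq> Idl ?T"
      using genideal_self[OF Tc(2)] by (intro genideal_minimal[OF I]) auto
    moreover have "Idl ?T \<subseteq> Idl (S \<union> W')" using Tc(1) by (intro genideal_mono) auto
    ultimately have "Q (W' - {w})" using W'W by (auto simp: Q_def)
    moreover have "card (W' - {w}) < card W'"
      using w W'W(1) W(1) by (intro card_Diff1_less) (auto intro: finite_subset)
    ultimately show False using min[of "W' - {w}"] by simp
  qed
  then show ?thesis using W'W by simp
qed

text \<open>\<open>Y\<close> stands for lifts of minimal generators of the maximal ideal of a
  quotient, \<open>T\<close> for generators of the ideal divided out. As \<open>T\<close> lies in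
  the square of M, Nakayama's lemma shows that \<open>Y\<close> alone generates M and that
  irredundancy amounts to independence modulo the square; exchange with \<open>W\<close> there
  bounds the number.\<close>

lemma irredundant_generators:
  assumes Y: "finite Y" "Y \<subseteq> H" and T: "T \<subseteq> M \<cdot> M" and gen: "Idl (Y \<union> T) = M"
    and irr: "\<And>y. y \<in> Y \<Longrightarrow> Idl (Y - {y} \<union> T) \<noteq> M"
  shows "Idl Y = M" "card Y \<le> card W"
proof -
  define cl where "cl S = Idl (S \<union> M \<cdot> M)" for S
  note sq = ideal_subset[OF square_ideal]
  have Yc: "Y \<subseteq> carrier R" and Tc: "T \<subseteq> carrier R" using Y H_carrier T sq by auto
  have YM: "Y \<subseteq> M" using gen genideal_self[of "Y \<union> T"] Yc Tc by blast
  have Mc: "M \<subseteq> carrier R" by (rule ideal_subset[OF M_ideal])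
  have full: "Idl Z = M" if Z: "Z \<subseteq> Y" and ZM: "M \<subseteq> Idl (Z \<union> M \<cdot> M)" for Z
    using Z Y(2) YM ZM by (intro nakayama) auto
  have "M \<subseteq> Idl (Y \<union> M \<cdot> M)" using gen genideal_mono[of "Y \<union> M \<cdot> M" "Y \<union> T"] Yc sq T by blast
  then show "Idl Y = M" by (rule full[OF subset_refl])
  have cl_ideal: "ideal (cl S) R" if "S \<subseteq> M" for S
    unfolding cl_def using that Mc sq by (intro genideal_ideal) auto
  have cl_self: "S \<union> M \<cdot> M \<subseteq> cl S" if "S \<subseteq> M" for S
    unfolding cl_def using that Mc sq by (intro genideal_self) auto
  \<comment> \<open>The closure operator is the span modulo the square of M. Intersecting with
    \<open>M\<close> first makes it monotone on all sets, as \<open>steinitz\<close>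
    demands.\<close>
  show "card Y \<le> card W"
  proof (rule steinitz[where V = M and cl = "\<lambda>S. cl (S \<inter> M)"])
    show "cl (S \<inter> M) \<subseteq> cl (S' \<inter> M)" if "S \<subseteq> S'" for S S'
      unfolding cl_def using that Mc sq by (intro genideal_mono) auto
    show "S \<subseteq> cl (S \<inter> M)" if "S \<subseteq> M" for S
      using that cl_self[of "S \<inter> M"] by auto
    show "cl (S \<inter> M) \<subseteq> cl (S' \<inter> M)" if "S \<subseteq> M" "S' \<subseteq> M" "S \<subseteq> cl (S' \<inter> M)" for S S'
      unfolding cl_def[of "S \<inter> M"] using that cl_self[of "S' \<inter> M"] by (intro genideal_minimal[OF cl_ideal]) auto
    show "w \<in> cl (insert x S \<inter> M)"
      if S: "S \<subseteq> M" and x: "x \<in> M" and w: "w \<in> M" and xw: "x \<in> cl (insert w S \<inter> M)" and xS: "x \<notin> cl (S \<inter> M)" for S x w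
    proof -
      have SM: "S \<inter> M = S" "insert w S \<inter> M = insert w S" "insert x S \<inter> M = insert x S" using S x w by auto
      have wc: "w \<in> carrier R" "x \<in> carrier R" using w x Mc by auto
      have "x \<in> Idl (insert w (S \<union> M \<cdot> M))" using xw SM by (simp add: cl_def)
      then obtain u r where ur: "u \<in> cl S" "r \<in> carrier R" "x = u \<oplus> w \<otimes> r"
        using Idl_insert[of w "S \<union> M \<cdot> M" x] wc S Mc sq unfolding cl_def by auto
      have uc: "u \<in> carrier R" using ideal.Icarr[OF cl_ideal[OF S] ur(1)] .
      \<comment> \<open>The cofactor of \<open>w\<close> is invertible modulo M, so \<open>w\<close>
        can be solved for up to an element of the square of M.\<close>
      have "r \<notin> M"
      proof
        assume "r \<in> M"
        then have "w \<otimes> r \<in> cl S" using w cl_self[OF S] ideal_prod.prod[of w M r M R] by blast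
        then show False using xS SM ur ideal_add[OF cl_ideal[OF S] ur(1)] by simp
      qed
      then obtain r' t where r': "r' \<in> carrier R" "t \<in> M" "r' \<otimes> r \<oplus> t = \<one>"
        using maximalideal_inverse[OF maximal_M ur(2)] by blast
      have tc: "t \<in> carrier R" using r' Mc by auto
      have "w = (r' \<otimes> r \<oplus> t) \<otimes> w" using r'(3) wc by simp
      also have "\<dots> = r' \<otimes> ((u \<oplus> w \<otimes> r) \<ominus> u) \<oplus> t \<otimes> w" using r'(1) tc wc uc ur(2) by algebra
      also have "\<dots> = r' \<otimes> (x \<ominus> u) \<oplus> t \<otimes> w" using ur(3) by simp
      finally have weq: "w = r' \<otimes> (x \<ominus> u) \<oplus> t \<otimes> w" .
      have xSM: "insert x S \<subseteq> M" using S x by auto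
      note I = cl_ideal[OF xSM]
      have "u \<in> cl (insert x S)"
        using ur(1) genideal_mono[of "insert x S \<union> M \<cdot> M" "S \<union> M \<cdot> M"] xSM Mc sq unfolding cl_def by blast
      moreover have "x \<in> cl (insert x S)" "t \<otimes> w \<in> cl (insert x S)"
        using cl_self[OF xSM] ideal_prod.prod[of t M w M R] r'(2) w by auto
      ultimately have "r' \<otimes> (x \<ominus> u) \<oplus> t \<otimes> w \<in> cl (insert x S)"
        using r'(1) ideal_diff[OF I] ideal_add[OF I ideal.I_l_closed[OF I]] by simp
      then show ?thesis using weq SM by simp
    qed
    have "W \<subseteq> M" using W genideal_self[of W] H_carrier by blast
    then show "W \<subseteq> M" .
    have "M \<subseteq> cl W" unfolding cl_def using W genideal_mono[of "W \<union> M \<cdot> M" W] H_carrier sq by auto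
    then show "Y \<subseteq> cl (W \<inter> M)" using YM \<open>W \<subseteq> M\<close> by (simp add: Int_absorb2)
    show "y \<notin> cl ((Y - {y}) \<inter> M)" if y: "y \<in> Y" for y
    proof
      assume "y \<in> cl ((Y - {y}) \<inter> M)"
      moreover have "(Y - {y}) \<inter> M = Y - {y}" using YM by auto
      ultimately have y_in: "y \<in> cl (Y - {y})" by simp
      have sub: "Y - {y} \<subseteq> M" using YM by auto
      have "Idl (Y \<union> M \<cdot> M) \<subseteq> cl (Y - {y})"
        using y_in cl_self[OF sub] by (intro genideal_minimal[OF cl_ideal[OF sub]]) auto
      then have "Idl (Y - {y}) = M"
        using \<open>M \<subseteq> Idl (Y \<union> M \<cdot> M)\<close> by (intro full) (auto simp: cl_def)
      moreover have "Idl (Y - {y}) \<subseteq> Idl (Y - {y} \<union> T)" using Yc Tc by (intro genideal_mono) auto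
      moreover have "Idl (Y - {y} \<union> T) \<subseteq> M"
        using sub T square_subset by (intro genideal_minimal[OF M_ideal]) auto
      ultimately show False using irr[OF y] by auto
    qed
  qed (use Y W YM in auto)
qed

end

section \<open>Cycles over the quotient ring\<close>

context cring
begin

text \<open>First syzygies are generated by the trivial ones. Regularity concerns the given order
  only, so for \<open>r\<close> below the last index the last element is eliminated first: its
  cofactor lies in the ideal of the preceding elements, and its \<open>a r\<close> component is
  moved into \<open>t\<close>.\<close>

lemma regular_syzygy:
  fixes a :: "nat \<Rightarrow> 'a"
  assumes "a \<in> {..<n} \<rightarrow> carrier R"
    and reg: "\<And>r t. r < n \<Longrightarrow> t \<in> carrier R \<Longrightarrow> a r \<otimes> t \<in> Idl (a ` {..<r}) \<Longrightarrow> t \<in> Idl (a ` {..<r})"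
    and "r < m" "m \<le> n" "t \<in> carrier R" "a r \<otimes> t \<in> Idl (a ` ({..<m} - {r}))"
  shows "t \<in> Idl (a ` {..<m})"
  using assms(3-)
proof (induction m arbitrary: t)
  case (Suc m)
  have ac: "a i \<in> carrier R" if "i < n" for i using assms(1) that by auto
  have gc: "a ` T \<subseteq> carrier R" if "T \<subseteq> {..<n}" for T using assms(1) that by auto
  have m: "m < n" "m \<le> n" using Suc.prems by auto
  have mono: "Idl (a ` T) \<subseteq> Idl (a ` {..<Suc m})" if "T \<subseteq> {..<Suc m}" for T
    using that Suc.prems by (intro genideal_mono gc image_mono) auto
  show ?case
  proof (cases "r = m")
    case True
    then have "{..<Suc m} - {r} = {..<m}" by auto
    then have "a m \<otimes> t \<in> Idl (a ` {..<m})" using Suc.prems(4) True by simp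
    then have "t \<in> Idl (a ` {..<m})" by (rule reg[OF m(1) Suc.prems(3)])
    then show ?thesis using mono[of "{..<m}"] by auto
  next
    case False
    then have r: "r < m" using Suc.prems by simp
    let ?B = "{..<m} - {r}"
    have B: "?B \<subseteq> {..<n}" using m by auto
    note IB = genideal_ideal[OF gc[OF B]]
    have Im: "ideal (Idl (a ` {..<m})) R" using m by (intro genideal_ideal gc) auto
    have BIm: "Idl (a ` ?B) \<subseteq> Idl (a ` {..<m})" using m by (intro genideal_mono gc) auto
    have arm: "a r \<in> Idl (a ` {..<m})" using r m genideal_self[OF gc[of "{..<m}"]] by auto
    have "{..<Suc m} - {r} = insert m ?B" using r by auto
    then have "a r \<otimes> t \<in> Idl (insert (a m) (a ` ?B))" using Suc.prems by simp
    then obtain b v where bv: "b \<in> Idl (a ` ?B)" "v \<in> carrier R" "a r \<otimes> t = b \<oplus> a m \<otimes> v"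
      using Idl_insert[OF ac[OF m(1)] gc[OF B]] by blast
    have "b \<oplus> a m \<otimes> v \<in> Idl (a ` {..<m})"
      using ideal.I_r_closed[OF Im arm Suc.prems(3)] bv(3) by simp
    then have "a m \<otimes> v \<in> Idl (a ` {..<m})"
      using ideal_add_cancel[OF Im, of b "a m \<otimes> v"] bv(1,2) BIm ac[OF m(1)] by auto
    then have "v \<in> Idl (a ` {..<m})" by (rule reg[OF m(1) bv(2)])
    moreover have "{..<m} = insert r ?B" using r by auto
    ultimately have "v \<in> Idl (insert (a r) (a ` ?B))" by (metis image_insert)
    then obtain b' v' where bv': "b' \<in> Idl (a ` ?B)" "v' \<in> carrier R" "v = b' \<oplus> a r \<otimes> v'"
      using Idl_insert[OF ac gc[OF B], of r v] r m by auto
    have c: "b \<in> carrier R" "b' \<in> carrier R" using bv bv' ideal.Icarr[OF IB] by auto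
    have arc: "a r \<in> carrier R" "a m \<in> carrier R" using ac r m by auto
    \<comment> \<open>Subtracting \<open>a m v'\<close> from \<open>t\<close> removes the part of
      the relation that is a multiple of both \<open>a r\<close> and \<open>a m\<close>; the rest
      lies in the ideal of the others, and the induction hypothesis applies.\<close>
    have "a r \<otimes> (t \<ominus> a m \<otimes> v') = a r \<otimes> t \<ominus> a m \<otimes> (a r \<otimes> v')"
      using arc Suc.prems(3) bv'(2) by algebra
    also have "\<dots> = (b \<oplus> a m \<otimes> (b' \<oplus> a r \<otimes> v')) \<ominus> a m \<otimes> (a r \<otimes> v')" using bv(3) bv'(3) by simp
    also have "\<dots> = b \<oplus> a m \<otimes> b'" using arc c bv'(2) by algebra
    also have "\<dots> \<in> Idl (a ` ?B)"
      using ideal_add[OF IB bv(1) ideal.I_l_closed[OF IB bv'(1) arc(2)]] .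
    finally have "t \<ominus> a m \<otimes> v' \<in> Idl (a ` {..<m})"
      using r m arc Suc.prems(3) bv'(2) by (intro Suc.IH) auto
    then have 1: "t \<ominus> a m \<otimes> v' \<in> Idl (a ` {..<Suc m})" using mono[of "{..<m}"] by auto
    have IS: "ideal (Idl (a ` {..<Suc m})) R" using Suc.prems by (intro genideal_ideal gc) auto
    have "a m \<in> Idl (a ` {..<Suc m})" using genideal_self[OF gc[of "{..<Suc m}"]] Suc.prems by auto
    then have 2: "a m \<otimes> v' \<in> Idl (a ` {..<Suc m})" using ideal.I_r_closed[OF IS] bv'(2) by blast
    have "(t \<ominus> a m \<otimes> v') \<oplus> a m \<otimes> v' = t" using arc Suc.prems(3) bv'(2) by algebra
    then show ?thesis using ideal_add[OF IS 1 2] by simp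
  qed
qed simp

text \<open>Only the first factor of a product is decomposed, so the cofactor of \<open>c\<close>
  inherits membership in \<open>J\<close> from the second.\<close>

lemma ideal_prod_insert_split:
  assumes "c \<in> carrier R" "S \<subseteq> carrier R" "ideal J R" "l \<in> (Idl (insert c S)) \<cdot> J"
  shows "\<exists>b\<in>Idl S. \<exists>j\<in>J. l = b \<oplus> c \<otimes> j"
  using assms(4)
proof (induction l rule: ideal_prod.induct)
  case (prod i j)
  note I = genideal_ideal[OF assms(2)]
  obtain u r where ur: "u \<in> Idl S" "r \<in> carrier R" "i = u \<oplus> c \<otimes> r"
    using Idl_insert[OF assms(1,2) prod(1)] by blast
  have cc: "u \<in> carrier R" "j \<in> carrier R" using ur(1) prod(2) ideal.Icarr[OF I] ideal.Icarr[OF assms(3)] by auto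
  have "i \<otimes> j = u \<otimes> j \<oplus> c \<otimes> (r \<otimes> j)" unfolding ur(3) using cc ur(2) assms(1) by algebra
  then show ?case using ideal.I_r_closed[OF I ur(1) cc(2)] ideal.I_l_closed[OF assms(3) prod(2) ur(2)] by blast
next
  case (sum s1 s2)
  note I = genideal_ideal[OF assms(2)]
  obtain b1 j1 b2 j2 where *: "b1 \<in> Idl S" "j1 \<in> J" "s1 = b1 \<oplus> c \<otimes> j1" "b2 \<in> Idl S" "j2 \<in> J" "s2 = b2 \<oplus> c \<otimes> j2"
    using sum by blast
  have cc: "b1 \<in> carrier R" "j1 \<in> carrier R" "b2 \<in> carrier R" "j2 \<in> carrier R"
    using * ideal.Icarr[OF I] ideal.Icarr[OF assms(3)] by auto
  have "s1 \<oplus> s2 = (b1 \<oplus> b2) \<oplus> c \<otimes> (j1 \<oplus> j2)" unfolding * using cc assms(1) by algebra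
  then show ?case using ideal_add[OF I *(1,4)] ideal_add[OF assms(3) *(2,5)] by blast
qed

text \<open>An element of IJ is \<open>b' + a r j\<close> with \<open>j\<close> in J. Comparing
  turns the relation into one for \<open>a r (t - j)\<close>, so \<open>regular_syzygy\<close> gives
  \<open>t - j\<close> in I, which is contained in J.\<close>

lemma regular_product_syzygy:
  fixes a :: "nat \<Rightarrow> 'a"
  assumes a: "a \<in> {..<n} \<rightarrow> carrier R"
    and reg: "\<And>r t. r < n \<Longrightarrow> t \<in> carrier R \<Longrightarrow> a r \<otimes> t \<in> Idl (a ` {..<r}) \<Longrightarrow> t \<in> Idl (a ` {..<r})"
    and m: "m \<le> n" "r < m" and t: "t \<in> carrier R" and b: "b \<in> Idl (a ` ({..<m} - {r}))"
    and l: "a r \<otimes> t \<oplus> b \<in> (Idl (a ` {..<m})) \<cdot> (Idl (a ` {..<n}))"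
  shows "t \<in> Idl (a ` {..<n})"
proof -
  let ?B = "{..<m} - {r}" and ?J = "Idl (a ` {..<n})"
  have gc: "a ` T \<subseteq> carrier R" if "T \<subseteq> {..<n}" for T using a that by auto
  have B: "?B \<subseteq> {..<n}" using m by auto
  note IB = genideal_ideal[OF gc[OF B]] and J = genideal_ideal[OF gc[OF subset_refl]]
  have arc: "a r \<in> carrier R" using a m by auto
  have "{..<m} = insert r ?B" using m by auto
  then have "a r \<otimes> t \<oplus> b \<in> (Idl (insert (a r) (a ` ?B))) \<cdot> ?J" using l by (metis image_insert)
  then obtain b' j where bj: "b' \<in> Idl (a ` ?B)" "j \<in> ?J" "a r \<otimes> t \<oplus> b = b' \<oplus> a r \<otimes> j"
    using ideal_prod_insert_split[OF arc gc[OF B] J] by blast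
  have c: "b \<in> carrier R" "b' \<in> carrier R" "j \<in> carrier R"
    using b bj ideal.Icarr[OF IB] ideal.Icarr[OF J] by auto
  have "a r \<otimes> (t \<ominus> j) = (a r \<otimes> t \<oplus> b) \<ominus> b \<ominus> a r \<otimes> j" using arc t c by algebra
  also have "\<dots> = (b' \<oplus> a r \<otimes> j) \<ominus> b \<ominus> a r \<otimes> j" using bj(3) by simp
  also have "\<dots> = b' \<ominus> b" using arc c by algebra
  finally have "a r \<otimes> (t \<ominus> j) \<in> Idl (a ` ?B)" using ideal_diff[OF IB bj(1) b] by simp
  then have "t \<ominus> j \<in> Idl (a ` {..<m})"
    using t c by (intro regular_syzygy[OF a reg m(2,1)]) auto
  moreover have "Idl (a ` {..<m}) \<subseteq> ?J" using m(1) by (intro genideal_mono gc image_mono) auto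
  ultimately have "t \<ominus> j \<in> ?J" by blast
  then have "(t \<ominus> j) \<oplus> j \<in> ?J" using bj(2) ideal_add[OF J] by blast
  moreover have "(t \<ominus> j) \<oplus> j = t" using t c by algebra
  ultimately show ?thesis by simp
qed

end

section \<open>Cycles modulo IJ in the Koszul complex\<close>

lemma nth_image_lessThan: "r \<le> length xs \<Longrightarrow> (!) xs ` {..<r} = set (take r xs)"
  by (simp add: nth_image[symmetric] lessThan_atLeast0)

context koszul_complex
begin

text \<open>Acyclicity is taken from \<open>ws\<close> and not from \<open>xs\<close>: the
  homotopies of the longer regular sequence act on the complex of \<open>xs\<close>, and their
  composite exceeds its top degree. The iterates belonging to \<open>as\<close> are then excluded by
  \<open>cycle_mod_product\<close>, with \<open>regular_product_syzygy\<close> as the syzygy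
  condition.\<close>

lemma koszul_cycle_split:
  assumes M: "Idl (set xs) = M"
    and ws: "regular_sequence R ws" "set ws \<subseteq> M" "length xs \<le> length ws"
    and as: "regular_sequence R as" "set as \<subseteq> M" and m: "m \<le> length as"
    and z: "z \<in> Pow {..<length xs} \<rightarrow>\<^sub>E carrier R" "z {} \<in> M"
      "kd ((!) xs) z \<in> Pow {..<length xs} \<rightarrow>\<^sub>E (Idl (set (take m as))) \<cdot> (Idl (set as))"
  shows "\<exists>p \<in> Pow {..<length xs} \<rightarrow>\<^sub>E Idl (set (take m as)). \<exists>q \<in> Pow {..<length xs} \<rightarrow>\<^sub>E carrier R.
    z = (\<lambda>S\<in>Pow {..<length xs}. p S \<oplus> kd ((!) xs) q S)"
proof -
  let ?D = "{..<length xs}"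
  have N: "Idl ((!) xs ` ?D) = M" using M nth_image_lessThan[of "length xs" xs] by simp
  interpret F: augmented_complex R form_module "kd ((!) xs)" "\<lambda>I. Pow ?D \<rightarrow>\<^sub>E I" kfil
    "restrict unit (Pow ?D)" "\<lambda>f. f {}" M
    using augmented_complex_forms[OF nth_carrier] unfolding N .
  have hom: "\<exists>s. F.homotopy c s" if "c \<in> M" for c
  proof -
    have "c \<in> Idl ((!) xs ` ?D)" using that N by simp
    then obtain b where "b \<in> ?D \<rightarrow> carrier R" "c = (\<Oplus>i\<in>?D. xs ! i \<otimes> b i)"
      using Idl_image_finsum[OF finite_D nth_carrier] by blast
    then show ?thesis using homotopy_forms[OF nth_carrier, of b] by auto
  qed
  define s where "s c = (SOME s. F.homotopy c s)" for c
  have s: "F.homotopy c (s c)" if "c \<in> M" for c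
    unfolding s_def using hom[OF that] by (rule someI_ex)
  \<comment> \<open>One construction for both sequences: their elements lie in the ideal generated
    by \<open>xs\<close>, so each has a homotopy on the complex of \<open>xs\<close>.\<close>
  have seq: "complex_sequence R form_module (kd ((!) xs)) (\<lambda>I. Pow ?D \<rightarrow>\<^sub>E I) kfil
      (restrict unit (Pow ?D)) (\<lambda>f. f {}) M ((!) vs) (\<lambda>r. s (vs ! r)) (length vs)"
    if vs: "regular_sequence R vs" "set vs \<subseteq> M" for vs
  proof (unfold_locales)
    show "vs ! r \<in> M" "F.homotopy (vs ! r) (s (vs ! r))" if "r < length vs" for r
      using that vs(2) s by (auto simp: subset_iff)
    show "t \<in> Idl ((!) vs ` {..<r})" if "r < length vs" "t \<in> carrier R" "vs ! r \<otimes> t \<in> Idl ((!) vs ` {..<r})" for r t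
      using vs(1) that by (simp add: nth_image_lessThan regular_sequence_def)
  qed
  interpret Wseq: complex_sequence R form_module "kd ((!) xs)" "\<lambda>I. Pow ?D \<rightarrow>\<^sub>E I" kfil
    "restrict unit (Pow ?D)" "\<lambda>f. f {}" M "(!) ws" "\<lambda>r. s (ws ! r)" "length ws"
    by (rule seq[OF ws(1,2)])
  interpret Aseq: complex_sequence R form_module "kd ((!) xs)" "\<lambda>I. Pow ?D \<rightarrow>\<^sub>E I" kfil
    "restrict unit (Pow ?D)" "\<lambda>f. f {}" M "(!) as" "\<lambda>r. s (as ! r)" "length as"
    by (rule seq[OF as])
  have top: "kfil (Suc (length ws)) \<subseteq> {\<zero>\<^bsub>form_module\<^esub>}"
  proof
    fix f assume f: "f \<in> kfil (Suc (length ws))"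
    have "f = (\<lambda>S\<in>Pow ?D. \<zero>)"
    proof (rule PiE_ext[of _ "Pow ?D" "\<lambda>_. carrier R"])
      fix S assume S: "S \<in> Pow ?D"
      then have "card S \<le> length xs" using card_mono[of ?D S] by simp
      then show "f S = (\<lambda>S\<in>Pow ?D. \<zero>) S" using f S ws(3) by (simp add: kfil_def)
    qed (use f in \<open>auto simp: kfil_def\<close>)
    then show "f \<in> {\<zero>\<^bsub>form_module\<^esub>}" by (simp add: form_module_simps)
  qed
  interpret Aseq: acyclic_sequence R form_module "kd ((!) xs)" "\<lambda>I. Pow ?D \<rightarrow>\<^sub>E I" kfil
    "restrict unit (Pow ?D)" "\<lambda>f. f {}" M "(!) as" "\<lambda>r. s (as ! r)" "length as"
    by unfold_locales (rule Wseq.acyclic_of_regular[OF top])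
  have asc: "set as \<subseteq> carrier R" using as(1) by (simp add: regular_sequence_def)
  have asn: "(!) as \<in> {..<length as} \<rightarrow> carrier R" using asc by auto
  have Im: "Idl ((!) as ` {..<m}) = Idl (set (take m as))" "Idl ((!) as ` {..<length as}) = Idl (set as)"
    using nth_image_lessThan[OF m] nth_image_lessThan[of "length as" as] by simp_all
  have mc: "set (take m as) \<subseteq> carrier R" using asc set_take_subset[of m as] by blast
  let ?L = "(Idl (set (take m as))) \<cdot> (Idl (set as))"
  have "z \<in> F.sub_bd (Idl ((!) as ` {..<m}))"
  proof (rule Aseq.cycle_mod_product[OF m])
    show "ideal ?L R" by (intro ideal_prod_is_ideal genideal_ideal mc asc)
    show "?L \<subseteq> Idl ((!) as ` {..<m})"
      unfolding Im using ideal_prod_inter[OF genideal_ideal[OF mc] genideal_ideal[OF asc]] by blast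
    show "t \<in> Idl ((!) as ` {..<length as})"
      if "r < m" "t \<in> carrier R" "b \<in> Idl ((!) as ` ({..<m} - {r}))" "as ! r \<otimes> t \<oplus> b \<in> ?L" for r t b
      by (rule regular_product_syzygy[OF asn Aseq.a_regular m]) (use that in \<open>simp_all add: Im\<close>)
  qed (use z in \<open>auto simp: form_module_simps\<close>)
  then obtain p q where "p \<in> Pow ?D \<rightarrow>\<^sub>E Idl ((!) as ` {..<m})" "q \<in> carrier form_module"
      "z = p \<oplus>\<^bsub>form_module\<^esub> kd ((!) xs) q"
    by (rule F.sub_bdE)
  then show ?thesis unfolding Im form_module_simps by blast
qed

end

section \<open>The homology of the Koszul complex\<close>

text \<open>Zorn's lemma; independence is a condition on finite lists, so it passes to unions of
  chains. The basis is sought inside \<open>V\<close>, which will consist of homogeneous classes,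
  and spanning extends from \<open>V\<close> to the additive group it generates.\<close>

lemma (in ring) exists_independent_spanning:
  assumes K: "subfield K R" and V: "V \<subseteq> carrier R"
  shows "\<exists>B\<subseteq>V. (\<forall>hs. distinct hs \<and> set hs \<subseteq> B \<longrightarrow> independent K hs) \<and>
    (\<forall>h\<in>generate (add_monoid R) V. \<exists>hs. set hs \<subseteq> B \<and> h \<in> Span K hs)"
proof -
  define F where "F = {B. B \<subseteq> V \<and> (\<forall>hs. distinct hs \<and> set hs \<subseteq> B \<longrightarrow> independent K hs)}"
  have "{} \<in> F" by (auto simp: F_def)
  moreover have "\<Union>C \<in> F" if C: "C \<noteq> {}" "subset.chain F C" for C
  proof -
    have "independent K hs" if hs: "distinct hs" "set hs \<subseteq> \<Union>C" for hs
    proof -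
      obtain B where "B \<in> C" "set hs \<subseteq> B"
        using finite_subset_Union_chain[of "set hs" C F] hs C by auto
      then show ?thesis using C(2) hs(1) by (auto simp: F_def pred_on.chain_def)
    qed
    moreover have "\<Union>C \<subseteq> V" using C(2) by (auto simp: F_def pred_on.chain_def)
    ultimately show ?thesis by (auto simp: F_def)
  qed
  ultimately obtain B where "B \<in> F" and max: "\<And>B'. B' \<in> F \<Longrightarrow> B \<subseteq> B' \<Longrightarrow> B' = B"
    using subset_Zorn_nonempty[of F] by blast
  then have B: "B \<subseteq> V" "\<And>hs. distinct hs \<Longrightarrow> set hs \<subseteq> B \<Longrightarrow> independent K hs" by (auto simp: F_def)
  have span: "\<exists>hs. set hs \<subseteq> B \<and> v \<in> Span K hs" if v: "v \<in> V" for v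
  proof (rule ccontr)
    assume n: "\<not> ?thesis"
    have "independent K hs" if hs: "distinct hs" "set hs \<subseteq> insert v B" for hs
    proof (cases "v \<in> set hs")
      case True
      let ?hs = "remove1 v hs"
      have set_hs: "set ?hs = set hs - {v}" "distinct ?hs" using hs(1) by auto
      then have "set ?hs \<subseteq> B" using hs(2) by auto
      then have "v \<notin> Span K ?hs" "independent K ?hs" using n B(2) set_hs by blast+
      then have "independent K (v # ?hs)" using v V by (intro li_Cons) auto
      moreover have "length (v # ?hs) = length hs" using True length_pos_if_in_set[OF True] by (simp add: length_remove1)
      ultimately show ?thesis using independent_same_set[OF K, of "v # ?hs" hs] set_hs True by auto
    qed (use hs B(2) in blast)
    then have "insert v B \<in> F" using v B(1) by (auto simp: F_def)
    then have vB: "v \<in> B" using max by blast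
    have "v \<in> Span K [v]"
      using Span_base_incl[OF K, of "[v]"] v V by auto
    then show False using n vB by (metis empty_set list.simps(15) empty_subsetI insert_subset)
  qed
  have Bc: "set hs \<subseteq> B \<Longrightarrow> set hs \<subseteq> carrier R" for hs using B(1) V by blast
  have "\<exists>hs. set hs \<subseteq> B \<and> h \<in> Span K hs" if "h \<in> generate (add_monoid R) V" for h
    using that
  proof (induction h rule: generate.induct)
    case one
    then show ?case using Span_subgroup_props(2)[OF K, of "[]"] by (intro exI[of _ "[]"]) auto
  next
    case (incl h)
    then show ?case by (rule span)
  next
    case (inv h)
    then obtain hs where "set hs \<subseteq> B" "h \<in> Span K hs" using span by blast
    then show ?case using Span_subgroup_props(4)[OF K Bc] by (auto simp: a_inv_def[symmetric])
  next
    case (eng h1 h2)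
    then obtain hs1 hs2 where *: "set hs1 \<subseteq> B" "h1 \<in> Span K hs1" "set hs2 \<subseteq> B" "h2 \<in> Span K hs2" by blast
    then have "h1 \<in> Span K (hs1 @ hs2)" "h2 \<in> Span K (hs1 @ hs2)"
      using mono_Span_append[OF K, of hs1 hs2] mono_Span_append[OF K, of hs2 hs1] Bc by blast+
    then show ?case
      using Span_subgroup_props(3)[OF K, of "hs1 @ hs2" h1 h2] Bc * by (intro exI[of _ "hs1 @ hs2"]) auto
  qed
  then show ?thesis using B by blast
qed

text \<open>The image is a copy of the field R/N. The target is not assumed commutative, so
  commutativity and inverses are transported from R.\<close>

lemma (in ring_hom_ring) img_is_subfield_of_maximal:
  assumes "cring R" "maximalideal N R" and ker: "\<And>r. r \<in> carrier R \<Longrightarrow> h r = \<zero>\<^bsub>S\<^esub> \<longleftrightarrow> r \<in> N"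
  shows "subfield (h ` carrier R) S"
proof (rule S.subfield_iff(1))
  interpret R: cring R by fact
  have "ring (S\<lparr>carrier := h ` carrier R\<rparr>)"
    using S.subring_is_ring[OF img_is_subring[OF R.carrier_is_subring]] .
  then interpret C0: ring "S\<lparr>carrier := h ` carrier R\<rparr>" .
  have "comm_monoid (S\<lparr>carrier := h ` carrier R\<rparr>)"
  proof (rule C0.monoid_comm_monoidI)
    fix a b assume "a \<in> carrier (S\<lparr>carrier := h ` carrier R\<rparr>)" "b \<in> carrier (S\<lparr>carrier := h ` carrier R\<rparr>)"
    then obtain a' b' where ab: "a' \<in> carrier R" "b' \<in> carrier R" "a = h a'" "b = h b'" by auto
    have "h a' \<otimes>\<^bsub>S\<^esub> h b' = h b' \<otimes>\<^bsub>S\<^esub> h a'"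
      using hom_mult[OF ab(1,2)] hom_mult[OF ab(2,1)] R.m_comm[OF ab(1,2)] by metis
    then show "a \<otimes>\<^bsub>S\<lparr>carrier := h ` carrier R\<rparr>\<^esub> b = b \<otimes>\<^bsub>S\<lparr>carrier := h ` carrier R\<rparr>\<^esub> a"
      using ab(3,4) by simp
  qed
  then interpret C: cring "S\<lparr>carrier := h ` carrier R\<rparr>"
    by (intro cring.intro C0.ring_axioms)
  show "field (S\<lparr>carrier := h ` carrier R\<rparr>)"
  proof (rule C.cring_fieldI2)
    have "\<one>\<^bsub>R\<^esub> \<notin> N"
      using ideal.one_imp_carrier[OF maximalideal.axioms(1)] maximalideal.I_notcarr assms(2) by blast
    then show "\<zero>\<^bsub>S\<lparr>carrier := h ` carrier R\<rparr>\<^esub> \<noteq> \<one>\<^bsub>S\<lparr>carrier := h ` carrier R\<rparr>\<^esub>"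
      using ker[of "\<one>\<^bsub>R\<^esub>"] by auto
    fix a assume a: "a \<in> carrier (S\<lparr>carrier := h ` carrier R\<rparr>)" "a \<noteq> \<zero>\<^bsub>S\<lparr>carrier := h ` carrier R\<rparr>\<^esub>"
    then obtain r where r: "r \<in> carrier R" "a = h r" "r \<notin> N" using ker by auto
    obtain r' t where r': "r' \<in> carrier R" "t \<in> N" "r' \<otimes>\<^bsub>R\<^esub> r \<oplus>\<^bsub>R\<^esub> t = \<one>\<^bsub>R\<^esub>"
      using R.maximalideal_inverse[OF assms(2) r(1,3)] by blast
    have t: "t \<in> carrier R" "h t = \<zero>\<^bsub>S\<^esub>"
      using r'(2) ideal.Icarr[OF maximalideal.axioms(1)[OF assms(2)]] ker by auto
    have "h (r' \<otimes>\<^bsub>R\<^esub> r \<oplus>\<^bsub>R\<^esub> t) = h r' \<otimes>\<^bsub>S\<^esub> h r" using r(1) r'(1) t by simp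
    moreover have "h r \<otimes>\<^bsub>S\<^esub> h r' = h r' \<otimes>\<^bsub>S\<^esub> h r"
      using hom_mult[OF r(1) r'(1)] hom_mult[OF r'(1) r(1)] R.m_comm[OF r(1) r'(1)] by metis
    ultimately have "h r \<otimes>\<^bsub>S\<^esub> h r' = \<one>\<^bsub>S\<^esub>" using r'(3) by simp
    then show "\<exists>b\<in>carrier (S\<lparr>carrier := h ` carrier R\<rparr>). a \<otimes>\<^bsub>S\<lparr>carrier := h ` carrier R\<rparr>\<^esub> b = \<one>\<^bsub>S\<lparr>carrier := h ` carrier R\<rparr>\<^esub>"
      using r r' by auto
  qed
qed auto

context exterior_algebra
begin

text \<open>Contraction lowers the degree by one and thus flips the sign in \<open>alt\<close>. As a
  consequence \<open>alt\<close> preserves cycles.\<close>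

lemma kd_alt:
  assumes y: "y \<in> D \<rightarrow> carrier R" and f: "f \<in> forms" and S: "S \<subseteq> D"
  shows "del y (alt f) S = \<ominus> alt (del y f) S"
proof -
  have yi: "y i \<in> carrier R" if "i \<in> D" for i using y that by auto
  note c = formsD[OF con_forms[OF f] S]
  have d: "del y f S \<in> carrier R" by (rule formsD[OF del_forms[OF y f] S])
  have con: "con i (alt f) S = \<ominus> sg (card S) \<otimes> con i f S" if i: "i \<in> D" for i
  proof (cases "i \<in> S")
    case False
    have fi: "f (insert i S) \<in> carrier R" using i S by (intro formsD[OF f]) auto
    have "sg (card (insert i S)) = \<ominus> sg (card S)"
      using False finite_sub[OF S] by (intro sg_parity_neg) simp
    then show ?thesis using False fi by (simp add: con_def alt_def l_minus r_minus m_lcomm)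
  qed (simp add: con_def)
  have "del y (alt f) S = (\<Oplus>i\<in>D. \<ominus> sg (card S) \<otimes> (y i \<otimes> con i f S))"
    unfolding del_def using yi c con by (intro finsum_cong') (auto simp: m_lcomm l_minus r_minus)
  also have "\<dots> = \<ominus> sg (card S) \<otimes> del y f S"
    unfolding del_def using yi c finite_D by (intro finsum_rdistr[symmetric]) auto
  finally show ?thesis using d by (simp add: alt_def l_minus)
qed

lemma alt_alt: "f \<in> forms \<Longrightarrow> S \<subseteq> D \<Longrightarrow> alt (alt f) S = f S"
  using formsD[of f S] by (simp add: alt_def sg_square)

definition trunc :: "nat \<Rightarrow> (nat set \<Rightarrow> 'a) \<Rightarrow> nat set \<Rightarrow> 'a" where
  "trunc k f = (\<lambda>S\<in>Pow D. if card S = k then f S else \<zero>)"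

lemma trunc_closed: "f \<in> Pow D \<rightarrow>\<^sub>E carrier R \<Longrightarrow> trunc k f \<in> Pow D \<rightarrow>\<^sub>E carrier R"
  by (auto simp: trunc_def)

lemma kd_trunc:
  assumes y: "y \<in> D \<rightarrow> carrier R" and f: "f \<in> Pow D \<rightarrow>\<^sub>E carrier R"
  shows "kd y (trunc (Suc k) f) = trunc k (kd y f)"
  unfolding kd_def trunc_def[of k]
proof (rule restrict_ext)
  fix S assume S: "S \<in> Pow D"
  have F: "f \<in> forms" by (rule PiE_forms[OF f])
  have yi: "y i \<in> carrier R" if "i \<in> D" for i using y that by auto
  have con: "con i (trunc (Suc k) f) S = (if card S = k then con i f S else \<zero>)" if i: "i \<in> D" for i
    using i S finite_sub[of S] by (auto simp: con_def trunc_def)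
  have c: "con i f S \<in> carrier R" if "i \<in> D" for i using formsD[OF con_forms[OF F that]] S by simp
  show "del y (trunc (Suc k) f) S = (if card S = k then restrict (del y f) (Pow D) S else \<zero>)"
  proof (cases "card S = k")
    case True
    then show ?thesis
      unfolding del_def using S con yi c by (simp, intro finsum_cong') auto
  next
    case False
    then show ?thesis
      unfolding del_def using S con yi by (simp, intro add.finprod_one_eqI) auto
  qed
qed

end

section \<open>The homology algebra and trivial Massey operations\<close>

context koszul_complex
begin

abbreviation K :: "(nat set \<Rightarrow> 'a) dga" where "K \<equiv> koszul R xs"
abbreviation P :: "nat set set" where "P \<equiv> Pow {..<length xs}"

lemma K_carrier: "carrier K = P \<rightarrow>\<^sub>E carrier R"
  by (rule koszul_simps(1))

lemma K_forms: "f \<in> carrier K \<Longrightarrow> f \<in> forms"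
  by (simp add: koszul_simps PiE_forms)

lemma diff_closed: "f \<in> carrier K \<Longrightarrow> diff K f \<in> carrier K"
  using kd_closed[OF nth_carrier] by (simp add: koszul_diff K_carrier)

lemma diff_add:
  assumes "f \<in> carrier K" "g \<in> carrier K"
  shows "diff K (f \<oplus>\<^bsub>K\<^esub> g) = diff K f \<oplus>\<^bsub>K\<^esub> diff K g"
proof -
  interpret K: ring K by (rule koszul_ring)
  show ?thesis
    using assms kd_add[OF nth_carrier] by (simp add: koszul_diff K.add.m_closed) (simp add: koszul_simps)
qed

lemma diff_diff:
  assumes f: "f \<in> carrier K"
  shows "diff K (diff K f) = \<zero>\<^bsub>K\<^esub>"
proof -
  have c: "kd ((!) xs) f \<in> carrier K" using diff_closed[OF f] koszul_diff[OF f] by simp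
  show ?thesis
    unfolding koszul_diff[OF f] koszul_diff[OF c] using kd_kd[OF nth_carrier] f by (simp add: koszul_simps)
qed

lemma diff_group_hom: "diff K \<in> hom (add_monoid K) (add_monoid K)"
  by (auto simp: hom_def diff_closed diff_add)

lemma diff_zero: "diff K \<zero>\<^bsub>K\<^esub> = \<zero>\<^bsub>K\<^esub>"
proof -
  interpret K: ring K by (rule koszul_ring)
  interpret d: group_hom "add_monoid K" "add_monoid K" "diff K"
    using diff_group_hom K.a_group by (auto intro: group_hom.intro group_hom_axioms.intro)
  show ?thesis using d.hom_one by simp
qed

lemma diff_minus: "f \<in> carrier K \<Longrightarrow> diff K (\<ominus>\<^bsub>K\<^esub> f) = \<ominus>\<^bsub>K\<^esub> diff K f"
proof -
  interpret K: ring K by (rule koszul_ring)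
  interpret d: group_hom "add_monoid K" "add_monoid K" "diff K"
    using diff_group_hom K.a_group by (auto intro: group_hom.intro group_hom_axioms.intro)
  show "f \<in> carrier K \<Longrightarrow> diff K (\<ominus>\<^bsub>K\<^esub> f) = \<ominus>\<^bsub>K\<^esub> diff K f" using d.hom_inv[of f] by (simp add: a_inv_def)
qed

lemma diff_alt:
  assumes f: "f \<in> carrier K" "diff K f = \<zero>\<^bsub>K\<^esub>"
  shows "diff K (restrict (alt f) P) = \<zero>\<^bsub>K\<^esub>"
proof -
  have a: "restrict (alt f) P \<in> carrier K"
    unfolding K_carrier by (intro restrict_forms alt_forms K_forms f)
  have "del ((!) xs) (restrict (alt f) P) S = \<zero>" if S: "S \<in> P" for S
  proof -
    have "del ((!) xs) (restrict (alt f) P) S = del ((!) xs) (alt f) S"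
      using S K_forms[OF f(1)] nth_carrier by (intro del_cong) auto
    also have "\<dots> = \<ominus> alt (del ((!) xs) f) S"
      using S K_forms[OF f(1)] nth_carrier by (intro kd_alt) auto
    also have "del ((!) xs) f S = \<zero>"
      using fun_cong[OF f(2), of S] S by (simp add: koszul_diff[OF f(1)] kd_def koszul_simps)
    then have "\<ominus> alt (del ((!) xs) f) S = \<zero>" by (simp add: alt_def)
    finally show ?thesis .
  qed
  then show ?thesis unfolding koszul_diff[OF a] kd_def koszul_simps(2) by (intro restrict_ext)
qed

lemma cycles_subring: "subring (cycles K) K"
proof -
  interpret K: ring K by (rule koszul_ring)
  have "diff K \<one>\<^bsub>K\<^esub> = \<zero>\<^bsub>K\<^esub>"
    using koszul_diff[OF K.one_closed] kd_unit[OF nth_carrier] by (simp add: koszul_simps)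
  moreover have "f \<otimes>\<^bsub>K\<^esub> g \<in> cycles K" if "f \<in> cycles K" "g \<in> cycles K" for f g
  proof -
    have *: "f \<in> carrier K" "g \<in> carrier K" "diff K f = \<zero>\<^bsub>K\<^esub>" "diff K g = \<zero>\<^bsub>K\<^esub>"
      using that by (auto simp: cycles_def)
    have "restrict (alt f) P \<in> carrier K"
      unfolding K_carrier by (intro restrict_forms alt_forms K_forms *)
    then show ?thesis using * koszul_leibniz[OF *(1,2)] by (simp add: cycles_def)
  qed
  ultimately show ?thesis
    by (intro K.subringI) (auto simp: cycles_def diff_add diff_minus)
qed

lemma boundaries_subset: "boundaries K \<subseteq> cycles K"
  by (auto simp: boundaries_def cycles_def diff_closed diff_diff)

lemma boundaries_ideal: "ideal (boundaries K) (K\<lparr>carrier := cycles K\<rparr>)"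
proof -
  interpret K: ring K by (rule koszul_ring)
  have ring: "ring (K\<lparr>carrier := cycles K\<rparr>)" by (rule K.subring_is_ring[OF cycles_subring])
  have sub: "subgroup (boundaries K) (add_monoid K)"
  proof (rule K.add.subgroupI)
    show "boundaries K \<subseteq> carrier K" by (auto simp: boundaries_def diff_closed)
    show "boundaries K \<noteq> {}" using K.zero_closed by (auto simp: boundaries_def)
    show "\<ominus>\<^bsub>K\<^esub> f \<in> boundaries K" if "f \<in> boundaries K" for f
      using that by (auto simp: boundaries_def diff_minus[symmetric])
    show "f \<oplus>\<^bsub>K\<^esub> g \<in> boundaries K" if "f \<in> boundaries K" "g \<in> boundaries K" for f g
      using that by (auto simp: boundaries_def diff_add[symmetric])
  qed
  show ?thesis
  proof (rule idealI[OF ring])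
    show "subgroup (boundaries K) (add_monoid (K\<lparr>carrier := cycles K\<rparr>))"
      using K.add.subgroup_incl[OF sub subring.axioms(1)[OF cycles_subring] boundaries_subset] by simp
    fix b z assume b: "b \<in> boundaries K" and z: "z \<in> carrier (K\<lparr>carrier := cycles K\<rparr>)"
    obtain q where q: "q \<in> carrier K" "b = diff K q" using b by (auto simp: boundaries_def)
    have zc: "z \<in> carrier K" "diff K z = \<zero>\<^bsub>K\<^esub>" using z by (auto simp: cycles_def)
    have aq: "restrict (alt q) P \<in> carrier K" "restrict (alt z) P \<in> carrier K"
      unfolding K_carrier by (intro restrict_forms alt_forms K_forms q zc)+
    \<comment> \<open>Leibniz rule with \<open>d z = 0\<close>: if \<open>b = d q\<close>, then
      \<open>b z = d (q z)\<close>.\<close>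
    have "b \<otimes>\<^bsub>K\<^esub> z = diff K (q \<otimes>\<^bsub>K\<^esub> z)"
      using koszul_leibniz[OF q(1) zc(1)] zc q aq diff_closed[OF q(1)] by simp
    then show "b \<otimes>\<^bsub>K\<lparr>carrier := cycles K\<rparr>\<^esub> z \<in> boundaries K"
      using q zc by (auto simp: boundaries_def)
    \<comment> \<open>For the other side the sign in the Leibniz rule is undone in advance:
      \<open>alt z\<close> is a cycle and \<open>alt\<close> is an involution, so
      \<open>z b = d (alt z q)\<close>.\<close>
    have "restrict (alt (restrict (alt z) P)) P = z"
    proof (rule PiE_ext[of _ P "\<lambda>_. carrier R"])
      show "restrict (alt (restrict (alt z) P)) P \<in> P \<rightarrow>\<^sub>E carrier R"
        by (intro restrict_forms alt_forms K_forms aq)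
      show "z \<in> P \<rightarrow>\<^sub>E carrier R" using zc K_carrier by simp
      show "restrict (alt (restrict (alt z) P)) P S = z S" if "S \<in> P" for S
        using alt_alt[OF K_forms[OF zc(1)], of S] that by (simp add: alt_def)
    qed
    then have "z \<otimes>\<^bsub>K\<^esub> b = diff K (restrict (alt z) P \<otimes>\<^bsub>K\<^esub> q)"
      using koszul_leibniz[OF aq(2) q(1)] diff_alt[OF zc] zc q diff_closed[OF q(1)] by simp
    then show "z \<otimes>\<^bsub>K\<lparr>carrier := cycles K\<rparr>\<^esub> b \<in> boundaries K"
      using q zc aq by (auto simp: boundaries_def)
  qed
qed

lemma homology_ring_is_ring: "ring (homology_ring K)"
  unfolding homology_ring_def by (rule ideal.quotient_is_ring[OF boundaries_ideal])

lemma hclass_eq: "hclass K z = boundaries K +>\<^bsub>K\<lparr>carrier := cycles K\<rparr>\<^esub> z"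
  by (simp add: hclass_def a_r_coset_def r_coset_def)

lemma hclass_hom: "hclass K \<in> ring_hom (K\<lparr>carrier := cycles K\<rparr>) (homology_ring K)"
  using ideal.rcos_ring_hom[OF boundaries_ideal] by (simp add: homology_ring_def hclass_eq[abs_def, symmetric] fun_eq_iff hclass_eq)

lemma hclass_zero_iff:
  assumes "z \<in> cycles K"
  shows "hclass K z = \<zero>\<^bsub>homology_ring K\<^esub> \<longleftrightarrow> z \<in> boundaries K"
proof -
  interpret I: ideal "boundaries K" "K\<lparr>carrier := cycles K\<rparr>" by (rule boundaries_ideal)
  show ?thesis
    using I.a_rcos_const[of z] I.a_rcos_self[of z] assms
    by (auto simp: homology_ring_def FactRing_def hclass_eq)
qed

definition scalar :: "'a \<Rightarrow> nat set \<Rightarrow> 'a" where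
  "scalar c = (\<lambda>S\<in>P. c \<otimes> unit S)"

lemma scalar_closed: "c \<in> carrier R \<Longrightarrow> scalar c \<in> carrier K"
  unfolding K_carrier scalar_def by (intro restrict_forms smult_forms unit_forms)

lemma scalar_ring_hom: "scalar \<in> ring_hom R (K\<lparr>carrier := cycles K\<rparr>)"
proof -
  interpret K: ring K by (rule koszul_ring)
  interpret F: augmented_complex R form_module "kd ((!) xs)" "\<lambda>I. P \<rightarrow>\<^sub>E I" kfil
    "restrict unit P" "\<lambda>f. f {}" "Idl ((!) xs ` {..<length xs})"
    by (rule augmented_complex_forms[OF nth_carrier])
  have sc: "scalar c = c \<odot>\<^bsub>form_module\<^esub> restrict unit P" for c
    unfolding form_module_simps scalar_def by (rule restrict_ext) simp
  have "diff K (scalar c) = \<zero>\<^bsub>K\<^esub>" if "c \<in> carrier R" for c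
  proof -
    have "kd ((!) xs) (scalar c) = \<zero>\<^bsub>form_module\<^esub>"
      unfolding sc F.d_smult[OF that F.e_closed] F.d_e using that by simp
    then show ?thesis
      unfolding koszul_diff[OF scalar_closed[OF that]] by (simp add: form_module_simps koszul_simps)
  qed
  then have cyc: "scalar c \<in> cycles K" if "c \<in> carrier R" for c
    using that scalar_closed by (simp add: cycles_def)
  show ?thesis
  proof (rule ring_hom_memI)
    fix a b assume ab: "a \<in> carrier R" "b \<in> carrier R"
    show "scalar a \<in> carrier (K\<lparr>carrier := cycles K\<rparr>)" using cyc ab by simp
    have "scalar a \<otimes>\<^bsub>K\<^esub> scalar b = scalar (a \<otimes> b)"
      unfolding koszul_mult[OF scalar_closed[OF ab(1)] scalar_closed[OF ab(2)]]
      unfolding scalar_def[of "a \<otimes> b"]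
    proof (rule restrict_ext)
      fix S assume S: "S \<in> P"
      have "mul (scalar a) (scalar b) S = mul (\<lambda>T. a \<otimes> unit T) (\<lambda>T. b \<otimes> unit T) S"
        using S ab by (intro mul_cong smult_forms unit_forms) (auto simp: scalar_def)
      also have "\<dots> = a \<otimes> (b \<otimes> unit S)"
        using S ab by (simp add: mul_smult_left mul_smult_right mul_unit_left smult_forms)
      finally show "mul (scalar a) (scalar b) S = a \<otimes> b \<otimes> unit S"
        using ab S formsD[OF unit_forms, of S] by (simp add: m_assoc)
    qed
    then show "scalar (a \<otimes> b) = scalar a \<otimes>\<^bsub>K\<lparr>carrier := cycles K\<rparr>\<^esub> scalar b" by simp
    show "scalar (a \<oplus> b) = scalar a \<oplus>\<^bsub>K\<lparr>carrier := cycles K\<rparr>\<^esub> scalar b"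
      using ab formsD[OF unit_forms] by (auto simp: scalar_def koszul_simps l_distr intro!: restrict_ext)
  next
    show "scalar \<one> = \<one>\<^bsub>K\<lparr>carrier := cycles K\<rparr>\<^esub>"
      using formsD[OF unit_forms] by (auto simp: scalar_def koszul_simps intro!: restrict_ext)
  qed
qed

text \<open>The unit coefficient of a boundary lies in the ideal of \<open>xs\<close> by
  \<open>ev_d\<close>, and \<open>N_e\<close> gives the converse. Thus homology in degree zero is R
  modulo this ideal.\<close>

lemma scalar_boundary_iff:
  assumes "c \<in> carrier R"
  shows "scalar c \<in> boundaries K \<longleftrightarrow> c \<in> Idl (set xs)"
proof -
  have N: "Idl ((!) xs ` {..<length xs}) = Idl (set xs)"
    by (simp add: lessThan_atLeast0 nth_image)
  interpret F: augmented_complex R form_module "kd ((!) xs)" "\<lambda>I. P \<rightarrow>\<^sub>E I" kfil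
    "restrict unit P" "\<lambda>f. f {}" "Idl (set xs)"
    using augmented_complex_forms[OF nth_carrier] unfolding N .
  have sc: "scalar c = c \<odot>\<^bsub>form_module\<^esub> restrict unit P"
    unfolding form_module_simps scalar_def by (rule restrict_ext) simp
  have b: "boundaries K = kd ((!) xs) ` carrier form_module"
    unfolding boundaries_def K_carrier form_module_simps
    by (rule image_cong[OF refl]) (simp add: koszul_diff K_carrier)
  show ?thesis
  proof
    assume "scalar c \<in> boundaries K"
    then obtain q where "q \<in> carrier form_module" "scalar c = kd ((!) xs) q" unfolding b by blast
    then have "scalar c {} \<in> Idl (set xs)" using F.ev_d by simp
    then show "c \<in> Idl (set xs)" using assms by (simp add: scalar_def unit_def)
  next
    assume "c \<in> Idl (set xs)"
    then show "scalar c \<in> boundaries K" using F.N_e unfolding b sc by blast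
  qed
qed

lemma homology_0: "homology K 0 = (\<lambda>c. hclass K (scalar c)) ` carrier R"
proof -
  have "cycles K \<inter> hcomp K 0 = scalar ` carrier R"
  proof
    show "scalar ` carrier R \<subseteq> cycles K \<inter> hcomp K 0"
    proof (rule image_subsetI)
      fix c assume c: "c \<in> carrier R"
      have "scalar c \<in> P \<rightarrow>\<^sub>E carrier R" using scalar_closed[OF c] K_carrier by simp
      moreover have "scalar c S = \<zero>" if "S \<in> P" "card S \<noteq> 0" for S
        using that c by (auto simp: scalar_def unit_def)
      ultimately show "scalar c \<in> cycles K \<inter> hcomp K 0"
        using ring_hom_memE(1)[OF scalar_ring_hom c] by (simp add: koszul_simps)
    qed
    show "cycles K \<inter> hcomp K 0 \<subseteq> scalar ` carrier R"
    proof
      fix z assume z: "z \<in> cycles K \<inter> hcomp K 0"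
      then have zP: "z \<in> P \<rightarrow>\<^sub>E carrier R" and z0: "\<And>S. S \<in> P \<Longrightarrow> card S \<noteq> 0 \<Longrightarrow> z S = \<zero>"
        by (auto simp: koszul_simps)
      have z1: "z {} \<in> carrier R" using zP by auto
      have "z = scalar (z {})"
      proof (rule PiE_ext[OF zP])
        show "scalar (z {}) \<in> P \<rightarrow>\<^sub>E carrier R" using scalar_closed[OF z1] K_carrier by simp
        show "z S = scalar (z {}) S" if S: "S \<in> P" for S
        proof (cases "S = {}")
          case False
          then have "card S \<noteq> 0" using S finite_sub[of S] by auto
          then show ?thesis using z0[OF S] S False z1 by (simp add: scalar_def unit_def)
        qed (use z1 in \<open>simp add: scalar_def unit_def\<close>)
      qed
      then show "z \<in> scalar ` carrier R" using z1 by blast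
    qed
  qed
  then show ?thesis by (simp add: homology_def image_image)
qed

lemma homology_0_subfield:
  assumes N: "maximalideal (Idl (set xs)) R"
  shows "subfield (homology K 0) (homology_ring K)"
proof -
  have "(\<lambda>c. hclass K (scalar c)) \<in> ring_hom R (homology_ring K)"
    using ring_hom_trans[OF scalar_ring_hom hclass_hom] by (simp add: comp_def)
  then interpret h: ring_hom_ring R "homology_ring K" "\<lambda>c. hclass K (scalar c)"
    by (intro ring_hom_ringI2 ring_axioms homology_ring_is_ring)
  show ?thesis
    unfolding homology_0
  proof (rule h.img_is_subfield_of_maximal[OF is_cring N])
    fix c assume c: "c \<in> carrier R"
    then have "scalar c \<in> cycles K" using ring_hom_memE(1)[OF scalar_ring_hom] by simp
    then show "hclass K (scalar c) = \<zero>\<^bsub>homology_ring K\<^esub> \<longleftrightarrow> c \<in> Idl (set xs)"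
      using hclass_zero_iff scalar_boundary_iff[OF c] by simp
  qed
qed

text \<open>If every positive homology class has a representative with coefficients in an ideal of square
  zero, then products of representatives vanish, and \<open>\<mu>\<close> can be taken zero on longer words.\<close>

lemma golod_criterion:
  assumes N: "maximalideal (Idl (set xs)) R"
    and I: "ideal I R" "\<And>a b. a \<in> I \<Longrightarrow> b \<in> I \<Longrightarrow> a \<otimes> b = \<zero>"
    and split: "\<And>z. z \<in> carrier K \<Longrightarrow> z {} = \<zero> \<Longrightarrow> diff K z = \<zero>\<^bsub>K\<^esub> \<Longrightarrow>
      \<exists>p\<in>P \<rightarrow>\<^sub>E I. \<exists>q\<in>carrier K. z = p \<oplus>\<^bsub>K\<^esub> diff K q"
  shows "admits_trivial_massey_operation K"
proof -
  interpret K: ring K by (rule koszul_ring)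
  interpret H: ring "homology_ring K" by (rule homology_ring_is_ring)
  interpret I: ideal I R by (rule I(1))
  interpret bd: ideal "boundaries K" "K\<lparr>carrier := cycles K\<rparr>" by (rule boundaries_ideal)
  define V where "V = (\<Union>i\<in>{1..}. homology K i)"
  have "V \<subseteq> carrier (homology_ring K)"
    using ring_hom_memE(1)[OF hclass_hom] by (auto simp: V_def homology_def)
  then obtain B where B: "B \<subseteq> V" "\<forall>hs. distinct hs \<and> set hs \<subseteq> B \<longrightarrow> H.independent (homology K 0) hs"
      "\<forall>h\<in>generate (add_monoid (homology_ring K)) V. \<exists>hs. set hs \<subseteq> B \<and> h \<in> H.Span (homology K 0) hs"
    using H.exists_independent_spanning[OF homology_0_subfield[OF N]] by metis
  have basis: "homogeneous_basis K B"
    using B by (simp add: homogeneous_basis_def positive_homology_def V_def)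
  have rep: "\<exists>p. p \<in> P \<rightarrow>\<^sub>E I \<and> p \<in> (\<Union>i. hcomp K i) \<and> p \<in> cycles K \<and> hclass K p = h" if h: "h \<in> B" for h
  proof -
    obtain i z where i: "i \<ge> 1" and z: "z \<in> cycles K" "z \<in> hcomp K i" "h = hclass K z"
      using h B(1) by (auto simp: V_def homology_def)
    have zc: "z \<in> carrier K" "diff K z = \<zero>\<^bsub>K\<^esub>" using z by (auto simp: cycles_def)
    have zi: "z S = \<zero>" if "S \<in> P" "card S \<noteq> i" for S using z(2) that by (auto simp: koszul_simps)
    then have "z {} = \<zero>" using i by auto
    then obtain p q where p: "p \<in> P \<rightarrow>\<^sub>E I" and q: "q \<in> carrier K" and zpq: "z = p \<oplus>\<^bsub>K\<^esub> diff K q"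
      using split[OF zc(1) _ zc(2)] by blast
    \<comment> \<open>The values of the Massey operation must be homogeneous, but
      \<open>split\<close> gives arbitrary \<open>p\<close> and \<open>q\<close>. As
      \<open>z\<close> has degree \<open>i\<close>, \<open>p\<close> may be cut down to degree
      \<open>i\<close> and \<open>q\<close> to degree \<open>i + 1\<close>.\<close>
    have tq: "trunc (Suc i) q \<in> carrier K" using trunc_closed q by (simp add: K_carrier)
    have pI: "trunc i p \<in> P \<rightarrow>\<^sub>E I" using p by (auto simp: trunc_def)
    then have pc: "trunc i p \<in> carrier K" unfolding K_carrier using I.Icarr by (auto simp: PiE_iff)
    have dq: "diff K (trunc (Suc i) q) = trunc i (diff K q)"
      using kd_trunc[OF nth_carrier] q by (simp add: koszul_diff[OF q] koszul_diff[OF tq] K_carrier)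
    have z_eq: "z = trunc i p \<oplus>\<^bsub>K\<^esub> diff K (trunc (Suc i) q)"
    proof (rule PiE_ext[of _ P "\<lambda>_. carrier R"])
      show "z \<in> P \<rightarrow>\<^sub>E carrier R" "trunc i p \<oplus>\<^bsub>K\<^esub> diff K (trunc (Suc i) q) \<in> P \<rightarrow>\<^sub>E carrier R"
        using zc(1) K.a_closed[OF pc diff_closed[OF tq]] by (simp_all only: K_carrier)
      fix S assume S: "S \<in> P"
      show "z S = (trunc i p \<oplus>\<^bsub>K\<^esub> diff K (trunc (Suc i) q)) S"
      proof (cases "card S = i")
        case True
        then show ?thesis using fun_cong[OF zpq, of S] S unfolding dq by (simp add: koszul_simps trunc_def)
      next
        case False
        then show ?thesis using zi[OF S] S unfolding dq by (simp add: koszul_simps trunc_def)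
      qed
    qed
    have dtq: "diff K (trunc (Suc i) q) \<in> boundaries K" using tq by (auto simp: boundaries_def)
    have "\<zero>\<^bsub>K\<^esub> = diff K (trunc i p) \<oplus>\<^bsub>K\<^esub> \<zero>\<^bsub>K\<^esub>"
      using zc(2) diff_diff[OF tq] pc diff_closed[OF tq] unfolding z_eq by (simp add: diff_add)
    then have cyc: "trunc i p \<in> cycles K" using pc diff_closed[OF pc] by (simp add: cycles_def)
    have "hclass K z = hclass K (trunc i p)"
    proof -
      have "z \<in> boundaries K +>\<^bsub>K\<lparr>carrier := cycles K\<rparr>\<^esub> trunc i p"
        using dtq z_eq K.a_comm[OF pc diff_closed[OF tq]] by (auto simp: a_r_coset_def r_coset_def)
      then show ?thesis
        using bd.a_repr_independence'[of z "trunc i p"] cyc by (simp add: hclass_eq)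
    qed
    moreover have "trunc i p \<in> hcomp K i" using pc by (auto simp: koszul_simps trunc_def)
    ultimately show ?thesis using pI cyc z(3) by blast
  qed
  define r where "r h = (SOME p. p \<in> P \<rightarrow>\<^sub>E I \<and> p \<in> (\<Union>i. hcomp K i) \<and> p \<in> cycles K \<and> hclass K p = h)" for h
  have r: "r h \<in> P \<rightarrow>\<^sub>E I" "r h \<in> (\<Union>i. hcomp K i)" "r h \<in> cycles K" "hclass K (r h) = h" if "h \<in> B" for h
    using someI_ex[OF rep[OF that]] unfolding r_def by blast+
  define \<mu> where "\<mu> w = (case w of [h] \<Rightarrow> r h | _ \<Rightarrow> \<zero>\<^bsub>K\<^esub>)" for w
  have zero_I: "\<zero>\<^bsub>K\<^esub> \<in> P \<rightarrow>\<^sub>E I" by (auto simp: koszul_simps)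
  have \<mu>_I: "\<mu> w \<in> P \<rightarrow>\<^sub>E I" if "w \<in> lists B" for w
  proof -
    have "\<mu> w = \<zero>\<^bsub>K\<^esub> \<or> (\<exists>h. w = [h] \<and> \<mu> w = r h)" by (auto simp: \<mu>_def split: list.splits)
    then show ?thesis
    proof (elim disjE exE conjE)
      fix h assume "w = [h]" "\<mu> w = r h"
      then show ?thesis using that r(1)[of h] by simp
    qed (use zero_I in simp)
  qed
  have I_K: "f \<in> P \<rightarrow>\<^sub>E I \<Longrightarrow> f \<in> carrier K" for f
    unfolding K_carrier using I.Icarr by (auto simp: PiE_iff)
  have minus_I: "\<ominus>\<^bsub>K\<^esub> f \<in> P \<rightarrow>\<^sub>E I" if f: "f \<in> P \<rightarrow>\<^sub>E I" for f
  proof -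
    have "(\<lambda>S\<in>P. \<ominus> f S) \<in> carrier K" using f I.Icarr by (auto simp: K_carrier PiE_iff)
    moreover have "f \<oplus>\<^bsub>K\<^esub> (\<lambda>S\<in>P. \<ominus> f S) = \<zero>\<^bsub>K\<^esub>"
      using PiE_mem[OF f] I.Icarr by (auto simp: koszul_simps r_neg intro!: restrict_ext)
    ultimately have "\<ominus>\<^bsub>K\<^esub> f = (\<lambda>S\<in>P. \<ominus> f S)"
      using I_K[OF f] by (intro K.minus_equality) (simp_all add: K.a_comm)
    then show ?thesis using f by (auto simp: PiE_iff)
  qed
  have mult_zero: "f \<otimes>\<^bsub>K\<^esub> g = \<zero>\<^bsub>K\<^esub>" if f: "f \<in> P \<rightarrow>\<^sub>E I" and g: "g \<in> P \<rightarrow>\<^sub>E I" for f g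
    unfolding koszul_mult[OF I_K[OF f] I_K[OF g]] koszul_simps(2)
  proof (rule restrict_ext)
    fix S assume S: "S \<in> P"
    have "f T \<otimes> g (S - T) = \<zero>" if "T \<in> Pow S" for T
      using S that by (intro I(2) PiE_mem[OF f] PiE_mem[OF g]) auto
    then show "mul f g S = \<zero>" unfolding mul_def by (intro add.finprod_one_eqI) simp
  qed
  have "trivial_massey_operation K B \<mu>"
    unfolding trivial_massey_operation_def
  proof (intro conjI ballI impI)
    fix w assume w: "w \<in> lists B"
    have "\<zero>\<^bsub>K\<^esub> \<in> hcomp K 0" by (auto simp: koszul_simps)
    then show "\<mu> w \<in> (\<Union>i. hcomp K i)"
      using w r(2) by (auto simp: \<mu>_def split: list.splits)
    assume l: "2 \<le> length w"
    then have "\<mu> w = \<zero>\<^bsub>K\<^esub>" by (auto simp: \<mu>_def split: list.splits)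
    moreover have "(\<Oplus>\<^bsub>K\<^esub>j\<in>{1..length w - 1}. bar K (\<mu> (take j w)) \<otimes>\<^bsub>K\<^esub> \<mu> (drop j w)) = \<zero>\<^bsub>K\<^esub>"
    proof (rule K.add.finprod_one_eqI)
      fix j
      have td: "take j w \<in> lists B" "drop j w \<in> lists B"
        using w set_take_subset[of j w] set_drop_subset[of j w] by (auto simp: in_lists_conv_set)
      have "bar K (\<mu> (take j w)) \<in> P \<rightarrow>\<^sub>E I"
        using \<mu>_I[OF td(1)] minus_I by (simp add: bar_def)
      then show "bar K (\<mu> (take j w)) \<otimes>\<^bsub>K\<^esub> \<mu> (drop j w) = \<zero>\<^bsub>K\<^esub>" using mult_zero \<mu>_I[OF td(2)] by blast
    qed
    ultimately show "diff K (\<mu> w) = (\<Oplus>\<^bsub>K\<^esub>j\<in>{1..length w - 1}. bar K (\<mu> (take j w)) \<otimes>\<^bsub>K\<^esub> \<mu> (drop j w))"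
      by (simp add: diff_zero)
  qed (use r(3,4) in \<open>auto simp: \<mu>_def\<close>)
  then show ?thesis using basis by (auto simp: admits_trivial_massey_operation_def)
qed

end

section \<open>Golod quotients\<close>

lemma (in ring_hom_ring) img_genideal:
  assumes A: "A \<subseteq> carrier R"
  shows "h ` (Idl\<^bsub>R\<^esub> A) \<subseteq> Idl\<^bsub>S\<^esub> (h ` A)"
proof -
  have hA: "h ` A \<subseteq> carrier S" using A by auto
  have "Idl\<^bsub>R\<^esub> A \<subseteq> {r \<in> carrier R. h r \<in> Idl\<^bsub>S\<^esub> (h ` A)}"
    using A S.genideal_self[OF hA]
    by (intro R.genideal_minimal ideal_vimage S.genideal_ideal[OF hA]) auto
  then show ?thesis by auto
qed

lemma carrier_quotient: "carrier (R Quot L) = (+>\<^bsub>R\<^esub>) L ` carrier R"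
  unfolding FactRing_def partial_object.simps A_RCOSETS_def' by blast

text \<open>Membership of products is extended from generators one factor at a time, since the
  elements multiplying a fixed one into an ideal form an ideal. In the graded case this exhibits
  homogeneous generators of IJ.\<close>

lemma (in cring) ideal_prod_genideal:
  assumes S: "S \<subseteq> carrier R" and T: "T \<subseteq> carrier R"
  shows "(Idl S) \<cdot> (Idl T) = Idl {s \<otimes> t | s t. s \<in> S \<and> t \<in> T}" (is "_ = Idl ?P")
proof
  have P: "?P \<subseteq> carrier R" using S T by auto
  note IP = genideal_ideal[OF P] and IS = genideal_ideal[OF S] and IT = genideal_ideal[OF T]
  have 1: "i \<otimes> t \<in> Idl ?P" if "i \<in> Idl S" "t \<in> T" for i t
  proof -
    have "Idl S \<subseteq> {r \<in> carrier R. r \<otimes> t \<in> Idl ?P}"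
    proof (rule genideal_minimal[OF colon_ideal[OF IP]])
      show "t \<in> carrier R" using that T by auto
      show "S \<subseteq> {r \<in> carrier R. r \<otimes> t \<in> Idl ?P}" using S that genideal_self[OF P] by auto
    qed
    then show ?thesis using that by auto
  qed
  have 2: "i \<otimes> j \<in> Idl ?P" if i: "i \<in> Idl S" and j: "j \<in> Idl T" for i j
  proof -
    have ic: "i \<in> carrier R" by (rule ideal.Icarr[OF IS i])
    have "Idl T \<subseteq> {r \<in> carrier R. r \<otimes> i \<in> Idl ?P}"
    proof (rule genideal_minimal[OF colon_ideal[OF IP ic]])
      show "T \<subseteq> {r \<in> carrier R. r \<otimes> i \<in> Idl ?P}" using T 1[OF i] ic by (auto simp: m_comm[of _ i])
    qed
    then show ?thesis using j ic ideal.Icarr[OF IT j] by (auto simp: m_comm[of i j])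
  qed
  show "(Idl S) \<cdot> (Idl T) \<subseteq> Idl ?P"
  proof
    fix x assume "x \<in> (Idl S) \<cdot> (Idl T)"
    then show "x \<in> Idl ?P"
      by (induction x rule: ideal_prod.induct) (auto intro: 2 ideal_add[OF IP])
  qed
  have "?P \<subseteq> (Idl S) \<cdot> (Idl T)"
    using genideal_self[OF S] genideal_self[OF T] by (auto intro!: ideal_prod.prod)
  then show "Idl ?P \<subseteq> (Idl S) \<cdot> (Idl T)"
    by (intro genideal_minimal ideal_prod_is_ideal IS IT)
qed

context ring_hom_cring
begin

lemma hom_sg: "h (R.sg n) = S.sg n"
  by (simp add: R.sg_def S.sg_def)

lemma hom_del:
  assumes "finite D" "y \<in> D \<rightarrow> carrier R" "f \<in> exterior_algebra.forms R D"
    and T: "T \<subseteq> D" and y': "\<And>i. i \<in> D \<Longrightarrow> y' i = h (y i)" and f': "\<And>U. U \<subseteq> D \<Longrightarrow> f' U = h (f U)"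
  shows "exterior_algebra.del S D y' f' T = h (exterior_algebra.del R D y f T)"
proof -
  interpret RE: exterior_algebra R D using assms by unfold_locales
  interpret SE: exterior_algebra S D using assms by unfold_locales
  have yi: "y i \<in> carrier R" if "i \<in> D" for i using assms(2) that by auto
  have fU: "f U \<in> carrier R" if "U \<subseteq> D" for U using RE.formsD[OF assms(3) that] .
  have con: "SE.con i f' T = h (RE.con i f T)" if "i \<in> D" for i
    using that T f'[of "insert i T"] fU[of "insert i T"] by (simp add: SE.con_def RE.con_def hom_sg)
  have c: "RE.con i f T \<in> carrier R" if "i \<in> D" for i
    using RE.formsD[OF RE.con_forms[OF assms(3) that] T] .
  have "h (RE.del y f T) = finsum S (h \<circ> (\<lambda>i. y i \<otimes>\<^bsub>R\<^esub> RE.con i f T)) D"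
    unfolding RE.del_def using yi c by (intro hom_finsum) auto
  also have "\<dots> = SE.del y' f' T"
    unfolding SE.del_def using yi c con y' by (intro S.finsum_cong') auto
  finally show ?thesis by simp
qed

end

section \<open>Passage to the quotient by IJ\<close>

context nakayama_ring
begin

lemma exists_minimal_generators:
  assumes "cring A" "finite V" "V \<subseteq> H'" "V \<subseteq> carrier A" "Idl\<^bsub>A\<^esub> V = N"
  shows "\<exists>xs. minimal_generators A H' N xs"
proof -
  define Q where "Q Z \<longleftrightarrow> Z \<subseteq> V \<and> Idl\<^bsub>A\<^esub> Z = N" for Z
  have "Q V" using assms by (simp add: Q_def)
  then obtain Z where Z: "Q Z" and min: "\<And>Z'. Q Z' \<Longrightarrow> card Z \<le> card Z'"
    using ex_has_least_nat[of Q V card] by blast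
  have finZ: "finite Z" using Z assms(2) by (auto simp: Q_def intro: finite_subset)
  then obtain xs where xs: "set xs = Z" "distinct xs" using finite_distinct_list by blast
  have "Idl\<^bsub>A\<^esub> T \<noteq> N" if "T \<subset> Z" for T
    using min[of T] psubset_card_mono[OF finZ that] that Z by (auto simp: Q_def)
  then show ?thesis
    using xs Z assms(3) by (intro exI[of _ xs]) (auto simp: minimal_generators_def Q_def)
qed

text \<open>The local and the graded case at once. A cycle of positive degree over the quotient is
  lifted coefficientwise, split over R by \<open>koszul_cycle_split\<close>, and the splitting is
  mapped back; the image of I has square zero, so \<open>golod_criterion\<close> applies.\<close>

theorem golod_quotient:
  assumes H_mult: "\<And>a b. a \<in> H \<Longrightarrow> b \<in> H \<Longrightarrow> a \<otimes> b \<in> H"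
    and ws: "regular_sequence R ws" "set ws \<subseteq> M" "card W \<le> length ws"
    and as: "regular_sequence R as" "set as \<subseteq> H" "set as \<subseteq> M" and m: "m \<le> length as"
    and L: "L = (Idl (set (take m as))) \<cdot> (Idl (set as))"
  shows "golod (R Quot L) ((+>) L ` H) ((+>) L ` M)"
proof -
  let ?A = "R Quot L" and ?\<pi> = "(+>) L" and ?I = "Idl (set (take m as))" and ?J = "Idl (set as)"
  have asc: "set as \<subseteq> carrier R" using as(1) by (simp add: regular_sequence_def)
  have mc: "set (take m as) \<subseteq> carrier R" "set (take m as) \<subseteq> set as" using asc set_take_subset[of m as] by auto
  note I = genideal_ideal[OF mc(1)] and J = genideal_ideal[OF asc]
  have IJ: "?I \<subseteq> ?J" using genideal_mono[OF asc mc(2)] .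
  have Li: "ideal L R" unfolding L by (rule ideal_prod_is_ideal[OF I J])
  \<comment> \<open>The products of the generators lie both in \<open>H\<close> and in the square of
    M, as the lifting of minimal generators requires.\<close>
  define T where "T = {s \<otimes> t | s t. s \<in> set (take m as) \<and> t \<in> set as}"
  have LT: "L = Idl T" unfolding L T_def by (rule ideal_prod_genideal[OF mc(1) asc])
  have TH: "T \<subseteq> H" using H_mult as(2) mc(2) by (auto simp: T_def)
  have TM: "T \<subseteq> M \<cdot> M" using as(3) mc(2) by (auto simp: T_def intro!: ideal_prod.prod)
  have Tc: "T \<subseteq> carrier R" using TH H_carrier by auto
  have LM: "L \<subseteq> M"
    using TM square_subset unfolding LT by (intro genideal_minimal[OF M_ideal]) auto
  have Mc: "M \<subseteq> carrier R" by (rule ideal_subset[OF M_ideal])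
  interpret \<pi>: ring_hom_cring R ?A ?\<pi> by (rule ideal.rcos_ring_hom_cring[OF Li is_cring])
  have surj: "carrier ?A = ?\<pi> ` carrier R" by (rule carrier_quotient)
  have \<pi>_eq: "?\<pi> x = ?\<pi> y \<longleftrightarrow> x \<ominus> y \<in> L" if "x \<in> carrier R" "y \<in> carrier R" for x y
    using quotient_eq_iff_same_a_r_cos[OF Li that] by simp
  have \<pi>_zero: "?\<pi> x = \<zero>\<^bsub>?A\<^esub> \<longleftrightarrow> x \<in> L" if "x \<in> carrier R" for x
    using \<pi>_eq[OF that zero_closed] that by (simp add: minus_eq)
  have \<pi>_mem: "x \<in> B" if B: "ideal B R" "L \<subseteq> B" and x: "x \<in> carrier R" "?\<pi> x \<in> ?\<pi> ` B" for B x
  proof -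
    obtain b where b: "b \<in> B" "?\<pi> x = ?\<pi> b" using x by auto
    have bc: "b \<in> carrier R" by (rule ideal.Icarr[OF B(1) b(1)])
    have "(x \<ominus> b) \<oplus> b \<in> B" using b \<pi>_eq[OF x(1) bc] B(2) by (intro ideal_add[OF B(1)]) auto
    moreover have "(x \<ominus> b) \<oplus> b = x" using x(1) bc by algebra
    ultimately show ?thesis by simp
  qed
  \<comment> \<open>Including generators of \<open>L\<close> makes \<open>Idl (S \<union> T)\<close>
    the full preimage, so that equality of ideals can be tested in R.\<close>
  have \<pi>_Idl: "Idl\<^bsub>?A\<^esub> (?\<pi> ` S) = ?\<pi> ` (Idl (S \<union> T))" if S: "S \<subseteq> carrier R" for S
  proof
    have ST: "S \<union> T \<subseteq> carrier R" using S Tc by auto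
    note IST = genideal_ideal[OF ST]
    show "Idl\<^bsub>?A\<^esub> (?\<pi> ` S) \<subseteq> ?\<pi> ` (Idl (S \<union> T))"
      using genideal_self[OF ST] by (intro \<pi>.S.genideal_minimal ring_ideal_imp_quot_ideal[OF Li IST]) auto
    have \<pi>S: "?\<pi> ` S \<subseteq> carrier ?A" using S surj by auto
    have "?\<pi> ` (S \<union> T) \<subseteq> Idl\<^bsub>?A\<^esub> (?\<pi> ` S)"
    proof
      fix y assume "y \<in> ?\<pi> ` (S \<union> T)"
      then consider "y \<in> ?\<pi> ` S" | x where "x \<in> T" "y = ?\<pi> x" by blast
      then show "y \<in> Idl\<^bsub>?A\<^esub> (?\<pi> ` S)"
      proof cases
        case 1
        then show ?thesis using \<pi>.S.genideal_self[OF \<pi>S] by blast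
      next
        case 2
        then have "x \<in> L" "x \<in> carrier R" using LT Tc genideal_self[OF Tc] by auto
        then have "y = \<zero>\<^bsub>?A\<^esub>" using \<pi>_zero 2(2) by simp
        then show ?thesis
          using additive_subgroup.zero_closed[OF ideal.axioms(1)[OF \<pi>.S.genideal_ideal[OF \<pi>S]]] by simp
      qed
    qed
    then have "Idl\<^bsub>?A\<^esub> (?\<pi> ` (S \<union> T)) \<subseteq> Idl\<^bsub>?A\<^esub> (?\<pi> ` S)"
      by (rule \<pi>.S.genideal_minimal[OF \<pi>.S.genideal_ideal[OF \<pi>S]])
    then show "?\<pi> ` (Idl (S \<union> T)) \<subseteq> Idl\<^bsub>?A\<^esub> (?\<pi> ` S)"
      using ring_hom_ring.img_genideal[OF ideal.rcos_ring_hom_ring[OF Li] ST] by blast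
  qed
  have gen_iff: "Idl\<^bsub>?A\<^esub> (?\<pi> ` S) = ?\<pi> ` M \<longleftrightarrow> Idl (S \<union> T) = M" if S: "S \<subseteq> carrier R" for S
  proof
    have ST: "S \<union> T \<subseteq> carrier R" using S Tc by auto
    note IST = genideal_ideal[OF ST]
    have LST: "L \<subseteq> Idl (S \<union> T)" unfolding LT using ST by (intro genideal_mono) auto
    show "Idl\<^bsub>?A\<^esub> (?\<pi> ` S) = ?\<pi> ` M" if "Idl (S \<union> T) = M" using \<pi>_Idl[OF S] that by simp
    assume "Idl\<^bsub>?A\<^esub> (?\<pi> ` S) = ?\<pi> ` M"
    then have eq: "?\<pi> ` (Idl (S \<union> T)) = ?\<pi> ` M" using \<pi>_Idl[OF S] by simp
    show "Idl (S \<union> T) = M"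
    proof
      show "Idl (S \<union> T) \<subseteq> M"
      proof
        fix x assume x: "x \<in> Idl (S \<union> T)"
        show "x \<in> M"
          by (rule \<pi>_mem[OF M_ideal LM ideal.Icarr[OF IST x]]) (use x eq in blast)
      qed
      show "M \<subseteq> Idl (S \<union> T)"
      proof
        fix x assume x: "x \<in> M"
        show "x \<in> Idl (S \<union> T)"
          by (rule \<pi>_mem[OF IST LST ideal.Icarr[OF M_ideal x]]) (use x eq in blast)
      qed
    qed
  qed
  have Wc: "W \<subseteq> carrier R" using W(2) H_carrier by auto
  have "Idl (W \<union> T) = M"
  proof
    have "W \<subseteq> M" using W(3) genideal_self[OF Wc] by simp
    then show "Idl (W \<union> T) \<subseteq> M" using TM square_subset by (intro genideal_minimal[OF M_ideal]) auto
    show "M \<subseteq> Idl (W \<union> T)" using W(3) Wc Tc genideal_mono[of "W \<union> T" W] by auto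
  qed
  then have "Idl\<^bsub>?A\<^esub> (?\<pi> ` W) = ?\<pi> ` M" using gen_iff[OF Wc] by simp
  then have ex: "\<exists>xs. minimal_generators ?A (?\<pi> ` H) (?\<pi> ` M) xs"
    using W Wc surj by (intro exists_minimal_generators[of ?A "?\<pi> ` W"] \<pi>.S.is_cring) auto
  have max: "maximalideal (?\<pi> ` M) ?A"
  proof (rule maximalidealI)
    show "ideal (?\<pi> ` M) ?A" by (rule ring_ideal_imp_quot_ideal[OF Li M_ideal])
    have "\<one> \<notin> M" using ideal.one_imp_carrier[OF M_ideal] maximalideal.I_notcarr[OF maximal_M] by auto
    then have "?\<pi> \<one> \<notin> ?\<pi> ` M" using \<pi>_mem[OF M_ideal LM, of \<one>] by auto
    then show "carrier ?A \<noteq> ?\<pi> ` M" using imageI[OF one_closed, of ?\<pi>] surj by blast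
    fix B assume B: "ideal B ?A" "?\<pi> ` M \<subseteq> B" "B \<subseteq> carrier ?A"
    let ?V = "{r \<in> carrier R. ?\<pi> r \<in> B}"
    have "?V = M \<or> ?V = carrier R"
      using ring_hom_ring.ideal_vimage[OF ideal.rcos_ring_hom_ring[OF Li] B(1)] B(2) Mc by (intro maximalideal.I_maximal[OF maximal_M]) auto
    moreover have "B = ?\<pi> ` ?V" using B(3) surj by auto
    ultimately show "B = ?\<pi> ` M \<or> B = carrier ?A" unfolding surj by (elim disjE) simp_all
  qed
  have "admits_trivial_massey_operation (koszul ?A xs)"
    if mg: "minimal_generators ?A (?\<pi> ` H) (?\<pi> ` M) xs" for xs
  proof -
    have xs: "distinct xs" "set xs \<subseteq> ?\<pi> ` H" "Idl\<^bsub>?A\<^esub> (set xs) = ?\<pi> ` M"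
        "\<And>S. S \<subset> set xs \<Longrightarrow> Idl\<^bsub>?A\<^esub> S \<noteq> ?\<pi> ` M"
      using mg by (auto simp: minimal_generators_def)
    \<comment> \<open>The lifts are chosen in \<open>H\<close>, hence homogeneous in the graded
      case, so that \<open>irredundant_generators\<close> applies to them.\<close>
    define g where "g x = (SOME y. y \<in> H \<and> ?\<pi> y = x)" for x
    have g: "g x \<in> H \<and> ?\<pi> (g x) = x" if "x \<in> set xs" for x
      unfolding g_def by (rule someI_ex) (use that xs(2) in auto)
    define ys where "ys = map g xs"
    have len: "length ys = length xs" by (simp add: ys_def)
    have ysH: "set ys \<subseteq> H" using g by (auto simp: ys_def)
    have ysc: "set ys \<subseteq> carrier R" using ysH H_carrier by auto
    have \<pi>_ys: "?\<pi> (ys ! i) = xs ! i" if "i < length xs" for i using g that by (simp add: ys_def)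
    have \<pi>_set: "?\<pi> ` set ys = set xs" using g by (force simp: ys_def)
    have inj: "inj_on ?\<pi> (set ys)" using g by (auto simp: ys_def inj_on_def)
    have gen: "Idl (set ys \<union> T) = M" using gen_iff[OF ysc] xs(3) \<pi>_set by simp
    have irr: "Idl (set ys - {y} \<union> T) \<noteq> M" if y: "y \<in> set ys" for y
    proof
      assume "Idl (set ys - {y} \<union> T) = M"
      then have "Idl\<^bsub>?A\<^esub> (?\<pi> ` (set ys - {y})) = ?\<pi> ` M"
        using gen_iff[of "set ys - {y}"] ysc by auto
      moreover have "?\<pi> ` (set ys - {y}) = set xs - {?\<pi> y}"
        using inj_on_image_set_diff[OF inj, of "set ys" "{y}"] y \<pi>_set by simp
      moreover have "set xs - {?\<pi> y} \<subset> set xs" using y \<pi>_set by blast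
      ultimately show False using xs(4) by metis
    qed
    \<comment> \<open>The lifts generate M, and their number is at most \<open>card W\<close>, hence
      at most the length of \<open>ws\<close>; this is the bound that makes the Koszul complex over
      R acyclic.\<close>
    have Idl_ys: "Idl (set ys) = M" and card: "card (set ys) \<le> card W"
      using irredundant_generators[OF _ ysH TM gen irr] by auto
    have "length ys = card (set ys)"
      using xs(1) \<pi>_set card_image[OF inj] len by (metis distinct_card)
    then have len_ws: "length ys \<le> length ws" using card ws(3) by simp
    have xsc: "set xs \<subseteq> carrier ?A" using xs(2) H_carrier surj by auto
    interpret KR: koszul_complex R ys
      by (intro koszul_complex.intro exterior_algebra_lessThan koszul_complex_axioms.intro ysc)
    interpret KA: koszul_complex ?A xs
      by (intro koszul_complex.intro \<pi>.S.exterior_algebra_lessThan koszul_complex_axioms.intro xsc)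
    let ?P = "Pow {..<length xs}"
    show ?thesis
    proof (rule KA.golod_criterion)
      show "maximalideal (Idl\<^bsub>?A\<^esub> (set xs)) ?A" using max xs(3) by simp
      show "ideal (?\<pi> ` ?I) ?A" by (rule ring_ideal_imp_quot_ideal[OF Li I])
      show "a \<otimes>\<^bsub>?A\<^esub> b = \<zero>\<^bsub>?A\<^esub>" if ab: "a \<in> ?\<pi> ` ?I" "b \<in> ?\<pi> ` ?I" for a b
      proof -
        obtain a' b' where ab: "a' \<in> ?I" "a = ?\<pi> a'" "b' \<in> ?I" "b = ?\<pi> b'" using ab by auto
        have c: "a' \<in> carrier R" "b' \<in> carrier R" using ab ideal.Icarr[OF I] by auto
        have "a' \<otimes> b' \<in> L" unfolding L using ab IJ by (intro ideal_prod.prod) auto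
        then show ?thesis using \<pi>_zero[of "a' \<otimes> b'"] c ab by simp
      qed
      fix z assume z: "z \<in> carrier (koszul ?A xs)" "z {} = \<zero>\<^bsub>?A\<^esub>"
        and dz: "diff (koszul ?A xs) z = \<zero>\<^bsub>koszul ?A xs\<^esub>"
      have zP: "z \<in> ?P \<rightarrow>\<^sub>E carrier ?A" using z(1) by (simp add: KA.koszul_simps)
      define u where "u S = (SOME r. r \<in> carrier R \<and> ?\<pi> r = z S)" for S
      have u: "u S \<in> carrier R \<and> ?\<pi> (u S) = z S" if "S \<in> ?P" for S
      proof -
        have "z S \<in> ?\<pi> ` carrier R" using PiE_mem[OF zP that] surj by simp
        then show ?thesis unfolding u_def by (intro someI_ex[of "\<lambda>r. r \<in> carrier R \<and> ?\<pi> r = z S"]) auto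
      qed
      define z' where "z' = restrict u ?P"
      have z': "z' \<in> ?P \<rightarrow>\<^sub>E carrier R" using u by (auto simp: z'_def)
      have \<pi>z': "?\<pi> (z' S) = z S" if "S \<in> ?P" for S using u that by (simp add: z'_def)
      have hd: "KA.del ((!) xs) (\<lambda>S. ?\<pi> (f S)) S = ?\<pi> (KR.del ((!) ys) f S)"
        if "f \<in> ?P \<rightarrow>\<^sub>E carrier R" "S \<in> ?P" for f S
        using \<pi>.hom_del[of "{..<length xs}" "(!) ys" f S "(!) xs" "\<lambda>S. ?\<pi> (f S)"] that \<pi>_ys len
          KR.nth_carrier KR.PiE_forms[of f] by (simp add: len)
      have kd_z': "KR.kd ((!) ys) z' \<in> Pow {..<length ys} \<rightarrow>\<^sub>E L"
        unfolding KR.kd_def restrict_PiE_iff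
      proof
        fix S assume "S \<in> Pow {..<length ys}"
        then have S: "S \<in> ?P" by (simp add: len)
        have fz: "z' \<in> KR.forms" using KR.PiE_forms z' len by simp
        have "?\<pi> (KR.del ((!) ys) z' S) = KA.del ((!) xs) (\<lambda>S. ?\<pi> (z' S)) S" using hd[OF z' S] by simp
        also have "\<dots> = KA.del ((!) xs) z S"
          using \<pi>z' S KA.nth_carrier KA.PiE_forms[OF zP] by (intro KA.del_cong) auto
        also have "\<dots> = \<zero>\<^bsub>?A\<^esub>"
          using fun_cong[OF dz, of S] S by (simp add: KA.koszul_diff[OF z(1)] KA.kd_def KA.koszul_simps)
        finally show "KR.del ((!) ys) z' S \<in> L"
          using \<pi>_zero KR.formsD[OF KR.del_forms[OF KR.nth_carrier fz], of S] S len by auto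
      qed
      \<comment> \<open>Positivity of the degree enters here: the unit coefficient of
        \<open>z\<close> is zero, so that of its lift is in \<open>L\<close> and hence in
        \<open>M\<close>.\<close>
      have "z' {} \<in> M"
      proof -
        have "z' {} \<in> carrier R" using z' by auto
        then show ?thesis using \<pi>_zero \<pi>z'[of "{}"] z(2) LM by auto
      qed
      then obtain p q where p: "p \<in> ?P \<rightarrow>\<^sub>E ?I" and q: "q \<in> ?P \<rightarrow>\<^sub>E carrier R"
        and zpq: "z' = (\<lambda>S\<in>?P. p S \<oplus> KR.kd ((!) ys) q S)"
        using KR.koszul_cycle_split[OF Idl_ys ws(1,2) len_ws as(1,3) m, of z'] z' kd_z'
        unfolding len L by blast
      define p' q' where "p' = (\<lambda>S\<in>?P. ?\<pi> (p S))" and "q' = (\<lambda>S\<in>?P. ?\<pi> (q S))"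
      have p': "p' \<in> ?P \<rightarrow>\<^sub>E ?\<pi> ` ?I" using p by (auto simp: p'_def)
      have q': "q' \<in> carrier (koszul ?A xs)"
        using q surj by (auto simp: q'_def KA.koszul_simps)
      have "z = p' \<oplus>\<^bsub>koszul ?A xs\<^esub> diff (koszul ?A xs) q'"
        unfolding KA.koszul_diff[OF q'] KA.koszul_simps(4)
      proof (rule PiE_ext[OF zP])
        have kq': "KA.kd ((!) xs) q' \<in> ?P \<rightarrow>\<^sub>E carrier ?A"
          using KA.kd_closed[OF KA.nth_carrier] q' by (simp add: KA.koszul_simps)
        have "?\<pi> ` ?I \<subseteq> carrier ?A" unfolding surj by (intro image_mono ideal_subset[OF I])
        then have "p' \<in> ?P \<rightarrow>\<^sub>E carrier ?A" by (intro subsetD[OF PiE_mono p'])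
        then show "(\<lambda>S\<in>?P. p' S \<oplus>\<^bsub>?A\<^esub> KA.kd ((!) xs) q' S) \<in> ?P \<rightarrow>\<^sub>E carrier ?A"
          using kq' by (auto simp: PiE_iff)
        fix S assume S: "S \<in> ?P"
        have qf: "q \<in> KR.forms" using KR.PiE_forms q len by simp
        have c: "p S \<in> carrier R" "KR.del ((!) ys) q S \<in> carrier R"
          using p S ideal.Icarr[OF I] KR.formsD[OF KR.del_forms[OF KR.nth_carrier qf], of S] len by auto
        have "z S = ?\<pi> (z' S)" using \<pi>z'[OF S] by simp
        also have "z' S = p S \<oplus> KR.del ((!) ys) q S"
        proof -
          have "KR.kd ((!) ys) q S = KR.del ((!) ys) q S" unfolding KR.kd_def using S len by simp
          then show ?thesis by (simp only: zpq restrict_apply' S)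
        qed
        also have "?\<pi> \<dots> = ?\<pi> (p S) \<oplus>\<^bsub>?A\<^esub> ?\<pi> (KR.del ((!) ys) q S)" using c by simp
        also have "?\<pi> (KR.del ((!) ys) q S) = KA.del ((!) xs) (\<lambda>S. ?\<pi> (q S)) S" using hd[OF q S] by simp
        also have "\<dots> = KA.del ((!) xs) q' S"
        proof (rule KA.del_cong[symmetric])
          show "(\<lambda>S. ?\<pi> (q S)) \<in> KA.forms" using q surj by (auto simp: KA.forms_def)
        qed (use S KA.nth_carrier in \<open>auto simp: q'_def\<close>)
        finally show "z S = (\<lambda>S\<in>?P. p' S \<oplus>\<^bsub>?A\<^esub> KA.kd ((!) xs) q' S) S"
          using S by (simp add: p'_def KA.kd_def)
      qed
      then show "\<exists>p\<in>?P \<rightarrow>\<^sub>E ?\<pi> ` ?I. \<exists>q\<in>carrier (koszul ?A xs). z = p \<oplus>\<^bsub>koszul ?A xs\<^esub> diff (koszul ?A xs) q"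
        using p' q' by blast
    qed
  qed
  then show ?thesis using ex by (auto simp: golod_def)
qed

end

section \<open>The local case\<close>

lemma golod_local:
  assumes R: "regular_local_ring R M" and as: "regular_sequence R as"
    and J: "J = Idl\<^bsub>R\<^esub> (set as)" "J \<noteq> carrier R" and m: "m \<le> length as" and I: "I = Idl\<^bsub>R\<^esub> (set (take m as))"
  shows "golod_local_ring (R Quot (I \<cdot>\<^bsub>R\<^esub> J)) ((+>\<^bsub>R\<^esub>) (I \<cdot>\<^bsub>R\<^esub> J) ` M)"
proof -
  have loc: "local_ring R M" using R by (simp add: regular_local_ring_def)
  interpret cring R using loc by (simp add: local_ring_def)
  obtain ws where ws: "regular_sequence R ws" "Idl\<^bsub>R\<^esub> (set ws) = M"
    using regular_local_ring_regular_sequence[OF R] by blast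
  have wsc: "set ws \<subseteq> carrier R" using ws(1) by (simp add: regular_sequence_def)
  have asc: "set as \<subseteq> carrier R" using as by (simp add: regular_sequence_def)
  have "J \<subseteq> M" using local_ring_subset[OF loc _ J(2)] genideal_ideal[OF asc] J(1) by simp
  then have asM: "set as \<subseteq> M" using genideal_self[OF asc] J(1) by blast
  interpret nakayama_ring R M "carrier R" "set ws"
  proof (rule nakayama_ring.intro[OF is_cring nakayama_ring_axioms.intro])
    show "maximalideal M R" using loc by (simp add: local_ring_def)
    fix s x and S assume s: "s \<in> carrier R - M" and S: "S \<subseteq> carrier R" and x: "x \<in> carrier R" "s \<otimes>\<^bsub>R\<^esub> x \<in> Idl\<^bsub>R\<^esub> S"
    have u: "s \<in> Units R" by (rule local_ring_unit[OF loc s])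
    have "inv\<^bsub>R\<^esub> s \<otimes>\<^bsub>R\<^esub> (s \<otimes>\<^bsub>R\<^esub> x) \<in> Idl\<^bsub>R\<^esub> S"
      using u x by (intro ideal.I_l_closed[OF genideal_ideal[OF S] x(2) Units_inv_closed[OF u]])
    moreover have "inv\<^bsub>R\<^esub> s \<otimes>\<^bsub>R\<^esub> (s \<otimes>\<^bsub>R\<^esub> x) = x" using u x(1) s by (simp add: m_assoc[symmetric])
    ultimately show "x \<in> Idl\<^bsub>R\<^esub> S" by simp
  qed (use wsc ws in auto)
  have "golod (R Quot (I \<cdot>\<^bsub>R\<^esub> J)) ((+>\<^bsub>R\<^esub>) (I \<cdot>\<^bsub>R\<^esub> J) ` carrier R) ((+>\<^bsub>R\<^esub>) (I \<cdot>\<^bsub>R\<^esub> J) ` M)"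
    using ws(1) wsc genideal_self[OF wsc] ws(2) card_length[of ws] as asc asM m
    by (intro golod_quotient[of ws as m]) (auto simp: I J)
  then show ?thesis by (simp add: golod_local_ring_def carrier_quotient)
qed

section \<open>Polynomial rings\<close>

lemma mpoly_ring_cring: "cring (mpoly_ring :: (('v::finite \<Rightarrow>\<^sub>0 nat) \<Rightarrow>\<^sub>0 'k::field) ring)"
  by (rule cring_from_type_algebra)

lemma mpoly_ring_simps:
  "carrier mpoly_ring = UNIV" "x \<oplus>\<^bsub>mpoly_ring\<^esub> y = x + y" "x \<otimes>\<^bsub>mpoly_ring\<^esub> y = x * y"
  "\<zero>\<^bsub>mpoly_ring\<^esub> = 0" "\<one>\<^bsub>mpoly_ring\<^esub> = 1"
  by (simp_all add: ring_of_type_algebra_def)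

interpretation mpoly: cring "mpoly_ring :: (('v::finite \<Rightarrow>\<^sub>0 nat) \<Rightarrow>\<^sub>0 'k::field) ring"
  rewrites "carrier mpoly_ring = UNIV" and "x \<oplus>\<^bsub>mpoly_ring\<^esub> y = x + y" and "x \<otimes>\<^bsub>mpoly_ring\<^esub> y = x * y"
    and "\<zero>\<^bsub>mpoly_ring\<^esub> = 0" and "\<one>\<^bsub>mpoly_ring\<^esub> = 1"
  by (rule mpoly_ring_cring) (simp_all add: mpoly_ring_simps)

lemma mpoly_a_inv: "\<ominus>\<^bsub>mpoly_ring\<^esub> x = - x"
  using mpoly.minus_equality[of "- x" x] by simp

lemma mpoly_idealI:
  assumes "0 \<in> I" "\<And>p q. p \<in> I \<Longrightarrow> q \<in> I \<Longrightarrow> p + q \<in> I" "\<And>p r. p \<in> I \<Longrightarrow> r * p \<in> I"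
  shows "ideal I (mpoly_ring :: (('v::finite \<Rightarrow>\<^sub>0 nat) \<Rightarrow>\<^sub>0 'k::field) ring)"
proof (rule idealI[OF mpoly.ring_axioms])
  let ?G = "add_monoid (mpoly_ring :: (('v \<Rightarrow>\<^sub>0 nat) \<Rightarrow>\<^sub>0 'k) ring)"
  show "subgroup I ?G"
  proof
    fix p assume "p \<in> I"
    then have "- p \<in> I" using assms(3)[of p "- 1"] by simp
    then show "inv\<^bsub>?G\<^esub> p \<in> I" using mpoly_a_inv[of p] unfolding a_inv_def by (rule back_subst[OF _ sym])
  qed (use assms(1,2) in \<open>auto simp: mpoly_ring_simps\<close>)
qed (use assms(3) in \<open>auto simp: mpoly_ring_simps mult.commute\<close>)

lemma mpoly_idealD:
  assumes "ideal I (mpoly_ring :: (('v::finite \<Rightarrow>\<^sub>0 nat) \<Rightarrow>\<^sub>0 'k::field) ring)"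
  shows "0 \<in> I" "p \<in> I \<Longrightarrow> q \<in> I \<Longrightarrow> p + q \<in> I" "p \<in> I \<Longrightarrow> r * p \<in> I"
  using additive_subgroup.zero_closed[OF ideal.axioms(1)[OF assms]]
    additive_subgroup.a_closed[OF ideal.axioms(1)[OF assms]] ideal.I_l_closed[OF assms]
  by (simp_all add: mpoly_ring_simps)

lemma mpoly_ideal_sum:
  assumes "ideal I (mpoly_ring :: (('v::finite \<Rightarrow>\<^sub>0 nat) \<Rightarrow>\<^sub>0 'k::field) ring)" "\<And>i. i \<in> A \<Longrightarrow> f i \<in> I"
  shows "sum f A \<in> I"
  using assms(2) by (induction A rule: infinite_finite_induct) (auto intro: mpoly_idealD[OF assms(1)])

section \<open>Degrees and homogeneous parts of polynomials\<close>

definition mdegree :: "('v::finite \<Rightarrow>\<^sub>0 nat) \<Rightarrow> nat" where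
  "mdegree e = (\<Sum>v\<in>UNIV. Poly_Mapping.lookup e v)"

lemma mdegree_add: "mdegree (a + b) = mdegree a + mdegree b"
  by (simp add: mdegree_def lookup_add sum.distrib)

lemma mdegree_zero_iff: "mdegree e = 0 \<longleftrightarrow> e = 0"
  by (auto simp: mdegree_def intro!: poly_mapping_eqI)

lemma homogeneous_polys_iff: "p \<in> homogeneous_polys i \<longleftrightarrow> Poly_Mapping.keys p \<subseteq> mdegree -` {i}"
  by (auto simp: homogeneous_polys_def mdegree_def)

text \<open>For \<open>E\<close> a fibre of the degree this is a homogeneous part, for a singleton
  it is a single term.\<close>

definition mpoly_part :: "'e set \<Rightarrow> ('e \<Rightarrow>\<^sub>0 'k::zero) \<Rightarrow> ('e \<Rightarrow>\<^sub>0 'k)" where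
  "mpoly_part E = Poly_Mapping.mapp (\<lambda>e c. c when e \<in> E)"

lemma lookup_mpoly_part: "Poly_Mapping.lookup (mpoly_part E p) e = (Poly_Mapping.lookup p e when e \<in> E)"
  by (auto simp: mpoly_part_def lookup_mapp when_def in_keys_iff)

lemma keys_mpoly_part: "Poly_Mapping.keys (mpoly_part E p) = Poly_Mapping.keys p \<inter> E"
  by (auto simp: in_keys_iff lookup_mpoly_part)

lemma mpoly_part_add: "mpoly_part E (p + q) = mpoly_part E p + (mpoly_part E q :: 'e \<Rightarrow>\<^sub>0 'k::monoid_add)"
  by (rule poly_mapping_eqI) (simp add: lookup_mpoly_part lookup_add when_def)

lemma mpoly_part_id: "Poly_Mapping.keys p \<subseteq> E \<Longrightarrow> mpoly_part E p = p"
  by (rule poly_mapping_eqI) (auto simp: lookup_mpoly_part when_def in_keys_iff)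

lemma mpoly_part_zero: "Poly_Mapping.keys p \<inter> E = {} \<Longrightarrow> mpoly_part E p = 0"
  by (rule poly_mapping_eqI) (auto simp: lookup_mpoly_part when_def in_keys_iff)

lemma mpoly_part_sum: "mpoly_part E (sum f A) = (\<Sum>i\<in>A. mpoly_part E (f i) :: 'e \<Rightarrow>\<^sub>0 'k::comm_monoid_add)"
  by (induction A rule: infinite_finite_induct) (auto simp: mpoly_part_add mpoly_part_zero)

lemma mpoly_part_split: "mpoly_part E p + mpoly_part (- E) p = (p :: 'e \<Rightarrow>\<^sub>0 'k::monoid_add)"
  by (rule poly_mapping_eqI) (simp add: lookup_mpoly_part lookup_add when_def)

lemma mpoly_part_singleton: "mpoly_part {e} p = Poly_Mapping.single e (Poly_Mapping.lookup p e)"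
  by (rule poly_mapping_eqI) (auto simp: lookup_mpoly_part lookup_single when_def)

lemma mpoly_sum_fibres:
  "(\<Sum>i\<in>g ` Poly_Mapping.keys p. mpoly_part (g -` {i}) p) = (p :: 'e \<Rightarrow>\<^sub>0 'k::comm_monoid_add)"
proof (rule poly_mapping_eqI)
  fix e
  have "Poly_Mapping.lookup (\<Sum>i\<in>g ` Poly_Mapping.keys p. mpoly_part (g -` {i}) p) e
      = (\<Sum>i\<in>g ` Poly_Mapping.keys p. if i = g e then Poly_Mapping.lookup p e else 0)"
    by (auto simp: lookup_sum lookup_mpoly_part when_def intro!: sum.cong)
  also have "\<dots> = Poly_Mapping.lookup p e" by (auto simp: sum.delta in_keys_iff)
  finally show "Poly_Mapping.lookup (\<Sum>i\<in>g ` Poly_Mapping.keys p. mpoly_part (g -` {i}) p) e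
      = Poly_Mapping.lookup p e" .
qed

text \<open>The hypothesis says that the exponent of \<open>p\<close> alone decides whether a
  product of terms falls into \<open>G\<close>, so the parts of \<open>p\<close> inside and outside
  \<open>E\<close> contribute inside and outside \<open>G\<close>.\<close>

lemma mpoly_part_mult:
  fixes p q :: "'e::monoid_add \<Rightarrow>\<^sub>0 'k::semiring_0"
  assumes "\<And>a b. a \<in> Poly_Mapping.keys p \<Longrightarrow> b \<in> Poly_Mapping.keys q \<Longrightarrow> a + b \<in> G \<longleftrightarrow> a \<in> E"
  shows "mpoly_part G (p * q) = mpoly_part E p * q"
proof -
  have "Poly_Mapping.keys (mpoly_part E p * q) \<subseteq> G"
    using keys_mult[of "mpoly_part E p" q] assms by (auto simp: keys_mpoly_part)
  moreover have "Poly_Mapping.keys (mpoly_part (- E) p * q) \<inter> G = {}"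
    using keys_mult[of "mpoly_part (- E) p" q] assms by (auto simp: keys_mpoly_part)
  moreover have "p * q = mpoly_part E p * q + mpoly_part (- E) p * q"
    by (simp add: mpoly_part_split flip: distrib_right)
  ultimately show ?thesis by (simp add: mpoly_part_add mpoly_part_id mpoly_part_zero)
qed

lemma homogeneous_polys_mult:
  assumes "p \<in> homogeneous_polys i" "q \<in> homogeneous_polys j"
  shows "p * q \<in> homogeneous_polys (i + j)"
  using assms keys_mult[of p q] unfolding homogeneous_polys_iff by (fastforce simp: mdegree_add)

text \<open>The polynomials all of whose homogeneous parts lie in the ideal form an ideal containing
  \<open>S\<close>.\<close>

lemma homogeneous_ideal_part:
  fixes S :: "(('v::finite \<Rightarrow>\<^sub>0 nat) \<Rightarrow>\<^sub>0 'k::field) set"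
  assumes S: "S \<subseteq> (\<Union>i. homogeneous_polys i)" and p: "p \<in> Idl\<^bsub>mpoly_ring\<^esub> S"
  shows "mpoly_part (mdegree -` {k}) p \<in> Idl\<^bsub>mpoly_ring\<^esub> S"
proof -
  note I = mpoly.genideal_ideal[OF subset_UNIV[of S]]
  let ?V = "{p. \<forall>k. mpoly_part (mdegree -` {k}) p \<in> Idl\<^bsub>mpoly_ring\<^esub> S}"
  have "Idl\<^bsub>mpoly_ring\<^esub> S \<subseteq> ?V"
  proof (rule mpoly.genideal_minimal[OF mpoly_idealI])
    show "0 \<in> ?V" using mpoly_idealD(1)[OF I] by (simp add: mpoly_part_zero)
    show "p + q \<in> ?V" if "p \<in> ?V" "q \<in> ?V" for p q
      using that mpoly_idealD(2)[OF I] by (simp add: mpoly_part_add)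
    show "r * p \<in> ?V" if p: "p \<in> ?V" for p r
    proof
      show "\<forall>k. mpoly_part (mdegree -` {k}) (r * p) \<in> Idl\<^bsub>mpoly_ring\<^esub> S"
      proof
        fix k
        \<comment> \<open>Multiplication by a homogeneous polynomial shifts degrees, so only the
          terms of \<open>r\<close> of complementary degree contribute.\<close>
        have "mpoly_part (mdegree -` {k}) (r * mpoly_part (mdegree -` {j}) p)
          = mpoly_part {a. mdegree a + j = k} r * mpoly_part (mdegree -` {j}) p" for j
          by (rule mpoly_part_mult) (auto simp: keys_mpoly_part mdegree_add)
        then have *: "mpoly_part (mdegree -` {k}) (r * mpoly_part (mdegree -` {j}) p) \<in> Idl\<^bsub>mpoly_ring\<^esub> S" for j
          using p mpoly_idealD(3)[OF I] by simp
        have "r * p = (\<Sum>j\<in>mdegree ` Poly_Mapping.keys p. r * mpoly_part (mdegree -` {j}) p)"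
          by (simp add: mpoly_sum_fibres flip: sum_distrib_left)
        then show "mpoly_part (mdegree -` {k}) (r * p) \<in> Idl\<^bsub>mpoly_ring\<^esub> S"
          using * by (simp add: mpoly_part_sum mpoly_ideal_sum[OF I])
      qed
    qed
    show "S \<subseteq> ?V"
    proof
      fix s assume s: "s \<in> S"
      then obtain i where i: "Poly_Mapping.keys s \<subseteq> mdegree -` {i}"
        using S by (auto simp: homogeneous_polys_iff)
      have "s \<in> Idl\<^bsub>mpoly_ring\<^esub> S" using s mpoly.genideal_self[OF subset_UNIV[of S]] by blast
      moreover have "mpoly_part (mdegree -` {k}) s = (if k = i then s else 0)" for k
        using i by (auto intro: mpoly_part_id mpoly_part_zero)
      ultimately show "s \<in> ?V" using mpoly_idealD(1)[OF I] by simp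
    qed
  qed
  then show ?thesis using p by blast
qed

text \<open>In degree \<open>d\<close> the product \<open>s x\<close> is the constant term of
  \<open>s\<close> times \<open>x\<close>. This supplies \<open>H_cancel\<close>: polynomials
  outside the irrelevant ideal need not be units, but homogeneous elements can be freed from
  them.\<close>

lemma homogeneous_ideal_cancel:
  fixes S :: "(('v::finite \<Rightarrow>\<^sub>0 nat) \<Rightarrow>\<^sub>0 'k::field) set"
  assumes S: "S \<subseteq> (\<Union>i. homogeneous_polys i)" and x: "x \<in> homogeneous_polys d"
    and c: "Poly_Mapping.lookup s 0 \<noteq> 0" and sx: "s * x \<in> Idl\<^bsub>mpoly_ring\<^esub> S"
  shows "x \<in> Idl\<^bsub>mpoly_ring\<^esub> S"
proof -
  note I = mpoly.genideal_ideal[OF subset_UNIV[of S]]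
  have "mpoly_part (mdegree -` {d}) (s * x) = mpoly_part {0} s * x"
    using x by (intro mpoly_part_mult) (auto simp: homogeneous_polys_iff mdegree_add mdegree_zero_iff)
  then have "Poly_Mapping.single 0 (Poly_Mapping.lookup s 0) * x \<in> Idl\<^bsub>mpoly_ring\<^esub> S"
    using homogeneous_ideal_part[OF S sx, of d] by (simp add: mpoly_part_singleton)
  then have "Poly_Mapping.single 0 (inverse (Poly_Mapping.lookup s 0))
      * (Poly_Mapping.single 0 (Poly_Mapping.lookup s 0) * x) \<in> Idl\<^bsub>mpoly_ring\<^esub> S"
    by (rule mpoly_idealD(3)[OF I])
  then show ?thesis using c by (simp add: mult_single flip: mult.assoc)
qed

section \<open>Variables and the irrelevant ideal\<close>

definition mpoly_var :: "'v \<Rightarrow> (('v::finite \<Rightarrow>\<^sub>0 nat) \<Rightarrow>\<^sub>0 'k::field)" where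
  "mpoly_var v = Poly_Mapping.single (Poly_Mapping.single v 1) 1"

text \<open>Membership in a monomial ideal is decided term by term, which reduces regularity of the
  variables to a computation with exponents.\<close>

lemma genideal_mpoly_var:
  "Idl\<^bsub>mpoly_ring\<^esub> (mpoly_var ` U) =
    {p :: ('v::finite \<Rightarrow>\<^sub>0 nat) \<Rightarrow>\<^sub>0 'k::field. \<forall>e\<in>Poly_Mapping.keys p. \<exists>u\<in>U. Poly_Mapping.lookup e u \<noteq> 0}"
  (is "?I = ?V")
proof
  show "?I \<subseteq> ?V"
  proof (rule mpoly.genideal_minimal[OF mpoly_idealI])
    show "p + q \<in> ?V" if "p \<in> ?V" "q \<in> ?V" for p q using that keys_add[of p q] by auto
    show "r * p \<in> ?V" if "p \<in> ?V" for p r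
    proof
      show "\<forall>e\<in>Poly_Mapping.keys (r * p). \<exists>u\<in>U. Poly_Mapping.lookup e u \<noteq> 0"
      proof
        fix e assume "e \<in> Poly_Mapping.keys (r * p)"
        then obtain a b where "e = a + b" "b \<in> Poly_Mapping.keys p" using keys_mult[of r p] by blast
        then show "\<exists>u\<in>U. Poly_Mapping.lookup e u \<noteq> 0" using that by (auto simp: lookup_add)
      qed
    qed
    show "mpoly_var ` U \<subseteq> ?V" by (auto simp: mpoly_var_def intro!: rev_bexI)
  qed auto
  note I = mpoly.genideal_ideal[OF subset_UNIV[of "mpoly_var ` U"]]
  show "?V \<subseteq> ?I"
  proof
    fix p :: "('v \<Rightarrow>\<^sub>0 nat) \<Rightarrow>\<^sub>0 'k" assume p: "p \<in> ?V"
    have "mpoly_part (id -` {e}) p \<in> ?I" if e: "e \<in> Poly_Mapping.keys p" for e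
    proof -
      obtain u where u: "u \<in> U" "Poly_Mapping.lookup e u \<noteq> 0" using p e by auto
      have "e - Poly_Mapping.single u 1 + Poly_Mapping.single u 1 = e"
        using u(2) by (intro poly_mapping_eqI) (auto simp: lookup_add lookup_minus lookup_single when_def)
      then have "mpoly_part {e} p = Poly_Mapping.single (e - Poly_Mapping.single u 1) (Poly_Mapping.lookup p e) * mpoly_var u"
        by (simp add: mpoly_part_singleton mpoly_var_def mult_single)
      moreover have "mpoly_var u \<in> ?I" using u mpoly.genideal_self[OF subset_UNIV] by blast
      ultimately show ?thesis using mpoly_idealD(3)[OF I] by (simp add: vimage_def)
    qed
    then show "p \<in> ?I" using mpoly_sum_fibres[of id p] mpoly_ideal_sum[OF I] by (metis image_id id_apply)
  qed
qed

definition irrelevant_ideal :: "(('v::finite \<Rightarrow>\<^sub>0 nat) \<Rightarrow>\<^sub>0 'k::field) set" where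
  "irrelevant_ideal = {p. Poly_Mapping.lookup p 0 = 0}"

lemma genideal_mpoly_vars:
  "Idl\<^bsub>mpoly_ring\<^esub> (range mpoly_var) = (irrelevant_ideal :: (('v::finite \<Rightarrow>\<^sub>0 nat) \<Rightarrow>\<^sub>0 'k::field) set)"
proof -
  have "(\<exists>u. Poly_Mapping.lookup e u \<noteq> 0) \<longleftrightarrow> e \<noteq> 0" for e :: "'v \<Rightarrow>\<^sub>0 nat"
    by (metis lookup_zero poly_mapping_eqI)
  moreover have "(\<forall>e\<in>Poly_Mapping.keys p. e \<noteq> 0) \<longleftrightarrow> Poly_Mapping.lookup p 0 = 0"
    for p :: "('v \<Rightarrow>\<^sub>0 nat) \<Rightarrow>\<^sub>0 'k"
    unfolding not_in_keys_iff_lookup_eq_zero[symmetric] by blast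
  ultimately show ?thesis unfolding genideal_mpoly_var irrelevant_ideal_def by (simp del: neq0_conv)
qed

lemma mpoly_unit_ideal:
  assumes I: "ideal I (mpoly_ring :: (('v::finite \<Rightarrow>\<^sub>0 nat) \<Rightarrow>\<^sub>0 'k::field) ring)"
    and c: "Poly_Mapping.single 0 c \<in> I" "c \<noteq> 0"
  shows "I = UNIV"
proof -
  have "p = p * Poly_Mapping.single 0 (inverse c) * Poly_Mapping.single 0 c" for p :: "('v \<Rightarrow>\<^sub>0 nat) \<Rightarrow>\<^sub>0 'k"
    using c(2) by (simp add: mult.assoc mult_single)
  then show ?thesis using mpoly_idealD(3)[OF I c(1)] by (metis UNIV_eq_I)
qed

lemma irrelevant_maximalideal:
  "maximalideal irrelevant_ideal (mpoly_ring :: (('v::finite \<Rightarrow>\<^sub>0 nat) \<Rightarrow>\<^sub>0 'k::field) ring)"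
proof (rule maximalidealI)
  show "ideal irrelevant_ideal (mpoly_ring :: (('v \<Rightarrow>\<^sub>0 nat) \<Rightarrow>\<^sub>0 'k) ring)"
    unfolding genideal_mpoly_vars[symmetric] by (rule mpoly.genideal_ideal) simp
  have "(1 :: ('v \<Rightarrow>\<^sub>0 nat) \<Rightarrow>\<^sub>0 'k) \<notin> irrelevant_ideal" by (simp add: irrelevant_ideal_def)
  then show "carrier (mpoly_ring :: (('v \<Rightarrow>\<^sub>0 nat) \<Rightarrow>\<^sub>0 'k) ring) \<noteq> irrelevant_ideal"
    unfolding mpoly_ring_simps by blast
  fix I assume I: "ideal I (mpoly_ring :: (('v \<Rightarrow>\<^sub>0 nat) \<Rightarrow>\<^sub>0 'k) ring)" "irrelevant_ideal \<subseteq> I"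
  show "I = irrelevant_ideal \<or> I = carrier mpoly_ring"
  proof (cases "I \<subseteq> irrelevant_ideal")
    case False
    then obtain p where p: "p \<in> I" "Poly_Mapping.lookup p 0 \<noteq> 0" by (auto simp: irrelevant_ideal_def)
    \<comment> \<open>All nonconstant terms of \<open>p\<close> lie in the irrelevant ideal;
      removing them leaves a nonzero constant in \<open>I\<close>.\<close>
    have "- mpoly_part (- {0}) p \<in> I" using I(2) by (auto simp: irrelevant_ideal_def lookup_mpoly_part)
    then have "p + - mpoly_part (- {0}) p \<in> I" by (rule mpoly_idealD(2)[OF I(1) p(1)])
    moreover have "p + - mpoly_part (- {0}) p = mpoly_part {0} p"
      using mpoly_part_split[of "{0}" p] by (simp add: algebra_simps)
    ultimately show ?thesis
      using mpoly_unit_ideal[OF I(1), of "Poly_Mapping.lookup p 0"] p(2)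
      by (simp add: mpoly_part_singleton mpoly_ring_simps)
  qed (use I(2) in auto)
qed

lemma regular_sequence_mpoly_vars:
  assumes "distinct vs"
  shows "regular_sequence (mpoly_ring :: (('v::finite \<Rightarrow>\<^sub>0 nat) \<Rightarrow>\<^sub>0 'k::field) ring) (map mpoly_var vs)"
  unfolding regular_sequence_def mpoly_ring_simps
proof (intro conjI allI impI ballI)
  let ?X = "mpoly_var :: 'v \<Rightarrow> ('v \<Rightarrow>\<^sub>0 nat) \<Rightarrow>\<^sub>0 'k"
  have "1 \<notin> Idl\<^bsub>mpoly_ring\<^esub> (?X ` set vs)" unfolding genideal_mpoly_var by simp
  then show "Idl\<^bsub>mpoly_ring\<^esub> (set (map ?X vs)) \<noteq> UNIV" unfolding set_map by blast
  fix i r assume i: "i < length (map ?X vs)"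
    and r: "map ?X vs ! i * r \<in> Idl\<^bsub>mpoly_ring\<^esub> (set (take i (map ?X vs)))"
  let ?U = "set (take i vs)"
  define w where "w = vs ! i"
  have w: "w \<notin> ?U" using assms i by (auto simp: w_def in_set_conv_nth nth_eq_iff_index_eq)
  have U: "set (take i (map ?X vs)) = ?X ` ?U" by (simp add: take_map)
  have "\<exists>u\<in>?U. Poly_Mapping.lookup e u \<noteq> 0" if e: "e \<in> Poly_Mapping.keys r" for e
  proof -
    let ?e = "e + Poly_Mapping.single w 1"
    \<comment> \<open>Multiplication by a variable shifts exponents injectively, so the term of
      \<open>r\<close> at \<open>e\<close> survives in the product. A variable from
      \<open>?U\<close> dividing the shifted exponent already divides \<open>e\<close>, since
      \<open>w\<close> is not in \<open>?U\<close>.\<close>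
    have "mpoly_part {?e} (r * ?X w) = mpoly_part {e} r * ?X w"
      by (rule mpoly_part_mult) (auto simp: mpoly_var_def)
    also have "\<dots> = Poly_Mapping.single ?e (Poly_Mapping.lookup r e)"
      by (simp add: mpoly_part_singleton mpoly_var_def mult_single)
    finally have "?e \<in> Poly_Mapping.keys (r * ?X w)"
      using e by (metis keys_mpoly_part keys_single in_keys_iff insertI1 IntD1)
    then obtain u where u: "u \<in> ?U" "Poly_Mapping.lookup ?e u \<noteq> 0"
      using r i unfolding U genideal_mpoly_var by (auto simp: w_def mult.commute)
    then have "Poly_Mapping.lookup e u \<noteq> 0" using w by (auto simp: lookup_add lookup_single when_def split: if_splits)
    then show ?thesis using u(1) by blast
  qed
  then show "r \<in> Idl\<^bsub>mpoly_ring\<^esub> (set (take i (map ?X vs)))" unfolding U genideal_mpoly_var by blast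
qed simp

section \<open>The graded case\<close>

lemma golod_graded:
  fixes bs :: "(('v::finite \<Rightarrow>\<^sub>0 nat) \<Rightarrow>\<^sub>0 'k::field) list"
  assumes bs: "regular_sequence mpoly_ring bs" "set bs \<subseteq> (\<Union>i. homogeneous_polys i)"
    and J: "J = Idl\<^bsub>mpoly_ring\<^esub> (set bs)" "J \<noteq> carrier mpoly_ring"
    and m: "m \<le> length bs" and I: "I = Idl\<^bsub>mpoly_ring\<^esub> (set (take m bs))"
  shows "golod_graded_ring (mpoly_ring Quot (I \<cdot>\<^bsub>mpoly_ring\<^esub> J))
    (\<lambda>i. (+>\<^bsub>mpoly_ring\<^esub>) (I \<cdot>\<^bsub>mpoly_ring\<^esub> J) ` homogeneous_polys i)"
proof -
  let ?R = "mpoly_ring :: (('v \<Rightarrow>\<^sub>0 nat) \<Rightarrow>\<^sub>0 'k) ring"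
  let ?M = "irrelevant_ideal :: (('v \<Rightarrow>\<^sub>0 nat) \<Rightarrow>\<^sub>0 'k) set"
  let ?X = "mpoly_var :: 'v \<Rightarrow> ('v \<Rightarrow>\<^sub>0 nat) \<Rightarrow>\<^sub>0 'k"
  let ?L = "I \<cdot>\<^bsub>?R\<^esub> J" and ?H = "\<Union>i. homogeneous_polys i :: (('v \<Rightarrow>\<^sub>0 nat) \<Rightarrow>\<^sub>0 'k) set"
  have "Poly_Mapping.keys (?X v) \<subseteq> mdegree -` {1}" for v by (simp add: mpoly_var_def mdegree_def lookup_single when_def)
  then have X: "?X v \<in> homogeneous_polys 1" for v unfolding homogeneous_polys_iff by blast
  note Ii = mpoly.genideal_ideal[OF subset_UNIV[of "set (take m bs)"]]
  note Ji = mpoly.genideal_ideal[OF subset_UNIV[of "set bs"]]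
  \<comment> \<open>A homogeneous polynomial with nonzero constant term is a constant, and would
    make \<open>J\<close> the unit ideal.\<close>
  have bsM: "set bs \<subseteq> ?M"
  proof
    fix b assume b: "b \<in> set bs"
    then have bJ: "b \<in> J" using mpoly.genideal_self[OF subset_UNIV[of "set bs"]] J(1) by auto
    obtain i where i: "Poly_Mapping.keys b \<subseteq> mdegree -` {i}" using b bs(2) by (auto simp: homogeneous_polys_iff)
    show "b \<in> ?M"
    proof (rule ccontr)
      assume "b \<notin> ?M"
      then have c: "Poly_Mapping.lookup b 0 \<noteq> 0" by (simp add: irrelevant_ideal_def)
      then have "0 \<in> Poly_Mapping.keys b" by (simp add: in_keys_iff)
      then have "mdegree (0 :: 'v \<Rightarrow>\<^sub>0 nat) = i" using i by blast
      then have "i = 0" using mdegree_zero_iff[of "0 :: 'v \<Rightarrow>\<^sub>0 nat"] by simp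
      then have "mpoly_part {0} b = b" using i by (intro mpoly_part_id) (auto simp: mdegree_zero_iff)
      then have "Poly_Mapping.single 0 (Poly_Mapping.lookup b 0) \<in> J" using bJ by (simp add: mpoly_part_singleton)
      then show False using mpoly_unit_ideal[of J] Ji c J by (simp add: mpoly_ring_simps)
    qed
  qed
  interpret N: nakayama_ring ?R ?M ?H "range ?X"
  proof (rule nakayama_ring.intro[OF mpoly_ring_cring nakayama_ring_axioms.intro])
    show "range ?X \<subseteq> ?H" using X by blast
    fix s x and S :: "(('v \<Rightarrow>\<^sub>0 nat) \<Rightarrow>\<^sub>0 'k) set"
    assume "s \<in> carrier ?R - ?M" "S \<subseteq> ?H" "x \<in> ?H" "s \<otimes>\<^bsub>?R\<^esub> x \<in> Idl\<^bsub>?R\<^esub> S"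
    then show "x \<in> Idl\<^bsub>?R\<^esub> S"
      using homogeneous_ideal_cancel by (auto simp: irrelevant_ideal_def mpoly_ring_simps)
  qed (auto simp: irrelevant_maximalideal genideal_mpoly_vars mpoly_ring_simps)
  obtain vs :: "'v list" where vs: "set vs = UNIV" "distinct vs" using finite_distinct_list[OF finite] by blast
  have "golod (?R Quot ?L) ((+>\<^bsub>?R\<^esub>) ?L ` ?H) ((+>\<^bsub>?R\<^esub>) ?L ` ?M)"
  proof (rule N.golod_quotient[of "map ?X vs" bs m])
    show "a \<otimes>\<^bsub>?R\<^esub> b \<in> ?H" if "a \<in> ?H" "b \<in> ?H" for a b
      using that homogeneous_polys_mult unfolding mpoly_ring_simps by blast
    show "regular_sequence ?R (map ?X vs)" by (rule regular_sequence_mpoly_vars[OF vs(2)])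
    show "set (map ?X vs) \<subseteq> ?M"
      unfolding genideal_mpoly_vars[symmetric] using mpoly.genideal_self[OF subset_UNIV[of "range ?X"]] by auto
    show "card (range ?X) \<le> length (map ?X vs)"
      using card_image_le[of "UNIV :: 'v set" ?X] distinct_card[OF vs(2)] vs(1) by simp
  qed (use bs bsM m I J in auto)
  \<comment> \<open>The ideal in the definition of graded Golod rings is generated by the images of
    the components of positive degree; it is the image of the irrelevant ideal because the variables
    have degree one.\<close>
  moreover have "Idl\<^bsub>?R Quot ?L\<^esub> (\<Union>i\<in>{1..}. (+>\<^bsub>?R\<^esub>) ?L ` homogeneous_polys i) = (+>\<^bsub>?R\<^esub>) ?L ` ?M"
  proof
    have Li: "ideal ?L ?R" unfolding I J(1) by (rule mpoly.ideal_prod_is_ideal[OF Ii Ji])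
    interpret \<pi>: ring_hom_ring ?R "?R Quot ?L" "(+>\<^bsub>?R\<^esub>) ?L" by (rule ideal.rcos_ring_hom_ring[OF Li])
    let ?H1 = "\<Union>i\<in>{1..}. homogeneous_polys i :: (('v \<Rightarrow>\<^sub>0 nat) \<Rightarrow>\<^sub>0 'k) set"
    have H1: "(\<Union>i\<in>{1..}. (+>\<^bsub>?R\<^esub>) ?L ` homogeneous_polys i) = (+>\<^bsub>?R\<^esub>) ?L ` ?H1" by blast
    have "?H1 \<subseteq> ?M"
    proof
      fix p assume "p \<in> ?H1"
      then obtain i where "1 \<le> i" "Poly_Mapping.keys p \<subseteq> mdegree -` {i}" by (auto simp: homogeneous_polys_iff)
      then have "0 \<notin> Poly_Mapping.keys p" using mdegree_zero_iff[of "0 :: 'v \<Rightarrow>\<^sub>0 nat"] by auto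
      then show "p \<in> ?M" by (simp add: irrelevant_ideal_def in_keys_iff)
    qed
    then show "Idl\<^bsub>?R Quot ?L\<^esub> (\<Union>i\<in>{1..}. (+>\<^bsub>?R\<^esub>) ?L ` homogeneous_polys i) \<subseteq> (+>\<^bsub>?R\<^esub>) ?L ` ?M"
      unfolding H1 by (intro \<pi>.S.genideal_minimal mpoly.ring_ideal_imp_quot_ideal[OF Li N.M_ideal] image_mono)
    have "?M \<subseteq> Idl\<^bsub>?R\<^esub> ?H1"
      unfolding genideal_mpoly_vars[symmetric] using X
      by (intro mpoly.genideal_mono) (auto simp: mpoly_ring_simps)
    then show "(+>\<^bsub>?R\<^esub>) ?L ` ?M \<subseteq> Idl\<^bsub>?R Quot ?L\<^esub> (\<Union>i\<in>{1..}. (+>\<^bsub>?R\<^esub>) ?L ` homogeneous_polys i)"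
      unfolding H1 using \<pi>.img_genideal[of ?H1] by (auto simp: mpoly_ring_simps)
  qed
  moreover have "(\<Union>i. (+>\<^bsub>?R\<^esub>) ?L ` homogeneous_polys i) = (+>\<^bsub>?R\<^esub>) ?L ` ?H" by blast
  ultimately show ?thesis by (simp add: golod_graded_ring_def)
qed

theorem corollary4p5:
  fixes R :: "('a, 'r) ring_scheme" and M I J :: "'a set" and as :: "'a list"
    and I' J' :: "(('v::finite \<Rightarrow>\<^sub>0 nat) \<Rightarrow>\<^sub>0 'k::field) set"
    and bs :: "(('v \<Rightarrow>\<^sub>0 nat) \<Rightarrow>\<^sub>0 'k) list"
    and m :: nat
  shows
    "(regular_local_ring R M \<and> regular_sequence R as \<and>
      J = Idl\<^bsub>R\<^esub> (set as) \<and> J \<noteq> carrier R \<and>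
      1 \<le> m \<and> m \<le> length as \<and> I = Idl\<^bsub>R\<^esub> (set (take m as)) \<longrightarrow>
      golod_local_ring (R Quot (I \<cdot>\<^bsub>R\<^esub> J)) ((\<lambda>x. (I \<cdot>\<^bsub>R\<^esub> J) +>\<^bsub>R\<^esub> x) ` M)) \<and>
     (regular_sequence mpoly_ring bs \<and> set bs \<subseteq> (\<Union>i. homogeneous_polys i) \<and>
      J' = Idl\<^bsub>mpoly_ring\<^esub> (set bs) \<and> J' \<noteq> carrier mpoly_ring \<and>
      1 \<le> m \<and> m \<le> length bs \<and> I' = Idl\<^bsub>mpoly_ring\<^esub> (set (take m bs)) \<longrightarrow>
      golod_graded_ring (mpoly_ring Quot (I' \<cdot>\<^bsub>mpoly_ring\<^esub> J'))
        (\<lambda>i. (\<lambda>x. (I' \<cdot>\<^bsub>mpoly_ring\<^esub> J') +>\<^bsub>mpoly_ring\<^esub> x) ` homogeneous_polys i))"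
  using golod_local[of R M as J m I] golod_graded[of bs J' m I'] by blast

end
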